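(* Let $K/k$ be a finite abelian $p$-extension, and let $n,m\in\mathbb{N}$ and $N\in R_T$ be such that $K\subseteq {}_nk(\Lambda_N)_m$. Put $M:=L_nk_m$ and $$E:=KM\cap k(\Lambda_N).$$ Then $K_{\mathfrak{ge}}=E_{\mathfrak{ge}}K$ and $K_{\mathfrak{ge}}/k$ is an abelian $p$-extension.
   Context: $k=\mathbb{F}_q(T)$ is a global rational function field of characteristic $p$, $R_T=\mathbb{F}_q[T]$, and $P_\infty$ (the infinite prime) is the pole of $T$ in $k$. For nonzero $N\in R_T$, $k(\Lambda_N)$ is the $N$-th Carlitz cyclotomic function field. $L_n$ denotes the subfield of degree $q^n$ over $k$ of $k(\Lambda_{1/T^{n+1}})$, the cyclotomic function field of modulus $(1/T)^{n+1}$ constructed with $\mathbb{F}_q[1/T]$ in place of $\mathbb{F}_q[T]$ (so $L_n$ is the fixed field of $\mathbb{F}_q^*$). $k_m:=\mathbb{F}_{q^m}(T)$, and ${}_nk(\Lambda_N)_m:=L_n\,k(\Lambda_N)\,\mathbb{F}_{q^m}$. By the Kronecker--Weber theorem every finite abelian extension of $k$ is contained in some ${}_nk(\Lambda_N)_m$. The genus field $F_{\mathfrak{ge}}$ of a finite abelian extension $F/k$ is the maximal extension of $F$ that is abelian over $k$ and contained in the Hilbert class field of $F$, the latter being (Rosen) the maximal abelian extension of $F$ that is unramified at every prime and in which every prime of $F$ above $P_\infty$ decomposes fully. *)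

theory Defs
  imports
    "HOL-Library.Cardinality"
    "HOL-Algebra.Generated_Fields"
    "HOL-Algebra.Embedded_Algebras"
    "HOL-Algebra.Algebraic_Closure_Type"
begin

text \<open>
  The type \<open>'q\<close> is the finite field with \<open>q = CARD('q)\<close> elements. All extensions of
  \<open>k = \<F>\<^sub>q(T)\<close> are taken inside one algebraic closure of \<open>k\<close>, as subsets of its type.
\<close>

type_synonym 'q ratfun_ac = "'q poly fract alg_closure"

abbreviation \<Omega> :: "('q :: {field, finite}) ratfun_ac ring" where
  "\<Omega> \<equiv> ring_of_type_algebra"

definition const :: "('q :: {field, finite}) \<Rightarrow> 'q ratfun_ac" where
  "const c = to_ac (Fract [:c:] 1)"

definition T :: "('q :: {field, finite}) ratfun_ac" where
  "T = to_ac (Fract [:0, 1:] 1)"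

definition base_field :: "('q :: {field, finite}) ratfun_ac set" where
  "base_field = range to_ac"

definition compositum ::
    "('q :: {field, finite}) ratfun_ac set \<Rightarrow> 'q ratfun_ac set \<Rightarrow> 'q ratfun_ac set" where
  "compositum F L = generate_field \<Omega> (F \<union> L)"


section \<open>Galois theory inside the algebraic closure\<close>

definition subextension ::
    "('q :: {field, finite}) ratfun_ac set \<Rightarrow> 'q ratfun_ac set \<Rightarrow> bool" where
  "subextension F L \<longleftrightarrow> subfield F \<Omega> \<and> subfield L \<Omega> \<and> F \<subseteq> L"

definition ext_degree ::
    "('q :: {field, finite}) ratfun_ac set \<Rightarrow> 'q ratfun_ac set \<Rightarrow> nat" where
  "ext_degree F L = ring.dim \<Omega> F L"

definition Gal ::
    "('q :: {field, finite}) ratfun_ac set \<Rightarrow> 'q ratfun_ac set \<Rightarrow>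
     ('q ratfun_ac \<Rightarrow> 'q ratfun_ac) monoid" where
  "Gal F L =
    \<lparr>carrier = {\<sigma> \<in> extensional L.
        \<sigma> \<in> ring_iso (\<Omega>\<lparr>carrier := L\<rparr>) (\<Omega>\<lparr>carrier := L\<rparr>) \<and> (\<forall>x\<in>F. \<sigma> x = x)},
     monoid.mult = compose L,
     one = restrict id L\<rparr>"

definition finite_galois ::
    "('q :: {field, finite}) ratfun_ac set \<Rightarrow> 'q ratfun_ac set \<Rightarrow> bool" where
  "finite_galois F L \<longleftrightarrow>
     subextension F L \<and> ring.finite_dimension \<Omega> F L \<and>
     {x \<in> L. \<forall>\<sigma> \<in> carrier (Gal F L). \<sigma> x = x} = F"

definition finite_abelian ::
    "('q :: {field, finite}) ratfun_ac set \<Rightarrow> 'q ratfun_ac set \<Rightarrow> bool" where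
  "finite_abelian F L \<longleftrightarrow> finite_galois F L \<and> comm_group (Gal F L)"

definition finite_abelian_p_extension ::
    "('q :: {field, finite}) ratfun_ac set \<Rightarrow> 'q ratfun_ac set \<Rightarrow> bool" where
  "finite_abelian_p_extension F L \<longleftrightarrow>
     finite_abelian F L \<and> (\<exists>r. Coset.order (Gal F L) = CHAR('q) ^ r)"


section \<open>Primes\<close>

text \<open>A prime of \<open>F\<close> is represented by its valuation ring.\<close>

definition primes_of ::
    "('q :: {field, finite}) ratfun_ac set \<Rightarrow> 'q ratfun_ac set set" where
  "primes_of F =
     {V. subring V \<Omega> \<and> range const \<subseteq> V \<and> V \<subset> F \<and>
         (\<forall>x\<in>F. x \<noteq> 0 \<longrightarrow> x \<in> V \<or> inverse x \<in> V)}"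

definition max_ideal ::
    "('q :: {field, finite}) ratfun_ac set \<Rightarrow> 'q ratfun_ac set" where
  "max_ideal V = {x \<in> V. x = 0 \<or> inverse x \<notin> V}"

definition primes_above ::
    "('q :: {field, finite}) ratfun_ac set \<Rightarrow> 'q ratfun_ac set \<Rightarrow>
     'q ratfun_ac set \<Rightarrow> 'q ratfun_ac set set" where
  "primes_above F L V = {W \<in> primes_of L. W \<inter> F = V}"

definition P_infinity :: "('q :: {field, finite}) ratfun_ac set" where
  "P_infinity = {to_ac (Fract a b) | a b. b \<noteq> 0 \<and> Polynomial.degree a \<le> Polynomial.degree b}"

text \<open>
  Ramification index one: the maximal ideal of \<open>V\<close> generates that of \<open>W\<close>. As \<open>V\<close> is a
  discrete valuation ring, its maximal ideal is principal, so the products \<open>x * y\<close> below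
  already form an ideal. Residue fields are finite, hence residue extensions are separable.
\<close>

definition unramified_over ::
    "('q :: {field, finite}) ratfun_ac set \<Rightarrow> 'q ratfun_ac set \<Rightarrow> bool" where
  "unramified_over V W \<longleftrightarrow> max_ideal W = {x * y | x y. x \<in> max_ideal V \<and> y \<in> W}"

definition unramified_extension ::
    "('q :: {field, finite}) ratfun_ac set \<Rightarrow> 'q ratfun_ac set \<Rightarrow> bool" where
  "unramified_extension F L \<longleftrightarrow>
     (\<forall>V \<in> primes_of F. \<forall>W \<in> primes_above F L V. unramified_over V W)"

definition decomposes_fully ::
    "('q :: {field, finite}) ratfun_ac set \<Rightarrow> 'q ratfun_ac set \<Rightarrow> 'q ratfun_ac set \<Rightarrow> bool" where
  "decomposes_fully F L V \<longleftrightarrow> card (primes_above F L V) = ext_degree F L"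


section \<open>Hilbert class fields and genus fields\<close>

text \<open>
  The extensions of \<open>F\<close> in question are closed under composita, so the maximal one is the
  compositum of all the finite ones.
\<close>

definition hilbert_class_field ::
    "('q :: {field, finite}) ratfun_ac set \<Rightarrow> 'q ratfun_ac set" where
  "hilbert_class_field F = compositum F
     (\<Union>{L. finite_abelian F L \<and> unramified_extension F L \<and>
         (\<forall>V \<in> primes_above base_field F P_infinity. decomposes_fully F L V)})"

definition genus_field ::
    "('q :: {field, finite}) ratfun_ac set \<Rightarrow> 'q ratfun_ac set" where
  "genus_field F = compositum F
     (\<Union>{L. F \<subseteq> L \<and> L \<subseteq> hilbert_class_field F \<and> finite_abelian base_field L})"


section \<open>Carlitz cyclotomic function fields\<close>

text \<open>
  The Carlitz action for \<open>\<F>\<^sub>q[t]\<close>: the variable of \<open>f\<close> acts by \<open>u \<mapsto> u\<^sup>q + t u\<close>.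
  Below \<open>t\<close> is \<open>T\<close> or \<open>1/T\<close>; in the second case \<open>f\<close> stands for the polynomial \<open>f(1/T)\<close>.
\<close>

definition carlitz_action ::
    "('q :: {field, finite}) ratfun_ac \<Rightarrow> 'q poly \<Rightarrow> 'q ratfun_ac \<Rightarrow> 'q ratfun_ac" where
  "carlitz_action t f u =
     (\<Sum>i\<le>Polynomial.degree f. const (poly.coeff f i) * ((\<lambda>z. z ^ CARD('q) + t * z) ^^ i) u)"

definition cyclotomic_function_field ::
    "('q :: {field, finite}) ratfun_ac \<Rightarrow> 'q poly \<Rightarrow> 'q ratfun_ac set" where
  "cyclotomic_function_field t f = compositum base_field {u. carlitz_action t f u = 0}"

definition L_field :: "nat \<Rightarrow> ('q :: {field, finite}) ratfun_ac set" where
  "L_field n = (THE L. subextension base_field L \<and>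
     L \<subseteq> cyclotomic_function_field (inverse T) (Polynomial.monom 1 (n + 1)) \<and>
     ext_degree base_field L = CARD('q) ^ n)"

definition const_extension :: "nat \<Rightarrow> ('q :: {field, finite}) ratfun_ac set" where
  "const_extension m = compositum base_field {x. x ^ (CARD('q) ^ m) = x}"

end

theory Submission
 imports Defs "HOL-Algebra.Sylow"
begin

text \<open>
  Splitting and ramification are expressed by decomposition and inertia groups. The key fact is that
  \<open>k = \<F>\<^sub>q(T)\<close> has no nontrivial abelian extension that is unramified everywhere and split at infinity:
  such an extension has an integral basis whose leading vectors at infinity are independent, of
  degrees \<open>d\<^sub>i \<ge> 0\<close>; the dual basis is integral too, and pairing leading vectors forces all \<open>d\<^sub>i\<close> to
  vanish, so that the basis consists of constants. Hence the Galois group of an abelian extension of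
  \<open>k\<close> is generated by its inertia groups and its decomposition groups at infinity, which bounds the
  genus field of a \<open>p\<close>-extension \<open>K\<close> and shows that it is a \<open>p\<close>-extension.

  In \<open>k(\<Lambda>\<^sub>N)\<close> the decomposition groups at infinity are inertia groups of exponent \<open>q - 1\<close>, whereas
  inertia groups of \<open>KM\<close> are \<open>p\<close>-groups; so infinity splits in \<open>E\<close>. As \<open>KM = EM\<close> and \<open>M/k\<close> is unramified
  at the finite primes, base change through \<open>KM\<close> carries extensions of \<open>E\<close> unramified at the finite
  primes to such extensions of \<open>K\<close> and back, and passing to the fixed field of the decomposition group
  at infinity restores the condition there.
\<close>
section \<open>Subfields and their automorphisms\<close>

text \<open>\<open>galois F L\<close> asks for a finite group with fixed field \<open>F\<close>, as
  in Artin's approach, so separability is never discussed separately; descent rests on one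
  idempotent built from characters. Splitting and ramification are put into automorphisms because
  such conditions restrict, lift and pass to composita easily; \<open>fam_iff\<close> matches them
  with the uniformizer and counting conditions of the definitions. Triviality over \<open>k0\<close>
  takes the place of genus computations: it is the splitting of a vector bundle on the projective
  line into line bundles of degrees \<open>- d i\<close>, phrased with lattices. A genus field is
  defined as a union of possibly infinitely many fields, so it must first be shown to be finite over
  \<open>k0\<close>. Only finitely many primes ramify, and each contributes a subgroup that embeds
  into the group of \<open>K\<close>, which bounds the degree. The obstacle in the comparison of
  \<open>K\<close> with \<open>E\<close> is infinity: \<open>M\<close> may ramify or be inert there,
  so the splitting condition does not survive base change through \<open>KM\<close>. It is therefore
  treated apart, by the coprimality of \<open>q - 1\<close> and powers of \<open>p\<close>.\<close>

definition sfd :: "'a::field set => bool" where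
 "sfd F \<longleftrightarrow> 0 : F & 1 : F & (ALL x:F. ALL y:F. x + y : F & x * y : F) &
 (ALL x:F. - x : F & inverse x : F)"

lemma sfd_0 [simp]: "sfd F ==> 0 : F"
 and sfd_1 [simp]: "sfd F ==> 1 : F"
 and sfd_add: "sfd F ==> x : F ==> y : F ==> x + y : F"
 and sfd_mult: "sfd F ==> x : F ==> y : F ==> x * y : F"
 and sfd_minus: "sfd F ==> x : F ==> - x : F"
 and sfd_inverse: "sfd F ==> x : F ==> inverse x : F"
 by (auto simp: sfd_def)

lemma sfd_diff: "sfd F ==> x : F ==> y : F ==> x - y : F"
 using sfd_add[of F x "- y"] sfd_minus by auto

lemma sfd_divide: "sfd F ==> x : F ==> y : F ==> x / y : F"
 by (simp add: divide_inverse sfd_mult sfd_inverse)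

lemma sfd_power: "sfd F ==> x : F ==> x ^ n : F"
 by (induction n) (auto simp: sfd_mult)

lemma sfd_sum: "sfd F ==> (!!i. i : A ==> f i : F) ==> sum f A : F"
 by (induction A rule: infinite_finite_induct) (auto simp: sfd_add)

lemma sfd_prod: "sfd F ==> (!!i. i : A ==> f i : F) ==> prod f A : F"
 by (induction A rule: infinite_finite_induct) (auto simp: sfd_mult)

lemmas sfd_closed = sfd_0 sfd_1 sfd_add sfd_mult sfd_minus sfd_inverse sfd_diff sfd_divide
 sfd_power sfd_sum sfd_prod

lemma sfd_Int: "sfd F ==> sfd M ==> sfd (F Int M)"
 unfolding sfd_def by blast

definition gen :: "'a::field set => 'a set" where
 "gen A = Inf {F. sfd F & A <= F}"

lemma sfd_gen [simp]: "sfd (gen A)"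
 unfolding gen_def by (subst sfd_def) (simp add: sfd_closed)

lemma gen_incl: "A <= gen A"
 by (auto simp: gen_def)

lemma gen_least: "sfd F ==> A <= F ==> gen A <= F"
 by (auto simp: gen_def)

lemma gen_mono: "A <= Y ==> gen A <= gen Y"
 by (auto simp: gen_def)

lemma gen_sfd: "sfd F ==> gen F = F"
 by (simp add: gen_incl gen_least subset_antisym)

lemma gen_Un_gen: "gen (gen A Un Y) = gen (A Un Y)"
proof (intro subset_antisym gen_least)
 show "gen A Un Y <= gen (A Un Y)" using gen_mono[of A "A Un Y"] gen_incl[of "A Un Y"] by blast
 show "A Un Y <= gen (gen A Un Y)" using gen_incl[of A] gen_incl[of "gen A Un Y"] by blast
qed simp_all

lemma gen_Un_gen_right: "gen (Y Un gen A) = gen (Y Un A)"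
 using gen_Un_gen[of A Y] by (simp add: Un_commute)

text \<open>The image may leave \<open>L\<close>, so the same predicate serves embeddings into the
  ambient field and automorphisms. The clause on \<open>1\<close> excludes the zero map.\<close>

definition rhom :: "'a::field set => ('a => 'a) => bool" where
 "rhom L s \<longleftrightarrow> (ALL x:L. ALL y:L. s (x + y) = s x + s y & s (x * y) = s x * s y) & s 1 = 1"

lemma rhom_add: "rhom L s ==> x : L ==> y : L ==> s (x + y) = s x + s y"
 and rhom_mult: "rhom L s ==> x : L ==> y : L ==> s (x * y) = s x * s y"
 and rhom_1: "rhom L s ==> s 1 = 1"
 by (auto simp: rhom_def)

lemma rhom_0: "rhom L s ==> sfd L ==> s 0 = 0"
 using rhom_add[of L s 0 0] sfd_0[of L] by (metis add_cancel_right_right add_0)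

lemma rhom_minus: "rhom L s ==> sfd L ==> x : L ==> s (- x) = - s x"
 using rhom_add[of L s x "- x"] by (simp add: sfd_minus rhom_0 minus_unique)

lemma rhom_diff: "rhom L s ==> sfd L ==> x : L ==> y : L ==> s (x - y) = s x - s y"
 using rhom_add[of L s x "- y"] by (simp add: sfd_minus rhom_minus)

lemma rhom_power: "rhom L s ==> sfd L ==> x : L ==> s (x ^ n) = s x ^ n"
 by (induction n) (auto simp: rhom_1 rhom_mult sfd_power)

lemma rhom_sum: "rhom L s ==> sfd L ==> (!!i. i : A ==> f i : L) ==> s (sum f A) = (SUM i:A. s (f i))"
 by (induction A rule: infinite_finite_induct) (auto simp: rhom_0 rhom_add sfd_sum)

lemma rhom_prod: "rhom L s ==> sfd L ==> (!!i. i : A ==> f i : L) ==> s (prod f A) = (PROD i:A. s (f i))"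
 by (induction A rule: infinite_finite_induct) (auto simp: rhom_1 rhom_mult sfd_prod)

lemma rhom_eq_0: assumes "rhom L s" "sfd L" "x : L" shows "s x = 0 \<longleftrightarrow> x = 0"
proof -
 have "s x * s (inverse x) = 1" if "x ~= 0"
 using rhom_mult[of L s x "inverse x"] assms that by (simp add: sfd_inverse rhom_1)
 then show ?thesis using assms rhom_0 by force
qed

lemma rhom_inverse: assumes "rhom L s" "sfd L" "x : L" shows "s (inverse x) = inverse (s x)"
proof (cases "x = 0")
 case False
 then have "s x * s (inverse x) = 1"
 using rhom_mult[of L s x "inverse x"] assms by (simp add: sfd_inverse rhom_1)
 then show ?thesis by (simp add: inverse_unique)
qed (use rhom_0[OF assms(1,2)] in auto)

lemma rhom_divide: "rhom L s ==> sfd L ==> x : L ==> y : L ==> s (x / y) = s x / s y"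
 by (simp add: divide_inverse rhom_inverse rhom_mult sfd_inverse)

lemma rhom_inj: "rhom L s ==> sfd L ==> inj_on s L"
proof (rule inj_onI)
 fix x y assume a: "rhom L s" "sfd L" "x : L" "y : L" "s x = s y"
 then have "s (x - y) = 0" by (simp add: rhom_diff[OF a(1,2)])
 then show "x = y" using rhom_eq_0[OF a(1,2) sfd_diff[OF a(2-4)]] by simp
qed

lemma rhom_mono: "rhom L s ==> M <= L ==> rhom M s"
 by (auto simp: rhom_def)

lemma rhom_agree_sfd:
 assumes "rhom L s" "rhom L t" "sfd L" shows "sfd {x : L. s x = t x}"
 unfolding sfd_def using assms
 by (auto simp: rhom_0 rhom_1 rhom_add rhom_mult rhom_minus rhom_inverse sfd_closed)

lemma rhom_gen_agree:
 assumes "rhom L s" "rhom L t" "sfd L" "A <= L" "!!x. x : A ==> s x = t x" "x : gen A"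
 shows "s x = t x"
 using gen_least[OF rhom_agree_sfd[OF assms(1-3)], of A] assms(4-6) by auto

lemma rhom_image_sfd:
 assumes "rhom L s" "sfd L" "sfd M" "M <= L" shows "sfd (s ` M)"
proof -
 have r: "rhom M s" using assms rhom_mono by auto
 have "s x + s y : s ` M" "s x * s y : s ` M" "- s x : s ` M" "inverse (s x) : s ` M"
 if "x : M" "y : M" for x y
 using that assms(3) r rhom_add[OF r, symmetric] rhom_mult[OF r, symmetric]
  rhom_minus[OF r, symmetric] rhom_inverse[OF r, symmetric]
 by (auto intro!: imageI sfd_closed)
 moreover have "0 : s ` M" "1 : s ` M"
 using assms(3) rhom_0[OF r] rhom_1[OF r] by (metis imageI sfd_0, metis imageI sfd_1)
 ultimately show ?thesis unfolding sfd_def by auto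
qed

text \<open>Extensionality makes an automorphism of \<open>L\<close> a unique function, so that
  \<open>auts F L\<close> can be counted and identified with the carrier of
  \<open>Gal F L\<close>.\<close>

definition auts :: "'a::field set => 'a set => ('a => 'a) set" where
 "auts F L = {s : extensional L. rhom L s & s ` L = L & (ALL x:F. s x = x)}"

lemma auts_rhom: "s : auts F L ==> rhom L s"
 and auts_fix: "s : auts F L ==> x : F ==> s x = x"
 and auts_in: "s : auts F L ==> x : L ==> s x : L"
 and auts_image: "s : auts F L ==> s ` L = L"
 by (auto simp: auts_def)

lemma auts_eqI:
 "s : auts F L ==> t : auts F' L ==> (!!x. x : L ==> s x = t x) ==> s = t"
 by (rule extensionalityI[of _ L]) (auto simp: auts_def)

lemma auts_id: "F <= L ==> (\<lambda>x\<in>L. x) : auts F L" if "sfd L"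
 using that by (auto simp: auts_def rhom_def sfd_closed)

lemma auts_compose: "s : auts F L ==> t : auts F L ==> F <= L ==> sfd L ==> compose L s t : auts F L"
proof -
 assume a: "s : auts F L" "t : auts F L" "F <= L" "sfd L"
 have i: "compose L s t ` L = s ` t ` L" by (force simp: compose_eq)
 have "rhom L (compose L s t)"
 using auts_rhom[OF a(1)] auts_rhom[OF a(2)] auts_in[OF a(2)] a(4)
 by (simp add: rhom_def compose_eq sfd_closed)
 then show ?thesis using a i by (auto simp: auts_def compose_eq subset_iff)
qed

definition Fix :: "'a set => ('a => 'a) set => 'a set" where
 "Fix L H = {x : L. ALL s:H. s x = x}"

lemma FixI: "x : L ==> (!!s. s : H ==> s x = x) ==> x : Fix L H"
 by (auto simp: Fix_def)

lemma Fix_sub: "Fix L H <= L" by (auto simp: Fix_def)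

lemma sfd_Inter: assumes "!!M. M : C ==> sfd M" shows "sfd (Inf C)"
 by (subst sfd_def) (auto simp: assms sfd_closed)

lemma Fix_sfd: "sfd L ==> H <= auts F L ==> sfd (Fix L H)"
proof -
 assume a: "sfd L" "H <= auts F L"
 have "Fix L H = Inf (insert L ((%s. {x : L. s x = x}) ` H))" by (auto simp: Fix_def)
 moreover have "sfd {x : L. s x = id x}" if "s : H" for s
 using that a by (intro rhom_agree_sfd) (auto simp: auts_def rhom_def)
 ultimately show "sfd (Fix L H)" using a(1) by (simp only:) (rule sfd_Inter, auto)
qed

text \<open>A finite group of automorphisms; inverses come for free from finiteness, see
  \<open>agrp_inv\<close>.\<close>

definition agrp :: "'a::field set => ('a => 'a) set => bool" where
 "agrp L H \<longleftrightarrow> H <= auts {} L & finite H & (\<lambda>x\<in>L. x) : H & (ALL s:H. ALL t:H. compose L s t : H)"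

lemma auts_mono: "F' <= F ==> auts F L <= auts F' L"
 by (auto simp: auts_def)

lemma agrp_D: assumes "agrp L H" "s : H"
 shows "rhom L s" "s ` L = L" "!!x. x : L ==> s x : L" "s : extensional L"
 using assms by (auto simp: agrp_def auts_def)

lemma agrp_compose_bij:
 assumes "agrp L H" "sfd L" "s : H" shows "bij_betw (compose L s) H H"
proof -
 have "inj_on (compose L s) H"
 proof (rule inj_onI)
 fix t u assume tu: "t : H" "u : H" "compose L s t = compose L s u"
 have "s (t x) = s (u x)" if "x : L" for x
  using fun_cong[OF tu(3), of x] that by (simp add: compose_eq)
 then have "t x = u x" if "x : L" for x
  using that agrp_D[OF assms(1)] tu rhom_inj[OF agrp_D(1)[OF assms(1,3)] assms(2)]
  by (meson inj_onD)
 then show "t = u" using agrp_D(4)[OF assms(1)] tu by (auto intro: extensionalityI)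
 qed
 moreover have "compose L s ` H <= H" using assms by (auto simp: agrp_def)
 ultimately show ?thesis using assms(1) by (simp add: agrp_def bij_betw_def endo_inj_surj)
qed

text \<open>Left translation by \<open>s\<close> permutes the finite set \<open>H\<close>, so the
  identity is among its values.\<close>

lemma agrp_inv:
 assumes "agrp L H" "sfd L" "s : H"
 shows "EX t:H. ALL x:L. t (s x) = x & s (t x) = x"
proof -
 obtain t where t: "t : H" "compose L s t = (\<lambda>x\<in>L. x)"
 using agrp_compose_bij[OF assms] assms(1) unfolding bij_betw_def agrp_def by (metis imageE)
 have st: "s (t x) = x" if "x : L" for x using fun_cong[OF t(2), of x] that by (simp add: compose_eq)
 have "t (s x) = x" if "x : L" for x
 proof -
 have "s (t (s x)) = s x" using st that agrp_D(3)[OF assms(1,3)] by blast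
 then show ?thesis using that rhom_inj[OF agrp_D(1)[OF assms(1,3)] assms(2)] 
  agrp_D(3)[OF assms(1,3)] agrp_D(3)[OF assms(1) t(1)] by (meson inj_onD)
 qed
 with st t show ?thesis by blast
qed

lemma agrp_sum_compose:
 assumes "agrp L H" "sfd L" "t : H" "!!s. s : H ==> f (compose L t s) = g s"
 shows "sum f H = sum g H"
 using sum.reindex_bij_betw[OF agrp_compose_bij[OF assms(1-3)], of f] assms(4) by simp

lemma agrp_prod_compose:
 assumes "agrp L H" "sfd L" "t : H" "!!s. s : H ==> f (compose L t s) = g s"
 shows "prod f H = prod g H"
 using prod.reindex_bij_betw[OF agrp_compose_bij[OF assms(1-3)], of f] assms(4) by simp

lemma agrp_trace_fixed:
 assumes "agrp L H" "sfd L" "x : L" shows "(SUM s:H. s x) : Fix L H"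
proof (rule FixI)
 show "(SUM s:H. s x) : L" using assms agrp_D(3) by (intro sfd_sum) auto
 fix t assume t: "t : H"
 have "t (SUM s:H. s x) = (SUM s:H. t (s x))"
 using assms agrp_D t by (intro rhom_sum) auto
 also have "... = (SUM s:H. s x)"
 by (rule agrp_sum_compose[OF assms(1,2) t, symmetric]) (use assms in "simp add: compose_eq")
 finally show "t (SUM s:H. s x) = (SUM s:H. s x)" .
qed

lemma agrp_norm_fixed:
 assumes "agrp L H" "sfd L" "x : L" shows "(PROD s:H. s x) : Fix L H"
proof (rule FixI)
 show "(PROD s:H. s x) : L" using assms agrp_D(3) by (intro sfd_prod) auto
 fix t assume t: "t : H"
 have "t (PROD s:H. s x) = (PROD s:H. t (s x))"
 using assms agrp_D t by (intro rhom_prod) auto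
 also have "... = (PROD s:H. s x)"
 by (rule agrp_prod_compose[OF assms(1,2) t, symmetric]) (use assms in "simp add: compose_eq")
 finally show "t (PROD s:H. s x) = (PROD s:H. s x)" .
qed

section \<open>Independence of characters and the Galois correspondence\<close>

text \<open>
  The element \<open>\<Sum> a \<otimes> b\<close> built here is the idempotent of \<open>M \<otimes> B\<close> attached to the
  character \<open>s0\<close>: it is a product of factors \<open>(x \<otimes> 1 - 1 \<otimes> s x) / (s0 x - s x)\<close>.
\<close>

lemma characters_separate_list:
 assumes "finite S" "sfd M" "sfd B" "rhom M s0" "s0 ` M <= B"
 and "!!s. s : S ==> rhom M s & s ` M <= B"
 shows "EX ps. set ps <= M \<times> B & (\<Sum>(a,b)\<leftarrow>ps. b * s0 a) = 1 &
 (ALL s:S. (EX x:M. s x ~= s0 x) --> (\<Sum>(a,b)\<leftarrow>ps. b * s a) = 0)"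
 using assms(1,6)
proof (induction S)
 case empty
 show ?case using assms by (intro exI[of _ "[(1,1)]"]) (auto simp: rhom_1)
next
 case (insert s S)
 then obtain ps where ps: "set ps <= M \<times> B" "(\<Sum>(a,b)\<leftarrow>ps. b * s0 a) = 1"
 "ALL s:S. (EX x:M. s x ~= s0 x) --> (\<Sum>(a,b)\<leftarrow>ps. b * s a) = 0" by auto
 show ?case
 proof (cases "EX x:M. s x ~= s0 x")
 case False
 then show ?thesis using ps by auto
 next
 case True
 then obtain x where x: "x : M" "s x ~= s0 x" by auto
 define d where "d = s0 x - s x"
 have d: "d ~= 0" using x by (auto simp: d_def)
 have xB: "s x : B" "s0 x : B" using x insert.prems assms by auto
 define qs where "qs = map (%(a,b). (a * x, b / d)) ps @ map (%(a,b). (a, - b * s x / d)) ps"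
 have val: "(\<Sum>(a,b)\<leftarrow>qs. b * t a) = (\<Sum>(a,b)\<leftarrow>ps. b * t a) * (t x - s x) / d"
  if "rhom M t" for t
 proof -
  have "(\<Sum>(a,b)\<leftarrow>map (%(a,b). (a * x, b / d)) ps @ map (%(a,b). (a, - b * s x / d)) ps. b * t a)
   = (\<Sum>(a,b)\<leftarrow>ps. b * t a) * (t x - s x) / d" using ps(1)
  apply (induction ps)
  apply (use x rhom_mult[OF that] in "auto simp: field_simps d split: prod.splits")
  done
  then show ?thesis by (simp add: qs_def)
 qed
 have "d : B" unfolding d_def using assms(3) xB by (intro sfd_diff)
 then have "set qs <= M \<times> B"
  using ps(1) x assms(2,3) xB unfolding qs_def by (auto intro!: sfd_divide sfd_mult sfd_minus)
 moreover have "(\<Sum>(a,b)\<leftarrow>qs. b * s0 a) = 1" using val[OF assms(4)] ps(2) d by (simp add: d_def)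
 moreover have "(\<Sum>(a,b)\<leftarrow>qs. b * t a) = 0" if "t : insert s S" "EX x:M. t x ~= s0 x" for t
  using val[of t] insert.prems that ps(3) by (cases "t = s") auto
 ultimately show ?thesis by blast
 qed
qed

lemma characters_separate:
 assumes "finite S" "sfd M" "sfd B" "rhom M s0" "s0 ` M <= B"
 and "!!s. s : S ==> rhom M s & s ` M <= B"
 obtains n :: nat and a b where "!!j. j < n ==> a j : M & b j : B"
 "(SUM j<n. b j * s0 (a j)) = 1"
 "!!s. s : S ==> (EX x:M. s x ~= s0 x) ==> (SUM j<n. b j * s (a j)) = 0"
proof -
 obtain ps where ps: "set ps <= M \<times> B" "(\<Sum>(a,b)\<leftarrow>ps. b * s0 a) = 1"
 "ALL s:S. (EX x:M. s x ~= s0 x) --> (\<Sum>(a,b)\<leftarrow>ps. b * s a) = 0"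
 using characters_separate_list[OF assms] by auto
 have e: "(SUM j<length ps. snd (ps ! j) * t (fst (ps ! j))) = (\<Sum>(a,b)\<leftarrow>ps. b * t a)" for t
 by (simp add: sum_list_sum_nth atLeast0LessThan case_prod_beta)
 show ?thesis
 by (rule that[of "length ps" "%j. fst (ps ! j)" "%j. snd (ps ! j)"])
  (use ps e in "auto dest!: nth_mem")
qed

text \<open>Pairing the relation with the idempotent attached to \<open>s0\<close> kills every other
  character and leaves \<open>c s0\<close>.\<close>

lemma dedekind:
 assumes "finite S" "sfd M" "!!s. s : S ==> rhom M s"
 and "!!s t. s : S ==> t : S ==> s ~= t ==> EX x:M. s x ~= t x"
 and "!!x. x : M ==> (SUM s:S. c s * s x) = 0" "s0 : S"
 shows "c s0 = 0"
proof -
 obtain n :: nat and a b where ab: "!!j. j < n ==> a j : M & b j : UNIV"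
 "(SUM j<n. b j * s0 (a j)) = 1"
 "!!s. s : S - {s0} ==> (EX x:M. s x ~= s0 x) ==> (SUM j<n. b j * s (a j)) = 0"
 by (rule characters_separate[of "S - {s0}" M UNIV s0])
  (use assms in "auto simp: sfd_def[of UNIV]")
 have "0 = (SUM j<n. b j * (SUM s:S. c s * s (a j)))" using ab assms by simp
 also have "... = (SUM s:S. c s * (SUM j<n. b j * s (a j)))"
 by (simp add: sum_distrib_left mult.left_commute) (rule sum.swap)
 also have "... = (SUM s:S. if s = s0 then c s else 0)"
 using ab assms by (intro sum.cong) auto
 also have "... = c s0" using assms by simp
 finally show ?thesis by simp
qed

text \<open>The trace is not the zero form by independence of characters; a nonzero value is fixed
  by \<open>H\<close> and may be divided out.\<close>

lemma agrp_trace_one: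
 assumes "agrp L H" "sfd L" shows "EX x:L. (SUM s:H. s x) = 1"
proof -
 have "EX y:L. (SUM s:H. s y) ~= 0"
 proof (rule ccontr)
 assume "~ ?thesis"
 then have "(1::'a) = 0"
 proof (intro dedekind[of H L "%_. 1" "\<lambda>x\<in>L. x"])
  show "EX x:L. s x ~= t x" if "s : H" "t : H" "s ~= t" for s t
  using that agrp_D(4)[OF assms(1)] by (meson extensionalityI)
 qed (use assms agrp_D(1)[OF assms(1)] in "auto simp: agrp_def")
 then show False by simp
 qed
 then obtain y where y: "y : L" "(SUM s:H. s y) ~= 0" by auto
 define c where "c = (SUM s:H. s y)"
 have c: "c : Fix L H" using agrp_trace_fixed[OF assms y(1)] by (simp add: c_def)
 have "s (y / c) = s y / c" if "s : H" for s
 using that agrp_D[OF assms(1)] assms y c by (subst rhom_divide[of L]) (auto simp: Fix_def)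
 then have "(SUM s:H. s (y / c)) = (SUM s:H. s y) / c"
 by (simp add: sum_divide_distrib)
 then have "(SUM s:H. s (y / c)) = 1"
 using y by (simp add: c_def)
 then show ?thesis using y c assms by (auto simp: Fix_def intro!: bexI[of _ "y / c"] sfd_divide)
qed

text \<open>For \<open>t\<close> outside \<open>H\<close> the coset of \<open>t\<close> is disjoint
  from \<open>H\<close>. Since \<open>t\<close> fixes all traces, the sum over the coset minus the
  sum over \<open>H\<close> is a vanishing combination of distinct characters with coefficients one
  and minus one.\<close>

lemma artin_auts:
 assumes "agrp L H" "sfd L" shows "auts (Fix L H) L = H"
proof (intro subset_antisym subsetI)
 fix t assume t: "t : H"
 then show "t : auts (Fix L H) L"
 using agrp_D[OF assms(1) t] by (auto simp: auts_def Fix_def)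
next
 fix t assume t: "t : auts (Fix L H) L"
 note tr = auts_rhom[OF t]
 have fin: "finite H" using assms by (auto simp: agrp_def)
 show "t : H"
 proof (rule ccontr)
 assume nt: "t ~: H"
 define C where "C = compose L t ` H"
 have inj: "inj_on (compose L t) H"
 proof (rule inj_onI)
  fix u v assume uv: "u : H" "v : H" "compose L t u = compose L t v"
  have "u x = v x" if "x : L" for x
  using fun_cong[OF uv(3), of x] that
   inj_on_eq_iff[OF rhom_inj[OF tr assms(2)], of "u x" "v x"] agrp_D(3)[OF assms(1)] uv(1,2)
  by (simp add: compose_eq)
  then show "u = v" using agrp_D(4)[OF assms(1)] uv by (auto intro: extensionalityI)
 qed
 have disj: "C Int H = {}"
 proof (rule ccontr)
  assume "C Int H ~= {}"
  then obtain h where h: "h : H" "compose L t h : H" by (auto simp: C_def)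
  obtain g where g: "g : H" "ALL x:L. g (h x) = x & h (g x) = x"
  using agrp_inv[OF assms h(1)] by auto
  have "compose L (compose L t h) g = t"
  using g agrp_D(3)[OF assms(1) g(1)] t by (intro extensionalityI[of _ L]) (auto simp: compose_eq auts_def)
  then show False using nt h g assms(1) by (metis agrp_def)
 qed
 have rC: "rhom L s & s : extensional L" if "s : C Un H" for s
 proof (cases "s : H")
  case False
  then obtain h where h: "h : H" "s = compose L t h" using \<open>s : C Un H\<close> by (auto simp: C_def)
  note r = agrp_D(1)[OF assms(1) h(1)]
  show ?thesis unfolding h(2) using agrp_D(3)[OF assms(1) h(1)] assms(2)
  by (auto simp: rhom_def[of L "compose L t h"] compose_eq sfd_closed rhom_1[OF tr] rhom_add[OF tr]
   rhom_mult[OF tr] rhom_1[OF r] rhom_add[OF r] rhom_mult[OF r])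
 qed (use agrp_D[OF assms(1)] in auto)
 have "(SUM s:C Un H. (if s : C then 1 else -1) * s x) = 0" if "x : L" for x
 proof -
  have "(SUM s:C Un H. (if s : C then 1 else -1) * s x) =
   (SUM s:C. s x) + (SUM s:H. - s x)"
  proof (subst sum.union_disjoint)
  have "s ~: C" if "s : H" for s using disj that by auto
  then show "(SUM s:C. (if s : C then 1 else -1) * s x) + (SUM s:H. (if s : C then 1 else -1) * s x)
   = (SUM s:C. s x) + (SUM s:H. - s x)" by simp
  qed (use fin disj in "auto simp: C_def")
  also have "(SUM s:C. s x) = (SUM s:H. t (s x))"
  unfolding C_def using inj that by (subst sum.reindex) (auto simp: compose_eq)
  also have "... = t (SUM s:H. s x)"
  using agrp_D[OF assms(1)] assms(2) that by (intro rhom_sum[OF tr, symmetric]) auto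
  also have "... = (SUM s:H. s x)" using agrp_trace_fixed[OF assms that] auts_fix[OF t] by auto
  finally show ?thesis by (simp add: sum_negf)
 qed
 moreover have "(\<lambda>x\<in>L. x) : H" using assms by (auto simp: agrp_def)
 moreover have "EX x:L. s x ~= u x" if "s : C Un H" "u : C Un H" "s ~= u" for s u
  using that rC by (meson extensionalityI)
 ultimately have "(if (\<lambda>x\<in>L. x) : C then 1 else -1 :: 'a) = 0"
  using fin assms(2) rC
  by (intro dedekind[of "C Un H" L "%s. if s : C then 1 else -1" "\<lambda>x\<in>L. x"]) (auto simp: C_def)
 then show False by (auto split: if_splits)
 qed
qed

text \<open>Finiteness is required of the group only; \<open>dimension\<close> shows later that its
  order is the degree.\<close>

locale galois =
 fixes F L :: "'a::field set"
 assumes sfF: "sfd F" and sfL: "sfd L" and FL: "F <= L" and finG: "finite (auts F L)"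
 and Fix_auts: "Fix L (auts F L) <= F"
begin

abbreviation "G == auts F L"

lemma Fix_G: "Fix L G = F"
 using Fix_auts FL by (auto simp: Fix_def auts_def)

lemma fixedD: "x : L ==> (!!s. s : G ==> s x = x) ==> x : F"
 using Fix_auts by (auto simp: Fix_def)

lemma G_agrp: "agrp L G"
 using auts_id[OF sfL FL] auts_compose[OF _ _ FL sfL] finG auts_mono[of "{}" F L]
 by (auto simp: agrp_def)

lemma G_inv: "s : G ==> EX t:G. ALL x:L. t (s x) = x & s (t x) = x"
 using agrp_inv[OF G_agrp sfL] .

lemma G_id: "(\<lambda>x\<in>L. x) : G"
 using auts_id[OF sfL FL] .

lemma trace_F: "x : L ==> (SUM s:G. s x) : F"
 using agrp_trace_fixed[OF G_agrp sfL] Fix_G by blast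

lemma norm_F: "x : L ==> (PROD s:G. s x) : F"
 using agrp_norm_fixed[OF G_agrp sfL] Fix_G by blast

text \<open>The idempotent at the identity gives relations for conjugates of the \<open>a j\<close>.
  Applying \<open>s\<close> to the relation of its inverse \<open>t\<close> moves the conjugation to
  the \<open>b j\<close>, while the \<open>a j\<close> stay in \<open>M\<close>.\<close>

lemma dual_family:
 assumes "sfd M" "F <= M" "M <= L"
 obtains n :: nat and a b where "!!j. j < n ==> a j : M & b j : L"
 "!!s. s : G ==> (SUM j<n. a j * s (b j)) = (if ALL x:M. s x = x then 1 else 0)"
proof -
 let ?i = "\<lambda>x\<in>L. x"
 obtain n :: nat and a b where ab: "!!j. j < n ==> a j : M & b j : L"
 "(SUM j<n. b j * ?i (a j)) = 1"
 "!!s. s : G ==> (EX x:M. s x ~= ?i x) ==> (SUM j<n. b j * s (a j)) = 0"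
 by (rule characters_separate[of G M L ?i])
  (use finG sfL assms G_id auts_in rhom_mono[OF auts_rhom] in blast)+
 show ?thesis
 proof (rule that[of n a b])
 fix s assume s: "s : G"
 obtain t where t: "t : G" "ALL x:L. t (s x) = x & s (t x) = x" using G_inv[OF s] by auto
 have iff: "(ALL x:M. s x = x) \<longleftrightarrow> (ALL x:M. t x = x)"
  using t assms by (metis subsetD)
 have aL: "a j : L" if "j < n" for j using ab(1)[OF that] assms by auto
 have "(SUM j<n. a j * s (b j)) = (SUM j<n. s (t (a j)) * s (b j))"
  using t aL by (intro sum.cong) auto
 also have "... = (SUM j<n. s (t (a j) * b j))"
  using aL ab t s by (intro sum.cong) (auto simp: rhom_mult[OF auts_rhom[OF s]] auts_in)
 also have "... = s (SUM j<n. t (a j) * b j)"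
  using aL ab t s sfL by (intro rhom_sum[symmetric, OF auts_rhom[OF s]]) (auto simp: auts_in sfd_mult)
 also have "(SUM j<n. t (a j) * b j) = (if ALL x:M. s x = x then 1 else 0)"
 proof (cases "ALL x:M. s x = x")
  case True
  then have "(SUM j<n. t (a j) * b j) = (SUM j<n. b j * ?i (a j))"
  using iff ab aL by (intro sum.cong) auto
  then show ?thesis using True ab by simp
 next
  case False
  then obtain x where "x : M" "t x ~= x" using iff by auto
  then have "(SUM j<n. b j * t (a j)) = 0" using ab(3)[OF t(1)] assms(3) by (auto simp: subset_iff)
  then show ?thesis using False by (auto simp: mult.commute)
 qed
 finally show "(SUM j<n. a j * s (b j)) = (if ALL x:M. s x = x then 1 else 0)"
  using rhom_0[OF auts_rhom[OF s] sfL] rhom_1[OF auts_rhom[OF s]] by auto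
 qed (use ab in auto)
qed

lemma auts_M: "F <= M ==> auts M L = {s : G. ALL x:M. s x = x}"
 by (auto simp: auts_def)

lemma agrp_M: assumes "F <= M" "M <= L" shows "agrp L (auts M L)"
proof -
 have "auts M L <= auts {} L" "finite (auts M L)"
 using finite_subset[OF _ finG] auts_mono[of F M L] auts_mono[of "{}" M L] assms by auto
 then show ?thesis using auts_id[OF sfL assms(2)] auts_compose[OF _ _ assms(2) sfL] by (auto simp: agrp_def)
qed

text \<open>
  With \<open>\<Sum> a \<otimes> b\<close> the idempotent of \<open>M\<close> and \<open>z\<close> of trace one over \<open>Stab M\<close>, a fixed
  point \<open>y\<close> of \<open>Stab M\<close> equals \<open>\<Sum> a \<cdot> Tr (y z b)\<close>, which lies in \<open>M\<close>.
\<close>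

lemma galois_upper:
 assumes "sfd M" "F <= M" "M <= L" shows "galois M L"
proof
 show "sfd M" "sfd L" "M <= L" using assms sfL by auto
 show "finite (auts M L)" using finite_subset[OF _ finG] auts_mono[of F M L] assms by auto
 show "Fix L (auts M L) <= M"
 proof
 fix y assume y: "y : Fix L (auts M L)"
 obtain n :: nat and a b where ab: "!!j. j < n ==> a j : M & b j : L"
  "!!s. s : G ==> (SUM j<n. a j * s (b j)) = (if ALL x:M. s x = x then 1 else 0)"
  by (rule dual_family[OF assms]) blast
 obtain z where z: "z : L" "(SUM s:auts M L. s z) = 1"
  using agrp_trace_one[OF agrp_M[OF assms(2,3)] sfL] by auto
 have yL: "y : L" using y by (auto simp: Fix_def)
 have "(SUM j<n. a j * (SUM s:G. s (y * z * b j))) = (SUM s:G. SUM j<n. a j * s (y * z * b j))"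
  by (simp add: sum_distrib_left) (rule sum.swap)
 also have "... = (SUM s:G. s (y * z) * (SUM j<n. a j * s (b j)))"
 proof (intro sum.cong refl)
  fix s assume "s : G"
  then have "s (y * z * b j) = s (y * z) * s (b j)" if "j < n" for j
  using that ab yL z sfL by (intro rhom_mult[OF auts_rhom]) (auto intro: sfd_mult)
  then show "(SUM j<n. a j * s (y * z * b j)) = s (y * z) * (SUM j<n. a j * s (b j))"
  by (simp add: sum_distrib_left mult_ac)
 qed
 also have "... = (SUM s:G. if s : auts M L then s (y * z) else 0)"
  using ab(2) by (intro sum.cong refl) (simp add: auts_M[OF assms(2)])
 also have "... = (SUM s:auts M L. s (y * z))"
  using finG auts_M[OF assms(2)] by (auto simp: sum.inter_filter intro!: sum.cong)
 also have "... = (SUM s:auts M L. y * s z)"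
 proof (intro sum.cong refl)
  fix s assume s: "s : auts M L"
  show "s (y * z) = y * s z" using y z s rhom_mult[OF auts_rhom[OF s] yL z(1)] by (auto simp: Fix_def)
 qed
 also have "... = y" using z by (simp add: sum_distrib_left[symmetric])
 finally have "y = (SUM j<n. a j * (SUM s:G. s (y * z * b j)))" by simp
 moreover have "a j * (SUM s:G. s (y * z * b j)) : M" if "j < n" for j
  using ab that yL z assms sfL by (intro sfd_mult subsetD[OF assms(2) trace_F]) (auto intro!: sfd_mult)
 ultimately show "y : M" using assms(1) sfd_sum[of M] by (metis (no_types, lifting) lessThan_iff)
 qed
qed

end

lemma galois_artin: assumes "agrp L H" "sfd L" shows "galois (Fix L H) L"
 by standard (use assms artin_auts[OF assms] in "auto simp: Fix_sub agrp_def intro: Fix_sfd")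

section \<open>Splitting fields\<close>

definition polys :: "'a::field set => 'a poly set" where
 "polys M = {p. ALL i. coeff p i : M}"

lemma polysD: "p : polys M ==> coeff p i : M"
 by (auto simp: polys_def)

lemma polys_mono: "M <= N ==> polys M <= polys N"
 by (auto simp: polys_def)

lemma polys_add: "sfd M ==> p : polys M ==> q : polys M ==> p + q : polys M"
 and polys_diff: "sfd M ==> p : polys M ==> q : polys M ==> p - q : polys M"
 and polys_minus: "sfd M ==> p : polys M ==> - p : polys M"
 and polys_mult: "sfd M ==> p : polys M ==> q : polys M ==> p * q : polys M"
 and polys_0: "sfd M ==> 0 : polys M"
 and polys_1: "sfd M ==> 1 : polys M"
 by (auto simp: polys_def sfd_add sfd_diff sfd_minus coeff_mult coeff_1 intro!: sfd_sum sfd_mult)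

lemma polys_pCons: "a : M ==> p : polys M ==> pCons a p : polys M"
 by (auto simp: polys_def coeff_pCons split: nat.splits)

lemma polys_monom: "sfd M ==> c : M ==> monom c n : polys M"
 by (auto simp: polys_def)

lemma polys_prod: "sfd M ==> (!!i. i : A ==> f i : polys M) ==> prod f A : polys M"
 by (induction A rule: infinite_finite_induct) (auto simp: polys_mult polys_1)

lemma polys_poly: "sfd N ==> M <= N ==> p : polys M ==> x : N ==> poly p x : N"
 unfolding poly_altdef by (intro sfd_sum sfd_mult sfd_power) (auto simp: polys_def)

section \<open>Minimal polynomials, simple extensions and the continuation of embeddings\<close>

lemma polys_divide:
 assumes M: "sfd M" and h: "h : polys M" "h ~= 0" and "p : polys M"
 shows "EX q:polys M. EX r:polys M. p = h * q + r & (r = 0 | degree r < degree h)"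
 using assms(4)
proof (induction "if p = 0 then 0 else Suc (degree p)" arbitrary: p rule: less_induct)
 case less
 show ?case
 proof (cases "p = 0 | degree p < degree h")
 case True
 then show ?thesis using less.prems polys_0[OF M] by (intro bexI[of _ 0] bexI[of _ p]) auto
 next
 case False
 define c where "c = monom (lead_coeff p / lead_coeff h) (degree p - degree h)"
 define p' where "p' = p - h * c"
 have c: "c : polys M" unfolding c_def
  using less.prems h M by (intro polys_monom sfd_divide) (auto simp: polys_def)
 have p': "p' : polys M" using c less.prems h M by (auto simp: p'_def intro!: polys_diff polys_mult)
 have "degree (h * c) = degree p"
  using False h by (simp add: c_def degree_mult_eq degree_monom_eq)
 then have "degree p' <= degree p" unfolding p'_def by (intro degree_diff_le) auto
 moreover have "coeff p' (degree p) = 0"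
  using False h coeff_mult_degree_sum[of h c]
  by (simp add: p'_def c_def degree_monom_eq)
 ultimately have "p' = 0 | degree p' < degree p" by (rule eq_zero_or_degree_less)
 then obtain q r where "q : polys M" "r : polys M" "p' = h * q + r" "r = 0 | degree r < degree h"
  using less.hyps[OF _ p'] False by (cases "p' = 0") auto
 moreover from this have "p = h * (q + c) + r" by (simp add: p'_def algebra_simps)
 ultimately show ?thesis using polys_add[OF M _ c] by blast
 qed
qed

definition minp :: "'a::field set => 'a => 'a poly => bool" where
 "minp M x h \<longleftrightarrow> h : polys M & h ~= 0 & poly h x = 0 &
 (ALL p:polys M. p ~= 0 --> poly p x = 0 --> degree h <= degree p)"

lemma minp_ex: assumes "f : polys M" "f ~= 0" "poly f x = 0" shows "EX h. minp M x h"
 using ex_has_least_nat[of "%h. h : polys M & h ~= 0 & poly h x = 0" f degree] assms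
 by (auto simp: minp_def)

lemma minp_degree: assumes "minp M x h" shows "degree h > 0"
proof (rule ccontr)
 assume "~ degree h > 0"
 then obtain a where "h = [:a:]" by (auto elim: degree_eq_zeroE)
 then show False using assms by (auto simp: minp_def)
qed

lemma minp_reduce:
 assumes "sfd M" "minp M x h" "p : polys M"
 shows "EX r:polys M. poly r x = poly p x & (r = 0 | degree r < degree h)"
proof -
 obtain q r where "q : polys M" "r : polys M" "p = h * q + r" "r = 0 | degree r < degree h"
 using polys_divide[of M h p] assms by (auto simp: minp_def)
 then show ?thesis using assms by (intro bexI[of _ r]) (auto simp: minp_def)
qed

lemma minp_dvd:
 assumes "sfd M" "minp M x h" "p : polys M" "poly p x = 0"
 shows "EX q:polys M. p = h * q"
proof -
 obtain q r where qr: "q : polys M" "r : polys M" "p = h * q + r" "r = 0 | degree r < degree h"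
 using polys_divide[of M h p] assms by (auto simp: minp_def)
 then have "poly r x = 0" using assms by (simp add: minp_def)
 then have "r = 0" using qr assms by (auto simp: minp_def)
 with qr show ?thesis by auto
qed

text \<open>Descent on the degree: from \<open>h = p * q + r\<close> and \<open>h(x) = 0\<close>
  follows \<open>r(x) = - p(x) q(x)\<close>, so an inverse of \<open>r(x)\<close> yields one of
  \<open>p(x)\<close>. Here \<open>q(x)\<close> is nonzero because \<open>q\<close> has smaller
  degree than \<open>h\<close>.\<close>

lemma minp_inverse:
 assumes M: "sfd M" and h: "minp M x h" and "p : polys M" "poly p x ~= 0"
 shows "EX q:polys M. poly q x = inverse (poly p x)"
 using assms(3,4)
proof (induction "degree p" arbitrary: p rule: less_induct)
 case less
 have "EX q:polys M. poly q x = inverse (poly p x)"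
 if p: "p : polys M" "poly p x ~= 0" "degree p < degree h"
  "!!r. r : polys M ==> poly r x ~= 0 ==> degree r < degree p ==> EX q:polys M. poly q x = inverse (poly r x)" for p
 proof (cases "degree p = 0")
 case True
 then obtain a where "p = [:a:]" by (auto elim: degree_eq_zeroE)
 then show ?thesis using p M sfd_inverse[OF M] polysD[of p M 0]
  by (intro bexI[of _ "[:inverse a:]"]) (auto simp: polys_pCons polys_0)
 next
 case False
 obtain q r where qr: "q : polys M" "r : polys M" "h = p * q + r" "r = 0 | degree r < degree p"
  using polys_divide[of M p h] M p h by (cases "p = 0") (auto simp: minp_def)
 have e: "poly r x = - (poly p x * poly q x)"
  using h qr(3) by (auto simp: minp_def eq_neg_iff_add_eq_0 add.commute)
 have "q ~= 0" using qr p by auto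
 moreover have "degree q < degree h"
 proof -
  have "degree (p * q) <= max (degree h) (degree r)"
  using degree_diff_le_max[of h r] qr(3) by simp
  moreover have "degree (p * q) = degree p + degree q" using `q ~= 0` False by (intro degree_mult_eq) auto
  ultimately show ?thesis using p(3) False qr(4) by (auto simp: max_def split: if_splits)
 qed
 ultimately have "poly q x ~= 0" using h qr by (force simp: minp_def)
 then have "poly r x ~= 0" using e p by simp
 then obtain u where u: "u : polys M" "poly u x = inverse (poly r x)"
  using p(4)[OF qr(2)] qr(4) by auto
 show ?thesis
  using u e qr(1) `poly q x ~= 0` p(2) M
  by (intro bexI[of _ "- (q * u)"]) (auto simp: polys_minus polys_mult field_simps)
 qed
 note small = this
 show ?case
 proof (cases "degree p < degree h")
 case True
 then show ?thesis using small[OF less.prems True] less.hyps by blast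
 next
 case False
 obtain r where "r : polys M" "poly r x = poly p x" "r = 0 | degree r < degree h"
  using minp_reduce[OF M h less.prems(1)] by auto
 then show ?thesis using less.hyps[of r] less.prems False by auto
 qed
qed

lemma gen_adjoin:
 assumes M: "sfd M" and h: "minp M x h"
 shows "gen (insert x M) = (%p. poly p x) ` polys M"
proof (intro subset_antisym gen_least)
 let ?A = "(%p. poly p x) ` polys M"
 have "0 : ?A" "1 : ?A" using polys_0[OF M] polys_1[OF M] by (force simp: image_iff)+
 moreover have "a + b : ?A" "a * b : ?A" "- a : ?A" "inverse a : ?A" if ab: "a : ?A" "b : ?A" for a b
 proof -
 obtain p q where pq: "p : polys M" "q : polys M" "a = poly p x" "b = poly q x" using ab by auto
 have "a + b = poly (p + q) x" "a * b = poly (p * q) x" "- a = poly (- p) x" using pq(3,4) by auto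
 then show "a + b : ?A" "a * b : ?A" "- a : ?A"
  using polys_add[OF M pq(1,2)] polys_mult[OF M pq(1,2)] polys_minus[OF M pq(1)] by blast+
 show "inverse a : ?A"
 proof (cases "a = 0")
  case False
  then show ?thesis using minp_inverse[OF M h pq(1)] pq(3) by (metis image_eqI)
 qed (use \<open>0 : ?A\<close> in auto)
 qed
 ultimately show "sfd ?A" unfolding sfd_def by (intro conjI ballI)
 have "[:0,1:] : polys M" using M by (intro polys_pCons polys_0) auto
 moreover have "[:a:] : polys M" if "a : M" for a using that M by (intro polys_pCons polys_0) auto
 ultimately show "insert x M <= ?A" by (force simp: image_iff)
 show "?A <= gen (insert x M)"
 using gen_incl[of "insert x M"] by (auto intro!: polys_poly[of _ M])
qed

lemma map_poly_hom:
 assumes "rhom M s" "sfd M" "p : polys M" "q : polys M"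
 shows "map_poly s (p + q) = map_poly s p + map_poly s q"
 "map_poly s (p - q) = map_poly s p - map_poly s q"
 "map_poly s (p * q) = map_poly s p * map_poly s q"
proof -
 note c = coeff_map_poly[of s, OF rhom_0[OF assms(1,2)]] polysD[OF assms(3)] polysD[OF assms(4)]
 show "map_poly s (p + q) = map_poly s p + map_poly s q"
 by (rule poly_eqI) (simp add: c rhom_add[OF assms(1)])
 show "map_poly s (p - q) = map_poly s p - map_poly s q"
 by (rule poly_eqI) (simp add: c rhom_diff[OF assms(1,2)])
 show "map_poly s (p * q) = map_poly s p * map_poly s q"
 by (rule poly_eqI) (simp add: c coeff_mult rhom_sum[OF assms(1,2)] rhom_mult[OF assms(1)] sfd_mult[OF assms(2)])
qed

lemma poly_map_poly:
 assumes "rhom L s" "sfd L" "p : polys L" "x : L"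
 shows "poly (map_poly s p) (s x) = s (poly p x)"
proof -
 have d: "degree (map_poly s p) = degree p"
 using rhom_eq_0[OF assms(1,2) polysD[OF assms(3)], of "degree p"]
 by (cases "p = 0") (auto intro!: map_poly_degree_eq)
 show ?thesis unfolding poly_altdef d
 using assms rhom_0[OF assms(1,2)]
 by (subst rhom_sum[OF assms(1,2)])
  (auto simp: polysD sfd_mult sfd_power coeff_map_poly rhom_mult[OF assms(1)] rhom_power[OF assms(1,2)])
qed

lemma map_poly_fix:
 assumes "p : polys F" "!!x. x : F ==> s x = x" "s 0 = 0" shows "map_poly s p = p"
 by (rule poly_eqI) (use assms in "auto simp: coeff_map_poly polysD")

text \<open>The value at \<open>p(x)\<close> must be the conjugated polynomial at \<open>y\<close>;
  this is independent of \<open>p\<close> since two choices differ by a multiple of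
  \<open>h\<close>.\<close>

lemma adjoin_extend:
 assumes M: "sfd M" and h: "minp M x h" and s: "rhom M s" and root: "poly (map_poly s h) y = 0"
 shows "EX t. rhom (gen (insert x M)) t & (ALL a:M. t a = s a) & t x = y"
proof -
 define t where "t = (%z. poly (map_poly s (SOME p. p : polys M & poly p x = z)) y)"
 have wd: "poly (map_poly s p) y = poly (map_poly s q) y"
 if pq: "p : polys M" "q : polys M" "poly p x = poly q x" for p q
 proof -
 obtain u where u: "u : polys M" "p - q = h * u"
  using minp_dvd[OF M h, of "p - q"] polys_diff[OF M pq(1,2)] pq(3) by auto
 have "map_poly s p - map_poly s q = map_poly s h * map_poly s u"
  using map_poly_hom[OF s M pq(1,2)] map_poly_hom[OF s M _ u(1), of h] u h by (auto simp: minp_def)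
 then show ?thesis using root by (metis eq_iff_diff_eq_0 mult_zero_left poly_diff poly_mult)
 qed
 have t: "t (poly p x) = poly (map_poly s p) y" if "p : polys M" for p
 proof -
 define p' where "p' = (SOME p'. p' : polys M & poly p' x = poly p x)"
 have "p' : polys M & poly p' x = poly p x"
  unfolding p'_def by (rule someI[of _ p]) (use that in auto)
 then show ?thesis using wd[of p' p] that by (simp add: t_def p'_def)
 qed
 have s0: "s 0 = 0" using rhom_0[OF s M] .
 have X: "[:0,1:] : polys M" and c: "!!a. a : M ==> [:a:] : polys M"
 using M by (auto intro!: polys_pCons polys_0)
 have "rhom (gen (insert x M)) t"
 unfolding gen_adjoin[OF M h] rhom_def
 proof (intro conjI ballI; (elim imageE)?)
 fix u v p q assume "u = poly p x" "v = poly q x" "p : polys M" "q : polys M"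
 then show "t (u + v) = t u + t v" "t (u * v) = t u * t v"
  using t[of p] t[of q] t[OF polys_add[OF M, of p q]] t[OF polys_mult[OF M, of p q]]
  map_poly_hom[OF s M, of p q] by auto
 next
 show "t 1 = 1" using t[OF c[of 1]] M rhom_1[OF s] s0 by (simp add: map_poly_pCons)
 qed
 moreover have "t a = s a" if "a : M" for a using t[OF c[OF that]] s0 by (simp add: map_poly_pCons)
 moreover have "t x = y" using t[OF X] s0 rhom_1[OF s] by (simp add: map_poly_pCons)
 ultimately show ?thesis by blast
qed

text \<open>Separability in counting form: each linear factor divides \<open>g\<close> or its
  cofactor and can be cancelled there. It supplies minimal polynomials with as many distinct roots
  as their degree.\<close>

lemma dvd_linear_prod_roots:
 fixes g q :: "'a::field poly"
 assumes "finite C" "g * q = (PROD b:C. [:- b, 1:])"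
 shows "degree g <= card {b : C. poly g b = 0}"
 using assms
proof (induction C arbitrary: g q)
 case empty
 then have "g dvd 1" by (metis dvdI prod.empty)
 then show ?case using is_unit_iff_degree[of g] by (cases "g = 0") auto
next
 case (insert b C)
 have "poly (g * q) b = 0" using insert by simp
 then consider "poly q b = 0" | "poly g b = 0" by auto
 then show ?case
 proof cases
 case 1
 then obtain q' where q': "q = [:- b, 1:] * q'" by (auto simp: poly_eq_0_iff_dvd)
 then have "[:- b, 1:] * (g * q') = [:- b, 1:] * (PROD b:C. [:- b, 1:])"
  using insert.prems insert.hyps by (simp only: prod.insert not_False_eq_True mult.left_commute)
 then have "g * q' = (PROD b:C. [:- b, 1:])" by (simp only: mult_cancel_left) simp
 from insert.IH[OF this] have "degree g <= card {b : C. poly g b = 0}" .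
 also have "... <= card {c : insert b C. poly g c = 0}" using insert by (intro card_mono) auto
 finally show ?thesis .
 next
 case 2
 then obtain g' where g': "g = [:- b, 1:] * g'" by (auto simp: poly_eq_0_iff_dvd)
 then have "[:- b, 1:] * (g' * q) = [:- b, 1:] * (PROD b:C. [:- b, 1:])"
  using insert.prems insert.hyps by (simp only: prod.insert not_False_eq_True mult.assoc)
 then have e: "g' * q = (PROD b:C. [:- b, 1:])" by (simp only: mult_cancel_left) simp
 then have "g' ~= 0" using insert.hyps by (auto simp: prod_zero_iff)
 then have "degree g = Suc (degree g')" unfolding g' by (subst degree_mult_eq) auto
 also have "... <= Suc (card {b : C. poly g' b = 0})" using insert.IH[OF e] by simp
 also have "... = card (insert b {c : C. poly g' c = 0})" using insert by simp
 also have "... <= card {c : insert b C. poly g c = 0}"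
  using insert by (intro card_mono) (auto simp: g')
 finally show ?thesis .
 qed
qed

text \<open>\<open>S\<close> contains with each element all roots of a separable polynomial over \<open>F\<close> killing it.\<close>

definition split_set :: "'a::field set => 'a set => bool" where
 "split_set F S \<longleftrightarrow> finite S & (ALL x:S. \<exists>C\<subseteq>S. x : C & (PROD b:C. [:- b, 1:]) : polys F)"

text \<open>The conjugate of \<open>h\<close> still divides the split polynomial, whose coefficients
  \<open>s\<close> fixes, and thus has enough roots in \<open>S\<close>.\<close>

lemma split_set_minp:
 assumes "sfd F" "split_set F S" "x : S" "sfd M" "F <= M" "rhom M s" "!!a. a : F ==> s a = a"
 obtains h where "minp M x h" "degree h <= card {b : S. poly (map_poly s h) b = 0}"
proof -
 obtain C where C: "C <= S" "x : C" "(PROD b:C. [:- b, 1:]) : polys F" (is "?f : _")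
 using assms by (auto simp: split_set_def)
 have fin: "finite C" "finite S" using C assms by (auto simp: split_set_def intro: finite_subset)
 have f: "?f : polys M" "?f ~= 0" "poly ?f x = 0"
 using C polys_mono[OF assms(5)] fin by (auto simp: poly_prod prod_zero_iff)
 obtain h where h: "minp M x h" using minp_ex[OF f] by auto
 obtain q where q: "q : polys M" "?f = h * q" using minp_dvd[OF assms(4) h f(1,3)] by auto
 have s0: "s 0 = 0" using rhom_0 assms by blast
 have hM: "h : polys M" "h ~= 0" using h by (auto simp: minp_def)
 have "map_poly s h * map_poly s q = ?f"
 using map_poly_hom(3)[OF assms(6,4) hM(1) q(1)] q(2) map_poly_fix[OF C(3) assms(7) s0] by metis
 from dvd_linear_prod_roots[OF fin(1) this]
 have "degree (map_poly s h) <= card {b : C. poly (map_poly s h) b = 0}" .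
 also have "... <= card {b : S. poly (map_poly s h) b = 0}" using C fin by (intro card_mono) auto
 also have "degree (map_poly s h) = degree h"
 using rhom_eq_0[OF assms(6,4) polysD[OF hM(1)], of "degree h"] hM(2) by (intro map_poly_degree_eq) auto
 finally show ?thesis using h that by blast
qed

lemma split_set_extend:
 assumes "sfd F" "split_set F S" "sfd M" "F <= M" "rhom M s" "!!a. a : F ==> s a = a"
 "finite A" "A <= S"
 shows "EX t. rhom (gen (M Un A)) t & (ALL a:M. t a = s a)"
 using assms(7,8)
proof (induction A)
 case empty
 then show ?case using assms gen_sfd[of M] by auto
next
 case (insert x A)
 then obtain t where t: "rhom (gen (M Un A)) t" "ALL a:M. t a = s a" by auto
 let ?N = "gen (M Un A)"
 have MN: "M <= ?N" using gen_incl[of "M Un A"] by auto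
 obtain h where h: "minp ?N x h" "degree h <= card {b : S. poly (map_poly t h) b = 0}"
 by (rule split_set_minp[OF assms(1,2) _ sfd_gen _ t(1), of x])
  (use insert.prems MN assms t in auto)
 then have "card {b : S. poly (map_poly t h) b = 0} > 0" using minp_degree[OF h(1)] by linarith
 then obtain b where b: "poly (map_poly t h) b = 0" by (auto simp: card_gt_0_iff)
 obtain u where u: "rhom (gen (insert x ?N)) u" "ALL a:?N. u a = t a"
 using adjoin_extend[OF sfd_gen h(1) t(1) b] by auto
 have "gen (insert x ?N) = gen (M Un insert x A)"
 using gen_Un_gen[of "M Un A" "{x}"] by (simp add: Un_ac)
 then show ?case using u t MN by (intro exI[of _ u]) auto
qed

text \<open>Induction on the adjoined elements. If \<open>x = p(y)\<close> with \<open>p\<close> of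
  smaller degree than \<open>h\<close>, each root \<open>b\<close> of \<open>h\<close> in
  \<open>S\<close> is the image of \<open>y\<close> under an embedding over \<open>M\<close> that
  fixes \<open>x\<close>, so \<open>p(b) = x\<close>. Then \<open>p - x\<close> has too many roots
  and vanishes, and \<open>x\<close> is a coefficient of \<open>p\<close>.\<close>

lemma split_set_fixed:
 assumes "sfd F" "split_set F S" "finite A" "A <= S" "sfd M" "F <= M" "gen (M Un A) = L" "x : L"
 "!!t. rhom L t ==> ALL a:M. t a = a ==> t x = x"
 shows "x : M"
 using assms(3-9)
proof (induction A arbitrary: M)
 case empty
 then show ?case using gen_sfd[of M] by auto
next
 case (insert y A)
 let ?N = "gen (insert y M)"
 have MN: "M <= ?N" using gen_incl[of "insert y M"] by auto
 have NL: "gen (?N Un A) = L"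
 using gen_Un_gen[of "insert y M" A] insert.prems(4) by simp
 have xN: "x : ?N"
 proof (rule insert.IH)
 fix t assume t: "rhom L t" "ALL a:?N. t a = a"
 then have "ALL a:M. t a = a" using MN by blast
 then show "t x = x" using insert.prems(6) t(1) by blast
 qed (use insert.prems(1,3,5) MN NL in auto)
 have id: "rhom M (%x. x)" by (auto simp: rhom_def)
 obtain h where h: "minp M y h" "degree h <= card {b : S. poly (map_poly (%x. x) h) b = 0}"
 by (rule split_set_minp[OF assms(1,2) _ insert.prems(2,3) id, of y])
  (use insert.prems in auto)
 have mp: "map_poly (%x. x) h = h" by (simp add: map_poly_idI)
 obtain p0 where p0: "p0 : polys M" "x = poly p0 y"
 using xN gen_adjoin[OF insert.prems(2) h(1)] by auto
 then obtain p where p: "p : polys M" "x = poly p y" "p = 0 | degree p < degree h"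
 using minp_reduce[OF insert.prems(2) h(1) p0(1)] by auto
 have val: "poly p b = x" if b: "b : S" "poly h b = 0" for b
 proof -
 obtain t where t: "rhom ?N t" "ALL a:M. t a = a" "t y = b"
  using adjoin_extend[OF insert.prems(2) h(1) id, of b] b mp by auto
 obtain u where u: "rhom L u" "ALL a:?N. u a = t a"
 proof -
  have "F <= ?N" "!!a. a : F ==> t a = a" "A <= S" using MN insert.prems t(2) by auto
  from split_set_extend[OF assms(1,2) sfd_gen this(1) t(1) this(2) insert.hyps(1) this(3)]
  show ?thesis using that unfolding NL by blast
 qed
 have "u x = x" by (rule insert.prems(6)[OF u(1)]) (use u t MN in auto)
 moreover have "u x = poly (map_poly u p) (u y)"
 proof -
  have "sfd L" "y : L" "M <= L" using NL gen_incl[of "?N Un A"] gen_incl[of "insert y M"] by auto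
  then show ?thesis using poly_map_poly[OF u(1), of p y] p polys_mono[of M L] by auto
 qed
 moreover have "map_poly u p = p" 
  using map_poly_fix[OF p(1), of u] u t MN insert.prems(2) by (auto simp: subset_iff)
 moreover have "u y = b" using u t gen_incl[of "insert y M"] by auto
 ultimately show ?thesis by simp
 qed
 have "p - [:x:] = 0"
 proof (rule ccontr)
 assume nz: "p - [:x:] ~= 0"
 have "degree h <= card {b. poly (p - [:x:]) b = 0}"
  using h(2) mp val poly_roots_finite[OF nz]
  by (intro order_trans[OF h(2)] card_mono) auto
 also have "... <= degree (p - [:x:])" using nz by (rule card_poly_roots_bound)
 also have "... < degree h" using p(3) minp_degree[OF h(1)]
  by (intro degree_diff_less) auto
 finally show False by simp
 qed
 then have "p = [:x:]" by simp
 then show ?case using polysD[OF p(1), of 0] by simp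
qed

lemma poly_linear_prod_0: "finite C ==> poly (PROD b:C. [:- b, 1:]) x = 0 \<longleftrightarrow> x : (C :: 'a::field set)"
 by (auto simp: poly_prod prod_zero_iff)

lemma split_set_normal:
 assumes "sfd F" "split_set F S" "rhom (gen (F Un S)) t" "!!a. a : F ==> t a = a"
 shows "t ` S = S" "t ` gen (F Un S) = gen (F Un S)"
proof -
 let ?L = "gen (F Un S)"
 have FL: "F <= ?L" "S <= ?L" using gen_incl[of "F Un S"] by auto
 have fin: "finite S" using assms by (auto simp: split_set_def)
 have "t x : S" if x: "x : S" for x
 proof -
 obtain C where C: "C <= S" "x : C" "(PROD b:C. [:- b, 1:]) : polys F" (is "?f : _")
  using assms x by (auto simp: split_set_def)
 have "finite C" using C fin finite_subset by auto
 then have f0: "poly ?f x = 0" using C by (simp add: poly_linear_prod_0)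
 moreover have "poly (map_poly t ?f) (t x) = t (poly ?f x)"
  using C FL polys_mono[OF FL(1)] x by (intro poly_map_poly[OF assms(3)]) auto
 moreover have "map_poly t ?f = ?f"
  by (rule map_poly_fix[OF C(3)]) (use assms rhom_0[OF assms(3)] in auto)
 ultimately have "poly ?f (t x) = 0"
  using f0 rhom_0[OF assms(3)] by simp
 then show ?thesis using C `finite C` by (auto simp: poly_linear_prod_0)
 qed
 moreover have inj: "inj_on t ?L" using rhom_inj[OF assms(3)] by simp
 ultimately show S: "t ` S = S"
 using endo_inj_surj[OF fin, of t] inj_on_subset[OF inj FL(2)] by auto
 have tL: "sfd (t ` ?L)" by (rule rhom_image_sfd[OF assms(3)]) auto
 have tF: "t ` F = F" using assms(4) by (auto simp: image_iff)
 have "F Un S <= t ` ?L" using S tF image_mono[OF FL(1), of t] image_mono[OF FL(2), of t] by blast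
 then have 1: "?L <= t ` ?L" by (rule gen_least[OF tL])
 have r: "rhom ?L t" and sL: "sfd ?L" using assms by auto
 have "sfd {x : ?L. t x : ?L}" unfolding sfd_def
 using sL rhom_0[OF r sL] rhom_1[OF r] rhom_add[OF r] rhom_mult[OF r] rhom_minus[OF r sL] rhom_inverse[OF r sL]
 by (auto simp: sfd_closed)
 then have "?L <= {x : ?L. t x : ?L}"
 by (rule gen_least) (use S tF FL in "auto simp: image_iff subset_iff")
 with 1 show "t ` ?L = ?L" by auto
qed

text \<open>Automorphisms are determined by the permutation they induce on the finite set
  \<open>S\<close>, and \<open>split_set_fixed\<close> bounds the fixed field.\<close>

lemma galois_split_set:
 assumes "sfd F" "split_set F S" shows "galois F (gen (F Un S))"
proof
 let ?L = "gen (F Un S)"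
 show FL: "F <= ?L" using gen_incl[of "F Un S"] by auto
 have SL: "S <= ?L" using gen_incl[of "F Un S"] by auto
 have fin: "finite S" using assms by (auto simp: split_set_def)
 show "finite (auts F ?L)"
 proof (rule inj_on_finite[of "%s. restrict s S" _ "S \<rightarrow>\<^sub>E S"])
 show "inj_on (%s. restrict s S) (auts F ?L)"
 proof (rule inj_onI)
  fix s t assume st: "s : auts F ?L" "t : auts F ?L" "restrict s S = restrict t S"
  show "s = t"
  proof (rule auts_eqI[OF st(1,2)])
  fix x assume "x : ?L"
  moreover have "s y = t y" if "y : F Un S" for y
   using that fun_cong[OF st(3), of y] auts_fix[OF st(1)] auts_fix[OF st(2)] by auto
  ultimately show "s x = t x"
   using FL SL by (intro rhom_gen_agree[OF auts_rhom[OF st(1)] auts_rhom[OF st(2)] sfd_gen, of "F Un S" x])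
   simp_all
  qed
 qed
 have "s x : S" if "s : auts F ?L" "x : S" for s x
  using split_set_normal(1)[OF assms auts_rhom[OF that(1)] auts_fix[OF that(1)]] that(2) by auto
 then show "(%s. restrict s S) ` auts F ?L <= S \<rightarrow>\<^sub>E S" by auto
 show "finite (S \<rightarrow>\<^sub>E S)" using fin by (intro finite_PiE)
 qed
 show "Fix ?L (auts F ?L) <= F"
 proof
 fix x assume x: "x : Fix ?L (auts F ?L)"
 show "x : F"
 proof (rule split_set_fixed[OF assms fin subset_refl assms(1) subset_refl refl])
  show "x : ?L" using x by (auto simp: Fix_def)
  fix t assume t: "rhom ?L t" "ALL a:F. t a = a"
  then have "restrict t ?L : auts F ?L"
  using split_set_normal(2)[OF assms t(1)] FL by (auto simp: auts_def rhom_def sfd_closed)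
  then have "restrict t ?L x = x" using x unfolding Fix_def by blast
  then show "t x = x" using x by (auto simp: Fix_def)
 qed
 qed
qed (use assms in auto)

context galois
begin

text \<open>The product runs over the orbit as a set, so its roots are simple even when
  \<open>a\<close> has a nontrivial stabiliser.\<close>

lemma linear_prod_orbit_polys:
 assumes "a : L" shows "(PROD b:(%s. s a) ` G. [:- b, 1:]) : polys F"
proof -
 let ?O = "(%s. s a) ` G" and ?f = "%b. [:- b, 1:]"
 have OL: "?O <= L" using assms auts_in by auto
 have f: "?f b : polys L" if "b : L" for b using that sfL by (auto intro!: polys_pCons polys_0 sfd_minus)
 have P: "prod ?f ?O : polys L" using OL f by (intro polys_prod sfL) auto
 have inv: "map_poly t (prod ?f ?O) = prod ?f ?O" if t: "t : G" for t
 proof -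
 note tr = auts_rhom[OF t]
 have "map_poly t (prod ?f A) = prod (%b. ?f (t b)) A" if "A <= L" for A
  using that
 proof (induction A rule: infinite_finite_induct)
  case (insert b A)
  have "map_poly t (?f b * prod ?f A) = map_poly t (?f b) * map_poly t (prod ?f A)"
  using insert f by (intro map_poly_hom(3)[OF tr sfL] polys_prod[OF sfL]) auto
  then show ?case using insert rhom_minus[OF tr sfL] rhom_0[OF tr sfL] rhom_1[OF tr]
  by (simp add: map_poly_pCons)
 qed (use rhom_0[OF tr sfL] rhom_1[OF tr] in "auto simp: map_poly_1")
 then have "map_poly t (prod ?f ?O) = prod (%b. ?f (t b)) ?O" using OL by auto
 also have "... = prod ?f (t ` ?O)"
  using inj_on_subset[OF rhom_inj[OF tr sfL] OL] by (subst prod.reindex) auto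
 also have "t ` ?O = ?O"
 proof -
  have "t ` ?O <= ?O"
  proof
  fix y assume "y : t ` ?O"
  then obtain s where s: "s : G" "y = t (s a)" by auto
  then have "compose L t s : G" "y = compose L t s a"
   using auts_compose[OF t s(1) FL sfL] assms by (auto simp: compose_eq)
  then show "y : ?O" by blast
  qed
  then show ?thesis
  using endo_inj_surj[of ?O t] finG inj_on_subset[OF rhom_inj[OF tr sfL] OL] by auto
 qed
 finally show ?thesis .
 qed
 have "coeff (prod ?f ?O) i : F" for i
 proof (rule fixedD)
 show "coeff (prod ?f ?O) i : L" using P by (rule polysD)
 fix t assume t: "t : G"
 show "t (coeff (prod ?f ?O) i) = coeff (prod ?f ?O) i"
  using inv[OF t] coeff_map_poly[of t "prod ?f ?O" i] rhom_0[OF auts_rhom[OF t] sfL] by simp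
 qed
 then show ?thesis by (auto simp: polys_def)
qed

text \<open>A dual pair of generating families for the trace form; the \<open>a j\<close> need not
  be independent, and \<open>n\<close> may exceed the degree.\<close>

lemma dual_basis:
 obtains n :: nat and a b where "!!j. j < n ==> a j : L & b j : L"
 "!!s. s : G ==> (SUM j<n. a j * s (b j)) = (if ALL x:L. s x = x then 1 else 0)"
 "!!x. x : L ==> x = (SUM j<n. a j * (SUM s:G. s (x * b j)))"
proof -
 obtain n :: nat and a b where ab: "!!j. j < n ==> a j : L & b j : L"
 "!!s. s : G ==> (SUM j<n. a j * s (b j)) = (if ALL x:L. s x = x then 1 else 0)"
 by (rule dual_family[OF sfL FL subset_refl]) blast
 have "x = (SUM j<n. a j * (SUM s:G. s (x * b j)))" if x: "x : L" for x
 proof -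
 have "(SUM j<n. a j * (SUM s:G. s (x * b j))) = (SUM s:G. SUM j<n. a j * s (x * b j))"
  by (simp add: sum_distrib_left) (rule sum.swap)
 also have "... = (SUM s:G. if s = (\<lambda>x\<in>L. x) then x else 0)"
 proof (intro sum.cong refl)
  fix s assume s: "s : G"
  have m: "s (x * b j) = s x * s (b j)" if "j < n" for j
  using that ab x by (intro rhom_mult[OF auts_rhom[OF s]]) auto
  have "(SUM j<n. a j * s (x * b j)) = s x * (SUM j<n. a j * s (b j))"
  by (simp add: m sum_distrib_left mult_ac)
  moreover have "s = (\<lambda>x\<in>L. x) \<longleftrightarrow> (ALL x:L. s x = x)"
  using auts_eqI[OF s G_id] by auto
  ultimately show "(SUM j<n. a j * s (x * b j)) = (if s = (\<lambda>x\<in>L. x) then x else 0)"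
  using ab(2)[OF s] x by auto
 qed
 also have "... = x" using finG G_id by simp
 finally show ?thesis by simp
 qed
 from this ab show ?thesis by (rule that[of n a b, rotated 2]) assumption+
qed

text \<open>The coefficients in the expansion of \<open>dual_basis\<close> are traces, so the
  \<open>a j\<close> generate \<open>L\<close> over \<open>F\<close>; all their conjugates together
  form the split set.\<close>

lemma split_set_ex: "\<exists>S\<subseteq>L. split_set F S & gen (F Un S) = L"
proof -
 obtain n :: nat and a b where ab: "!!j. j < n ==> a j : L & b j : L"
 "!!s. s : G ==> (SUM j<n. a j * s (b j)) = (if ALL x:L. s x = x then 1 else 0)"
 "!!x. x : L ==> x = (SUM j<n. a j * (SUM s:G. s (x * b j)))"
 by (rule dual_basis) blast
 define S where "S = (\<Union>j<n. (%s. s (a j)) ` G)"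
 have SL: "S <= L" using ab(1) auts_in[of _ F L] by (force simp: S_def)
 have "split_set F S"
 unfolding split_set_def
 proof (intro conjI ballI)
 show "finite S" using finG by (auto simp: S_def)
 fix x assume "x : S"
 then obtain j where "j < n" "x : (%s. s (a j)) ` G" by (auto simp: S_def)
 then show "\<exists>C\<subseteq>S. x : C & (PROD b:C. [:- b, 1:]) : polys F"
  using linear_prod_orbit_polys[of "a j"] ab(1)[of j]
  by (intro exI[of _ "(%s. s (a j)) ` G"]) (auto simp: S_def)
 qed
 moreover have "gen (F Un S) = L"
 proof (intro subset_antisym gen_least subsetI)
 fix x assume x: "x : L"
 have "a j : gen (F Un S)" if "j < n" for j
 proof -
  have "a j = (\<lambda>x\<in>L. x) (a j)" using ab that by auto
  then have "a j : S" using that G_id unfolding S_def by blast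
  then show ?thesis using gen_incl by blast
 qed
 moreover have "(SUM s:G. s (x * b j)) : gen (F Un S)" if "j < n" for j
  using that trace_F[of "x * b j"] ab x sfL gen_incl[of "F Un S"] by (auto simp: sfd_mult)
 ultimately have "(SUM j<n. a j * (SUM s:G. s (x * b j))) : gen (F Un S)"
  by (intro sfd_sum[OF sfd_gen, of "{..<n}"] sfd_mult[OF sfd_gen]) simp_all
 then show "x : gen (F Un S)" using ab(3)[OF x] by simp
 qed (use SL sfL FL in auto)
 ultimately show ?thesis using SL by blast
qed

lemma normal:
 assumes "rhom L t" "!!a. a : F ==> t a = a" shows "t ` L = L"
 using split_set_ex split_set_normal(2)[OF sfF, of _ t] assms by auto

lemma auts_restrict:
 assumes "rhom N t" "L <= N" "!!a. a : F ==> t a = a" shows "restrict t L : G"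
 using normal[of t] rhom_mono[OF assms(1,2)] assms FL sfL
 by (auto simp: auts_def rhom_def sfd_closed)

text \<open>The restrictions form a finite group on \<open>M\<close> with fixed field
  \<open>F\<close>, and Artin's theorem turns this into both claims; no automorphism of
  \<open>M\<close> has to be extended by hand.\<close>

lemma restrict_auts:
 assumes M: "sfd M" "F <= M" "M <= L" and st: "!!s. s : G ==> s ` M <= M"
 shows "galois F M" "auts F M = (%s. restrict s M) ` G"
proof -
 define H where "H = (%s. restrict s M) ` G"
 have r: "restrict s M : auts F M" if s: "s : G" for s
 proof -
 obtain t where t: "t : G" "ALL x:L. t (s x) = x & s (t x) = x" using G_inv[OF s] by auto
 have "M <= s ` M"
 proof
  fix x assume x: "x : M"
  then have "t x : M" "s (t x) = x" using st[OF t(1)] t(2) M by auto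
  then show "x : s ` M" by force
 qed
 then have "s ` M = M" using st[OF s] by blast
 then show ?thesis
  using rhom_mono[OF auts_rhom[OF s] M(3)] auts_fix[OF s] M by (auto simp: auts_def rhom_def sfd_closed)
 qed
 have agr: "agrp M H"
 unfolding agrp_def
 proof (intro conjI ballI)
 show "H <= auts {} M" using r auts_mono[of "{}" F M] by (auto simp: H_def)
 show "finite H" using finG by (auto simp: H_def)
 have "restrict (\<lambda>x\<in>L. x) M = (\<lambda>x\<in>M. x)" using M by (auto simp: fun_eq_iff restrict_def)
 then show "(\<lambda>x\<in>M. x) : H" using G_id unfolding H_def by (metis imageI)
 fix s t assume "s : H" "t : H"
 then obtain u v where uv: "u : G" "v : G" "s = restrict u M" "t = restrict v M" by (auto simp: H_def)
 have "compose M s t = restrict (compose L u v) M"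
  using uv st[OF uv(2)] M by (intro extensionalityI[of _ M]) (auto simp: compose_eq image_subset_iff)
 then show "compose M s t : H"
  using auts_compose[OF uv(1,2) FL sfL] unfolding H_def by (metis imageI)
 qed
 have Fix: "Fix M H = F"
 proof (intro subset_antisym subsetI)
 fix x assume x: "x : Fix M H"
 show "x : F"
 proof (rule fixedD)
  show "x : L" using x M by (auto simp: Fix_def)
  fix s assume "s : G"
  then have "restrict s M x = x" using x unfolding Fix_def H_def by blast
  then show "s x = x" using x by (auto simp: Fix_def)
 qed
 next
 fix x assume "x : F"
 then show "x : Fix M H" using M auts_fix by (auto simp: Fix_def H_def)
 qed
 show "auts F M = (%s. restrict s M) ` G" using artin_auts[OF agr M(1)] Fix by (simp add: H_def)
 show "galois F M" using galois_artin[OF agr M(1)] Fix by simp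
qed

lemma restrict_auts_galois:
 assumes "galois F M" "M <= L" shows "auts F M = (%s. restrict s M) ` G"
proof -
 interpret M: galois F M by fact
 show ?thesis
 proof (intro restrict_auts(2) M.sfL M.FL assms(2))
 fix s assume s: "s : G"
 have "s ` M = M"
  by (rule M.normal[OF rhom_mono[OF auts_rhom[OF s] assms(2)]]) (rule auts_fix[OF s])
 then show "s ` M <= M" by (rule equalityD1)
 qed
qed

end

lemma galois_compositum:
 assumes "galois F L1" "galois F L2" shows "galois F (gen (L1 Un L2))"
proof -
 interpret L1: galois F L1 by fact
 interpret L2: galois F L2 by fact
 obtain S1 S2 where S: "split_set F S1" "gen (F Un S1) = L1" "split_set F S2" "gen (F Un S2) = L2"
 using L1.split_set_ex L2.split_set_ex by auto
 have "split_set F (S1 Un S2)" unfolding split_set_def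
 proof (intro conjI ballI)
 fix x assume "x : S1 Un S2"
 then obtain C where "C <= S1 | C <= S2" "x : C" "(PROD b:C. [:- b, 1:]) : polys F"
  using S(1,3) unfolding split_set_def by blast
 then show "\<exists>C\<subseteq>S1 Un S2. x : C & (PROD b:C. [:- b, 1:]) : polys F" by blast
 qed (use S(1,3) in "auto simp: split_set_def")
 then have "galois F (gen (F Un (S1 Un S2)))" using L1.sfF by (rule galois_split_set[rotated])
 moreover have "gen (F Un (S1 Un S2)) = gen ((F Un S1) Un (F Un S2))" by (simp add: Un_ac)
 moreover have "... = gen (L1 Un L2)" using S gen_Un_gen gen_Un_gen_right by metis
 ultimately show ?thesis by simp
qed

lemma galois_refl: assumes "sfd F" shows "galois F F"
proof -
 have "agrp F {\<lambda>x\<in>F. x}"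
 using auts_id[OF assms, of "{}"] by (auto simp: agrp_def compose_def restrict_def fun_eq_iff)
 moreover have "Fix F {\<lambda>x\<in>F. x} = F" by (auto simp: Fix_def)
 ultimately show ?thesis using galois_artin[OF _ assms] by metis
qed

section \<open>Abelian extensions\<close>

locale abel = galois +
 assumes comm: "s : G ==> t : G ==> x : L ==> s (t x) = t (s x)"
begin

lemma stable: assumes "sfd M" "F <= M" "M <= L" "s : G" shows "s ` M <= M"
proof
 interpret M: galois M L using galois_upper[OF assms(1-3)] .
 fix y assume "y : s ` M"
 then obtain x where x: "x : M" "y = s x" by auto
 show "y : M"
 proof (rule M.fixedD)
 show "y : L" using x assms auts_in by blast
 fix t assume t: "t : auts M L"
 then have "t : G" using auts_M[OF assms(2)] by auto
 then have "t y = s (t x)" using x comm assms by auto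
 then show "t y = y" using auts_fix[OF t x(1)] x(2) by simp
 qed
qed

lemma abel_upper: assumes "sfd M" "F <= M" "M <= L" shows "abel M L"
proof -
 interpret M: galois M L using galois_upper[OF assms] .
 show ?thesis by unfold_locales (use comm auts_M[OF assms(2)] in auto)
qed

lemma abel_lower: assumes "sfd M" "F <= M" "M <= L"
 shows "abel F M" "auts F M = (%s. restrict s M) ` G"
proof -
 note r = restrict_auts[OF assms stable[OF assms]]
 show "auts F M = (%s. restrict s M) ` G" by (rule r(2))
 interpret M: galois F M by (rule r(1))
 show "abel F M"
 proof unfold_locales
 fix s t x assume a: "s : auts F M" "t : auts F M" "x : M"
 then obtain u v where uv: "u : G" "v : G" "s = restrict u M" "t = restrict v M" using r(2) by auto
 moreover have "u x : M" "v x : M" using stable[OF assms uv(1)] stable[OF assms uv(2)] a by auto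
 ultimately show "s (t x) = t (s x)" using a comm[of u v x] assms by auto
 qed
qed

end

lemma abel_compositum:
 assumes "abel F L1" "abel F L2" shows "abel F (gen (L1 Un L2))"
proof -
 interpret L1: abel F L1 by fact
 interpret L2: abel F L2 by fact
 let ?L = "gen (L1 Un L2)"
 interpret L: galois F ?L by (rule galois_compositum) unfold_locales
 have sub: "L1 <= ?L" "L2 <= ?L" using gen_incl[of "L1 Un L2"] by auto
 show ?thesis
 proof unfold_locales
 fix s t x assume st: "s : auts F ?L" "t : auts F ?L" and x: "x : ?L"
 have c: "s (t y) = t (s y)" if y: "y : M" and M: "abel F M" "M <= ?L" for y M
 proof -
  interpret M: abel F M by fact
  have r: "restrict u M : auts F M & u y : M" if "u : auts F ?L" for u
  using M.auts_restrict[OF auts_rhom[OF that] M(2) auts_fix[OF that]] auts_in[of "restrict u M" F M y] y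
  by auto
  show ?thesis using M.comm[of "restrict s M" "restrict t M" y] r st y by auto
 qed
 have "rhom ?L (compose ?L s t)" "rhom ?L (compose ?L t s)"
  using st auts_compose[OF _ _ L.FL L.sfL] auts_rhom by blast+
 then have "compose ?L s t x = compose ?L t s x"
  by (rule rhom_gen_agree[of ?L _ _ "L1 Un L2"])
  (use sub x c[OF _ assms(1)] c[OF _ assms(2)] in "auto simp: compose_eq subset_iff")
 then show "s (t x) = t (s x)" using x by (simp add: compose_eq)
 qed
qed

lemma abel_refl: "sfd F ==> abel F F"
 using galois_refl[of F] by (auto simp: abel_def abel_axioms_def auts_def)

section \<open>Degrees\<close>

lemma linear_system_solvable:
 assumes "finite I" "finite J" "card I < card J" "sfd K" "!!i j. i : I ==> j : J ==> m i j : K"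
 shows "EX c. (ALL j:J. c j : K) & (EX j:J. c j ~= 0) & (ALL i:I. (SUM j:J. m i j * c j) = 0)"
 using assms(1,2,3,5)
proof (induction I arbitrary: J m)
 case empty
 then show ?case using assms(4) by (intro exI[of _ "%_. 1"]) (auto simp: card_gt_0_iff)
next
 case (insert i I)
 show ?case
 proof (cases "ALL j:J. m i j = 0")
 case True
 then show ?thesis using insert.IH[of J m] insert.prems insert.hyps by auto
 next
 case False
 then obtain l where l: "l : J" "m i l ~= 0" by auto
 define m' where "m' = (%i' j. m i' j - m i' l * m i j / m i l)"
 have "card I < card (J - {l})" using insert.prems insert.hyps l by simp
 moreover have "m' i' j : K" if "i' : I" "j : J - {l}" for i' j
  unfolding m'_def using that insert.prems l by (intro sfd_diff sfd_divide sfd_mult assms) auto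
 ultimately obtain c where c: "ALL j:J-{l}. c j : K" "EX j:J-{l}. c j ~= 0"
  "ALL i':I. (SUM j:J-{l}. m' i' j * c j) = 0"
  using insert.IH[of "J - {l}" m'] insert.prems by auto
 define s where "s = (SUM j:J-{l}. m i j * c j)"
 have sK: "s : K" unfolding s_def using c insert.prems assms(4) by (intro sfd_sum sfd_mult) auto
 define d where "d = c(l := - s / m i l)"
 have eq: "(SUM j:J. m i' j * d j) = (SUM j:J-{l}. m i' j * c j) - m i' l * s / m i l" for i'
  using sum.remove[OF insert.prems(1) l(1), of "%j. m i' j * d j"] by (simp add: d_def)
 have "(SUM j:J. m i j * d j) = 0" using eq[of i] l by (simp add: s_def)
 moreover have "(SUM j:J. m i' j * d j) = 0" if "i' : I" for i'
 proof -
  have "0 = (SUM j:J-{l}. m' i' j * c j)" using c that by simp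
  also have "... = (SUM j:J-{l}. m i' j * c j - m i' l / m i l * (m i j * c j))"
  by (intro sum.cong) (auto simp: m'_def field_simps)
  also have "... = (SUM j:J. m i' j * d j)"
  by (simp add: eq s_def sum_subtractf sum_distrib_left sum_divide_distrib)
  finally show ?thesis by simp
 qed
 moreover have "ALL j:J. d j : K"
  using c sK l insert.prems assms(4) by (auto simp: d_def intro!: sfd_divide sfd_minus)
 moreover have "EX j:J. d j ~= 0" using c(2) by (auto simp: d_def)
 ultimately show ?thesis by auto
 qed
qed

section \<open>Comparison with the library notions of subfield, dimension and Galois group\<close>

abbreviation "\<R> == (ring_of_type_algebra :: 'a::field ring)"

interpretation R: ring \<R> by (rule ring_from_type_algebra)

lemmas R_field = field_from_type_algebra

lemma R_simps [simp]: "carrier \<R> = UNIV" "x \<otimes>\<^bsub>\<R>\<^esub> y = x * y" "x \<oplus>\<^bsub>\<R>\<^esub> y = x + y"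
 "\<one>\<^bsub>\<R>\<^esub> = 1" "\<zero>\<^bsub>\<R>\<^esub> = 0"
 by (auto simp: ring_of_type_algebra_def)

lemma R_minus: "\<ominus>\<^bsub>\<R>\<^esub> x = - x"
 using R.minus_equality[of "- x" x] by simp

lemma R_inv: "x ~= 0 ==> inv\<^bsub>\<R>\<^esub> x = inverse x"
 using comm_monoid.comm_inv_char[OF cring.axioms(2)[OF cring_from_type_algebra], of x "inverse x"] by simp

lemma subring_iff: "subring V \<R> \<longleftrightarrow>
 1 : V & (ALL x:V. - x : V) & (ALL x:V. ALL y:V. x * y : V & x + y : V)"
proof
 assume "subring V \<R>"
 from subringE[OF this] show "1 : V & (ALL x:V. - x : V) & (ALL x:V. ALL y:V. x * y : V & x + y : V)"
 by (simp add: R_minus)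
next
 assume "1 : V & (ALL x:V. - x : V) & (ALL x:V. ALL y:V. x * y : V & x + y : V)"
 then show "subring V \<R>" by (intro R.subringI) (auto simp: R_minus)
qed

lemma subfield_iff: "subfield F \<R> \<longleftrightarrow> sfd F"
proof
 assume s: "subfield F \<R>"
 have "inverse x : F" if "x : F" for x
 using R.subfield_m_inv(1)[OF s, of x] that R_inv[of x] by (cases "x = 0") auto
 moreover have "0 : F" using subringE(2)[OF subfieldE(1)[OF s]] by simp
 moreover note subfieldE(1)[OF s, unfolded subring_iff]
 ultimately show "sfd F" unfolding sfd_def by blast
next
 assume s: "sfd F"
 show "subfield F \<R>"
 by (rule field.subfieldI'[OF R_field]) (use s in "auto simp: subring_iff sfd_closed R_inv")
qed

lemma generate_field_eq_gen: "generate_field \<R> A = gen A"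
proof (intro subset_antisym)
 show "generate_field \<R> A <= gen A"
 by (rule field.generate_field_min_subfield1[OF R_field]) (auto simp: subfield_iff gen_incl)
 show "gen A <= generate_field \<R> A"
 using field.generate_field_is_subfield[OF R_field, of A] generate_field.incl[of _ A \<R>]
 by (intro gen_least) (auto simp: subfield_iff)
qed

lemma combine_eq: "length ks = length us ==> R.combine ks us = (SUM i<length us. ks ! i * us ! i)"
 by (induction ks us rule: list_induct2) (simp_all add: sum.lessThan_Suc_shift del: sum.lessThan_Suc)

lemma Span_eq: assumes "sfd K" shows "R.Span K us = {SUM i<length us. k i * us ! i | k. ALL i<length us. k i : K}"
proof -
 have "R.Span K us = {R.combine ks us | ks. length ks = length us & set ks <= K}"
 by (rule R.Span_eq_combine_set_length_version) (use assms in "auto simp: subfield_iff")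
 also have "... = {SUM i<length us. k i * us ! i | k. ALL i<length us. k i : K}"
 proof (intro subset_antisym subsetI)
 fix x assume "x : {R.combine ks us | ks. length ks = length us & set ks <= K}"
 then obtain ks where "length ks = length us" "set ks <= K" "x = R.combine ks us" by auto
 then show "x : {SUM i<length us. k i * us ! i | k. ALL i<length us. k i : K}"
  by (auto simp: combine_eq intro!: exI[of _ "%i. ks ! i"])
 next
 fix x assume "x : {SUM i<length us. k i * us ! i | k. ALL i<length us. k i : K}"
 then obtain k where k: "ALL i<length us. k i : K" "x = (SUM i<length us. k i * us ! i)" by auto
 then show "x : {R.combine ks us | ks. length ks = length us & set ks <= K}"
  by (auto simp: combine_eq intro!: exI[of _ "map k [0..<length us]"])
 qed
 finally show ?thesis .
qed

text \<open>With more automorphisms than basis vectors, the values on a basis satisfy a nontrivial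
  relation, which extends by linearity to a relation between characters.\<close>

lemma finite_auts_of_dimension:
 assumes "sfd F" "sfd L" "R.dimension n F L" "S <= auts F L" "finite S"
 shows "card S <= n"
proof (rule ccontr)
 assume "~ card S <= n"
 obtain us where us: "length us = n" "R.Span F us = L"
 using R.exists_base[OF _ assms(3)] assms(1) by (auto simp: subfield_iff)
 obtain c where c: "EX s:S. c s ~= 0" "ALL i:{..<n}. (SUM s:S. s (us ! i) * c s) = 0"
 proof -
 have "sfd (UNIV :: 'a set)" unfolding sfd_def by simp
 then have "EX c. (ALL j:S. c j : UNIV) & (EX j:S. c j ~= 0) & (ALL i:{..<n}. (SUM j:S. j (us ! i) * c j) = 0)"
  using `~ card S <= n`
  by (intro linear_system_solvable[of "{..<n}" S UNIV "%i s. s (us ! i)", OF _ assms(5)]) auto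
 then show ?thesis by (elim exE conjE) (rule that)
 qed
 have usL: "us ! i : L" if "i < n" for i
 proof -
 have "(SUM j<n. (if j = i then 1 else 0) * us ! j) = us ! i"
  using that by (subst sum.remove[of _ i]) auto
 moreover have "(SUM j<n. (if j = i then 1 else 0) * us ! j) : R.Span F us"
  unfolding Span_eq[OF assms(1)] us(1) using assms(1) by (auto intro!: exI[of _ "%j. if j = i then 1 else 0"])
 ultimately show ?thesis using us by simp
 qed
 have FL: "F <= L"
 proof -
 obtain k where k: "ALL i<n. k i : F" "1 = (SUM i<n. k i * us ! i)"
  using us sfd_1[OF assms(2)] unfolding us(2)[symmetric] Span_eq[OF assms(1)] by auto
 have "x = (SUM i<n. (x * k i) * us ! i)" for x using k(2) by (simp add: mult.assoc sum_distrib_left[symmetric])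
 then show ?thesis unfolding us(2)[symmetric] Span_eq[OF assms(1)] us(1) using k(1) sfd_mult[OF assms(1)]
  by (auto intro!: exI[of _ "%i. _ * k i"])
 qed
 have "(SUM s:S. c s * s x) = 0" if "x : L" for x
 proof -
 obtain k where k: "ALL i<n. k i : F" "x = (SUM i<n. k i * us ! i)"
 proof -
  have "x : R.Span F us" using \<open>x : L\<close> us by simp
  then show ?thesis using that unfolding Span_eq[OF assms(1)] us(1) by auto
 qed
 have "s x = (SUM i<n. k i * s (us ! i))" if s: "s : S" for s
 proof -
  have s': "s : auts F L" using s assms by auto
  note r = auts_rhom[OF s']
  have "s x = (SUM i<n. s (k i * us ! i))"
  unfolding k(2) using k(1) usL FL by (intro rhom_sum[OF r assms(2)] sfd_mult[OF assms(2)]) auto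
  also have "... = (SUM i<n. k i * s (us ! i))"
  using k(1) usL FL auts_fix[OF s'] by (intro sum.cong refl) (simp add: rhom_mult[OF r] subset_iff)
  finally show ?thesis .
 qed
 have "(SUM s:S. c s * s x) = (SUM s:S. SUM i<n. k i * (s (us ! i) * c s))"
 proof (rule sum.cong[OF refl])
  fix s assume "s : S"
  note e = \<open>!!s. s : S ==> s x = (SUM i<n. k i * s (us ! i))\<close>[OF this]
  show "c s * s x = (SUM i<n. k i * (s (us ! i) * c s))"
  unfolding e by (simp add: sum_distrib_left mult_ac)
 qed
 also have "... = (SUM i<n. k i * (SUM s:S. s (us ! i) * c s))"
  by (subst sum.swap) (simp add: sum_distrib_left)
 also have "... = 0" using c(2) by simp
 finally show ?thesis .
 qed
 moreover have "EX x:L. s x ~= t x" if "s : S" "t : S" "s ~= t" for s t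
 using that assms(4) auts_eqI[of s F L t F] by blast
 moreover have "rhom L s" if "s : S" for s using that assms(4) auts_rhom by blast
 ultimately have "c s = 0" if "s : S" for s
 using dedekind[of S L c s] assms that by blast
 then show False using c(1) by auto
qed

text \<open>Were there more basis vectors than automorphisms, the conjugate system would have a
  nontrivial solution in \<open>L\<close>. Conjugating its equations and summing them turns the
  solution into its traces, which gives an \<open>F\<close>-linear relation of the basis.\<close>

lemma (in galois) dimension: "R.dimension (card G) F L"
proof -
 have sf: "subfield F \<R>" using sfF by (simp add: subfield_iff)
 obtain n :: nat and a b where ab: "!!j. j < n ==> a j : L & b j : L"
 "!!s. s : G ==> (SUM j<n. a j * s (b j)) = (if ALL x:L. s x = x then 1 else 0)"
 "!!x. x : L ==> x = (SUM j<n. a j * (SUM s:G. s (x * b j)))"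
 by (rule dual_basis) blast
 have "R.Span F (map a [0..<n]) = L"
 proof (intro subset_antisym subsetI)
 fix x assume x: "x : L"
 show "x : R.Span F (map a [0..<n])"
  unfolding Span_eq[OF sfF]
 proof (intro CollectI exI[of _ "%j. SUM s:G. s (x * b j)"] conjI allI impI)
  show "x = (SUM i<length (map a [0..<n]). (SUM s:G. s (x * b i)) * map a [0..<n] ! i)"
  using ab(3)[OF x] by (simp add: mult.commute)
 qed (use trace_F ab(1) x sfL in "auto intro!: sfd_mult")
 next
 fix x assume "x : R.Span F (map a [0..<n])"
 then obtain k where k: "ALL i<n. k i : F" "x = (SUM i<n. k i * map a [0..<n] ! i)"
  unfolding Span_eq[OF sfF] by auto
 then show "x : L" using ab(1) FL sfL by (auto intro!: sfd_sum sfd_mult)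
 qed
 then have "R.finite_dimension F L" using R.Span_finite_dimension[OF sf, of "map a [0..<n]"] by simp
 then obtain d where d: "R.dimension d F L" by auto
 have "card G <= d" by (rule finite_auts_of_dimension[OF sfF sfL d subset_refl finG])
 moreover have "d <= card G"
 proof (rule ccontr)
 assume "~ d <= card G"
 obtain us where us: "R.independent F us" "length us = d" "R.Span F us = L"
  using R.exists_base[OF sf d] by auto
 have usL: "us ! i : L" if "i < d" for i
 proof -
  have "(SUM j<d. (if j = i then 1 else 0) * us ! j) = us ! i"
  using that by (subst sum.remove[of _ i]) auto
  moreover have "(SUM j<d. (if j = i then 1 else 0) * us ! j) : R.Span F us"
  unfolding Span_eq[OF sfF] us(2) using sfF by (auto intro!: exI[of _ "%j. if j = i then 1 else 0"])
  ultimately show ?thesis using us by simp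
 qed
 obtain c where c: "ALL j:{..<d}. c j : L" "EX j:{..<d}. c j ~= 0" "ALL s:G. (SUM j<d. s (us ! j) * c j) = 0"
  using linear_system_solvable[of G "{..<d}" L "%s j. s (us ! j)"] finG sfL usL auts_in[of _ F L]
  `~ d <= card G` by auto
 then obtain j0 where j0: "j0 < d" "c j0 ~= 0" by auto
 obtain z where z: "z : L" "(SUM s:G. s z) = 1" using agrp_trace_one[OF G_agrp sfL] by auto
 \<comment> \<open>The scaling makes the coordinate at \<open>j0\<close> equal to \<open>z\<close>,
   whose trace is one, so that the final relation is nontrivial.\<close>
 define e where "e j = z / c j0 * c j" for j
 have eL: "e j : L" if "j < d" for j
  unfolding e_def using that c j0 z sfL by (intro sfd_mult sfd_divide) auto
 have sys: "(SUM j<d. s (us ! j) * e j) = 0" if "s : G" for s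
 proof -
  have "(SUM j<d. s (us ! j) * e j) = z / c j0 * (SUM j<d. s (us ! j) * c j)"
  by (simp add: e_def sum_distrib_left mult_ac)
  then show ?thesis using c that by simp
 qed
 have sys': "(SUM j<d. us ! j * s (e j)) = 0" if s: "s : G" for s
 proof -
  obtain t where t: "t : G" "ALL x:L. t (s x) = x & s (t x) = x" using G_inv[OF s] by auto
  note r = auts_rhom[OF s]
  have "0 = s (SUM j<d. t (us ! j) * e j)" using sys[OF t(1)] rhom_0[OF r sfL] by simp
  also have "... = (SUM j<d. s (t (us ! j) * e j))"
  using usL eL auts_in[OF t(1)] by (intro rhom_sum[OF r sfL] sfd_mult[OF sfL]) auto
  also have "... = (SUM j<d. us ! j * s (e j))"
  using usL eL auts_in[OF t(1)] t(2) by (intro sum.cong refl) (simp add: rhom_mult[OF r])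
  finally show ?thesis by simp
 qed
 have "0 = (SUM s:G. SUM j<d. us ! j * s (e j))" using sys' by simp
 also have "... = (SUM j<d. (SUM s:G. s (e j)) * us ! j)"
  by (subst sum.swap) (simp add: sum_distrib_left mult.commute)
 also have "... = R.combine (map (%j. SUM s:G. s (e j)) [0..<d]) us"
  using us(2) by (simp add: combine_eq)
 finally have "R.combine (map (%j. SUM s:G. s (e j)) [0..<d]) us = \<zero>\<^bsub>\<R>\<^esub>" by simp
 then have "set (take (length us) (map (%j. SUM s:G. s (e j)) [0..<d])) <= {\<zero>\<^bsub>\<R>\<^esub>}"
  by (intro R.independent_imp_trivial_combine[OF sf us(1)]) (use trace_F eL in auto)
 then have "(SUM s:G. s (e j0)) = 0" using us(2) j0(1) by (simp add: image_subset_iff)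
 then show False using z j0 by (simp add: e_def)
 qed
 ultimately show ?thesis using d by simp
qed

lemma ring_iso_carrier: "s : ring_iso (\<R>\<lparr>carrier := L\<rparr>) (\<R>\<lparr>carrier := L\<rparr>) \<longleftrightarrow>
 s ` L = L & inj_on s L & (ALL x:L. ALL y:L. s (x + y) = s x + s y & s (x * y) = s x * s y) & s 1 = 1"
 by (auto simp: ring_iso_def ring_hom_def bij_betw_def)

lemma carrier_Gal: "sfd L ==> carrier (Gal F L) = auts F L"
 using rhom_inj by (auto simp: Gal_def auts_def ring_iso_carrier rhom_def)

lemma compositum_eq: "compositum F L = gen (F Un L)"
 by (simp add: compositum_def generate_field_eq_gen)

lemma subextension_iff: "subextension F L \<longleftrightarrow> sfd F & sfd L & F <= L"
 by (simp add: subextension_def subfield_iff)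

lemma finite_galois_iff: "finite_galois F L \<longleftrightarrow> galois F L"
proof
 assume a: "finite_galois F L"
 then have s: "sfd F" "sfd L" "F <= L" by (auto simp: finite_galois_def subextension_iff)
 obtain n where "R.dimension n F L" using a by (auto simp: finite_galois_def)
 then have "finite (auts F L)"
 using finite_auts_of_dimension[OF s(1,2)] by (metis infinite_arbitrarily_large not_less_eq_eq order_refl)
 then show "galois F L" using a s
 by unfold_locales (auto simp: finite_galois_def Fix_def carrier_Gal)
next
 assume "galois F L"
 then interpret galois F L .
 show "finite_galois F L"
 using sfF sfL FL Fix_G R.finite_dimensionI[OF dimension]
 by (simp add: finite_galois_def subextension_iff carrier_Gal Fix_def)
qed

lemma ext_degree_eq: assumes "galois F L" shows "ext_degree F L = card (auts F L)"
proof -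
 interpret galois F L by fact
 show ?thesis using R.dimI[OF _ dimension] sfF by (simp add: ext_degree_def subfield_iff over_def)
qed

lemma finite_abelian_iff: "finite_abelian F L \<longleftrightarrow> abel F L"
proof -
 have "comm_group (Gal F L) \<longleftrightarrow> (ALL s:auts F L. ALL t:auts F L. ALL x:L. s (t x) = t (s x))"
 if "galois F L"
 proof -
 interpret galois F L by fact
 note c = carrier_Gal[OF sfL, of F]
 have one: "\<one>\<^bsub>Gal F L\<^esub> = (\<lambda>x\<in>L. x)" and m: "s \<otimes>\<^bsub>Gal F L\<^esub> t = compose L s t" for s t
  by (auto simp: Gal_def id_def)
 show ?thesis
 proof
  assume "comm_group (Gal F L)"
  then interpret H: comm_group "Gal F L" .
  show "ALL s:G. ALL t:G. ALL x:L. s (t x) = t (s x)"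
  proof (intro ballI)
  fix s t x assume "s : G" "t : G" "x : L"
  then show "s (t x) = t (s x)"
   using fun_cong[OF H.m_comm[of s t], of x] by (simp add: c m compose_eq)
  qed
 next
  assume comm: "ALL s:G. ALL t:G. ALL x:L. s (t x) = t (s x)"
  show "comm_group (Gal F L)"
  proof (rule comm_groupI)
  fix s assume "s : carrier (Gal F L)"
  then have s: "s : G" by (simp add: c)
  show "\<one>\<^bsub>Gal F L\<^esub> \<otimes>\<^bsub>Gal F L\<^esub> s = s"
   using s auts_in[OF s] by (intro extensionalityI[of _ L]) (auto simp: one m compose_eq auts_def)
  obtain t where t: "t : G" "ALL x:L. t (s x) = x & s (t x) = x" using G_inv[OF s] by auto
  then have "compose L t s = (\<lambda>x\<in>L. x)"
   by (intro extensionalityI[of _ L]) (auto simp: compose_eq)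
  then show "EX t:carrier (Gal F L). t \<otimes>\<^bsub>Gal F L\<^esub> s = \<one>\<^bsub>Gal F L\<^esub>"
   using t by (auto simp: c m one)
  next
  fix s t u assume "s : carrier (Gal F L)" "t : carrier (Gal F L)" "u : carrier (Gal F L)"
  then have stu: "s : G" "t : G" "u : G" by (simp_all add: c)
  then show "s \<otimes>\<^bsub>Gal F L\<^esub> t \<otimes>\<^bsub>Gal F L\<^esub> u = s \<otimes>\<^bsub>Gal F L\<^esub> (t \<otimes>\<^bsub>Gal F L\<^esub> u)"
   using auts_in[OF stu(3)] by (intro extensionalityI[of _ L]) (auto simp: m compose_eq)
  next
  fix s t assume "s : carrier (Gal F L)" "t : carrier (Gal F L)"
  then have st: "s : G" "t : G" by (simp_all add: c)
  then show "s \<otimes>\<^bsub>Gal F L\<^esub> t = t \<otimes>\<^bsub>Gal F L\<^esub> s"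
   using comm by (intro extensionalityI[of _ L]) (auto simp: m compose_eq)
  show "s \<otimes>\<^bsub>Gal F L\<^esub> t : carrier (Gal F L)"
   using auts_compose[OF st FL sfL] by (simp add: c m)
  qed (use G_id in "simp add: c one")
 qed
 qed
 then show ?thesis
 unfolding finite_abelian_def finite_galois_iff abel_def abel_axioms_def by blast
qed

section \<open>Valuation rings\<close>

definition vr :: "'a::field set => 'a set => bool" where
 "vr L W \<longleftrightarrow> sfd L & 1 : W & (ALL x:W. - x : W) & (ALL x:W. ALL y:W. x * y : W & x + y : W) &
 W \<subset> L & (ALL x:L. x ~= 0 --> x : W | inverse x : W)"

definition mx :: "'a::field set => 'a set" where
 "mx W = {x : W. x = 0 | inverse x ~: W}"

lemma vr_sfd: "vr L W ==> sfd L"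
 and vr_1: "vr L W ==> 1 : W"
 and vr_minus: "vr L W ==> x : W ==> - x : W"
 and vr_mult: "vr L W ==> x : W ==> y : W ==> x * y : W"
 and vr_add: "vr L W ==> x : W ==> y : W ==> x + y : W"
 and vr_sub: "vr L W ==> W <= L"
 and vr_dich: "vr L W ==> x : L ==> x ~= 0 ==> x : W | inverse x : W"
 unfolding vr_def by blast+

lemma vr_0: "vr L W ==> 0 : W"
 using vr_add[of L W 1 "-1"] vr_1[of L W] vr_minus[of L W 1] by simp

lemma vr_diff: "vr L W ==> x : W ==> y : W ==> x - y : W"
 using vr_add[of L W x "- y"] vr_minus[of L W y] by simp

lemma vr_power: "vr L W ==> x : W ==> x ^ n : W"
 by (induction n) (auto simp: vr_1 vr_mult)

lemma vr_sum: "vr L W ==> (!!i. i : A ==> f i : W) ==> sum f A : W"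
 by (induction A rule: infinite_finite_induct) (auto simp: vr_0 vr_add)

lemma vr_prod: "vr L W ==> (!!i. i : A ==> f i : W) ==> prod f A : W"
 by (induction A rule: infinite_finite_induct) (auto simp: vr_1 vr_mult)

lemma mx_sub: "x : mx W ==> x : W"
 and mx_0: "vr L W ==> 0 : mx W"
 and mx_1: "vr L W ==> 1 ~: mx W"
 and mx_unit: "x : W ==> x ~: mx W ==> x ~= 0 & inverse x : W"
 by (auto simp: mx_def vr_0 vr_1)

lemma mx_add: assumes W: "vr L W" and x: "x : mx W" and y: "y : mx W" shows "x + y : mx W"
proof -
 have *: "x + y : mx W" if xy: "x : mx W" "y : mx W" "x / y : W" "y ~= 0" for x y
 proof (rule ccontr)
 assume "x + y ~: mx W"
 then have u: "x + y ~= 0" "inverse (x + y) : W"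
  using mx_unit[of "x + y" W] vr_add[OF W, of x y] xy mx_sub by auto
 have "(1 + x / y) * inverse (x + y) : W" using u xy W by (intro vr_mult[OF W] vr_add[OF W] vr_1) auto
 also have "(1 + x / y) * inverse (x + y) = inverse y" using u xy by (simp add: field_simps)
 finally show False using xy by (auto simp: mx_def)
 qed
 consider "x = 0" | "y = 0" | "x ~= 0" "y ~= 0" by auto
 then show ?thesis
 proof cases
 case 3
 have "x / y : L" using x y mx_sub vr_sub[OF W] vr_sfd[OF W] by (blast intro: sfd_divide)
 then have "x / y : W | y / x : W" using vr_dich[OF W, of "x / y"] 3 by auto
 then show ?thesis using *[OF x y] *[OF y x] 3 by (auto simp: add.commute)
 qed (use x y in auto)
qed

lemma mx_mult: assumes W: "vr L W" and x: "x : mx W" and y: "y : W" shows "x * y : mx W"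
proof (rule ccontr)
 assume "x * y ~: mx W"
 then have u: "x * y ~= 0" "inverse (x * y) : W"
 using mx_unit[of "x * y" W] vr_mult[OF W, of x y] x y mx_sub by auto
 have "y * inverse (x * y) : W" using u(2) y by (intro vr_mult[OF W])
 moreover have "y * inverse (x * y) = inverse x" using u(1) by (simp add: field_simps)
 ultimately have "inverse x : W" by metis
 then show False using u(1) x by (auto simp: mx_def)
qed

lemma mx_minus: "vr L W ==> x : mx W ==> - x : mx W"
 using mx_mult[of L W x "-1"] vr_minus[of L W 1] vr_1[of L W] by simp

lemma mx_diff: "vr L W ==> x : mx W ==> y : mx W ==> x - y : mx W"
 using mx_add[of L W x "- y"] mx_minus[of L W y] by simp

lemma mx_sum: "vr L W ==> (!!i. i : A ==> f i : mx W) ==> sum f A : mx W"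
 by (induction A rule: infinite_finite_induct) (auto simp: mx_0 mx_add)

lemma mx_prime: assumes W: "vr L W" and "x : W" "y : W" "x * y : mx W" shows "x : mx W | y : mx W"
proof (rule ccontr)
 assume n: "~ ?thesis"
 then have u: "x ~= 0" "inverse x : W" using mx_unit[of x W] assms by auto
 then have "x * y * inverse x : mx W" using mx_mult[OF W assms(4)] by blast
 moreover have "x * y * inverse x = y" using u by simp
 ultimately show False using n by simp
qed

lemma mx_prod:
 assumes W: "vr L W" and "finite A" "!!i. i : A ==> f i : W" "i : A" "f i : mx W"
 shows "prod f A : mx W"
 using prod.remove[OF assms(2,4), of f] mx_mult[OF W assms(5)] vr_prod[OF W, of "A - {i}" f] assms(3) by auto

lemma mx_prod_notin:
 assumes W: "vr L W" and "!!i. i : A ==> f i : W & f i ~: mx W" shows "prod f A ~: mx W"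
 using assms(2)
proof (induction A rule: infinite_finite_induct)
 case (insert x A)
 then show ?case using mx_prime[OF W, of "f x" "prod f A"] vr_prod[OF W, of A f] by auto
qed (use mx_1[OF W] in auto)

text \<open>The value at zero is left free, which is why \<open>pw\<close> treats zero separately.
  The last clause normalises the value group to all integers.\<close>

definition dval :: "'a::field set => 'a set => ('a => int) => bool" where
 "dval L W v \<longleftrightarrow> (ALL x:L. ALL y:L. x ~= 0 --> y ~= 0 --> v (x * y) = v x + v y) &
 (ALL x:L. x ~= 0 --> (x : W \<longleftrightarrow> 0 <= v x)) & (EX p:L. p ~= 0 & v p = 1)"

definition ord :: "'a::field set => 'a set => 'a => int" where
 "ord L W = (SOME v. dval L W v)"

definition pw :: "'a::field set => 'a set => int => 'a set" where
 "pw L W n = {x : L. x = 0 | n <= ord L W x}"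

text \<open>Finiteness of the residue field is stated through representatives, which avoids quotient
  rings; it is what makes \<open>residue_power_fixed\<close> possible.\<close>

locale dvr =
 fixes L W :: "'a::field set"
 assumes vr: "vr L W" and dval_ex: "EX v. dval L W v"
 and finres: "EX R. finite R & R <= W & (ALL x:W. EX r:R. x - r : mx W)"
begin

abbreviation "nu == ord L W"

lemma sfL: "sfd L" using vr by (rule vr_sfd)

lemma dval: "dval L W nu"
 unfolding ord_def using dval_ex by (rule someI_ex)

lemma ord_mult: "x : L ==> y : L ==> x ~= 0 ==> y ~= 0 ==> nu (x * y) = nu x + nu y"
 and mem_iff: "x : L ==> x ~= 0 ==> x : W \<longleftrightarrow> 0 <= nu x"
 and unif: "EX p:L. p ~= 0 & nu p = 1"
 using dval unfolding dval_def by blast+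

lemma ord_1 [simp]: "nu 1 = 0"
 using ord_mult[of 1 1] sfL by simp

lemma ord_inverse: "x : L ==> x ~= 0 ==> nu (inverse x) = - nu x"
 using ord_mult[of x "inverse x"] sfL by (simp add: sfd_inverse)

lemma ord_divide: "x : L ==> y : L ==> x ~= 0 ==> y ~= 0 ==> nu (x / y) = nu x - nu y"
 using ord_mult[of x "inverse y"] sfL by (simp add: ord_inverse divide_inverse sfd_inverse)

lemma ord_power: "x : L ==> x ~= 0 ==> nu (x ^ n) = int n * nu x"
 using sfL by (induction n) (auto simp: ord_mult sfd_power algebra_simps)

lemma ord_minus: assumes "x : L" shows "nu (- x) = nu x"
proof (cases "x = 0")
 case False
 have m: "-1 : L" using sfL sfd_minus[of L 1] by simp
 have "2 * nu (-1) = nu ((-1) * (-1))" using ord_mult[OF m m] by simp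
 then show ?thesis using ord_mult[OF m assms] False by simp
qed auto

lemma pw_0_eq: "W = pw L W 0"
 using mem_iff vr_sub[OF vr] vr_0[OF vr] by (auto simp: pw_def)

lemma mx_eq: "mx W = pw L W 1"
proof (rule Set.set_eqI)
 fix x
 show "x : mx W \<longleftrightarrow> x : pw L W 1"
 proof (cases "x : L & x ~= 0")
 case True
 then show ?thesis using mem_iff[of x] mem_iff[of "inverse x"] ord_inverse[of x] sfL
  by (auto simp: mx_def pw_def sfd_inverse)
 qed (use vr_0[OF vr] sfL vr_sub[OF vr] in "auto simp: mx_def pw_def")
qed

lemma pw_mono: "n <= m ==> pw L W m <= pw L W n" by (auto simp: pw_def)

lemma pw_zero [simp]: "0 : pw L W n" using sfL by (auto simp: pw_def)

lemma pw_mult: "x : pw L W n ==> y : pw L W m ==> x * y : pw L W (n + m)"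
 using sfL by (cases "x = 0 | y = 0") (auto simp: pw_def ord_mult sfd_mult)

lemma pw_add: assumes "x : pw L W n" "y : pw L W n" shows "x + y : pw L W n"
proof -
 have *: "x + y : pw L W n" if xy: "x : pw L W n" "y : pw L W n" "x ~= 0" "y ~= 0" "nu y <= nu x" for x y
 proof (cases "x + y = 0")
 case False
 have L: "x : L" "y : L" "x / y : L" using xy sfL by (auto simp: pw_def sfd_divide)
 have "x / y : W" using mem_iff[OF L(3)] ord_divide[OF L(1,2)] xy by auto
 then have "1 + x / y : W" using vr_add[OF vr] vr_1[OF vr] by auto
 moreover have e: "x + y = y * (1 + x / y)" using xy by (simp add: field_simps)
 moreover from e have nz: "1 + x / y ~= 0" using False by (metis mult_zero_right)
 moreover have L': "1 + x / y : L" using L sfL by (auto simp: sfd_add)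
 ultimately have "nu (x + y) >= nu y" using ord_mult[OF L(2) L'] mem_iff[OF L' nz] xy(4) by simp
 then show ?thesis using xy L sfL by (auto simp: pw_def sfd_add)
 qed auto
 consider "x = 0" | "y = 0" | "x ~= 0" "y ~= 0" "nu y <= nu x" | "x ~= 0" "y ~= 0" "nu x <= nu y" by linarith
 then show ?thesis using assms *[of x y] *[of y x] by cases (auto simp: add.commute)
qed

lemma pw_minus: "x : pw L W n ==> - x : pw L W n"
 using sfL by (auto simp: pw_def ord_minus sfd_minus)

lemma pw_diff: "x : pw L W n ==> y : pw L W n ==> x - y : pw L W n"
 using pw_add[of x n "- y"] pw_minus by auto

lemma ord_add_eq:
 assumes "x : L" "y : L" "x ~= 0" "y ~= 0" "nu x < nu y"
 shows "x + y ~= 0" "nu (x + y) = nu x"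
proof -
 show nz: "x + y ~= 0"
 proof
 assume "x + y = 0"
 then have "y = - x" by (simp add: eq_neg_iff_add_eq_0 add.commute)
 then show False using assms ord_minus by simp
 qed
 have "x + y : pw L W (nu x)" using assms by (intro pw_add) (auto simp: pw_def)
 moreover have "x + y ~: pw L W (nu x + 1)"
 proof
 assume "x + y : pw L W (nu x + 1)"
 then have "(x + y) - y : pw L W (nu x + 1)" using assms by (intro pw_diff) (auto simp: pw_def)
 then show False using assms by (auto simp: pw_def)
 qed
 ultimately show "nu (x + y) = nu x" using nz by (auto simp: pw_def)
qed

lemma pw_Inter: assumes "!!n. x : pw L W n" shows "x = 0"
 using assms[of "nu x + 1"] by (auto simp: pw_def)

text \<open>An element of negative value has powers with arbitrarily deep poles, so together with
  \<open>W\<close> it produces all of \<open>L\<close>.\<close>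

lemma maximal: assumes "vr L W'" "W <= W'" shows "W' = W"
proof (rule ccontr)
 assume "W' ~= W"
 then obtain y where y: "y : W'" "y ~: W" using assms by auto
 have yL: "y : L" "y ~= 0" using y assms vr_sub vr_0[OF vr] by auto
 have neg: "nu y < 0" using mem_iff[OF yL] y by auto
 have "x : W'" if x: "x : L" for x
 proof (cases "x = 0")
 case False
 define k where "k = nat \<bar>nu x\<bar>"
 have yk: "y ^ k : L" "y ^ k ~= 0" using yL sfL by (auto simp: sfd_power)
 have "nu (x / y ^ k) = nu x - int k * nu y" using ord_divide[OF x yk(1) False yk(2)] ord_power[OF yL] by simp
 also have "... >= 0"
 proof -
  have "int k * nu y <= int k * (-1)" using neg by (intro mult_left_mono) auto
  then show ?thesis unfolding k_def by simp
 qed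
 finally have "x / y ^ k : W" using mem_iff[of "x / y ^ k"] x yk False sfL by (auto simp: sfd_divide)
 then have "x / y ^ k * y ^ k : W'" using assms y by (intro vr_mult[OF assms(1)] vr_power[OF assms(1)]) auto
 moreover have "x / y ^ k * y ^ k = x" using yk by simp
 ultimately show ?thesis by metis
 qed (use vr_0[OF assms(1)] in auto)
 then show False using assms(1) unfolding vr_def by blast
qed

text \<open>Elements of equal value differ by a unit of \<open>W\<close>, so two valuations with the
  same ring are proportional; since both take the value one, the nonnegative integral factor is
  one.\<close>

lemma ord_unique: assumes v: "dval L W v" and x: "x : L" "x ~= 0" shows "nu x = v x"
proof -
 have main: "v2 x = v1 x * v2 p" if d: "dval L W v1" "dval L W v2" "p : L" "p ~= 0" "v1 p = 1" "x : L" "x ~= 0"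
 for v1 v2 p x
 proof -
 have m1: "!!x y. x : L ==> y : L ==> x ~= 0 ==> y ~= 0 ==> v1 (x * y) = v1 x + v1 y"
  and m2: "!!x y. x : L ==> y : L ==> x ~= 0 ==> y ~= 0 ==> v2 (x * y) = v2 x + v2 y"
  and w: "!!x. x : L ==> x ~= 0 ==> 0 <= v1 x \<longleftrightarrow> 0 <= v2 x"
  using d(1,2) unfolding dval_def by blast+
 have same: "v2 a = v2 b" if ab: "a : L" "b : L" "a ~= 0" "b ~= 0" "v1 a = v1 b" for a b
 proof -
  have 1: "a / b : L" "a / b ~= 0" "b / a : L" "b / a ~= 0" using ab sfL by (auto simp: sfd_divide)
  have "v1 (a / b) = 0" "v1 (b / a) = 0"
  using m1[OF 1(1) ab(2) 1(2) ab(4)] m1[OF 1(3) ab(1) 1(4) ab(3)] ab by simp_all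
  then have "0 <= v2 (a / b)" "0 <= v2 (b / a)"
  using w[OF 1(1,2)] w[OF 1(3,4)] by simp_all
  moreover have "v2 a = v2 (a / b) + v2 b" "v2 b = v2 (b / a) + v2 a"
  using m2[OF 1(1) ab(2) 1(2) ab(4)] m2[OF 1(3) ab(1) 1(4) ab(3)] ab by simp_all
  ultimately show ?thesis by simp
 qed
 have p1: "v1 (p ^ n) = int n" "v2 (p ^ n) = int n * v2 p" for n
 proof (induction n)
  case 0
  show "v1 (p ^ 0) = int 0" "v2 (p ^ 0) = int 0 * v2 p" using m1[of 1 1] m2[of 1 1] sfL by auto
 next
  case (Suc n)
  have "p ^ n : L" using d sfL by (auto simp: sfd_power)
  then show "v1 (p ^ Suc n) = int (Suc n)" "v2 (p ^ Suc n) = int (Suc n) * v2 p"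
  using m1[of p "p ^ n"] m2[of p "p ^ n"] Suc d by (auto simp: algebra_simps)
 qed
 have pL: "p ^ n : L" for n using d sfL by (auto simp: sfd_power)
 show ?thesis
 proof (cases "0 <= v1 x")
  case True
  then have "v1 (p ^ nat (v1 x)) = v1 x" using p1(1)[of "nat (v1 x)"] by simp
  from same[OF d(6) pL d(7) _ this[symmetric]] p1(2)[of "nat (v1 x)"] True d(4) show ?thesis by simp
 next
  case False
  let ?k = "nat (- v1 x)"
  have "v1 (x * p ^ ?k) = 0" using m1[OF d(6) pL d(7)] p1(1)[of ?k] d(4) False by simp
  moreover have "v1 1 = 0" using p1(1)[of 0] by simp
  ultimately have "v2 (x * p ^ ?k) = v2 1" using sfL d pL by (intro same) (auto simp: sfd_mult)
  then have "v2 x + int ?k * v2 p = 0" using m2[OF d(6) pL d(7)] p1(2)[of ?k] p1(2)[of 0] d(4) by simp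
  then show ?thesis using False by (simp add: algebra_simps)
 qed
 qed
 obtain p where p: "p : L" "p ~= 0" "nu p = 1" using unif by auto
 obtain p' where p': "p' : L" "p' ~= 0" "v p' = 1" using v unfolding dval_def by auto
 have "nu p' * v p = 1" using main[OF dval v p p'(1,2)] p'(3) by simp
 moreover have "0 <= v p" using mem_iff[OF p(1,2)] p v unfolding dval_def by simp
 ultimately have "v p = 1" by (auto simp: zmult_eq_1_iff)
 then show ?thesis using main[OF dval v p x] by simp
qed

end

section \<open>Weak approximation for finitely many discrete valuation rings\<close>

lemma dvr_distinct: assumes "dvr L W" "dvr L W'" "W ~= W'" shows "EX x:L. x ~= 0 & ord L W x < 0 & ord L W' x > 0"
proof -
 interpret W: dvr L W by fact
 interpret W': dvr L W' by fact
 have "~ W' <= W" "~ W <= W'" using W.maximal[OF W'.vr] W'.maximal[OF W.vr] assms by auto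
 then obtain a b where ab: "a : W'" "a ~: W" "b : W" "b ~: W'" by auto
 have L: "a : L" "b : L" "a ~= 0" "b ~= 0"
 using ab vr_sub[OF W.vr] vr_sub[OF W'.vr] vr_0[OF W.vr] vr_0[OF W'.vr] by auto
 show ?thesis
 using ab L W.mem_iff W'.mem_iff W.sfL W.ord_divide[OF L(1,2)] W'.ord_divide[OF L(1,2)]
 by (intro bexI[of _ "a / b"]) (auto simp: sfd_divide)
qed

lemma exists_large_multiple:
 assumes "finite A" shows "\<exists>n::nat. n > 0 & (ALL i:A. \<forall>a::int. a > 0 --> int n * a + f i >= k)"
proof -
 define n where "n = Suc (nat (SUM i:A. \<bar>f i\<bar>) + nat \<bar>k\<bar>)"
 have "int n * a + f i >= k" if "i : A" "a > 0" for i and a :: int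
 proof -
 have "\<bar>f i\<bar> <= (SUM i:A. \<bar>f i\<bar>)" using assms that by (intro member_le_sum) auto
 moreover have "int n * 1 <= int n * a" using that by (intro mult_left_mono) auto
 ultimately show ?thesis by (auto simp: n_def)
 qed
 then show ?thesis by (intro exI[of _ n]) (auto simp: n_def)
qed

text \<open>Induction on the finite set, with \<open>b\<close> separating \<open>W0\<close> from the
  new ring. If \<open>c\<close> has value zero there, \<open>c ^ n * b\<close> works; if
  \<open>c\<close> has a pole there, the factor \<open>c ^ n / (c ^ n + 1)\<close> has value zero at
  both poles and leaves the sign to \<open>b\<close>. The large \<open>n\<close> keeps the other
  values positive.\<close>

lemma approx_separate:
 assumes "dvr L W0" "finite \<W>" "!!W. W : \<W> ==> dvr L W & W ~= W0"
 shows "EX c:L. c ~= 0 & ord L W0 c < 0 & (ALL W:\<W>. ord L W c > 0)"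
 using assms(2,3)
proof (induction \<W>)
 case empty
 interpret dvr L W0 by fact
 obtain p where "p : L" "p ~= 0" "nu p = 1" using unif by auto
 then show ?case using ord_inverse[of p] sfL by (intro bexI[of _ "inverse p"]) (auto simp: sfd_inverse)
next
 case (insert W1 \<W>)
 interpret V0: dvr L W0 by fact
 interpret V1: dvr L W1 using insert by auto
 obtain c where c: "c : L" "c ~= 0" "ord L W0 c < 0" "ALL W:\<W>. ord L W c > 0" using insert by auto
 obtain b where b: "b : L" "b ~= 0" "ord L W0 b < 0" "ord L W1 b > 0"
 using dvr_distinct[of L W0 W1] assms(1) insert.prems by auto
 obtain n :: nat where n: "n > 0" "ALL W:\<W>. ALL a>0. int n * a + ord L W b >= 1"
 using exists_large_multiple[OF insert.hyps(1), of 1 "%W. ord L W b"] by metis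
 have cn: "c ^ n : L" "c ^ n ~= 0" "c ^ n * b : L" "c ^ n * b ~= 0"
 using c b V0.sfL by (auto simp: sfd_power sfd_mult)
 have W: "ord L W (c ^ n * b) > 0" "ord L W (c ^ n) > 0" if W: "W : \<W>" for W
 proof -
 interpret V: dvr L W using insert.prems W by auto
 have "0 < ord L W c" using c W by auto
 then show "ord L W (c ^ n) > 0" "ord L W (c ^ n * b) > 0"
  using V.ord_mult[OF cn(1) b(1) cn(2) b(2)] V.ord_power[OF c(1,2)] n W by fastforce+
 qed
 have W0: "ord L W0 (c ^ n * b) < 0" "ord L W0 (c ^ n) < 0"
 using V0.ord_mult[OF cn(1) b(1) cn(2) b(2)] V0.ord_power[OF c(1,2), of n] n(1) b c
 by (auto simp: mult_less_0_iff intro!: add_neg_neg)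
 consider "ord L W1 c > 0" | "ord L W1 c = 0" | "ord L W1 c < 0" by linarith
 then show ?case
 proof cases
 case 1
 then show ?thesis using c by auto
 next
 case 2
 then have "ord L W1 (c ^ n * b) > 0"
  using V1.ord_mult[OF cn(1) b(1) cn(2) b(2)] V1.ord_power[OF c(1,2)] b by auto
 then show ?thesis using W W0 cn by (intro bexI[of _ "c ^ n * b"]) auto
 next
 case 3
 have one: "1 : L" "(1::'a) ~= 0" using V0.sfL by auto
 note s0 = V0.ord_add_eq[OF cn(1) one(1) cn(2) one(2)]
 have u: "c ^ n + 1 : L" "c ^ n + 1 ~= 0" using s0 W0 cn one V0.sfL by (auto simp: sfd_add)
 have ordd: "ord L V (c ^ n * b / (c ^ n + 1)) = ord L V (c ^ n) + ord L V b - ord L V (c ^ n + 1)"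
  if "dvr L V" for V
 proof -
  interpret V: dvr L V by fact
  show ?thesis using V.ord_divide[OF cn(3) u(1) cn(4) u(2)] V.ord_mult[OF cn(1) b(1) cn(2) b(2)] by simp
 qed
 have "ord L W1 (c ^ n) < 0" using 3 V1.ord_power[OF c(1,2), of n] n(1) by (simp add: mult_less_0_iff)
 then have "ord L W1 (c ^ n * b / (c ^ n + 1)) > 0"
  using ordd[OF V1.dvr_axioms] V1.ord_add_eq[OF cn(1) one(1) cn(2) one(2)] b by simp
 moreover have "ord L W0 (c ^ n * b / (c ^ n + 1)) < 0"
  using ordd[OF assms(1)] s0 W0 b by simp
 moreover have "ord L V (c ^ n * b / (c ^ n + 1)) > 0" if V: "V : \<W>" for V
 proof -
  interpret V: dvr L V using insert.prems V by auto
  have "ord L V (c ^ n + 1) = 0"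
  using V.ord_add_eq[OF one(1) cn(1) one(2) cn(2)] W[OF V] by (simp add: add.commute)
  then show ?thesis using ordd[OF V.dvr_axioms] W[OF V] V.ord_mult[OF cn(1) b(1) cn(2) b(2)] by simp
 qed
 ultimately show ?thesis using cn u V0.sfL by (intro bexI[of _ "c ^ n * b / (c ^ n + 1)"]) (auto simp: sfd_divide)
 qed
qed

theorem approximation:
 assumes "dvr L W0" "finite \<W>" "!!W. W : \<W> ==> dvr L W & W ~= W0"
 shows "EX x:L. x - 1 : pw L W0 k & (ALL W:\<W>. x : pw L W k)"
proof -
 obtain c where c: "c : L" "c ~= 0" "ord L W0 c < 0" "ALL W:\<W>. ord L W c > 0"
 using approx_separate[OF assms] by auto
 interpret V0: dvr L W0 by fact
 define n where "n = Suc (nat \<bar>k\<bar>)"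
 have one: "1 : L" "(1::'a) ~= 0" using V0.sfL by auto
 have cn: "c ^ n : L" "c ^ n ~= 0" using c V0.sfL by (auto simp: sfd_power)
 have n1: "int n * a >= k" if "a > 0" for a
 proof -
 have "int n * 1 <= int n * a" using that by (intro mult_left_mono) auto
 then show ?thesis by (auto simp: n_def)
 qed
 have n0: "int n * a < 0" if "a < 0" for a using that by (simp add: n_def mult_less_0_iff)
 have W0: "ord L W0 (c ^ n) < 0" using V0.ord_power[OF c(1,2)] c n0 by simp
 note s0 = V0.ord_add_eq[OF cn(1) one(1) cn(2) one(2)]
 have u: "c ^ n + 1 : L" "c ^ n + 1 ~= 0" using s0 W0 cn one V0.sfL by (auto simp: sfd_add)
 \<comment> \<open>This fraction is close to one where \<open>c\<close> has a pole and close to zero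
   where \<open>c\<close> has a zero; \<open>n\<close> makes both approximations as good as
   \<open>k\<close>.\<close>
 define x where "x = c ^ n / (c ^ n + 1)"
 have "x - 1 = - inverse (c ^ n + 1)" using u by (simp add: x_def field_simps)
 moreover have "ord L W0 (inverse (c ^ n + 1)) >= k"
 using V0.ord_inverse[OF u] s0 W0 V0.ord_power[OF c(1,2), of n] n1[of "- ord L W0 c"] c(3) by simp
 then have "inverse (c ^ n + 1) : pw L W0 k" using u V0.sfL by (auto simp: pw_def sfd_inverse)
 ultimately have "x - 1 : pw L W0 k" using V0.pw_minus by metis
 moreover have "x : pw L W k" if W: "W : \<W>" for W
 proof -
 interpret V: dvr L W using assms W by auto
 have p: "ord L W (c ^ n) > 0" "ord L W (c ^ n) >= k"
  using V.ord_power[OF c(1,2), of n] c(4) W n1[of "ord L W c"] by (auto simp: n_def[THEN arg_cong[of _ _ int]] simp del: power_Suc)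
 have "ord L W (c ^ n + 1) = 0" using V.ord_add_eq[OF one(1) cn(1) one(2) cn(2)] p by (simp add: add.commute)
 then have "ord L W x = ord L W (c ^ n)" using V.ord_divide[OF cn(1) u(1) cn(2) u(2)] by (simp add: x_def)
 then show ?thesis using p cn u V.sfL by (auto simp: pw_def x_def sfd_divide)
 qed
 ultimately show ?thesis using cn u V0.sfL by (intro bexI[of _ x]) (auto simp: x_def sfd_divide)
qed

section \<open>Extending discrete valuation rings\<close>

lemma vr_poly: "vr L W ==> p : polys W ==> x : W ==> poly p x : W"
 unfolding poly_altdef by (intro vr_sum vr_mult vr_power) (auto simp: polys_def)

lemma vr_exists_max:
 assumes W: "vr L W" and "finite A" "A ~= {}" "A <= L - {0}"
 shows "EX m:A. ALL a:A. a / m : W"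
 using assms(2-4)
proof (induction A rule: finite_ne_induct)
 case (singleton x)
 then show ?case using vr_1[OF W] by auto
next
 case (insert x A)
 then obtain m where m: "m : A" "ALL a:A. a / m : W" by auto
 have L: "x : L" "m : L" "x ~= 0" "m ~= 0" using insert.prems m by auto
 then have "x / m : W | m / x : W" using vr_dich[OF W, of "x / m"] vr_sfd[OF W] by (auto simp: sfd_divide)
 then show ?case
 proof
 assume "m / x : W"
 have "a / x : W" if "a : A" for a
  using vr_mult[OF W, of "a / m" "m / x"] m(2) that \<open>m / x : W\<close> L by simp
 then show ?thesis using vr_1[OF W] L by (intro bexI[of _ x]) auto
 qed (use m in auto)
qed

lemma synthetic_div_polys:
 assumes W: "vr L W" and "p : polys W" "a : W" shows "synthetic_div p a : polys W"
 using assms(2)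
proof (induction p)
 case 0
 then show ?case by simp
next
 case (pCons c p)
 have p: "p : polys W"
 unfolding polys_def using polysD[OF pCons.prems, of "Suc _"] by simp
 then show ?case using pCons.IH vr_poly[OF W p assms(3)] by (simp add: polys_pCons)
qed

text \<open>Synthetic division at a root modulo the maximal ideal leaves a quotient of smaller
  degree that is still nonzero modulo that ideal; primality does the rest.\<close>

lemma roots_mod_finite:
 assumes W: "vr L W" and "q : polys W" "EX i. coeff q i ~: mx W"
 shows "EX A. finite A & A <= W & (ALL x:W. poly q x : mx W --> (EX a:A. x - a : mx W))"
 using assms(2,3)
proof (induction "degree q" arbitrary: q rule: less_induct)
 case less
 show ?case
 proof (cases "EX a:W. poly q a : mx W")
 case False
 then show ?thesis by (intro exI[of _ "{}"]) auto
 next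
 case True
 then obtain a where a: "a : W" "poly q a : mx W" by auto
 define r where "r = synthetic_div q a"
 have q: "q = [:-a, 1:] * r + [:poly q a:]" using synthetic_div_correct'[of a q] by (simp add: r_def)
 have r: "r : polys W" unfolding r_def by (rule synthetic_div_polys[OF W less.prems(1) a(1)])
 have nz: "EX i. coeff r i ~: mx W"
 proof (rule ccontr)
  assume n: "~ ?thesis"
  have "coeff q i : mx W" for i
  proof -
  have "coeff q i = (if i = 0 then 0 else coeff r (i - 1)) - coeff r i * a + (if i = 0 then poly q a else 0)"
   by (subst q, cases i) (auto simp: coeff_pCons)
  also have "... : mx W"
   by (intro mx_add[OF W] mx_diff[OF W] mx_mult[OF W]) (use n a mx_0[OF W] in auto)
  finally show ?thesis .
  qed
  then show False using less.prems(2) by auto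
 qed
 have "degree q > 0"
 proof (rule ccontr)
  assume "~ degree q > 0"
  then obtain c where "q = [:c:]" by (auto elim: degree_eq_zeroE)
  moreover obtain i where "coeff q i ~: mx W" using less.prems(2) by auto
  ultimately show False using a mx_0[OF W] by (cases i) auto
 qed
 then have "degree r < degree q" by (simp add: r_def degree_synthetic_div)
 then obtain A where A: "finite A" "A <= W" "ALL x:W. poly r x : mx W --> (EX a:A. x - a : mx W)"
  using less.hyps[OF _ r nz] by auto
 have "EX b:insert a A. x - b : mx W" if x: "x : W" "poly q x : mx W" for x
 proof -
  have "poly q x = (x - a) * poly r x + poly q a" by (subst q) (simp add: algebra_simps)
  then have "(x - a) * poly r x : mx W" using mx_diff[OF W x(2) a(2)] by simp
  then show ?thesis using mx_prime[OF W, of "x - a" "poly r x"] vr_diff[OF W x(1) a(1)] vr_poly[OF W r x(1)] A(3) x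
  by auto
 qed
 then show ?thesis using A a by (intro exI[of _ "insert a A"]) auto
 qed
qed

lemma mx_Int: "vr L W ==> sfd F ==> mx (W Int F) = mx W Int F"
 by (auto simp: mx_def sfd_inverse)

context galois
begin

lemma killing_poly:
 assumes "x : L" obtains p where "p : polys F" "p ~= 0" "degree p <= card G" "poly p x = 0"
 "lead_coeff p = 1" "!!y. poly p y = 0 ==> EX s:G. y = s x"
proof -
 let ?C = "(%s. s x) ` G" let ?p = "PROD b:?C. [:- b, 1:]"
 have fin: "finite ?C" using finG by simp
 have "x = (\<lambda>x\<in>L. x) x" using assms by simp
 then have "x : ?C" using G_id by blast
 then have "poly ?p x = 0" using fin by (simp add: poly_linear_prod_0)
 moreover have "degree ?p <= card G"
 using degree_prod_sum_le[OF fin, of "%b. [:- b, 1:]"] card_image_le[OF finG, of "%s. s x"] by simp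
 moreover have "?p ~= 0" using fin by (simp add: prod_zero_iff)
 moreover have "lead_coeff ?p = 1" by (simp add: lead_coeff_prod)
 moreover have "EX s:G. y = s x" if "poly ?p y = 0" for y
 using that fin by (auto simp: poly_linear_prod_0)
 ultimately show ?thesis using linear_prod_orbit_polys[OF assms] that by blast
qed

context
 fixes W assumes dV: "dvr F (W Int F)" and vW: "vr L W"
begin

interpretation V: dvr F "W Int F" by (rule dV)

lemma mxV: "x : mx (W Int F) ==> x : mx W"
 using mx_Int[OF vW sfF] by auto

text \<open>In \<open>p(x) = 0\<close> a single dominant term could not cancel, so two terms differ
  by a unit of \<open>W\<close>. Hence some \<open>x ^ d\<close> with \<open>0 < d <= card G\<close>
  is a unit times an element of \<open>F\<close>. The factorial is a common multiple of all possible
  \<open>d\<close>, which makes the exponent the same for every \<open>x\<close>.\<close>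

lemma power_equiv_base:
 assumes x: "x : L" "x ~= 0"
 shows "EX a:F. a ~= 0 & x ^ fact (card G) / a : W & a / x ^ fact (card G) : W"
proof -
 obtain p where p: "p : polys F" "p ~= 0" "degree p <= card G" "poly p x = 0"
 by (rule killing_poly[OF x(1)]) blast
 define I where "I = {i. i <= degree p & coeff p i ~= 0}"
 define t where "t i = coeff p i * x ^ i" for i
 have cF: "coeff p i : F" for i using p by (auto simp: polys_def)
 have tL: "t i : L" "i : I ==> t i ~= 0" for i
 using cF[of i] FL x sfL by (auto simp: t_def I_def intro!: sfd_mult sfd_power)
 have I: "finite I" "I ~= {}" using p(2) by (auto simp: I_def intro!: exI[of _ "degree p"])
 obtain m where m: "m : I" "ALL i:I. t i / t m : W"
 proof -
 have "t ` I <= L - {0}" by (auto simp: tL)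
 with vr_exists_max[OF vW, of "t ` I"] I show ?thesis using that by auto
 qed
 have "0 = (SUM i:I. t i)"
 unfolding p(4)[symmetric] poly_altdef t_def by (rule sum.mono_neutral_right) (auto simp: I_def)
 then have s0: "(SUM i:I. t i / t m) = 0" by (simp add: sum_divide_distrib[symmetric])
 have "EX i:I - {m}. t i / t m ~: mx W"
 proof (rule ccontr)
 assume n: "~ ?thesis"
 have "(SUM i:I. t i / t m) = 1 + (SUM i:I - {m}. t i / t m)"
  using sum.remove[OF I(1) m(1), of "%i. t i / t m"] tL m by simp
 then have "1 = - (SUM i:I - {m}. t i / t m)" using s0 by (simp add: eq_neg_iff_add_eq_0)
 also have "... : mx W" using n by (intro mx_minus[OF vW] mx_sum[OF vW]) auto
 finally show False using mx_1[OF vW] by simp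
 qed
 then obtain i where i: "i : I" "i ~= m" "t i / t m ~: mx W" by auto
 define u where "u = t i / t m"
 have u: "u : W" "u ~= 0" "inverse u : W" using mx_unit[of u W] i m by (auto simp: u_def)
 have ex: "EX d a v. 0 < d & d <= degree p & a : F & a ~= 0 & x ^ d = v * a & v : W & inverse v : W & v ~= 0"
 proof (cases "m < i")
 case True
 have "x ^ i = x ^ (i - m) * x ^ m" using True by (simp add: power_add[symmetric])
 then have "x ^ (i - m) = u * (coeff p m / coeff p i)"
  using i m x unfolding u_def t_def I_def by (simp add: field_simps)
 then show ?thesis using True i m u cF sfF
  by (intro exI[of _ "i - m"] exI[of _ "coeff p m / coeff p i"] exI[of _ u]) (auto simp: I_def sfd_divide)
 next
 case False
 then have "x ^ m = x ^ (m - i) * x ^ i" by (simp add: power_add[symmetric])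
 then have "x ^ (m - i) = inverse u * (coeff p i / coeff p m)"
  using i m x unfolding u_def t_def I_def by (simp add: field_simps)
 then show ?thesis using False i m u cF sfF
  by (intro exI[of _ "m - i"] exI[of _ "coeff p i / coeff p m"] exI[of _ "inverse u"]) (auto simp: I_def sfd_divide)
 qed
 then obtain d a v where d: "0 < d" "d <= card G" "a : F" "a ~= 0" "x ^ d = v * a" "v : W" "inverse v : W" "v ~= 0"
 using p(3) by (metis order_trans)
 obtain e where e: "fact (card G) = d * e" using dvd_fact[of d "card G"] d by (auto simp: dvd_def)
 have "x ^ fact (card G) = v ^ e * a ^ e" by (simp add: e power_mult d(5) power_mult_distrib)
 then have "x ^ fact (card G) / a ^ e = v ^ e" "a ^ e / x ^ fact (card G) = inverse v ^ e"
 using d by (simp_all add: field_simps power_inverse)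
 then show ?thesis using d sfF vr_power[OF vW] by (intro bexI[of _ "a ^ e"]) (auto simp: sfd_power)
qed

text \<open>The provisional value of \<open>x\<close> is that of an element of \<open>F\<close>
  equivalent to \<open>x ^ N\<close>. It takes the value \<open>N\<close> on a uniformizer of
  \<open>F\<close>, so there is a least positive value \<open>D\<close>, and division by
  \<open>D\<close> normalises.\<close>

lemma dval_above: "EX v. dval L W v"
proof -
 define N :: nat where "N = fact (card G)"
 have N0: "N > 0" by (simp add: N_def)
 define ok where "ok x a \<longleftrightarrow> a : F & a ~= 0 & x ^ N / a : W & a / x ^ N : W" for x a
 define w0 where "w0 x = V.nu (SOME a. ok x a)" for x
 have w0: "w0 x = V.nu a" if x: "x : L" "x ~= 0" and a: "ok x a" for x a
 proof -
 define b where "b = (SOME a. ok x a)"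
 have b: "ok x b" unfolding b_def by (rule someI[of _ a]) (rule a)
 have ab: "V.nu c >= V.nu d" if "ok x c" "ok x d" for c d
 proof -
  have "c / d = (c / x ^ N) * (x ^ N / d)" using x by simp
  then have "c / d : W Int F" using that vr_mult[OF vW, of "c / x ^ N" "x ^ N / d"] sfF
  by (auto simp: ok_def sfd_divide)
  then show ?thesis using that V.mem_iff[of "c / d"] V.ord_divide[of c d] by (auto simp: ok_def)
 qed
 show ?thesis using ab[OF a b] ab[OF b a] by (simp add: w0_def b_def)
 qed
 have ex: "EX a. ok x a" if "x : L" "x ~= 0" for x
 using power_equiv_base[OF that] by (auto simp: ok_def N_def)
 have mult: "w0 (x * y) = w0 x + w0 y" if xy: "x : L" "y : L" "x ~= 0" "y ~= 0" for x y
 proof -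
 obtain a b where ab: "ok x a" "ok y b" using ex xy by metis
 have "(x * y) ^ N / (a * b) = (x ^ N / a) * (y ^ N / b)" "a * b / (x * y) ^ N = (a / x ^ N) * (b / y ^ N)"
  by (simp_all add: power_mult_distrib)
 then have "(x * y) ^ N / (a * b) : W" "a * b / (x * y) ^ N : W"
  using ab vr_mult[OF vW, of "x ^ N / a" "y ^ N / b"] vr_mult[OF vW, of "a / x ^ N" "b / y ^ N"]
  by (simp_all add: ok_def)
 then have "ok (x * y) (a * b)" using ab sfF by (auto simp: ok_def sfd_mult)
 then show ?thesis using w0[of "x * y" "a * b"] w0[of x a] w0[of y b] ab xy sfL V.ord_mult[of a b]
  by (auto simp: sfd_mult ok_def)
 qed
 have mem: "x : W \<longleftrightarrow> 0 <= w0 x" if x: "x : L" "x ~= 0" for x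
 proof -
 obtain a where a: "ok x a" using ex x by metis
 have "x : W \<longleftrightarrow> x ^ N : W"
 proof
  assume p: "x ^ N : W"
  show "x : W"
  proof (rule ccontr)
  assume "x ~: W"
  then have i: "inverse x : mx W" using vr_dich[OF vW x] by (auto simp: mx_def)
  have "inverse x ^ (N - 1) * x ^ N : W" using p i mx_sub by (blast intro: vr_mult[OF vW] vr_power[OF vW])
  moreover have "inverse x ^ (N - 1) * x ^ N = x"
   using N0 x by (cases N) (auto simp: power_inverse field_simps)
  ultimately show False using `x ~: W` by simp
  qed
 qed (rule vr_power[OF vW])
 also have "... \<longleftrightarrow> a : W"
 proof
  assume "x ^ N : W"
  then have "a / x ^ N * x ^ N : W" using a by (intro vr_mult[OF vW]) (auto simp: ok_def)
  then show "a : W" using x by simp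
 next
  assume "a : W"
  then have "x ^ N / a * a : W" using a by (intro vr_mult[OF vW]) (auto simp: ok_def)
  then show "x ^ N : W" using a by (simp add: ok_def)
 qed
 also have "... \<longleftrightarrow> 0 <= V.nu a" using V.mem_iff[of a] a by (auto simp: ok_def)
 finally show ?thesis using w0[OF x a] by simp
 qed
 obtain p where p: "p : F" "p ~= 0" "V.nu p = 1" using V.unif by auto
 have "ok p (p ^ N)" using p sfF vr_1[OF vW] by (auto simp: ok_def sfd_power)
 then have pN: "w0 p = int N" using w0[of p "p ^ N"] p FL V.ord_power[of p N] by auto
 define D where "D = (LEAST k. k > 0 & (EX x:L. x ~= 0 & w0 x = int k))"
 have "D > 0 & (EX x:L. x ~= 0 & w0 x = int D)" unfolding D_def
 by (rule LeastI[of _ N]) (use pN p FL N0 in auto)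
 then obtain \<pi> where \<pi>: "D > 0" "\<pi> \<in> L" "\<pi> ~= 0" "w0 \<pi> = int D" by auto
 have least: "D <= k" if "k > 0" "x : L" "x ~= 0" "w0 x = int k" for k x
 unfolding D_def using that by (intro Least_le) auto
 have one: "w0 1 = 0" using mult[of 1 1] sfL by simp
 have \<pi>n: "\<pi> ^ n : L" "\<pi> ^ n ~= 0" "w0 (\<pi> ^ n) = int n * int D" for n
 proof -
 show "\<pi> ^ n : L" "\<pi> ^ n ~= 0" using \<pi> sfL by (auto simp: sfd_power)
 show "w0 (\<pi> ^ n) = int n * int D"
  by (induction n) (use \<pi> sfL one in "auto simp: mult sfd_power algebra_simps")
 qed
 have dvd: "int D dvd w0 x" if x: "x : L" "x ~= 0" for x
 proof -
 \<comment> \<open>Positive and negative part of the quotient, as only natural exponents are at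
   hand; the value of \<open>y\<close> becomes the remainder modulo \<open>D\<close>, which
   minimality of \<open>D\<close> forces to be zero.\<close>
 define k where "k = nat (- (w0 x div int D))"
 define l where "l = nat (w0 x div int D)"
 define y where "y = x * \<pi> ^ k * inverse (\<pi> ^ l)"
 have il: "inverse (\<pi> ^ l) : L" "inverse (\<pi> ^ l) ~= 0" using \<pi>n sfL by (auto simp: sfd_inverse)
 have "w0 (inverse (\<pi> ^ l)) = - w0 (\<pi> ^ l)"
  using mult[OF \<pi>n(1)[of l] il(1) \<pi>n(2)[of l] il(2)] one \<pi>n by simp
 moreover have yL: "x * \<pi> ^ k : L" "x * \<pi> ^ k ~= 0" using x \<pi>n sfL by (auto simp: sfd_mult)
 ultimately have "w0 y = w0 x + int k * int D - int l * int D"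
  using mult[OF yL(1) il(1) yL(2) il(2)] mult[OF x(1) \<pi>n(1) x(2) \<pi>n(2)] \<pi>n by (simp add: y_def)
 also have "... = w0 x - (w0 x div int D) * int D"
  by (cases "w0 x div int D >= 0") (simp_all add: k_def l_def)
 also have "... = w0 x mod int D" by (simp add: minus_div_mult_eq_mod)
 finally have wy: "w0 y = w0 x mod int D" .
 have "y : L" "y ~= 0" using yL il sfL by (auto simp: y_def sfd_mult)
 then have "~ 0 < w0 x mod int D"
  using least[of "nat (w0 x mod int D)" y] wy \<pi>(1) pos_mod_bound[of "int D" "w0 x"] by fastforce
 then have "w0 x mod int D = 0" using pos_mod_sign[of "int D" "w0 x"] \<pi>(1) by linarith
 then show ?thesis by (simp add: dvd_eq_mod_eq_0)
 qed
 have "dval L W (%x. w0 x div int D)"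
 unfolding dval_def
 proof (intro conjI ballI impI)
 fix x y assume "x : L" "y : L" "x ~= 0" "y ~= 0"
 then show "w0 (x * y) div int D = w0 x div int D + w0 y div int D"
  using mult dvd by (simp add: div_add)
 next
 fix x assume "x : L" "x ~= 0"
 then show "x : W \<longleftrightarrow> 0 <= w0 x div int D" using mem \<pi>(1) by (simp add: pos_imp_zdiv_nonneg_iff)
 next
 show "EX p:L. p ~= 0 & w0 p div int D = 1" using \<pi> by (intro bexI[of _ \<pi>]) auto
 qed
 then show ?thesis by blast
qed

text \<open>Dividing the annihilating polynomial by a coefficient of least value makes it integral
  with one coefficient equal to one. Replacing coefficients by representatives leaves finitely many
  polynomials, each with finitely many roots modulo the maximal ideal.\<close>

lemma finres_above: "EX R. finite R & R <= W & (ALL x:W. EX r:R. x - r : mx W)"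
proof -
 obtain R where R: "finite R" "R <= W Int F" "!!x. x : W Int F ==> EX r:R. x - r : mx (W Int F)"
 using V.finres by blast
 define n where "n = card G"
 define mk where "mk c = (SUM i<=n. monom (c i) i :: 'a poly)" for c :: "nat => 'a"
 have cmk: "coeff (mk c) i = (if i <= n then c i else 0)" for c i
 unfolding mk_def by (simp add: coeff_sum)
 define Q where "Q = {q : mk ` ({..n} \<rightarrow>\<^sub>E R). EX i. coeff q i ~: mx W}"
 have "finite (mk ` ({..n} \<rightarrow>\<^sub>E R))" using R(1) by (intro finite_imageI finite_PiE) auto
 then have finQ: "finite Q" unfolding Q_def by (rule finite_subset[rotated]) auto
 have "EX A. finite A & A <= W & (ALL x:W. poly q x : mx W --> (EX a:A. x - a : mx W))" if "q : Q" for q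
 proof (rule roots_mod_finite[OF vW])
 obtain c where "c : {..n} \<rightarrow>\<^sub>E R" "q = mk c" using \<open>q : Q\<close> by (auto simp: Q_def)
 then have "coeff q i : W" for i using R(2) vr_0[OF vW] PiE_mem[of c "{..n}" "%_. R" i] by (auto simp: cmk)
 then show "q : polys W" by (simp add: polys_def)
 qed (use that in "auto simp: Q_def")
 then obtain A where A: "!!q. q : Q ==> finite (A q) & A q <= W"
 "!!q x. q : Q ==> x : W ==> poly q x : mx W ==> EX a:A q. x - a : mx W" by metis
 have "EX a:\<Union>(A ` Q). x - a : mx W" if x: "x : W" for x
 proof -
 have xL: "x : L" using x vr_sub[OF vW] by auto
 obtain p where p: "p : polys F" "p ~= 0" "degree p <= n" "poly p x = 0"
  unfolding n_def by (rule killing_poly[OF xL]) blast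
 have cF: "coeff p i : F" for i using p by (auto simp: polys_def)
 define I where "I = {i. i <= n & coeff p i ~= 0}"
 have I: "finite I" "degree p : I" using p by (auto simp: I_def)
 obtain m where m: "m : I" "ALL i:I. coeff p i / coeff p m : W Int F"
 proof -
  have "coeff p ` I <= F - {0}" using cF by (auto simp: I_def)
  with vr_exists_max[OF V.vr, of "coeff p ` I"] I show ?thesis using that by auto
 qed
 define d where "d i = coeff p i / coeff p m" for i
 have d: "d i : W Int F" for i
 proof (cases "i : I")
  case False
  then have "coeff p i = 0" using p(3) le_degree[of p i] by (force simp: I_def)
  then show ?thesis using vr_0[OF vW] sfF by (simp add: d_def)
 qed (use m in "simp add: d_def")
 obtain r where r: "!!i. r i : R & d i - r i : mx (W Int F)" using R(3)[OF d] by metis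
 define c where "c = restrict r {..n}"
 have dm: "d m = 1" using m(1) by (simp add: d_def I_def)
 have "coeff (mk c) m ~: mx W"
 proof
  assume "coeff (mk c) m : mx W"
  then have "(d m - r m) + r m : mx W" using m(1) r mxV by (intro mx_add[OF vW]) (auto simp: cmk c_def I_def)
  then show False using dm mx_1[OF vW] by simp
 qed
 moreover have "c : {..n} \<rightarrow>\<^sub>E R" using r by (auto simp: c_def)
 ultimately have Q: "mk c : Q" unfolding Q_def by blast
 have "(SUM i<=n. d i * x ^ i) = 0"
 proof -
  have "poly p x = (SUM i<=n. coeff p i * x ^ i)"
  unfolding poly_altdef using p(3) by (intro sum.mono_neutral_left) (auto simp: coeff_eq_0)
  then show ?thesis using p(4) by (simp add: d_def sum_divide_distrib[symmetric])
 qed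
 moreover have "(SUM i<=n. (d i - r i) * x ^ i) : mx W"
  using r mxV x by (intro mx_sum[OF vW] mx_mult[OF vW] vr_power[OF vW]) auto
 moreover have "poly (mk c) x = (SUM i<=n. d i * x ^ i) - (SUM i<=n. (d i - r i) * x ^ i)"
  by (simp add: mk_def poly_sum poly_monom c_def sum_subtractf[symmetric] algebra_simps)
 ultimately have "poly (mk c) x : mx W" using mx_minus[OF vW] by simp
 then show ?thesis using A(2)[OF Q x] Q by auto
 qed
 moreover have "finite (\<Union>(A ` Q))" "\<Union>(A ` Q) <= W" using finQ A(1) by auto
 ultimately show ?thesis by blast
qed

lemma dvr_above: "dvr L W"
 by unfold_locales (use vW dval_above finres_above in auto)

end

end

section \<open>Existence of valuation rings\<close>

definition subr :: "'a::field set => bool" where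
 "subr R \<longleftrightarrow> 1 : R & (ALL x:R. - x : R) & (ALL x:R. ALL y:R. x * y : R & x + y : R)"

lemma subr_1: "subr R ==> 1 : R"
 and subr_minus: "subr R ==> x : R ==> - x : R"
 and subr_mult: "subr R ==> x : R ==> y : R ==> x * y : R"
 and subr_add: "subr R ==> x : R ==> y : R ==> x + y : R"
 unfolding subr_def by blast+

lemma subr_0: "subr R ==> 0 : R"
 using subr_add[of R 1 "-1"] subr_1[of R] subr_minus[of R 1] by simp

lemma subr_sum: "subr R ==> (!!i. i : A ==> f i : R) ==> sum f A : R"
 by (induction A rule: infinite_finite_induct) (auto simp: subr_0 subr_add)

lemma subr_power: "subr R ==> x : R ==> x ^ n : R"
 by (induction n) (auto simp: subr_1 subr_mult)

lemma subr_adjoin: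
 assumes "subr R" shows "subr ((%p. poly p x) ` polys R)"
proof -
 have m: "p * q : polys R" "p + q : polys R" "- p : polys R" if "p : polys R" "q : polys R" for p q
 using that assms by (auto simp: polys_def coeff_mult intro!: subr_sum subr_mult subr_add subr_minus)
 have "1 : polys R" using assms by (auto simp: polys_def coeff_1 subr_0 subr_1)
 then have one: "1 : (%p. poly p x) ` polys R" by (rule rev_image_eqI) simp
 show ?thesis unfolding subr_def
 proof (intro conjI ballI one; elim imageE)
 fix a b p q assume a: "a = poly p x" "b = poly q x" "p : polys R" "q : polys R"
 show "a * b : (%p. poly p x) ` polys R" by (rule rev_image_eqI[OF m(1)[OF a(3,4)]]) (simp add: a)
 show "a + b : (%p. poly p x) ` polys R" by (rule rev_image_eqI[OF m(2)[OF a(3,4)]]) (simp add: a)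
 next
 fix a p assume a: "a = poly p x" "p : polys R"
 show "- a : (%p. poly p x) ` polys R" by (rule rev_image_eqI[OF m(3)[OF a(2,2)]]) (simp add: a)
 qed
qed

text \<open>Zorn's lemma gives a maximal ring between \<open>A\<close> and \<open>L\<close> in which
  \<open>s\<close> stays a nonunit; adjoining any further element makes \<open>s\<close> invertible,
  and this forces the valuation property.\<close>

theorem chevalley:
 assumes L: "sfd L" and A: "subr A" "A <= L" and s: "s : A" "s ~= 0" "!!a. a : A ==> s * a ~= 1"
 shows "EX W. vr L W & A <= W & s : mx W"
proof -
 define \<A> where "\<A> = {R. subr R & A <= R & R <= L & (ALL a:R. s * a ~= 1)}"
 have "EX R:\<A>. ALL R':\<A>. R <= R' --> R' = R"
 proof (rule subset_Zorn_nonempty)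
 show "\<A> ~= {}" using assms by (auto simp: \<A>_def)
 fix \<C> assume C: "\<C> ~= {}" "subset.chain \<A> \<C>"
 have mem: "subr R" "A <= R" "R <= L" "!!a. a : R ==> s * a ~= 1" if "R : \<C>" for R
  using C(2) that by (auto simp: subset.chain_def \<A>_def)
 have two: "EX R:\<C>. x : R & y : R" if xy: "x : \<Union>\<C>" "y : \<Union>\<C>" for x y
 proof -
  obtain R S where "R : \<C>" "S : \<C>" "x : R" "y : S" using xy by auto
  moreover have "R <= S | S <= R" using C(2) calculation unfolding subset.chain_def by blast
  ultimately show ?thesis by blast
 qed
 have "subr (\<Union>\<C>)" unfolding subr_def
 proof (intro conjI ballI)
  show "1 : \<Union>\<C>" using C(1) mem(1) subr_1 by blast
  fix x assume "x : \<Union>\<C>"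
  then show "- x : \<Union>\<C>" using mem(1) subr_minus by blast
 next
  fix x y assume "x : \<Union>\<C>" "y : \<Union>\<C>"
  then obtain R where "R : \<C>" "x : R" "y : R" using two by blast
  then show "x * y : \<Union>\<C>" "x + y : \<Union>\<C>" using mem(1) subr_mult subr_add by blast+
 qed
 then show "\<Union>\<C> \<in> \<A>" using mem C(1) unfolding \<A>_def by blast
 qed
 then obtain R where R: "R : \<A>" "!!R'. R' : \<A> ==> R <= R' ==> R' = R" by blast
 have r: "subr R" "A <= R" "R <= L" "!!a. a : R ==> s * a ~= 1" using R(1) by (auto simp: \<A>_def)
 have sR: "s : R" using s r by auto
 have adj: "EX p:polys R. s * poly p x = 1" if x: "x : L" "x ~: R" for x
 proof (rule ccontr)
 let ?R = "(%p. poly p x) ` polys R"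
 assume n: "~ ?thesis"
 have const: "[:a:] : polys R" if "a : R" for a
  using that subr_0[OF r(1)] by (auto simp: polys_def coeff_pCons split: nat.splits)
 have "[:0, 1:] : polys R" using subr_0[OF r(1)] subr_1[OF r(1)]
  by (auto simp: polys_def coeff_pCons split: nat.splits)
 then have "x : ?R" by (rule rev_image_eqI) simp
 moreover have "R <= ?R" using const by (auto intro!: rev_image_eqI[of "[:_:]"])
 then have "A <= ?R" using r(2) by blast
 moreover note `R <= ?R`
 moreover have "?R <= L" using x r(3) L by (auto intro!: polys_poly[OF L r(3)])
 moreover have "?R : \<A>" using `A <= ?R` `?R <= L` subr_adjoin[OF r(1), of x] n r(2) by (auto simp: \<A>_def)
 ultimately show False using R(2)[of ?R] x(2) by blast
 qed
 \<comment> \<open>If the inverse of \<open>c = 1 - s * b\<close> were missing, adjoining it would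
   invert \<open>s\<close>. Clearing denominators gives \<open>s * a = c ^ k\<close>, and
   \<open>c ^ k\<close> is one minus a multiple of \<open>s\<close>, so \<open>s\<close> would be
   invertible in \<open>R\<close> already.\<close>
 have unit: "inverse (1 - s * b) : R" if b: "b : R" for b
 proof (rule ccontr)
 define c where "c = 1 - s * b"
 assume "inverse (1 - s * b) ~: R"
 then have n: "inverse c ~: R" by (simp add: c_def)
 have c: "c : R" "c ~= 0" using b r(4)[of b] sR subr_add[OF r(1) subr_1[OF r(1)] subr_minus[OF r(1) subr_mult[OF r(1) sR b]]]
  by (auto simp: c_def)
 obtain p where p: "p : polys R" "s * poly p (inverse c) = 1" using adj[OF sfd_inverse[OF L] n] c(1) r(3) by blast
 define k where "k = degree p"
 define a where "a = (SUM i<=k. coeff p i * c ^ (k - i))"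
 have a: "a : R" unfolding a_def using p(1) c(1)
  by (intro subr_sum[OF r(1)] subr_mult[OF r(1)] subr_power[OF r(1)]) (auto simp: polys_def)
 have "c ^ k * poly p (inverse c) = a" unfolding a_def poly_altdef k_def sum_distrib_left
  using c(2) by (intro sum.cong) (auto simp: power_diff power_inverse divide_inverse)
 then have sa: "s * a = c ^ k" using p(2) by (metis mult.left_commute mult.right_neutral)
 have "EX e:R. c ^ k = 1 - s * e"
 proof (induction k)
  case 0
  show ?case using subr_0[OF r(1)] by (intro bexI[of _ 0]) auto
 next
  case (Suc k)
  then obtain e where e: "e : R" "c ^ k = 1 - s * e" by auto
  have "c ^ Suc k = 1 - s * (e + b * c ^ k)" using e(2) by (simp add: c_def algebra_simps)
  moreover have "e + b * c ^ k : R" using e b c by (intro subr_add[OF r(1)] subr_mult[OF r(1)] subr_power[OF r(1)])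
  ultimately show ?case by blast
 qed
 then obtain e where e: "e : R" "s * (a + e) = 1" using sa by (auto simp: algebra_simps)
 then show False using r(4)[OF subr_add[OF r(1) a e(1)]] by simp
 qed
 \<comment> \<open>The equation at \<open>inverse x\<close> is solved for \<open>x ^ n\<close>,
   which needs the unit \<open>1 - s * coeff q 0\<close>. Substituting removes the leading term of
   \<open>p\<close>, against the minimality of its degree.\<close>
 have key: False
 if x: "x ~= 0" and p: "p : polys R" "s * poly p x = 1"
  and pm: "!!p'. p' : polys R ==> s * poly p' x = 1 ==> degree p <= degree p'"
  and q: "q : polys R" "s * poly q (inverse x) = 1" "degree q <= degree p" for x p q
 proof -
 define n where "n = degree p"
 have "degree p ~= 0"
 proof
  assume "degree p = 0"
  then obtain a where "p = [:a:]" by (auto elim: degree_eq_zeroE)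
  then show False using p r(4)[of a] polysD[OF p(1), of 0] by simp
 qed
 then have n: "n > 0" by (simp add: n_def)
 define u where "u = inverse (1 - s * coeff q 0)"
 have qR: "coeff q i : R" and pR: "coeff p i : R" for i using q p by (auto simp: polys_def)
 have u: "u : R" unfolding u_def by (rule unit[OF qR])
 have u1: "u * (1 - s * coeff q 0) = 1" using r(4)[OF qR[of 0]] by (simp add: u_def)
 have qn: "poly q (inverse x) = (SUM i<=n. coeff q i * inverse x ^ i)"
  unfolding poly_altdef n_def using q(3) by (intro sum.mono_neutral_left) (auto simp: coeff_eq_0)
 have sp: "(SUM i<=n. f i) = f 0 + (SUM i=1..n. f i)" for f :: "nat => 'a"
  by (simp add: atMost_atLeast0 sum.atLeast_Suc_atMost)
 have e1: "1 - s * coeff q 0 = s * (SUM i=1..n. coeff q i * inverse x ^ i)"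
  using q(2) unfolding qn sp by (simp add: algebra_simps)
 have xn: "x ^ n = (SUM i=1..n. s * u * coeff q i * x ^ (n - i))"
 proof -
  have "x ^ n = x ^ n * (u * (1 - s * coeff q 0))" using u1 by simp
  also have "... = (SUM i=1..n. s * u * coeff q i * (x ^ n * inverse x ^ i))"
  unfolding e1 by (simp add: sum_distrib_left mult_ac)
  also have "... = (SUM i=1..n. s * u * coeff q i * x ^ (n - i))"
  using x by (intro sum.cong) (auto simp: power_diff power_inverse divide_inverse)
  finally show ?thesis .
 qed
 define p' where "p' = (SUM i<n. monom (coeff p i) i) + (SUM i=1..n. monom (coeff p n * (s * u * coeff q i)) (n - i))"
 have "poly p' x = (SUM i<n. coeff p i * x ^ i) + coeff p n * x ^ n"
  by (subst xn) (simp add: p'_def poly_sum poly_monom sum_distrib_left mult_ac)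
 also have "... = (SUM i<=n. coeff p i * x ^ i)" by (simp add: lessThan_Suc_atMost[symmetric])
 also have "... = poly p x" by (simp add: poly_altdef n_def)
 finally have "s * poly p' x = 1" using p by simp
 moreover have "p' : polys R"
 proof -
  have "(if b then a else 0) : R" if "a : R" for a b using that subr_0[OF r(1)] by auto
  then have "coeff p' i : R" for i
  unfolding p'_def Polynomial.coeff_add Polynomial.coeff_sum Polynomial.coeff_monom using pR qR u sR
  by (intro subr_add[OF r(1)] subr_sum[OF r(1)]) (auto intro!: subr_mult[OF r(1)] subr_0[OF r(1)])
  then show ?thesis by (simp add: polys_def)
 qed
 moreover have "degree p' < n"
 proof -
  have "degree p' <= n - 1" unfolding p'_def
  by (intro degree_add_le degree_sum_le) (auto intro!: order_trans[OF degree_monom_le])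
  then show ?thesis using n by simp
 qed
 ultimately show False using pm[of p'] by (simp add: n_def)
 qed
 have dich: "x : R | inverse x : R" if x: "x : L" "x ~= 0" for x
 proof (rule ccontr)
 assume n: "~ ?thesis"
 have least: "EX p. p : polys R & s * poly p y = 1 &
  (ALL p'. p' : polys R --> s * poly p' y = 1 --> degree p <= degree p')" if "y : L" "y ~: R" for y
  using adj[OF that] ex_has_least_nat[of "%p. p : polys R & s * poly p y = 1" _ degree] by blast
 obtain p where p: "p : polys R" "s * poly p x = 1"
  "!!p'. p' : polys R ==> s * poly p' x = 1 ==> degree p <= degree p'" using least[of x] n x by blast
 obtain q where q: "q : polys R" "s * poly q (inverse x) = 1"
  "!!p'. p' : polys R ==> s * poly p' (inverse x) = 1 ==> degree q <= degree p'"
  using least[of "inverse x"] n x L sfd_inverse by blast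
 show False
 proof (cases "degree q <= degree p")
  case True
  show False by (rule key[OF x(2) p q(1,2) True])
 next
  case False
  show False by (rule key[OF _ q p(1)]) (use p x False in auto)
 qed
 qed
 have "inverse s ~: R" using r(4)[of "inverse s"] s by auto
 moreover have "inverse s : L" using s A L by (auto intro: sfd_inverse)
 ultimately have "vr L R" using r L dich unfolding vr_def subr_def by blast
 moreover have "s : mx R" using sR `inverse s ~: R` by (simp add: mx_def)
 ultimately show ?thesis using r(2) by blast
qed

lemma vr_Int: assumes "vr L W" "sfd F" "F <= L" "~ F <= W" shows "vr F (W Int F)"
 using assms unfolding vr_def by (auto simp: sfd_closed)

text \<open>A uniformizer of \<open>V\<close> is kept a nonunit; the intersection with
  \<open>F\<close> is then a proper valuation ring containing \<open>V\<close>, and discrete rings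
  are maximal.\<close>

lemma dvr_extends: assumes "dvr F V" "sfd L" "F <= L" shows "EX W. vr L W & W Int F = V"
proof -
 interpret V: dvr F V by fact
 obtain p where p: "p : F" "p ~= 0" "V.nu p = 1" using V.unif by auto
 have pV: "p : mx V" using p V.mx_eq by (auto simp: pw_def)
 have "p * a ~= 1" if "a : V" for a using mx_mult[OF V.vr pV that] mx_1[OF V.vr] by auto
 moreover have "subr V" using V.vr unfolding vr_def subr_def by blast
 moreover have "V <= L" using vr_sub[OF V.vr] assms by auto
 ultimately obtain W where W: "vr L W" "V <= W" "p : mx W"
 using chevalley[of L V p] assms(2) mx_sub[OF pV] p(2) by blast
 have "inverse p ~: W" using W(3) p(2) by (auto simp: mx_def)
 then have "vr F (W Int F)" using vr_Int[OF W(1) V.sfL assms(3)] p(1) V.sfL sfd_inverse by blast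
 then have "W Int F = V" using V.maximal W(2) vr_sub[OF V.vr] by blast
 then show ?thesis using W(1) by blast
qed

section \<open>Decomposition and inertia\<close>

text \<open>Triviality of the decomposition group, which by \<open>card_primes_above\<close> is
  complete splitting of the prime below \<open>W\<close>.\<close>

definition tdec :: "'a::field set => 'a set => 'a set => bool" where
 "tdec F L W \<longleftrightarrow> (ALL s:auts F L. s ` W = W --> s = (\<lambda>x\<in>L. x))"

text \<open>Stability of \<open>W\<close> is a consequence of the congruences and the maximality of
  \<open>W\<close>, see \<open>inert_stable\<close>.\<close>

definition inert :: "'a::field set => 'a set => 'a set => ('a => 'a) set" where
 "inert F L W = {s : auts F L. ALL x:W. s x - x : mx W}"

definition tin :: "'a::field set => 'a set => 'a set => bool" where
 "tin F L W \<longleftrightarrow> inert F L W <= {\<lambda>x\<in>L. x}"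

lemma approximation_value:
 assumes "dvr L W0" "finite \<W>" "!!W. W : \<W> ==> dvr L W & W ~= W0" and b: "b : L"
 shows "EX x:L. x - b : pw L W0 k & (ALL W:\<W>. x : pw L W k)"
proof -
 have "EX m. ALL W:insert W0 \<W>. m + ord L W b >= k"
 proof -
 have fin: "finite (insert W0 \<W>)" using assms by simp
 have "k + (SUM W:insert W0 \<W>. \<bar>ord L W b\<bar>) + ord L W b >= k" if "W : insert W0 \<W>" for W
  using member_le_sum[OF that, of "%W. \<bar>ord L W b\<bar>"] fin by auto
 then show ?thesis by blast
 qed
 then obtain m where m: "ALL W:insert W0 \<W>. m + ord L W b >= k" by auto
 obtain x where x: "x : L" "x - 1 : pw L W0 m" "ALL W:\<W>. x : pw L W m"
 using approximation[OF assms(1-3), of m] by blast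
 have *: "u * b : pw L W k" if "dvr L W" "u : pw L W m" "W : insert W0 \<W>" for u W
 proof -
 interpret dvr L W by fact
 have "b : pw L W (nu b)" using b by (auto simp: pw_def)
 from pw_mult[OF that(2) this] show ?thesis using m that(3) pw_mono[of k "m + nu b"] by auto
 qed
 interpret V0: dvr L W0 by fact
 have "x * b - b = (x - 1) * b" by (simp add: algebra_simps)
 then have "x * b - b : pw L W0 k" using *[OF assms(1) x(2)] by simp
 then show ?thesis using x b * assms(3) V0.sfL by (intro bexI[of _ "x * b"]) (auto simp: sfd_mult)
qed

context galois
begin

lemma image_inv: assumes "s : G" obtains t where "t : G" "!!x. x : L ==> t (s x) = x" "!!x. x : L ==> s (t x) = x"
 "!!A. A <= L ==> t ` s ` A = A" "!!A. A <= L ==> s ` t ` A = A"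
proof -
 obtain t where t: "t : G" "ALL x:L. t (s x) = x & s (t x) = x" using G_inv[OF assms] by auto
 have "t ` s ` A = A" "s ` t ` A = A" if A: "A <= L" for A
 proof -
 have "(%x. t (s x)) ` A = id ` A" "(%x. s (t x)) ` A = id ` A"
  using t(2) A by (intro image_cong refl; auto)+
 then show "t ` s ` A = A" "s ` t ` A = A" by (simp_all add: image_image)
 qed
 with t show ?thesis by (intro that[of t]) auto
qed

lemma compose_G: "s : G ==> t : G ==> compose L s t : G"
 by (rule auts_compose[OF _ _ FL sfL])

lemma compose_image: "A <= L ==> compose L s t ` A = s ` t ` A"
 by (auto simp: compose_eq image_image subset_iff intro!: image_cong)

lemma vr_image: assumes s: "s : G" and W: "vr L W" shows "vr L (s ` W)"
proof -
 obtain t where t: "t : G" "!!x. x : L ==> t (s x) = x" "!!x. x : L ==> s (t x) = x"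
 "!!A. A <= L ==> t ` s ` A = A" "!!A. A <= L ==> s ` t ` A = A" by (rule image_inv[OF s]) blast
 note r = auts_rhom[OF s] and WL = vr_sub[OF W]
 have op: "s x * s y : s ` W" "s x + s y : s ` W" "- s x : s ` W" if "x : W" "y : W" for x y
 using that rhom_mult[OF r, of x y] rhom_add[OF r, of x y] rhom_minus[OF r sfL, of x] WL
  vr_mult[OF W that] vr_add[OF W that] vr_minus[OF W that(1)] by (auto simp: subset_iff intro: rev_image_eqI)
 have "1 : s ` W" using rhom_1[OF r] vr_1[OF W] by (metis imageI)
 moreover have "s ` W \<subset> L"
 proof -
 have "s ` W <= L" using WL auts_in[OF s] by auto
 moreover have "s ` W ~= L"
 proof
  assume "s ` W = L"
  then have "W = t ` L" using t(4)[OF WL] by simp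
  then show False using auts_image[OF t(1)] W unfolding vr_def by blast
 qed
 ultimately show ?thesis by auto
 qed
 moreover have "x : s ` W | inverse x : s ` W" if x: "x : L" "x ~= 0" for x
 proof -
 have tx: "t x : L" "t x ~= 0" using auts_in[OF t(1)] x rhom_eq_0[OF auts_rhom[OF t(1)] sfL] by auto
 have "inverse x = s (inverse (t x))" "x = s (t x)" using rhom_inverse[OF r sfL tx(1)] t(3) x by auto
 then show ?thesis using vr_dich[OF W tx] by (metis imageI)
 qed
 ultimately show ?thesis unfolding vr_def using sfL op by blast
qed

lemma image_Int_F: assumes "s : G" "W <= L" shows "s ` W Int F = W Int F"
proof (intro subset_antisym subsetI)
 fix x assume x: "x : s ` W Int F"
 then obtain y where y: "y : W" "x = s y" by auto
 have "s y = s x" using y x auts_fix[OF assms(1)] by auto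
 then have "y = x" using rhom_inj[OF auts_rhom[OF assms(1)] sfL] y x assms(2) FL by (auto dest: inj_onD)
 then show "x : W Int F" using y x by auto
next
 fix x assume "x : W Int F"
 then show "x : s ` W Int F" using auts_fix[OF assms(1), of x] by (auto intro: rev_image_eqI)
qed

lemma mx_image: assumes s: "s : G" and W: "vr L W" and x: "x : L" shows "s x : mx (s ` W) \<longleftrightarrow> x : mx W"
proof -
 note r = auts_rhom[OF s]
 have m: "s y : s ` W \<longleftrightarrow> y : W" if "y : L" for y
 using inj_on_image_mem_iff[OF rhom_inj[OF r sfL] that vr_sub[OF W]] .
 show ?thesis unfolding mx_def using m[OF x] m[of "inverse x"] x rhom_inverse[OF r sfL x] rhom_eq_0[OF r sfL x]
 by (auto simp: sfd_inverse[OF sfL])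
qed

lemma dvr_image: assumes s: "s : G" and W: "dvr L W" shows "dvr L (s ` W)" "x : L ==> x ~= 0 ==> ord L (s ` W) (s x) = ord L W x"
proof -
 interpret W: dvr L W by fact
 obtain t where t: "t : G" "!!x. x : L ==> t (s x) = x" "!!x. x : L ==> s (t x) = x"
 by (rule image_inv[OF s]) blast
 note r = auts_rhom[OF t(1)] and tL = auts_in[OF t(1)] and rs = auts_rhom[OF s]
 have d: "dval L (s ` W) (%x. W.nu (t x))" unfolding dval_def
 proof (intro conjI ballI impI)
 fix x y assume "x : L" "y : L" "x ~= 0" "y ~= 0"
 then show "W.nu (t (x * y)) = W.nu (t x) + W.nu (t y)"
  using W.ord_mult[of "t x" "t y"] tL rhom_eq_0[OF r sfL] rhom_mult[OF r] by simp
 next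
 fix x assume x: "x : L" "x ~= 0"
 have "x : s ` W \<longleftrightarrow> t x : W"
  using inj_on_image_mem_iff[OF rhom_inj[OF rs sfL] tL[OF x(1)] vr_sub[OF W.vr]] t(3)[OF x(1)] by simp
 then show "x : s ` W \<longleftrightarrow> 0 <= W.nu (t x)" using W.mem_iff tL x rhom_eq_0[OF r sfL] by auto
 next
 obtain p where p: "p : L" "p ~= 0" "W.nu p = 1" using W.unif by auto
 then show "EX p:L. p ~= 0 & W.nu (t p) = 1"
  using t(2) auts_in[OF s] rhom_eq_0[OF rs sfL] by (intro bexI[of _ "s p"]) auto
 qed
 obtain R where R: "finite R" "R <= W" "ALL x:W. EX r:R. x - r : mx W" using W.finres by blast
 have "EX R. finite R & R <= s ` W & (ALL x:s ` W. EX r:R. x - r : mx (s ` W))"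
 proof (intro exI conjI ballI)
 show "finite (s ` R)" "s ` R <= s ` W" using R by auto
 fix x assume "x : s ` W"
 then obtain y where y: "y : W" "x = s y" by auto
 then obtain u where u: "u : R" "y - u : mx W" using R by auto
 have uy: "u : L" "y : L" using u y R vr_sub[OF W.vr] by auto
 then have "s y - s u : mx (s ` W)" using u mx_image[OF s W.vr, of "y - u"] rhom_diff[OF rs sfL] sfd_diff[OF sfL] by auto
 then show "EX r:s ` R. x - r : mx (s ` W)" using u y by auto
 qed
 then show sW: "dvr L (s ` W)" using d vr_image[OF s W.vr] by unfold_locales auto
 then interpret sW: dvr L "s ` W" .
 show "ord L (s ` W) (s x) = ord L W x" if x: "x : L" "x ~= 0"
 using sW.ord_unique[OF d, of "s x"] x t(2) auts_in[OF s] rhom_eq_0[OF rs sfL] by simp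
qed

lemma pw_image:
 assumes "s : G" "dvr L W" "x : L" shows "s x : pw L (s ` W) n \<longleftrightarrow> x : pw L W n"
 using dvr_image(2)[OF assms(1,2), of x] assms auts_in[OF assms(1,3)]
 rhom_eq_0[OF auts_rhom[OF assms(1)] sfL assms(3)] by (auto simp: pw_def)

lemma pw_stable: "s : G ==> dvr L W ==> s ` W = W ==> x : pw L W n ==> s x : pw L W n"
 using pw_image[of s W x n] by (auto simp: pw_def)

lemma inert_stable: assumes "dvr L W" "s : inert F L W" shows "s : G" "s ` W = W"
proof -
 show s: "s : G" using assms by (auto simp: inert_def)
 interpret W: dvr L W by fact
 interpret sW: dvr L "s ` W" by (rule dvr_image(1)[OF s assms(1)])
 have "s x : W" if "x : W" for x
 using assms(2) that vr_add[OF W.vr, of "s x - x" x] mx_sub by (auto simp: inert_def)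
 then show "s ` W = W" using sW.maximal[OF W.vr] by auto
qed

lemma inert_agrp: assumes "dvr L W" shows "agrp L (inert F L W)"
proof -
 interpret W: dvr L W by fact
 have "compose L s t : inert F L W" if st: "s : inert F L W" "t : inert F L W" for s t
 proof -
 note S = inert_stable[OF assms st(1)] and TT = inert_stable[OF assms st(2)]
 have "compose L s t x - x : mx W" if x: "x : W" for x
 proof -
  have "t x : W" "x : L" using TT(2) x vr_sub[OF W.vr] by auto
  then have "(s (t x) - t x) + (t x - x) : mx W" using st x by (intro mx_add[OF W.vr]) (auto simp: inert_def)
  then show ?thesis using \<open>x : L\<close> by (simp add: compose_eq)
 qed
 then show ?thesis using auts_compose[OF S(1) TT(1) FL sfL] by (simp add: inert_def)
 qed
 moreover have "inert F L W <= G" by (auto simp: inert_def)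
 moreover have "(\<lambda>x\<in>L. x) : inert F L W" using G_id vr_sub[OF W.vr] mx_0[OF W.vr] by (auto simp: inert_def subset_iff)
 ultimately show ?thesis
 using finite_subset[OF _ finG] auts_mono[of "{}" F L] unfolding agrp_def by blast
qed

text \<open>If \<open>W'\<close> is no conjugate of \<open>W\<close>, approximation yields
  \<open>y\<close> lying in the maximal ideal of \<open>W'\<close> and congruent to one at all
  conjugates of \<open>W\<close>. Its norm lies in \<open>F\<close>, in the maximal ideal of
  \<open>W'\<close> but not in that of \<open>W\<close>, although both rings agree on
  \<open>F\<close>.\<close>

theorem primes_conjugate:
 assumes "dvr L W" "dvr L W'" "W Int F = W' Int F" shows "EX s:G. s ` W = W'"
proof (rule ccontr)
 assume n: "~ ?thesis"
 interpret W: dvr L W by fact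
 interpret W': dvr L W' by fact
 have WL: "W <= L" "W' <= L" using vr_sub W.vr W'.vr by auto
 \<comment> \<open>The other conjugates of \<open>W'\<close> are included so that every conjugate of
   \<open>y\<close> is integral at \<open>W'\<close>.\<close>
 define \<W> where "\<W> = (%s. s ` W) ` G Un ((%s. s ` W') ` G - {W'})"
 have fin: "finite \<W>" using finG by (auto simp: \<W>_def)
 have d: "dvr L V & V ~= W'" if "V : \<W>" for V
 using that n dvr_image(1) assms(1,2) by (auto simp: \<W>_def)
 obtain x where x: "x : L" "x - 1 : pw L W' 1" "ALL V:\<W>. x : pw L V 1"
 using approximation[OF assms(2) fin d, of 1] by blast
 define y where "y = 1 - x"
 have y: "y : L" using x sfL by (auto simp: y_def sfd_diff)
 have y1: "y : mx W'" using W'.pw_minus[OF x(2)] by (simp add: y_def W'.mx_eq)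
 have "s y : W'" if s: "s : G" for s
 proof (cases "s ` W' = W'")
 case True
 then show ?thesis using mx_sub[OF y1] by auto
 next
 case False
 obtain t where t: "t : G" "!!x. x : L ==> t (s x) = x" "!!x. x : L ==> s (t x) = x"
  "!!A. A <= L ==> t ` s ` A = A" "!!A. A <= L ==> s ` t ` A = A" by (rule image_inv[OF s]) blast
 have "t ` W' ~= W'" using False t(5)[OF WL(2)] by auto
 then have "t ` W' : \<W>" using t(1) by (auto simp: \<W>_def)
 then have "x : pw L (t ` W') 1" using x by auto
 then have "x : mx (t ` W')" using dvr.mx_eq[OF dvr_image(1)[OF t(1) assms(2)]] by simp
 then have "y : t ` W'" unfolding y_def
  using vr_diff[OF vr_image[OF t(1) W'.vr]] vr_1[OF vr_image[OF t(1) W'.vr]] mx_sub by blast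
 then show ?thesis using t(3) WL by auto
 qed
 then have "(PROD s:G. s y) : mx W'"
 by (rule mx_prod[OF W'.vr finG _ G_id]) (use y1 y in auto)
 then have N: "(PROD s:G. s y) : mx W"
 using norm_F[OF y] mx_Int[OF W.vr sfF] mx_Int[OF W'.vr sfF] assms(3) by auto
 have "s y : W & s y ~: mx W" if s: "s : G" for s
 proof -
 obtain t where t: "t : G" "!!x. x : L ==> t (s x) = x" "!!x. x : L ==> s (t x) = x"
  "!!A. A <= L ==> t ` s ` A = A" "!!A. A <= L ==> s ` t ` A = A" by (rule image_inv[OF s]) blast
 note v = vr_image[OF t(1) W.vr]
 have "x : pw L (t ` W) 1" using x t(1) by (auto simp: \<W>_def)
 then have xm: "x : mx (t ` W)" using dvr.mx_eq[OF dvr_image(1)[OF t(1) assms(1)]] by simp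
 have "y : t ` W" unfolding y_def using vr_diff[OF v vr_1[OF v] mx_sub[OF xm]] .
 then have "s y : W" using t(3) WL by auto
 moreover have "y ~: mx (t ` W)" unfolding y_def using mx_add[OF v _ xm, of "1 - x"] mx_1[OF v] by auto
 then have "s y ~: mx W" using mx_image[OF t(1) W.vr, of "s y"] t(2) y auts_in[OF s] by auto
 ultimately show ?thesis by simp
 qed
 then show False using mx_prod_notin[OF W.vr, of G "%s. s y"] N by auto
qed

lemma primes_above_eq_orbit:
 assumes "dvr L W" "dvr F (W Int F)" shows "{W'. vr L W' & W' Int F = W Int F} = (%s. s ` W) ` G"
proof (intro subset_antisym subsetI)
 fix W' assume "W' : {W'. vr L W' & W' Int F = W Int F}"
 then have W': "vr L W'" "W' Int F = W Int F" by auto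
 have "dvr L W'" using dvr_above[OF _ W'(1)] W'(2) assms(2) by simp
 then show "W' : (%s. s ` W) ` G" using primes_conjugate[OF assms(1)] W'(2) by blast
next
 fix W' assume "W' : (%s. s ` W) ` G"
 then show "W' : {W'. vr L W' & W' Int F = W Int F}"
 using vr_image[OF _ dvr.vr[OF assms(1)]] image_Int_F[OF _ vr_sub[OF dvr.vr[OF assms(1)]]] by auto
qed

text \<open>Orbit counting: the primes above form one orbit, which is as large as the group exactly
  when the stabiliser is trivial.\<close>

lemma card_primes_above:
 assumes "dvr L W" "dvr F (W Int F)"
 shows "card {W'. vr L W' & W' Int F = W Int F} = card G \<longleftrightarrow> tdec F L W"
proof -
 have WL: "W <= L" using vr_sub dvr.vr[OF assms(1)] .
 have "card ((%s. s ` W) ` G) = card G \<longleftrightarrow> inj_on (%s. s ` W) G"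
 using finG card_image eq_card_imp_inj_on by blast
 also have "... \<longleftrightarrow> tdec F L W"
 proof
 assume i: "inj_on (%s. s ` W) G"
 have "(\<lambda>x\<in>L. x) ` W = W" using WL by force
 then show "tdec F L W" unfolding tdec_def using inj_onD[OF i _ _ G_id] by auto
 next
 assume t: "tdec F L W"
 show "inj_on (%s. s ` W) G"
 proof (rule inj_onI)
  fix s u assume su: "s : G" "u : G" "s ` W = u ` W"
  obtain t' where t': "t' : G" "!!x. x : L ==> t' (u x) = x" "!!x. x : L ==> u (t' x) = x"
  "!!A. A <= L ==> t' ` u ` A = A" "!!A. A <= L ==> u ` t' ` A = A" by (rule image_inv[OF su(2)]) blast
  have "compose L t' s ` W = t' ` s ` W" using WL by (simp add: compose_image)
  also have "... = W" using su(3) t'(4)[OF WL] by simp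
  finally have e: "compose L t' s = (\<lambda>x\<in>L. x)"
  using t auts_compose[OF t'(1) su(1) FL sfL] by (auto simp: tdec_def)
  show "s = u"
  proof (rule auts_eqI[OF su(1,2)])
  fix x assume x: "x : L"
  have "t' (s x) = x" using fun_cong[OF e, of x] x by (simp add: compose_eq)
  then show "s x = u x" using t'(3)[OF auts_in[OF su(1) x]] by simp
  qed
 qed
 qed
 finally show ?thesis using primes_above_eq_orbit[OF assms] by simp
qed

text \<open>Artin's shortening of relations, modulo the maximal ideal. Trivial inertia keeps
  distinct elements of the decomposition group distinct modulo that ideal, so a suitable
  \<open>u x - s0 x\<close> is a unit and cancels by primality.\<close>

lemma characters_independent_mod:
 assumes W: "dvr L W" and t: "tin F L W" and "finite S" "S <= {s : G. s ` W = W}"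
 "!!s. s : S ==> c s : W" "!!b. b : W ==> (SUM s:S. c s * s b) : mx W" "s : S"
 shows "c s : mx W"
 using assms(3-7)
proof (induction S arbitrary: c s)
 case empty
 from empty.prems(4) show ?case by blast
next
 case (insert s0 S)
 interpret W: dvr L W by fact
 have WL: "W <= L" using vr_sub[OF W.vr] .
 have st: "u x : W" if "u : insert s0 S" "x : W" for u x using insert.prems(1) that by auto
 have IH: "c u : mx W" if u: "u : S" for u
 proof -
 have "u ~= s0" using u insert by auto
 have sG: "s0 : G" "u : G" "s0 ` W = W" using insert.prems u by auto
 obtain t' where t': "t' : G" "!!x. x : L ==> t' (s0 x) = x" "!!x. x : L ==> s0 (t' x) = x"
  "!!A. A <= L ==> t' ` s0 ` A = A" "!!A. A <= L ==> s0 ` t' ` A = A" by (rule image_inv[OF sG(1)]) blast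
 have "EX x:W. u x - s0 x ~: mx W"
 proof (rule ccontr)
  assume n: "~ ?thesis"
  have "compose L t' u x - x : mx W" if x: "x : W" for x
  proof -
  have xL: "x : L" "u x : L" "s0 x : L" using x WL sG auts_in by blast+
  have "u x - s0 x : mx W" using n x by auto
  then have "t' (u x - s0 x) : mx (t' ` W)" using mx_image[OF t'(1) W.vr] xL sfL by (simp add: sfd_diff)
  moreover have "t' ` W = W" using t'(4)[OF WL] sG by simp
  ultimately show ?thesis
   using rhom_diff[OF auts_rhom[OF t'(1)] sfL xL(2,3)] t'(2)[OF xL(1)] xL(1) by (simp add: compose_eq)
  qed
  then have "compose L t' u : inert F L W" using auts_compose[OF t'(1) sG(2) FL sfL] by (auto simp: inert_def)
  then have e: "compose L t' u = (\<lambda>x\<in>L. x)" using t by (auto simp: tin_def)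
  have "u = s0"
  proof (rule auts_eqI[OF sG(2,1)])
  fix x assume x: "x : L"
  have "t' (u x) = x" using fun_cong[OF e, of x] x by (simp add: compose_eq)
  then show "u x = s0 x" using t'(3)[OF auts_in[OF sG(2) x]] by simp
  qed
  then show False using `u ~= s0` by simp
 qed
 then obtain x where x: "x : W" "u x - s0 x ~: mx W" by auto
 have "c u * (u x - s0 x) : mx W"
 proof (rule insert.IH[of "%u. c u * (u x - s0 x)", OF _ _ _ u])
  show "S <= {s : G. s ` W = W}" using insert.prems by auto
  show "c s * (s x - s0 x) : W" if "s : S" for s
  using that insert.prems(2) st x by (intro vr_mult[OF W.vr] vr_diff[OF W.vr]) auto
  fix b assume b: "b : W"
  have m: "s (b * x) = s b * s x" if "s : insert s0 S" for s
  using that insert.prems(1) b x WL by (intro rhom_mult[of L]) (auto intro: auts_rhom)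
  have "(SUM s:insert s0 S. c s * s (b * x)) - s0 x * (SUM s:insert s0 S. c s * s b) : mx W"
  using insert.prems(3)[OF vr_mult[OF W.vr b x(1)]] mx_mult[OF W.vr insert.prems(3)[OF b] st[of s0 x]] x(1)
  by (intro mx_diff[OF W.vr]) (simp_all only: mult.commute insertI1)
  also have "(SUM s:insert s0 S. c s * s (b * x)) - s0 x * (SUM s:insert s0 S. c s * s b)
   = (SUM s:S. c s * (s x - s0 x) * s b)"
  proof -
  have "(SUM s:insert s0 S. c s * s (b * x)) = (SUM s:insert s0 S. c s * (s b * s x))"
   using m by (intro sum.cong) auto
  then have "(SUM s:insert s0 S. c s * s (b * x)) - s0 x * (SUM s:insert s0 S. c s * s b)
   = (SUM s:insert s0 S. c s * (s x - s0 x) * s b)"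
   by (simp add: sum_distrib_left sum_subtractf[symmetric] algebra_simps)
  then show ?thesis using insert.hyps by simp
  qed
  finally show "(SUM s:S. c s * (s x - s0 x) * s b) : mx W" .
 qed
 then show ?thesis using mx_prime[OF W.vr, of "c u" "u x - s0 x"] x insert.prems(2) u st
  vr_diff[OF W.vr] by auto
 qed
 have "c s0 : mx W"
 proof -
 have one: "u 1 = 1" if "u : insert s0 S" for u using that insert.prems(1) rhom_1[OF auts_rhom] by auto
 have "(SUM s:insert s0 S. c s * s 1) = (SUM s:insert s0 S. c s)" using one by (intro sum.cong) auto
 then have "c s0 + sum c S : mx W" using insert.prems(3)[OF vr_1[OF W.vr]] insert.hyps by simp
 moreover have "sum c S : mx W" using IH by (rule mx_sum[OF W.vr])
 ultimately show ?thesis using mx_diff[OF W.vr, of "c s0 + sum c S" "sum c S"] by simp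
 qed
 with IH show ?case using insert.prems(4) by (cases "s = s0") blast+
qed

text \<open>
  If inertia is trivial, the trace pairing is perfect at \<open>W\<close>: for \<open>y \<notin> W\<close> some \<open>x \<in> W\<close>
 that is small at the conjugates of `W` has `Tr (x y) ~: W`.
\<close>

theorem trace_pairing:
 assumes W: "dvr L W" and t: "tin F L W" and y: "y : L" "y ~: W"
 shows "EX x:W. (ALL u:G. u ` W ~= W --> u x : pw L W k) & (SUM s:G. s (x * y)) ~: W"
proof -
 interpret W: dvr L W by fact
 have WL: "W <= L" using vr_sub[OF W.vr] .
 define D where "D = {s : G. s ` W = W}"
 have D: "D <= G" "finite D" using finG by (auto simp: D_def)
 have y0: "y ~= 0" using y vr_0[OF W.vr] by auto
 \<comment> \<open>The decomposition group preserves the value of \<open>y\<close>, so these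
   quotients are units and the corresponding part of the trace is \<open>y\<close> times a
   combination of characters with unit coefficients.\<close>
 define c where "c s = s y / y" for s
 have cW: "c s : W & c s ~: mx W" if s: "s : D" for s
 proof -
 have sy: "s y : L" "s y ~= 0" using s D y0 y auts_in rhom_eq_0[OF auts_rhom sfL] by blast+
 have "W.nu (s y) = W.nu y" using dvr_image(2)[OF _ W, of s y] s y y0 by (auto simp: D_def)
 then have "W.nu (c s) = 0" using W.ord_divide[OF sy(1) y(1) sy(2) y0] by (simp add: c_def)
 moreover have "c s : L" "c s ~= 0" using sy y y0 sfL by (auto simp: c_def sfd_divide)
 ultimately show ?thesis using W.mem_iff[of "c s"] by (auto simp: W.mx_eq pw_def)
 qed
 have idD: "(\<lambda>x\<in>L. x) : D" using G_id WL by (force simp: D_def)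
 have "EX b:W. (SUM s:D. c s * s b) ~: mx W"
 proof (rule ccontr)
 assume n: "~ ?thesis"
 have "c (\<lambda>x\<in>L. x) : mx W"
 proof (intro characters_independent_mod[OF W t D(2), of c])
  show "D <= {s : G. s ` W = W}" by (simp add: D_def)
  show "(SUM s:D. c s * s b) : mx W" if "b : W" for b using n that by blast
 qed (use cW idD in auto)
 then show False using cW[OF idD] by simp
 qed
 then obtain b where b: "b : W" "(SUM s:D. c s * s b) ~: mx W" by auto
 \<comment> \<open>This precision absorbs the poles that conjugates of \<open>y\<close> may have at
   \<open>W\<close>, besides reaching the requested \<open>k\<close>.\<close>
 define m where "m = k + 1 + (SUM s:G. \<bar>W.nu (s y)\<bar>) + \<bar>k\<bar>"
 have m: "m >= k" "m + W.nu (s y) >= 0" if "s : G" for s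
 proof -
 have "\<bar>W.nu (s y)\<bar> <= (SUM s:G. \<bar>W.nu (s y)\<bar>)"
  using member_le_sum[of s G "%s. \<bar>W.nu (s y)\<bar>"] that finG by auto
 then show "m >= k" "m + W.nu (s y) >= 0" unfolding m_def by linarith+
 qed
 define \<W> where "\<W> = (%s. s ` W) ` G - {W}"
 obtain x where x: "x : L" "x - b : pw L W (max 1 m)" "ALL V:\<W>. x : pw L V (max 1 m)"
 using approximation_value[OF W, of \<W> b "max 1 m"] finG dvr_image(1)[OF _ W] b WL by (auto simp: \<W>_def)
 have xb: "x - b : mx W" using x(2) W.pw_mono[of 1 "max 1 m"] by (auto simp: W.mx_eq)
 have xW: "x : W" using vr_add[OF W.vr mx_sub[OF xb] b(1)] by simp
 have other: "u x : pw L W m" if u: "u : G" "u ` W ~= W" for u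
 proof -
 obtain v where v: "v : G" "!!x. x : L ==> v (u x) = x" "!!x. x : L ==> u (v x) = x"
  "!!A. A <= L ==> v ` u ` A = A" "!!A. A <= L ==> u ` v ` A = A" by (rule image_inv[OF u(1)]) blast
 have "v ` W ~= W" using u(2) v(5)[OF WL] by auto
 then have "v ` W : \<W>" using v(1) by (auto simp: \<W>_def)
 then have "x : pw L (v ` W) m"
  using x(3) dvr.pw_mono[OF dvr_image(1)[OF v(1) W], of m "max 1 m"] by auto
 then show ?thesis using pw_image[OF v(1) W, of "u x" m] v(2)[OF x(1)] auts_in[OF u(1) x(1)] by simp
 qed
 have mul: "s (x * y) = s x * s y" if "s : G" for s
 using that x y by (intro rhom_mult[OF auts_rhom]) auto
 have "(SUM s:G. s (x * y)) = (SUM s:D. s x * s y) + (SUM s:G - D. s x * s y)"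
 using mul sum.subset_diff[OF D(1) finG, of "%s. s x * s y"] by (simp add: add.commute)
 also have "(SUM s:D. s x * s y) = y * (SUM s:D. c s * s x)"
 unfolding sum_distrib_left using y0 by (intro sum.cong) (auto simp: c_def)
 finally have e: "(SUM s:G. s (x * y)) = y * (SUM s:D. c s * s x) + (SUM s:G - D. s x * s y)" .
 have small: "(SUM s:G - D. s x * s y) : W"
 proof (rule vr_sum[OF W.vr])
 fix s assume s: "s : G - D"
 then have "s : G" "s ` W ~= W" by (auto simp: D_def)
 then have "s x : pw L W m" "s y : pw L W (W.nu (s y))"
  using other[of s] auts_in[of s F L y] y(1) by (simp_all add: pw_def)
 from W.pw_mult[OF this] have "s x * s y : pw L W (m + W.nu (s y))" .
 then show "s x * s y : W" using W.pw_mono[of 0] m(2)[of s] s W.pw_0_eq by blast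
 qed
 define z where "z = (SUM s:D. c s * s x)"
 have sW: "s a : W" if "s : D" "a : W" for s a using that by (auto simp: D_def)
 have zW: "z : W" unfolding z_def using cW sW xW by (intro vr_sum[OF W.vr] vr_mult[OF W.vr]) auto
 have znm: "z ~: mx W"
 proof
 assume zm: "z : mx W"
 have "(SUM s:D. c s * s b) = z - (SUM s:D. s (x - b) * c s)"
 proof -
  have "s (x - b) = s x - s b" if "s : D" for s
  using that D x b WL by (intro rhom_diff[OF auts_rhom sfL]) auto
  note sub = this
  have "s (x - b) * c s = c s * s x - c s * s b" if "s : D" for s
  unfolding sub[OF that] by (simp add: algebra_simps)
  then have "(SUM s:D. s (x - b) * c s) = (SUM s:D. c s * s x - c s * s b)"
  by (rule sum.cong[OF refl])
  then show ?thesis by (simp add: z_def sum_subtractf)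
 qed
 also have "... : mx W"
 proof (intro mx_diff[OF W.vr zm] mx_sum[OF W.vr] mx_mult[OF W.vr])
  fix s assume s: "s : D"
  show "s (x - b) : mx W" using pw_stable[OF _ W, of s "x - b" 1] s xb by (auto simp: D_def W.mx_eq)
  show "c s : W" using cW s by auto
 qed
 finally show False using b by simp
 qed
 have zu: "z ~= 0" "inverse z : W" using mx_unit[OF zW znm] by auto
 have "(SUM s:G. s (x * y)) ~: W"
 proof
 assume "(SUM s:G. s (x * y)) : W"
 then have "y * z : W" using vr_diff[OF W.vr _ small] e by (fastforce simp: z_def)
 then have "y * z * inverse z : W" using zu(2) by (rule vr_mult[OF W.vr])
 moreover have "y * z * inverse z = y" using zu(1) by simp
 ultimately show False using y(2) by simp
 qed
 moreover have "ALL u:G. u ` W ~= W --> u x : pw L W k"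
 using other m(1) W.pw_mono[of k m] by blast
 ultimately show ?thesis using xW by blast
qed

text \<open>If \<open>p\<close> had value at least two, \<open>r / p\<close> with a uniformizer
  \<open>r\<close> of \<open>W\<close> would not be integral, and \<open>trace_pairing\<close> would
  give a trace outside \<open>W\<close>. But the trace of \<open>x * r\<close> lies in the maximal
  ideal below, hence is divisible by \<open>p\<close>.\<close>

lemma tin_imp_index_one:
 assumes W: "dvr L W" and V: "dvr F (W Int F)" and t: "tin F L W" and p: "p : F" "p ~= 0" "ord F (W Int F) p = 1"
 shows "ord L W p = 1"
proof (rule ccontr)
 assume n: "ord L W p ~= 1"
 interpret W: dvr L W by fact
 interpret V: dvr F "W Int F" by fact
 have pL: "p : L" using p FL by auto
 have pm: "p : mx (W Int F)" using p by (auto simp: V.mx_eq pw_def)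
 then have "p : mx W" using mx_Int[OF W.vr sfF] by auto
 then have "W.nu p > 1" using n p by (auto simp: W.mx_eq pw_def)
 obtain r where r: "r : L" "r ~= 0" "W.nu r = 1" using W.unif by auto
 define y where "y = r / p"
 have y: "y : L" "y ~= 0" using r pL p sfL by (auto simp: y_def sfd_divide)
 have "y ~: W" using W.mem_iff[OF y] W.ord_divide[OF r(1) pL r(2) p(2)] r(3) `W.nu p > 1` by (simp add: y_def)
 \<comment> \<open>Large enough to outweigh the poles at \<open>W\<close> of the conjugates of
   \<open>r\<close>, so that the terms outside the decomposition group also fall into the maximal
   ideal.\<close>
 define k where "k = 1 + (SUM s:G. \<bar>W.nu (s r)\<bar>)"
 obtain x where x: "x : W" "ALL u:G. u ` W ~= W --> u x : pw L W k" "(SUM s:G. s (x * y)) ~: W"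
 using trace_pairing[OF W t y(1) `y ~: W`] by blast
 have xL: "x : L" using x vr_sub[OF W.vr] by auto
 have "s (x * r) : mx W" if s: "s : G" for s
 proof (cases "s ` W = W")
 case True
 have "r : pw L W 1" using r by (auto simp: pw_def)
 then have "s r : mx W" "s x : W" using pw_stable[OF s W True] x True by (auto simp: W.mx_eq)
 then show ?thesis using mx_mult[OF W.vr, of "s r" "s x"] rhom_mult[OF auts_rhom[OF s] xL r(1)] by (simp add: mult.commute)
 next
 case False
 have "k + W.nu (s r) >= 1" using member_le_sum[of s G "%s. \<bar>W.nu (s r)\<bar>"] s finG unfolding k_def by force
 moreover have "s r : pw L W (W.nu (s r))" using auts_in[OF s r(1)] by (auto simp: pw_def)
 with x(2) s False have "s x * s r : pw L W (k + W.nu (s r))" by (auto intro: W.pw_mult)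
 ultimately have "s x * s r : mx W" unfolding W.mx_eq using W.pw_mono by blast
 then show ?thesis using rhom_mult[OF auts_rhom[OF s] xL r(1)] by simp
 qed
 then have "(SUM s:G. s (x * r)) : mx W" by (rule mx_sum[OF W.vr])
 then have "(SUM s:G. s (x * r)) : mx (W Int F)"
 using mx_Int[OF W.vr sfF] trace_F[of "x * r"] xL r sfL by (auto simp: sfd_mult)
 then have a: "(SUM s:G. s (x * r)) : pw F (W Int F) 1" by (simp add: V.mx_eq)
 have "inverse p : pw F (W Int F) (-1)" using V.ord_inverse[OF p(1,2)] p sfF by (auto simp: pw_def sfd_inverse)
 from V.pw_mult[OF a this] have "(SUM s:G. s (x * r)) * inverse p : W" using V.pw_0_eq by auto
 also have "(SUM s:G. s (x * r)) * inverse p = (SUM s:G. s (x * y))"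
 proof -
 have "s (x * y) = s (x * r) * inverse p" if s: "s : G" for s
 proof -
  have "x * y = (x * r) * inverse p" by (simp add: y_def divide_inverse)
  moreover have "s ((x * r) * inverse p) = s (x * r) * s (inverse p)"
  using xL r pL sfL by (intro rhom_mult[OF auts_rhom[OF s]] sfd_mult sfd_inverse) auto
  ultimately show ?thesis using auts_fix[OF s, of "inverse p"] p sfF by (simp only: sfd_inverse)
 qed
 then show ?thesis by (simp add: sum_distrib_right)
 qed
 finally show False using x(3) by simp
qed

end

text \<open>Two iterated Frobenius powers of \<open>x\<close> share a representative, and additivity
  of Frobenius with primality of the maximal ideal cancels the smaller iterate.\<close>

lemma (in dvr) residue_power_fixed:
 assumes p: "prime CHAR('a)" and x: "x : W"
 shows "EX d>0. x ^ (CHAR('a) ^ d) - x : mx W"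
proof -
 obtain R where R: "finite R" "ALL x:W. EX r:R. x - r : mx W" using finres by blast
 let ?q = "%i. CHAR('a) ^ i"
 have "ALL i. EX r. r : R & x ^ ?q i - r : mx W" using R(2) vr_power[OF vr x] by blast
 from choice[OF this] obtain f where f: "!!i. f i : R & x ^ ?q i - f i : mx W" by blast
 have "~ inj f"
 proof
 assume "inj f"
 then have "infinite (range f)" by (rule range_inj_infinite)
 then show False using R(1) f by (meson finite_subset image_subsetI)
 qed
 then obtain i j where ij: "i < j" "f i = f j" by (metis injI linorder_neqE_nat)
 have "(x ^ ?q j - f j) - (x ^ ?q i - f i) : mx W" using mx_diff[OF vr conjunct2[OF f[of j]] conjunct2[OF f[of i]]] .
 then have e: "x ^ ?q j - x ^ ?q i : mx W" using ij by simp
 define d where "d = j - i"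
 have "x ^ ?q j = (x ^ ?q d) ^ ?q i" using ij by (simp add: d_def power_mult[symmetric] power_add[symmetric])
 moreover have "(x ^ ?q d - x) ^ ?q i + x ^ ?q i = (x ^ ?q d) ^ ?q i"
 using freshmans_dream'[OF p refl, of "x ^ ?q d - x" x i] by simp
 ultimately have "(x ^ ?q d - x) ^ ?q i : mx W" using e by (metis add_diff_cancel_right')
 moreover have "y : mx W" if "y : W" "y ^ n : mx W" for y n
 using that mx_1[OF vr] by (induction n) (auto dest!: mx_prime[OF vr that(1) vr_power[OF vr that(1)]])
 ultimately have "x ^ ?q d - x : mx W" using vr_diff[OF vr vr_power[OF vr x] x] by blast
 then show ?thesis using ij by (intro exI[of _ d]) (auto simp: d_def)
qed

context galois
begin

text \<open>Since \<open>x \<equiv> x\<^sup>Q\<close> modulo a uniformizer of \<open>F\<close>, the error \<open>s x - x\<close> gains a power in each step.\<close>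

lemma index_one_imp_tin:
 assumes c: "prime CHAR('a)" and W: "dvr L W" and p: "p : F" "p ~= 0" "ord L W p = 1"
 shows "tin F L W"
 unfolding tin_def
proof
 fix s assume s: "s : inert F L W"
 interpret W: dvr L W by fact
 note sG = inert_stable[OF W s]
 note r = auts_rhom[OF sG(1)]
 have WL: "W <= L" using vr_sub[OF W.vr] .
 have pL: "p : L" using p FL by auto
 have "s x - x : pw L W (int (Suc n))" if "x : W" for n x
 using that
 proof (induction n arbitrary: x)
 case 0
 then show ?case using s by (auto simp: inert_def W.mx_eq)
 next
 case (Suc n)
 obtain d where d: "d > 0" "x ^ (CHAR('a) ^ d) - x : mx W" using W.residue_power_fixed[OF c Suc.prems] by auto
 define q where "q = CHAR('a) ^ d"
 have q2: "q >= 2" using prime_ge_2_nat[OF c] d(1) self_le_power[of "CHAR('a)" d] unfolding q_def by linarith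
 define y where "y = (x ^ q - x) / p"
 have "x ^ q - x : pw L W 1" "inverse p : pw L W (-1)"
  using d W.ord_inverse[OF pL p(2)] p pL W.sfL by (auto simp: q_def W.mx_eq pw_def sfd_inverse)
 from W.pw_mult[OF this] have y: "y : W" by (simp add: y_def divide_inverse W.pw_0_eq[symmetric])
 have xL: "x : L" "y : L" "x ^ q : L" using Suc.prems y WL sfL by (auto simp: sfd_power)
 have xe: "x = x ^ q - p * y" using p by (simp add: y_def)
 have "s x = s x ^ q - p * s y"
  using rhom_diff[OF r sfL xL(3), of "p * y"] rhom_power[OF r sfL xL(1)] rhom_mult[OF r pL xL(2)]
  auts_fix[OF sG(1) p(1)] sfd_mult[OF sfL pL xL(2)] xe by metis
 then have "s x - x = (s x ^ q - x ^ q) - p * (s y - y)" using xe by (simp add: algebra_simps)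
 moreover have "s x ^ q - x ^ q = (s x - x) ^ q"
  using freshmans_dream'[OF c refl, of "s x - x" x d] by (simp add: q_def algebra_simps)
 moreover have "(s x - x) ^ q : pw L W (int (Suc (Suc n)))"
 proof (cases "s x - x = 0")
  case False
  have IH: "s x - x : pw L W (int (Suc n))" using Suc.IH Suc.prems by blast
  then have v: "W.nu (s x - x) >= int (Suc n)" and L: "s x - x : L" using False by (auto simp: pw_def)
  have "int q * W.nu (s x - x) >= 2 * int (Suc n)" using q2 v by (intro mult_mono) auto
  moreover have "2 * int (Suc n) >= int (Suc (Suc n))" by simp
  ultimately have "int q * W.nu (s x - x) >= int (Suc (Suc n))" by (rule order_trans[rotated])
  then show ?thesis using W.ord_power[OF L False, of q] sfd_power[OF sfL L] by (simp add: pw_def)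
 qed (use q2 in "auto simp: power_0_left")
 moreover have "p * (s y - y) : pw L W (int (Suc (Suc n)))"
 proof -
  have "p : pw L W 1" using p pL by (auto simp: pw_def)
  from W.pw_mult[OF this Suc.IH[OF y]] show ?thesis by (simp add: add.commute)
 qed
 ultimately show ?case using W.pw_diff by metis
 qed
 note err = this
 have "s x - x : pw L W n" if "x : W" for x n
 proof -
 have "n <= int (Suc (nat n))" by simp
 from subsetD[OF W.pw_mono[OF this] err[OF that]] show ?thesis .
 qed
 then have sx: "s x = x" if "x : W" for x using W.pw_Inter[of "s x - x"] that by simp
 have "s x = x" if x: "x : L" for x
 proof (cases "x : W")
 case False
 then have "x ~= 0" "inverse x : W" using vr_dich[OF W.vr x] vr_0[OF W.vr] by auto
 then have "inverse (s x) = inverse x" using sx rhom_inverse[OF r sfL x] by metis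
 then show ?thesis by simp
 qed (rule sx)
 then show "s : {\<lambda>x\<in>L. x}" using auts_eqI[OF sG(1) G_id] by auto
qed

text \<open>Any lift of \<open>s\<close> moves \<open>W\<close> to a ring with the same intersection
  with \<open>M\<close>; conjugacy over \<open>M\<close> corrects it without changing its
  restriction.\<close>

lemma dec_lift:
 assumes M: "galois F M" "M <= L" and W: "dvr L W" and V: "dvr M (W Int M)" and s: "s : auts F M" "s ` (W Int M) = W Int M"
 shows "EX t:G. t ` W = W & s = restrict t M"
proof -
 interpret M: galois F M by fact
 interpret LM: galois M L by (rule galois_upper[OF M.sfL M.FL M(2)])
 have WL: "W <= L" using vr_sub[OF dvr.vr[OF W]] .
 obtain g where g: "g : G" "s = restrict g M" using restrict_auts_galois[OF M] s by auto
 have gM: "g ` M = M" using s g M.FL auts_image[OF s(1)] by auto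
 have "g ` W Int M = g ` (W Int M)"
 proof -
 have "g ` (W Int M) = g ` W Int g ` M"
  by (rule inj_on_image_Int[OF rhom_inj[OF auts_rhom[OF g(1)] sfL] WL M(2)])
 then show ?thesis using gM by simp
 qed
 also have "... = s ` (W Int M)" using g(2) by auto
 finally have "g ` W Int M = W Int M" using s(2) by simp
 then obtain h where h: "h : auts M L" "h ` g ` W = W"
 using LM.primes_conjugate[OF dvr_image(1)[OF g(1) W] W] by auto
 have hG: "h : G" using h auts_M[OF M.FL] by auto
 have "compose L h g ` W = h ` g ` W" using WL by (simp add: compose_image)
 moreover have "s = restrict (compose L h g) M"
 proof (rule extensionalityI[of _ M])
 fix x assume x: "x : M"
 then have "g x : M" using gM by auto
 then show "s x = restrict (compose L h g) M x"
  using g(2) x M(2) auts_fix[OF h(1), of "g x"] by (simp add: compose_eq subset_iff)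
 qed (use g(2) in auto)
 ultimately show ?thesis using auts_compose[OF hG g(1) FL sfL] h(2) by (intro bexI[of _ "compose L h g"]) auto
qed

lemma tdec_lower:
 assumes "galois F M" "M <= L" "dvr L W" "dvr M (W Int M)" "tdec F L W" shows "tdec F M (W Int M)"
 unfolding tdec_def
proof (intro ballI impI)
 fix s assume "s : auts F M" "s ` (W Int M) = W Int M"
 from dec_lift[OF assms(1-4) this] obtain t where "t : G" "t ` W = W" "s = restrict t M" by auto
 then show "s = (\<lambda>x\<in>M. x)" using assms(2,5) unfolding tdec_def
 by (intro extensionalityI[of _ M]) (auto simp: subset_iff)
qed

text \<open>The argument goes through uniformizers: an element of \<open>F\<close> of value one
  above \<open>M\<close> must have value one on \<open>M\<close> too, since values can only grow
  under extension.\<close>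

lemma tin_lower:
 assumes c: "prime CHAR('a)" and M: "galois F M" "M <= L" and W: "dvr L W" "dvr M (W Int M)" "dvr F (W Int F)"
 and t: "tin F L W"
 shows "tin F M (W Int M)"
proof -
 interpret M: galois F M by fact
 interpret W: dvr L W by fact
 interpret WM: dvr M "W Int M" by fact
 obtain p where p: "p : F" "p ~= 0" "ord F (W Int F) p = 1" using dvr.unif[OF W(3)] by auto
 have o1: "W.nu p = 1" by (rule tin_imp_index_one[OF W(1,3) t p])
 have pM: "p : M" "p : L" using p M.FL FL by auto
 have "p : mx (W Int M)" using o1 pM mx_Int[OF W.vr M.sfL] by (auto simp: W.mx_eq pw_def)
 then have ge: "WM.nu p >= 1" using p by (auto simp: WM.mx_eq pw_def)
 moreover have "WM.nu p <= 1"
 proof (rule ccontr)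
 assume n: "~ WM.nu p <= 1"
 obtain r where r: "r : M" "r ~= 0" "WM.nu r = 1" using WM.unif by auto
 have rL: "r : L" using r M(2) by auto
 have "p / r : M" "p / r ~= 0" using p r pM M.sfL by (auto simp: sfd_divide)
 then have "p / r : mx (W Int M)" "r : mx (W Int M)"
  using n WM.ord_divide[OF pM(1) r(1) p(2) r(2)] r by (auto simp: WM.mx_eq pw_def)
 then have "p / r : pw L W 1" "r : pw L W 1" using mx_Int[OF W.vr M.sfL] by (auto simp: W.mx_eq)
 from W.pw_mult[OF this] have "p : pw L W 2" using r by simp
 then show False using o1 p by (auto simp: pw_def)
 qed
 ultimately have "WM.nu p = 1" by simp
 from M.index_one_imp_tin[OF c W(2) p(1,2) this] show ?thesis .
qed

lemma tdec_upper: "tdec F L W ==> F <= M ==> tdec M L W"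
 unfolding tdec_def auts_M by auto

lemma inert_restrict:
 assumes "galois F M" "M <= L" "vr L W" "s : inert F L W" shows "restrict s M : inert F M (W Int M)"
proof -
 interpret M: galois F M by fact
 have s: "s : G" "!!x. x : W ==> s x - x : mx W" using assms by (auto simp: inert_def)
 have r: "restrict s M : auts F M" using restrict_auts_galois[OF assms(1,2)] s by blast
 have "restrict s M x - x : mx (W Int M)" if x: "x : W Int M" for x
 using s(2)[of x] x auts_in[OF r, of x] M.sfL mx_Int[OF assms(3) M.sfL] by (auto simp: sfd_diff)
 then show ?thesis using r by (auto simp: inert_def)
qed

lemma dec_restrict:
 assumes "galois F M" "M <= L" "W <= L" "s : G" "s ` W = W"
 shows "restrict s M : auts F M" "restrict s M ` (W Int M) = W Int M"
proof -
 show r: "restrict s M : auts F M" using restrict_auts_galois[OF assms(1,2)] assms(4) by blast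
 have "s ` M = M" using auts_image[OF r] by auto
 moreover have "s ` (W Int M) = s ` W Int s ` M"
 by (rule inj_on_image_Int[OF rhom_inj[OF auts_rhom[OF assms(4)] sfL] assms(3,2)])
 ultimately show "restrict s M ` (W Int M) = W Int M" using assms(5) by auto
qed

end

text \<open>An inertial automorphism of \<open>Z\<close> lifts to some \<open>t\<close> in the
  decomposition group of \<open>W\<close>. It fixes modulo the maximal ideal the coefficients of the
  orbit polynomial of \<open>x\<close> under inertia, so \<open>t x\<close> is congruent to some
  \<open>i x\<close> with \<open>i\<close> inertial, hence to \<open>x\<close>. Thus
  \<open>t\<close> is inertial and trivial on \<open>Z\<close>.\<close>

lemma (in abel) inert_fixed_field_tin:
 assumes W: "dvr L W"
 defines "Z == Fix L (inert F L W)"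
 assumes V: "dvr Z (W Int Z)"
 shows "tin F Z (W Int Z)"
 unfolding tin_def
proof
 fix s assume s: "s : inert F Z (W Int Z)"
 interpret W: dvr L W by fact
 have ag: "agrp L (inert F L W)" by (rule inert_agrp[OF W])
 have sZ: "sfd Z" unfolding Z_def using Fix_sfd[OF sfL, of "inert F L W" F] by (auto simp: inert_def)
 have FZ: "F <= Z" "Z <= L" using FL auts_fix by (auto simp: Z_def Fix_def inert_def)
 interpret Z: abel F Z by (rule abel_lower(1)[OF sZ FZ])
 note st = Z.inert_stable[OF V s]
 obtain t where t: "t : G" "t ` W = W" "s = restrict t Z"
 using dec_lift[OF Z.galois_axioms FZ(2) W V st] by auto
 note r = auts_rhom[OF t(1)]
 have WL: "W <= L" using vr_sub[OF W.vr] .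
 have fin: "finite (inert F L W)" using ag by (auto simp: agrp_def)
 have "t x - x : mx W" if x: "x : W" for x
 proof -
 have xL: "x : L" using x WL by auto
 interpret LZ: galois Z L by (rule galois_upper[OF sZ FZ])
 have aZ: "auts Z L = inert F L W" unfolding Z_def by (rule artin_auts[OF ag sfL])
 let ?f = "PROD b:(%s. s x) ` inert F L W. [:- b, 1:]"
 have fZ: "?f : polys Z" using LZ.linear_prod_orbit_polys[OF xL] aZ by simp
 have iW: "i x : W" if "i : inert F L W" for i using inert_stable(2)[OF W that] x by auto
 have fW: "?f : polys W"
 proof -
  have "finite A ==> A <= W ==> (PROD b:A. [:- b, 1:]) : polys W" for A
  proof (induction A rule: finite_induct)
  case empty
  then show ?case using vr_1[OF W.vr] vr_0[OF W.vr] by (auto simp: polys_def coeff_1)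
  next
  case (insert b A)
  then show ?case using vr_0[OF W.vr] vr_minus[OF W.vr] vr_add[OF W.vr] vr_mult[OF W.vr] vr_diff[OF W.vr]
   by (auto simp: polys_def coeff_pCons split: nat.splits)
  qed
  from this[of "(%s. s x) ` inert F L W"] show ?thesis using iW fin by blast
 qed
 have cf: "t (coeff ?f i) - coeff ?f i : mx W" for i
 proof -
  have "coeff ?f i : W Int Z" using fZ fW by (auto simp: polys_def)
  then have "s (coeff ?f i) - coeff ?f i : mx (W Int Z)" using s by (auto simp: inert_def)
  then show ?thesis using mx_Int[OF W.vr sZ] t(3) \<open>coeff ?f i : W Int Z\<close> by auto
 qed
 have x0: "poly ?f x = 0"
 proof -
  have "(\<lambda>x\<in>L. x) : inert F L W" using ag by (simp add: agrp_def)
  then have "x : (%s. s x) ` inert F L W" using xL by (intro rev_image_eqI[of "\<lambda>x\<in>L. x"]) auto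
  then show ?thesis using fin by (simp add: poly_linear_prod_0)
 qed
 have txW: "t x : W" using t x by auto
 have "poly (map_poly t ?f) (t x) = t (poly ?f x)"
  using fZ polys_mono[OF FZ(2)] xL by (intro poly_map_poly[OF r sfL]) auto
 also have "... = 0" using x0 rhom_0[OF r sfL] by simp
 finally have "poly ?f (t x) = poly (?f - map_poly t ?f) (t x)" by simp
 also have "... : mx W"
  unfolding poly_altdef using txW cf mx_minus[OF W.vr cf] rhom_0[OF r sfL]
  by (intro mx_sum[OF W.vr] mx_mult[OF W.vr] vr_power[OF W.vr]) (auto simp: coeff_map_poly)
 finally have "(PROD b:(%s. s x) ` inert F L W. t x - b) : mx W" by (simp add: poly_prod)
 then obtain i where i: "i : inert F L W" "t x - i x : mx W"
  using mx_prod_notin[OF W.vr, of "(%s. s x) ` inert F L W" "%b. t x - b"] vr_diff[OF W.vr txW iW] by auto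
 have "i x - x : mx W" using i x by (auto simp: inert_def)
 from mx_add[OF W.vr i(2) this] show ?thesis by simp
 qed
 then have "t : inert F L W" using t by (auto simp: inert_def)
 then have "t x = x" if "x : Z" for x using that by (auto simp: Z_def Fix_def)
 then show "s : {\<lambda>x\<in>Z. x}" using t(3) by (auto simp: restrict_def fun_eq_iff)
qed

text \<open>With \<open>Z\<close> the inertia field of \<open>W\<close>, the intersection of
  \<open>M\<close> and \<open>Z\<close> is unramified over \<open>F\<close>, so \<open>s\<close>
  fixes it. The inertia group restricted to \<open>M\<close> has exactly this fixed field, so by
  Artin's theorem it contains \<open>s\<close>.\<close>

lemma (in abel) inert_lift:
 assumes c: "prime CHAR('a)" and M: "sfd M" "F <= M" "M <= L" and W: "dvr L W" "dvr F (W Int F)"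
 and s: "s : inert F M (W Int M)"
 shows "EX t:inert F L W. s = restrict t M"
proof -
 interpret W: dvr L W by fact
 define Z where "Z = Fix L (inert F L W)"
 have ag: "agrp L (inert F L W)" by (rule inert_agrp[OF W(1)])
 have sZ: "sfd Z" unfolding Z_def using Fix_sfd[OF sfL, of "inert F L W" F] by (auto simp: inert_def)
 have FZ: "F <= Z" "Z <= L" using FL auts_fix by (auto simp: Z_def Fix_def inert_def)
 interpret Z: abel F Z by (rule abel_lower(1)[OF sZ FZ])
 interpret M: abel F M by (rule abel_lower(1)[OF M])
 have dv: "dvr N (W Int N)" if N: "galois F N" "N <= L" for N
 proof -
 interpret N: galois F N by fact
 have "W Int N Int F = W Int F" using N.FL by auto
 moreover have "~ N <= W"
 proof
  assume "N <= W"
  then have "W Int F = F" using N.FL by auto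
  then show False using dvr.vr[OF W(2)] by (simp add: vr_def)
 qed
 ultimately show ?thesis using N.dvr_above[of "W Int N"] W(2) vr_Int[OF W.vr N.sfL N(2)] by simp
 qed
 have dZ: "dvr Z (W Int Z)" by (rule dv[OF Z.galois_axioms FZ(2)])
 have tZ: "tin F Z (W Int Z)" unfolding Z_def
 by (rule inert_fixed_field_tin[OF W(1)]) (use dZ in "simp add: Z_def")
 define N where "N = M Int Z"
 have N: "sfd N" "F <= N" "N <= M" "N <= Z" using M FZ sfd_Int[OF M(1) sZ] by (auto simp: N_def)
 interpret N: abel F N by (rule M.abel_lower(1)[OF N(1-3)])
 have "W Int Z Int N = W Int N" "W Int Z Int F = W Int F" "W Int M Int N = W Int N" using N FZ by auto
 then have tN: "tin F N (W Int N)"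
 using Z.tin_lower[OF c N.galois_axioms N(4) dZ _ _ tZ] dv[OF N.galois_axioms] N FZ W(2) by auto
 have dM: "dvr M (W Int M)" by (rule dv[OF M.galois_axioms M(3)])
 have "restrict s N : inert F N (W Int N)"
 using M.inert_restrict[OF N.galois_axioms N(3) dvr.vr[OF dM] s] `W Int M Int N = W Int N` by simp
 then have "restrict s N = (\<lambda>x\<in>N. x)" using tN by (auto simp: tin_def)
 then have sN: "s x = x" if "x : N" for x using that by (metis restrict_apply')
 define H where "H = (%t. restrict t M) ` inert F L W"
 have HM: "restrict t M : auts F M" if "t : inert F L W" for t
 using that abel_lower(2)[OF M] by (auto simp: inert_def)
 have agH: "agrp M H"
 unfolding agrp_def
 proof (intro conjI ballI)
 show "H <= auts {} M" using HM auts_mono[of "{}" F M] by (auto simp: H_def)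
 show "finite H" using ag by (auto simp: H_def agrp_def)
 have "restrict (\<lambda>x\<in>L. x) M = (\<lambda>x\<in>M. x)" using M by (auto simp: restrict_def fun_eq_iff)
 then show "(\<lambda>x\<in>M. x) : H" using ag unfolding H_def agrp_def by (metis imageI)
 fix a b assume "a : H" "b : H"
 then obtain u v where uv: "u : inert F L W" "v : inert F L W" "a = restrict u M" "b = restrict v M"
  by (auto simp: H_def)
 have "v x : M" if "x : M" for x using auts_in[OF HM[OF uv(2)] that] that by simp
 then have "compose M a b = restrict (compose L u v) M"
  using uv M by (intro extensionalityI[of _ M]) (auto simp: compose_eq)
 moreover have "compose L u v : inert F L W" using ag uv by (auto simp: agrp_def)
 ultimately show "compose M a b : H" by (auto simp: H_def)
 qed
 have "Fix M H = N" using M by (auto simp: Fix_def H_def N_def Z_def)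
 then have "auts N M = H" using artin_auts[OF agH M(1)] by simp
 moreover have "s : auts N M" using s sN by (auto simp: inert_def auts_def)
 ultimately show ?thesis by (auto simp: H_def)
qed

section \<open>Primes of the rational function field\<close>

definition units :: "'a::field set => 'a set" where
 "units V = {u : V. u ~= 0 & inverse u : V}"

text \<open>The exponent is unique because a power of \<open>p\<close> lies in \<open>V\<close> only
  when its exponent is nonnegative.\<close>

lemma dval_of_uniformizer:
 assumes V: "vr L V" and p: "p : mx V" "p ~= 0"
 and dec: "!!x. x : L ==> x ~= 0 ==> EX n. x * p powi n : units V"
 shows "EX v. dval L V v"
proof -
 have um: "a * b : units V" "inverse a : units V" if "a : units V" "b : units V" for a b
 using that vr_mult[OF V] by (auto simp: units_def)
 have pn: "p powi n : V \<longleftrightarrow> 0 <= n" for n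
 proof
 assume n: "0 <= n"
 then show "p powi n : V" using vr_power[OF V mx_sub[OF p(1)]] by (simp add: power_int_def)
 next
 assume a: "p powi n : V"
 show "0 <= n"
 proof (rule ccontr)
  assume "~ 0 <= n"
  then have "p powi (- n - 1) : V" using vr_power[OF V mx_sub[OF p(1)]] by (simp add: power_int_def)
  from vr_mult[OF V this a] have "p powi (- 1) : V" using p(2) by (simp flip: power_int_add)
  then show False using p by (simp add: mx_def power_int_minus)
 qed
 qed
 define v where "v x = (THE n. x * p powi (- n) : units V)" for x
 have uniq: "m = n" if x: "x * p powi (- n) : units V" "x * p powi (- m) : units V" for x m n
 proof -
 have le: "m <= n" if "x * p powi (- n) : units V" "x * p powi (- m) : units V" for m n
 proof -
  have "x * p powi (- m) * inverse (x * p powi (- n)) = p powi (n - m)"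
  using that p(2) by (simp add: units_def power_int_minus power_int_diff field_simps)
  then show ?thesis using um(1)[OF that(2) um(2)[OF that(1,1)]] pn[of "n - m"] by (simp add: units_def)
 qed
 show ?thesis using le[OF x] le[OF x(2,1)] by simp
 qed
 have vI: "v x = n" if "x * p powi (- n) : units V" for x n
 unfolding v_def by (rule the_equality) (use that uniq in blast)+
 have v: "x * p powi (- v x) : units V" if x: "x : L" "x ~= 0" for x
 proof -
 obtain n where "x * p powi n : units V" using dec[OF x] by blast
 then show ?thesis using vI[of x "- n"] by simp
 qed
 have "dval L V v" unfolding dval_def
 proof (intro conjI ballI impI)
 fix x y assume "x : L" "y : L" "x ~= 0" "y ~= 0"
 then have "(x * p powi (- v x)) * (y * p powi (- v y)) : units V" by (intro um v)
 moreover have "(x * p powi (- v x)) * (y * p powi (- v y)) = x * y * p powi (- (v x + v y))"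
  using p(2) by (simp add: power_int_add mult_ac flip: power_int_add)
 ultimately show "v (x * y) = v x + v y" by (intro vI) simp
 next
 fix x assume x: "x : L" "x ~= 0"
 define u where "u = x * p powi (- v x)"
 have u: "u : V" "inverse u : V" "u ~= 0" using v[OF x] by (auto simp: u_def units_def)
 have e: "u * p powi v x = x" using p(2) by (simp add: u_def power_int_minus)
 then have e': "inverse u * x = p powi v x" using u(3) by (metis left_inverse mult.assoc mult.left_neutral)
 show "x : V \<longleftrightarrow> 0 <= v x"
  using vr_mult[OF V u(1), of "p powi v x"] vr_mult[OF V u(2), of x] pn[of "v x"] unfolding e e' by blast
 next
 have "v p = 1" using vI[of p 1] p(2) vr_1[OF V] by (simp add: units_def power_int_minus)
 then show "EX p:L. p ~= 0 & v p = 1" using mx_sub[OF p(1)] vr_sub[OF V] p(2) by (intro bexI[of _ p]) auto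
 qed
 then show ?thesis by blast
qed

section \<open>Constants, evaluation of polynomials, and the two coordinates of the projective
  line\<close>

abbreviation k0 :: "('q::{field,finite}) ratfun_ac set" where "k0 == base_field"

lemma const_simps [simp]:
 "const 0 = 0" "const 1 = 1" "const (a + b) = const a + const b" "const (a * b) = const a * const b"
 "const (- a) = - const a" "const a = 0 \<longleftrightarrow> a = 0" "const a = const b \<longleftrightarrow> a = b"
proof -
 show "const 0 = 0" by (simp add: const_def Zero_fract_def[symmetric])
 show "const 1 = 1" by (simp add: const_def One_fract_def[symmetric] flip: one_pCons)
 show "const (a + b) = const a + const b" "const (a * b) = const a * const b" "const (- a) = - const a"
 by (simp_all add: const_def mult.commute flip: to_ac_add to_ac_mult to_ac_minus)
 show "const a = 0 \<longleftrightarrow> a = 0" by (simp add: const_def Zero_fract_def eq_fract)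
 show "const a = const b \<longleftrightarrow> a = b" by (simp add: const_def eq_fract)
qed

lemma const_inverse: "const (inverse a) = inverse (const a)"
proof (cases "a = 0")
 case False
 then have "const a * const (inverse a) = 1" by (simp flip: const_simps(4))
 then show ?thesis by (simp add: inverse_unique)
qed simp

lemma const_power: "const (a ^ n) = const a ^ n" by (induction n) auto

definition ev :: "('q::{field,finite}) ratfun_ac => 'q poly => 'q ratfun_ac" where
 "ev t f = poly (map_poly const f) t"

lemma ev_pCons: "ev t (pCons a p) = const a + t * ev t p"
 by (simp add: ev_def map_poly_pCons)

lemma ev_0 [simp]: "ev t 0 = 0" and ev_1 [simp]: "ev t 1 = 1"
 by (simp_all add: ev_def map_poly_1)

lemma ev_add: "ev t (p + q) = ev t p + ev t q"
 by (induction p q rule: poly_induct2) (auto simp: ev_pCons algebra_simps)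

lemma ev_smult: "ev t (smult c p) = const c * ev t p"
 by (induction p) (auto simp: ev_pCons algebra_simps)

lemma ev_mult: "ev t (p * q) = ev t p * ev t q"
 by (induction p) (auto simp: ev_pCons ev_add ev_smult algebra_simps)

lemma ev_minus: "ev t (- p) = - ev t p" 
 using ev_add[of t p "- p"] by (simp add: minus_unique)

lemma ev_diff: "ev t (p - q) = ev t p - ev t q" 
 using ev_add[of t p "- q"] by (simp add: ev_minus)

lemma ev_power: "ev t (p ^ n) = ev t p ^ n" by (induction n) (auto simp: ev_mult)

lemma ev_altdef: "ev t f = (SUM i<=degree f. const (coeff f i) * t ^ i)"
proof -
 have "degree (map_poly const f) = degree f" by (intro degree_map_poly) simp
 then show ?thesis by (simp add: ev_def poly_altdef coeff_map_poly)
qed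

lemma ev_T: "ev T f = to_ac (Fract f 1)"
proof (induction f)
 case (pCons a p)
 have "Fract (pCons a p) 1 = Fract [:a:] 1 + Fract [:0, 1:] 1 * Fract p 1" by simp
 then show ?case using pCons by (simp only: ev_pCons const_def T_def to_ac_add to_ac_mult)
qed (simp add: Zero_fract_def[symmetric])

lemma base_field_eq: "k0 = {ev T a / ev T b | a b. b ~= 0}"
proof (intro subset_antisym subsetI)
 fix x :: "'a ratfun_ac" assume "x : k0"
 then obtain y where y: "x = to_ac y" by (auto simp: base_field_def)
 obtain a b where ab: "y = Fract a b" "b ~= 0" by (cases y) auto
 then have "y = Fract a 1 / Fract b 1" by simp
 then have "x = ev T a / ev T b" using y by (simp only: ev_T to_ac_divide)
 then show "x : {ev T a / ev T b | a b. b ~= 0}" using ab by blast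
next
 fix x :: "'a ratfun_ac" assume "x : {ev T a / ev T b | a b. b ~= 0}"
 then show "x : k0" by (auto simp: base_field_def ev_T simp flip: to_ac_divide)
qed

lemma sfd_base: "sfd k0"
proof -
 have "to_ac x + to_ac y : range to_ac" "to_ac x * to_ac y : range to_ac" "- to_ac x : range to_ac"
 "inverse (to_ac x) : range to_ac" for x y :: "'a poly fract"
 by (metis rangeI to_ac_add, metis rangeI to_ac_mult, metis rangeI to_ac_minus, metis rangeI to_ac_inverse)
 moreover have "0 : range (to_ac :: 'a poly fract => _)" "1 : range (to_ac :: 'a poly fract => _)"
 by (metis rangeI to_ac_0, metis rangeI to_ac_1)
 ultimately show ?thesis unfolding sfd_def base_field_def by blast
qed

lemma const_base: "range const <= k0" and T_base: "T : k0"
 by (auto simp: const_def T_def base_field_def)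

lemma ev_T_eq_0 [simp]: "ev T f = 0 \<longleftrightarrow> f = 0"
 by (simp add: ev_T Zero_fract_def eq_fract)

lemma T_nonzero [simp]: "T ~= 0"
 using ev_T_eq_0[of "[:0,1:]"] by (simp add: ev_pCons)

text \<open>Reversal of \<open>f\<close> viewed in formal degree \<open>n\<close>; it rewrites
  polynomials in \<open>t\<close> as polynomials in \<open>inverse t\<close>, up to a power of
  \<open>t\<close>.\<close>

definition flip_poly :: "nat => 'a::field poly => 'a poly" where
 "flip_poly n f = (SUM i<=n. monom (coeff f i) (n - i))"

lemma flip_poly_nonzero: assumes "f ~= 0" "degree f <= n" shows "flip_poly n f ~= 0"
proof -
 have "coeff (flip_poly n f) (n - degree f) = (SUM i<=n. if i = degree f then coeff f i else 0)"
 unfolding flip_poly_def coeff_sum using assms(2) by (intro sum.cong) auto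
 also have "... = lead_coeff f" using assms(2) by simp
 finally show ?thesis using assms(1) by auto
qed

lemma ev_monom: "ev t (monom c i) = const c * t ^ i"
 by (induction i) (auto simp: monom_0 monom_Suc ev_pCons)

lemma ev_sum: "ev t (sum g A) = (SUM i:A. ev t (g i))"
 by (induction A rule: infinite_finite_induct) (auto simp: ev_add)

lemma ev_flip: assumes "t ~= 0" "degree f <= n" shows "ev t f = ev (inverse t) (flip_poly n f) * t ^ n"
proof -
 have "ev t f = (SUM i<=n. const (coeff f i) * t ^ i)"
 unfolding ev_altdef using assms(2) by (intro sum.mono_neutral_left) (auto simp: coeff_eq_0)
 also have "... = ev (inverse t) (flip_poly n f) * t ^ n"
 unfolding flip_poly_def ev_sum ev_monom sum_distrib_right
 by (intro sum.cong) (use assms(1) in "auto simp: power_diff power_inverse field_simps")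
 finally show ?thesis .
qed

lemma ev_inverse_T_eq_0 [simp]: "ev (inverse T) f = 0 \<longleftrightarrow> f = 0"
 using ev_flip[of "inverse T" f "degree f"] flip_poly_nonzero[of f "degree f"] by auto

lemma base_field_eq_inverse: "k0 = {ev (inverse T) a / ev (inverse T) b | a b. b ~= 0}"
proof (intro subset_antisym subsetI)
 let ?t = "inverse T"
 fix x :: "'a ratfun_ac" assume "x : k0"
 then obtain a b where ab: "x = ev T a / ev T b" "b ~= 0" by (auto simp: base_field_eq)
 have pw: "EX h n. h ~= 0 & ev T f = ev ?t h * T ^ n" if "f ~= 0" for f :: "'a poly"
 using ev_flip[of T f "degree f"] flip_poly_nonzero[OF that order_refl] by auto
 show "x : {ev ?t a / ev ?t b | a b. b ~= 0}"
 proof (cases "a = 0")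
 case True
 then have "x = ev ?t 0 / ev ?t 1" using ab by simp
 then show ?thesis using one_neq_zero by blast
 next
 case False
 obtain h n g m where hg: "h ~= 0" "ev T a = ev ?t h * T ^ n" "g ~= 0" "ev T b = ev ?t g * T ^ m"
  using pw[OF False] pw[OF ab(2)] by auto
 have tm: "ev ?t (f * [:0,1:] ^ i) = ev ?t f * ?t ^ i" for f i
  by (simp add: ev_mult ev_power ev_pCons)
 have "x = ev ?t (h * [:0,1:] ^ m) / ev ?t (g * [:0,1:] ^ n)"
  unfolding ab(1) hg tm by (simp add: power_inverse field_simps)
 moreover have "g * [:0,1:] ^ n ~= 0" using hg by simp
 ultimately show ?thesis by blast
 qed
next
 let ?t = "inverse T"
 fix x :: "'a ratfun_ac" assume "x : {ev ?t a / ev ?t b | a b. b ~= 0}"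
 moreover have "ev ?t f : k0" for f
 unfolding ev_altdef using const_base T_base by (intro sfd_sum[OF sfd_base] sfd_mult[OF sfd_base] sfd_power[OF sfd_base] sfd_inverse[OF sfd_base]) auto
 ultimately show "x : k0" using sfd_divide[OF sfd_base] by blast
qed

text \<open>The two affine coordinates. Every prime contains at least one of them, so infinity is
  treated like the zero of the other coordinate.\<close>

definition param :: "('q::{field,finite}) ratfun_ac => bool" where
 "param t \<longleftrightarrow> t = T | t = inverse T"

lemma param_base: assumes "param t" "x : k0" shows "EX a b. b ~= 0 & x = ev t a / ev t b"
proof -
 have "x : {ev t a / ev t b | a b. b ~= 0}"
 using assms base_field_eq base_field_eq_inverse by (auto simp: param_def)
 then show ?thesis by blast
qed

lemma param_ev_0: "param t ==> ev t f = 0 \<longleftrightarrow> f = 0"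
 by (auto simp: param_def)

lemma param_nonzero: "param t ==> t ~= 0"
 by (auto simp: param_def)

lemma param_in_base: "param t ==> t : k0"
 using T_base sfd_inverse[OF sfd_base T_base] by (auto simp: param_def)

lemma finite_polys_degree: "finite {g :: 'q::{field,finite} poly. degree g <= n}"
proof (rule finite_subset)
 show "{g. degree g <= n} <= Poly ` {xs :: 'q list. set xs <= UNIV & length xs <= Suc n}"
 by (auto intro!: rev_image_eqI[of "coeffs _"] simp: length_coeffs_degree Poly_coeffs) 
  (metis Poly_coeffs coeffs_eq_Nil imageI length_coeffs_degree list.size(3) mem_Collect_eq not_less_eq_eq le0 Suc_le_mono)
 show "finite (Poly ` {xs :: 'q list. set xs <= UNIV & length xs <= Suc n})"
 by (intro finite_imageI finite_lists_length_le) simp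
qed

context
 fixes V :: "('q::{field,finite}) ratfun_ac set" and t
 assumes V: "vr k0 V" and cV: "range const <= V" and t: "param t" and tV: "t : V"
begin

lemma ev_in: "ev t f : V"
 unfolding ev_altdef using cV tV by (intro vr_sum[OF V] vr_mult[OF V] vr_power[OF V]) auto

lemma const_not_mx: "c ~= 0 ==> const c ~: mx V"
 using cV by (auto simp: mx_def subset_iff simp flip: const_inverse)

text \<open>The polynomials in the maximal ideal form an ideal, nonzero since \<open>V\<close> is
  not all of \<open>k0\<close>; an element of least degree generates it.\<close>

lemma prime_poly_ex: "EX P. P ~= 0 & (ALL f. ev t f : mx V \<longleftrightarrow> P dvd f)"
proof -
 obtain x where x: "x : k0" "x ~: V" using V by (auto simp: vr_def)
 obtain a b where ab: "b ~= 0" "x = ev t a / ev t b" using param_base[OF t x(1)] by auto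
 have "ev t b : mx V"
 proof (rule ccontr)
 assume "ev t b ~: mx V"
 then have "inverse (ev t b) : V" using mx_unit[OF ev_in] by auto
 then show False using x ab vr_mult[OF V ev_in] by (auto simp: divide_inverse)
 qed
 then obtain P where P: "P ~= 0" "ev t P : mx V" "!!f. f ~= 0 ==> ev t f : mx V ==> degree P <= degree f"
 using ab ex_has_least_nat[of "%f. f ~= 0 & ev t f : mx V" b degree] by blast
 have "ev t f : mx V \<longleftrightarrow> P dvd f" for f
 proof
 assume "P dvd f"
 then show "ev t f : mx V" using mx_mult[OF V P(2) ev_in] by (auto simp: ev_mult elim!: dvdE)
 next
 assume f: "ev t f : mx V"
 have "f mod P = f - P * (f div P)" by (simp add: minus_mult_div_eq_mod)
 then have "ev t (f mod P) = ev t f - ev t P * ev t (f div P)" by (simp add: ev_diff ev_mult)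
 then have "ev t (f mod P) : mx V" using mx_diff[OF V f mx_mult[OF V P(2) ev_in]] by simp
 then have "f mod P = 0" using P(3)[of "f mod P"] degree_mod_less[OF P(1), of f] by fastforce
 then show "P dvd f" by (simp add: dvd_eq_mod_eq_0)
 qed
 then show ?thesis using P(1) by blast
qed

text \<open>\<open>V\<close> is the localisation of the polynomials in \<open>t\<close> at
  \<open>P\<close>: powers of \<open>P\<close> can be split off from numerator and denominator, and
  remainders modulo \<open>P\<close> represent the residue field.\<close>

lemma base_vr_props:
 "dvr k0 V" "EX P. P ~= 0 & (ALL f. ev t f : mx V \<longleftrightarrow> P dvd f) & V = {ev t a / ev t b | a b. ~ P dvd b}"
proof -
 obtain P where P: "P ~= 0" "!!f. ev t f : mx V \<longleftrightarrow> P dvd f" using prime_poly_ex by blast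
 have unit: "inverse (ev t f) : V" "ev t f ~= 0" if "~ P dvd f" for f
 using mx_unit[OF ev_in, of f] P(2) that by auto
 have dP: "degree P > 0"
 proof (rule ccontr)
 assume "~ degree P > 0"
 then obtain c where c: "P = [:c:]" by (auto elim: degree_eq_zeroE)
 then have "const c : mx V" using P(2)[of P] by (simp add: ev_pCons)
 then show False using const_not_mx[of c] c P(1) by auto
 qed
 have fac: "EX i g. f = P ^ i * g & ~ P dvd g" if "f ~= 0" for f
 using that
 proof (induction "degree f" arbitrary: f rule: less_induct)
 case less
 show ?case
 proof (cases "P dvd f")
  case True
  then obtain g where g: "f = P * g" by auto
  then have "g ~= 0" using less.prems by auto
  moreover from this have "degree g < degree f" using g dP P(1) by (simp add: degree_mult_eq)
  ultimately obtain i h where "g = P ^ i * h" "~ P dvd h" using less.hyps by blast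
  then show ?thesis using g by (intro exI[of _ "Suc i"] exI[of _ h]) auto
 next
  case False
  then show ?thesis by (intro exI[of _ 0] exI[of _ f]) auto
 qed
 qed
 have Pm: "ev t P : mx V" "ev t P ~= 0" using P param_ev_0[OF t] by auto
 have rep: "EX i j a b. ~ P dvd a & ~ P dvd b & x * ev t P ^ j = ev t P ^ i * (ev t a / ev t b)"
 if x: "x : k0" "x ~= 0" for x
 proof -
 obtain a b where ab: "b ~= 0" "x = ev t a / ev t b" using param_base[OF t x(1)] by auto
 then have "a ~= 0" using x by auto
 then obtain i a' j b' where d: "a = P ^ i * a'" "~ P dvd a'" "b = P ^ j * b'" "~ P dvd b'"
  using fac ab(1) by metis
 have "x * ev t P ^ j = ev t P ^ i * (ev t a' / ev t b')"
  unfolding ab(2) d(1,3) ev_mult ev_power using Pm(2) unit(2)[OF d(4)] by (simp add: field_simps)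
 then show ?thesis using d by blast
 qed
 have un: "ev t a / ev t b : V" "ev t a / ev t b ~= 0" "inverse (ev t a / ev t b) : V" if "~ P dvd a" "~ P dvd b" for a b
 using that unit vr_mult[OF V ev_in[of a] unit(1)[of b]] vr_mult[OF V ev_in[of b] unit(1)[of a]]
 by (auto simp: divide_inverse mult.commute)
 have ex: "EX v. dval k0 V v"
 proof (rule dval_of_uniformizer[OF V Pm])
 fix x :: "'q ratfun_ac" assume x: "x : k0" "x ~= 0"
 obtain i j a b where r: "~ P dvd a" "~ P dvd b" "x * ev t P ^ j = ev t P ^ i * (ev t a / ev t b)" using rep[OF x] by blast
 have "x * ev t P powi (int j - int i) = ev t a / ev t b"
  using r(3) Pm(2) by (simp add: power_int_diff field_simps)
 then show "EX n. x * ev t P powi n : units V" using un[OF r(1,2)] by (metis (mono_tags, lifting) mem_Collect_eq units_def)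
 qed
 have mem: "EX a b. x = ev t a / ev t b & ~ P dvd b" if x: "x : V" for x
 proof (cases "x = 0")
 case True
 then show ?thesis using dP by (intro exI[of _ 0] exI[of _ 1]) (auto simp: is_unit_iff_degree P(1) dest: )
 next
 case False
 obtain i j a b where r: "~ P dvd a" "~ P dvd b" "x * ev t P ^ j = ev t P ^ i * (ev t a / ev t b)"
  using rep[OF _ False] x vr_sub[OF V] by blast
 have "j <= i"
 proof (rule ccontr)
  assume "~ j <= i"
  then obtain n where n: "j = i + Suc n" using less_imp_Suc_add by (metis add_Suc_right not_le)
  then have "ev t P ^ i * (x * ev t P ^ Suc n) = ev t P ^ i * (ev t a / ev t b)"
  using r(3) by (simp add: power_add mult_ac)
  moreover have "ev t P ^ i ~= 0" using Pm(2) by simp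
  ultimately have "x * ev t P ^ Suc n = ev t a / ev t b" using mult_left_cancel by blast
  then have "ev t P * (x * ev t P ^ n) = ev t a / ev t b" by (simp add: mult_ac)
  moreover have "ev t P * (x * ev t P ^ n) : mx V"
  by (intro mx_mult[OF V Pm(1)] vr_mult[OF V x] vr_power[OF V] ev_in)
  ultimately show False using un[OF r(1,2)] by (auto simp: mx_def)
 qed
 then have "x = x * ev t P ^ j / ev t P ^ j" "ev t P ^ (i - j) = ev t P ^ i / ev t P ^ j"
  using Pm(2) by (simp_all add: power_diff)
 then have "x = ev t (P ^ (i - j) * a) / ev t b"
  by (simp add: r(3) ev_mult ev_power)
 then show ?thesis using r(2) by blast
 qed
 have "EX R. finite R & R <= V & (ALL x:V. EX r:R. x - r : mx V)"
 proof (intro exI conjI ballI)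
 show "finite (ev t ` {g. degree g <= degree P})" using finite_polys_degree by (rule finite_imageI)
 show "ev t ` {g. degree g <= degree P} <= V" using ev_in by auto
 fix x assume "x : V"
 then obtain a b where ab: "x = ev t a / ev t b" "~ P dvd b" using mem by blast
 define S where "S = range (%f. f mod P)"
 have md: "degree (f mod P) <= degree P" for f using degree_mod_less[OF P(1), of f] by auto
 then have S: "S <= {g. degree g <= degree P}" by (auto simp: S_def)
 \<comment> \<open>Multiplication by \<open>b\<close> is injective on the finite set of remainders,
   hence surjective, which divides \<open>a\<close> by \<open>b\<close> modulo
   \<open>P\<close>.\<close>
 define h where "h = (%g. b * g mod P)"
 have "inj_on h S"
 proof (rule inj_onI)
  fix f g assume fg: "f : S" "g : S" "h f = h g"
  have "P dvd b * (f - g)" using fg(3) unfolding h_def right_diff_distrib by (simp add: mod_eq_dvd_iff)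
  then have "ev t b * ev t (f - g) : mx V" using P(2) ev_mult by metis
  then have "P dvd f - g" using mx_prime[OF V ev_in ev_in] P(2) ab(2) by blast
  then have "f mod P = g mod P" by (simp add: mod_eq_dvd_iff)
  then show "f = g" using fg by (auto simp: S_def)
 qed
 moreover have "h ` S <= S" by (auto simp: h_def S_def)
 ultimately have "a mod P : h ` S"
  using endo_inj_surj[of S h] finite_subset[OF S finite_polys_degree] by (auto simp: S_def)
 then obtain g where g: "g : S" "a mod P = b * g mod P" by (auto simp: h_def)
 have "x - ev t g = ev t (a - b * g) * inverse (ev t b)"
  using unit(2)[OF ab(2)] by (simp add: ab(1) ev_mult ev_diff field_simps)
 moreover have "ev t (a - b * g) : mx V" using g(2) unfolding P(2) by (simp add: mod_eq_dvd_iff)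
 ultimately have "x - ev t g : mx V" using mx_mult[OF V _ unit(1)[OF ab(2)]] by metis
 then show "EX r:ev t ` {g. degree g <= degree P}. x - r : mx V" using g(1) S by blast
 qed
 then show "dvr k0 V" using V ex by unfold_locales auto
 have "ev t a / ev t b : V" if "~ P dvd b" for a b
 using vr_mult[OF V ev_in unit(1)[OF that]] by (simp add: divide_inverse)
 then have "V = {ev t a / ev t b | a b. ~ P dvd b}" using mem by blast
 then show "EX P. P ~= 0 & (ALL f. ev t f : mx V \<longleftrightarrow> P dvd f) & V = {ev t a / ev t b | a b. ~ P dvd b}"
 using P by blast
qed

end

lemma base_dvr: assumes "vr k0 V" "range const <= V" shows "dvr k0 V"
proof (cases "T : V")
 case True
 then show ?thesis by (intro base_vr_props(1)[OF assms, of T]) (auto simp: param_def)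
next
 case False
 then have "inverse T : V" using vr_dich[OF assms(1) T_base] by auto
 then show ?thesis by (intro base_vr_props(1)[OF assms, of "inverse T"]) (auto simp: param_def)
qed

lemma finite_primes_dividing:
 assumes t: "param t" and N: "N ~= 0"
 shows "finite {V. vr k0 V & range const <= V & t : V & ev t N : mx V}"
proof (rule finite_subset)
 show "finite ((%P. {ev t a / ev t b | a b. ~ P dvd b}) ` {P. degree P <= degree N})"
 using finite_polys_degree by (rule finite_imageI)
 show "{V. vr k0 V & range const <= V & t : V & ev t N : mx V} <=
 (%P. {ev t a / ev t b | a b. ~ P dvd b}) ` {P. degree P <= degree N}"
 proof
 fix V assume "V : {V. vr k0 V & range const <= V & t : V & ev t N : mx V}"
 then have V: "vr k0 V" "range const <= V" "t : V" "ev t N : mx V" by auto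
 obtain P where P: "ALL f. ev t f : mx V \<longleftrightarrow> P dvd f" "V = {ev t a / ev t b | a b. ~ P dvd b}"
  using base_vr_props(2)[OF V(1,2) t V(3)] by blast
 have "P dvd N" using P V by auto
 then show "V : (%P. {ev t a / ev t b | a b. ~ P dvd b}) ` {P. degree P <= degree N}"
  using P(2) dvd_imp_degree_le[OF _ N] by blast
 qed
qed

lemma P_infinity_iff: "b ~= 0 ==> ev T a / ev T b : P_infinity \<longleftrightarrow> a = 0 | degree a <= degree b"
proof -
 assume b: "b ~= 0"
 have e: "ev T a / ev T b = to_ac (Fract a b)" using b by (simp add: ev_T flip: to_ac_divide)
 show ?thesis
 proof
 assume "ev T a / ev T b : P_infinity"
 then obtain c d where cd: "d ~= 0" "degree c <= degree d" "Fract a b = Fract c d" by (auto simp: e P_infinity_def)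
 then have "a * d = c * b" using b by (simp add: eq_fract)
 then have "degree a + degree d = degree c + degree b" if "a ~= 0"
  using b cd(1) that by (metis degree_mult_eq mult_eq_0_iff)
 then show "a = 0 | degree a <= degree b" using cd(2) by fastforce
 next
 assume "a = 0 | degree a <= degree b"
 then have "degree a <= degree b" by auto
 then show "ev T a / ev T b : P_infinity" using b unfolding e P_infinity_def by blast
 qed
qed

lemma param_inverse: "param t ==> param (inverse t)"
 by (auto simp: param_def)

lemma base_vr_ex: assumes t: "param (t :: ('q::{field,finite}) ratfun_ac)" and b: "degree b > 0"
 shows "EX V. vr k0 V & range (ev t) <= V & range const <= V & t : V & ev t b : mx V"
proof -
 have s: "subr (range (ev t))" unfolding subr_def
 by (auto simp flip: ev_minus ev_mult ev_add) (metis ev_1 rangeI)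
 have rk: "range (ev t) <= k0" using const_base param_in_base[OF t]
 by (auto simp: ev_altdef intro!: sfd_sum[OF sfd_base] sfd_mult[OF sfd_base] sfd_power[OF sfd_base])
 have b0: "b ~= 0" "ev t b ~= 0" using b param_ev_0[OF t] by auto
 have "ev t b * a ~= 1" if a: "a : range (ev t)" for a
 proof
 assume e: "ev t b * a = 1"
 obtain f where f: "a = ev t f" using a by auto
 have "ev t (b * f - 1) = 0" using e f by (simp add: ev_diff ev_mult)
 then have "b dvd 1" by (metis dvdI eq_iff_diff_eq_0 param_ev_0[OF t])
 then show False using b is_unit_iff_degree[OF b0(1)] by simp
 qed
 then obtain V where V: "vr k0 V" "range (ev t) <= V" "ev t b : mx V"
 using chevalley[OF sfd_base s rk _ b0(2)] by blast
 have "const c = ev t [:c:]" "t = ev t [:0, 1:]" for c by (simp_all add: ev_pCons)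
 then have "range const <= V" "t : V" using V(2) by (blast, metis range_subsetD)
 then show ?thesis using V by blast
qed

text \<open>The numerator of a uniformizer vanishes at \<open>t = 0\<close>, so its constant
  coefficient is zero and \<open>t\<close> divides the uniformizer in \<open>V\<close>.\<close>

lemma base_zero_ord:
 assumes t: "param t" and v: "vr k0 V" "range const <= V" and tm: "t : mx V" shows "ord k0 V t = 1"
proof -
 interpret V: dvr k0 V by (rule base_dvr[OF v])
 have tV: "t : V" using tm mx_sub by blast
 obtain P where P: "ALL f. ev t f : mx V \<longleftrightarrow> P dvd f" "V = {ev t a / ev t b | a b. ~ P dvd b}"
 using base_vr_props(2)[OF v t tV] by blast
 obtain p where p: "p : k0" "p ~= 0" "V.nu p = 1" using V.unif by blast
 have pm: "p : mx V" using p by (auto simp: V.mx_eq pw_def)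
 then have "p : V" using mx_sub by blast
 then obtain a b where ab: "p = ev t a / ev t b" "~ P dvd b" using P(2) by blast
 have b0: "ev t b ~= 0" using param_ev_0[OF t] ab(2) by auto
 have m: "ev t a : mx V" using mx_mult[OF v(1) pm ev_in[OF v t tV, of b]] ab b0 by simp
 obtain c g where a: "a = pCons c g" by (cases a) auto
 have "ev t a - t * ev t g : mx V" using m mx_mult[OF v(1) tm ev_in[OF v t tV]] by (intro mx_diff[OF v(1)])
 then have "const c : mx V" by (simp add: a ev_pCons)
 then have "c = 0" using const_not_mx[OF v t tV, of c] by auto
 then have "p = t * (ev t g / ev t b)" using ab a by (simp add: ev_pCons)
 moreover have "ev t g / ev t b : V" using P(2) ab(2) by blast
 ultimately obtain y where y: "p = t * y" "y : V" by blast
 have t0: "t : k0" "t ~= 0" using param_in_base[OF t] param_nonzero[OF t] by auto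
 have yk: "y : k0" "y ~= 0" using y p vr_sub[OF v(1)] by auto
 have "V.nu t >= 1" using tm t0 by (simp add: V.mx_eq pw_def)
 moreover have "V.nu y >= 0" using V.mem_iff[OF yk] y by simp
 moreover have "V.nu t + V.nu y = 1" using V.ord_mult[OF t0(1) yk(1) t0(2) yk(2)] p(3) y by simp
 ultimately show ?thesis by simp
qed

lemma eq_P_infinity: assumes V: "vr k0 V" "range const <= V" "T ~: V" shows "V = P_infinity"
proof -
 have t: "inverse T : mx V" using vr_dich[OF V(1) T_base] V(3) by (auto simp: mx_def)
 have "P_infinity <= V"
 proof
 fix x :: "'a ratfun_ac" assume x: "x : P_infinity"
 then obtain a b where ab: "b ~= 0" "degree a <= degree b" "x = to_ac (Fract a b)" by (auto simp: P_infinity_def)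
 then have x: "x = ev T a / ev T b" by (simp add: ev_T flip: to_ac_divide)
 define f where "f c = (SUM i<=degree b. const (coeff c i) * inverse T ^ (degree b - i))" for c :: "'a poly"
 have f: "ev T c = f c * T ^ degree b" if "degree c <= degree b" for c
 proof -
  have "ev T c = (SUM i<=degree b. const (coeff c i) * T ^ i)"
  unfolding ev_altdef using that by (intro sum.mono_neutral_left) (auto simp: coeff_eq_0)
  also have "... = f c * T ^ degree b"
  unfolding f_def sum_distrib_right by (intro sum.cong) (auto simp: power_inverse power_diff field_simps)
  finally show ?thesis .
 qed
 have fV: "f c : V" for c unfolding f_def
  using V(2) mx_sub[OF t] by (intro vr_sum[OF V(1)] vr_mult[OF V(1)] vr_power[OF V(1)]) auto
 have "f b - const (lead_coeff b) = (SUM i<degree b. const (coeff b i) * inverse T ^ (degree b - i))"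
  unfolding f_def by (simp add: lessThan_Suc_atMost[symmetric])
 also have "... : mx V"
 proof (rule mx_sum[OF V(1)])
  fix i assume "i : {..<degree b}"
  then have "degree b - i = Suc (degree b - i - 1)" by auto
  then have e: "inverse T ^ (degree b - i) = inverse T * inverse T ^ (degree b - i - 1)"
  by (metis power_Suc)
  have "inverse T * (inverse T ^ (degree b - i - 1) * const (coeff b i)) : mx V"
  using V(2) mx_sub[OF t] by (intro mx_mult[OF V(1) t] vr_mult[OF V(1)] vr_power[OF V(1)]) auto
  then show "const (coeff b i) * inverse T ^ (degree b - i) : mx V" by (simp add: e mult_ac)
 qed
 finally have d: "f b - const (lead_coeff b) : mx V" .
 have "f b ~: mx V"
 proof
  assume "f b : mx V"
  from mx_diff[OF V(1) this d] have "const (lead_coeff b) : mx V" by simp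
  then show False using ab(1) V(2) by (auto simp: mx_def simp flip: const_inverse)
 qed
 then have "inverse (f b) : V" using mx_unit[OF fV] by auto
 moreover have "x = f a * inverse (f b)" unfolding x f[OF ab(2)] f[OF order_refl] by (simp add: divide_inverse)
 ultimately show "x : V" using vr_mult[OF V(1) fV] by simp
 qed
 moreover have "V <= P_infinity"
 proof
 fix x assume x: "x : V"
 then obtain a b where ab: "b ~= 0" "x = ev T a / ev T b" using vr_sub[OF V(1)] by (auto simp: base_field_eq)
 show "x : P_infinity"
 proof (rule ccontr)
  assume "x ~: P_infinity"
  then have d: "a ~= 0" "degree b < degree a" using ab P_infinity_iff[OF ab(1), of a] by auto
  then have "ev T (pCons 0 b) / ev T a : V" using `P_infinity <= V` P_infinity_iff[OF d(1), of "pCons 0 b"] ab(1) by auto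
  from mx_mult[OF V(1) t this] have "inverse x : mx V" using ab(2) by (simp add: ev_pCons field_simps)
  from mx_mult[OF V(1) this x] show False using mx_1[OF V(1)] ab d by simp
 qed
 qed
 ultimately show ?thesis by simp
qed

lemma P_infinity_vr:
 shows "vr k0 (P_infinity :: ('q::{field,finite}) ratfun_ac set)"
 and "range const <= (P_infinity :: 'q ratfun_ac set)" and "(T :: 'q ratfun_ac) ~: P_infinity"
proof -
 obtain V :: "'q ratfun_ac set" where V: "vr k0 V" "range const <= V" "inverse T : mx V"
 using base_vr_ex[of "inverse T :: 'q ratfun_ac" "[:0, 1:]"] by (auto simp: param_def ev_pCons)
 have "T ~: V" using V(3) by (simp add: mx_def)
 from eq_P_infinity[OF V(1,2) this] this V
 show "vr k0 (P_infinity :: 'q ratfun_ac set)" "range const <= (P_infinity :: 'q ratfun_ac set)" "(T :: 'q ratfun_ac) ~: P_infinity" by auto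
qed

lemma P_infinity_dvr: "dvr k0 P_infinity"
 using base_dvr P_infinity_vr by blast

section \<open>Genus fields\<close>

lemma CHAR_ratfun_ac: "CHAR(('q::{field,finite}) ratfun_ac) = CHAR('q)"
proof (rule CHAR_eqI)
 have c: "of_nat n = const (of_nat n :: 'q)" for n by (induction n) auto
 show "of_nat CHAR('q) = (0 :: 'q ratfun_ac)" by (simp add: c)
 show "CHAR('q) dvd n" if "of_nat n = (0 :: 'q ratfun_ac)" for n
 using that by (simp add: c of_nat_eq_0_iff_char_dvd)
qed

lemma prime_CHAR_finite_field: "prime CHAR('q::{field,finite})"
 using prime_CHAR_semidom[where ?'a = 'q] finite_imp_CHAR_pos[where ?'a = 'q] by simp

lemma prime_CHAR_ratfun_ac: "prime CHAR(('q::{field,finite}) ratfun_ac)"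
 by (simp only: CHAR_ratfun_ac prime_CHAR_finite_field)

definition pr :: "('q::{field,finite}) ratfun_ac set => 'q ratfun_ac set => bool" where
 "pr L W \<longleftrightarrow> vr L W & range const <= W"

text \<open>What finite Galois extensions inherit from \<open>k0\<close>: every prime is discrete
  with finite residue field and lies over a genuine prime of \<open>k0\<close>.\<close>

definition good :: "('q::{field,finite}) ratfun_ac set => bool" where
 "good F \<longleftrightarrow> sfd F & k0 <= F & (ALL W. pr F W --> dvr F W & ~ k0 <= W)"

lemma goodD: "good F ==> sfd F" "good F ==> k0 <= F" "good F ==> pr F W ==> dvr F W"
 by (auto simp: good_def)

lemma prD: "pr L W ==> vr L W" "pr L W ==> range const <= W" by (auto simp: pr_def)

lemma good_base: "good k0"
 by (auto simp: good_def sfd_base pr_def base_dvr) (auto simp: vr_def)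

lemma pr_lower: "good L ==> pr L W ==> sfd M ==> k0 <= M ==> M <= L ==> pr M (W Int M)"
 using vr_Int[of L W M] const_base by (fastforce simp: good_def pr_def)

lemma vr_integrally_closed:
 assumes W: "vr L W" and p: "p : polys W" "lead_coeff p = 1" "poly p x = 0" and x: "x : L"
 shows "x : W"
proof (rule ccontr)
 assume n: "x ~: W"
 then have x0: "x ~= 0" using vr_0[OF W] by auto
 define y where "y = inverse x"
 have y: "y : mx W" using vr_dich[OF W x x0] n by (auto simp: mx_def y_def)
 define d where "d = degree p"
 have "0 = (SUM i<=d. coeff p i * x ^ i) * y ^ d" using p(3) by (simp add: poly_altdef d_def)
 also have "... = (SUM i<=d. coeff p i * y ^ (d - i))"
 unfolding sum_distrib_right y_def using x0 by (intro sum.cong) (auto simp: power_diff power_inverse field_simps)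
 also have "... = 1 + (SUM i<d. coeff p i * y ^ (d - i))"
 using p(2) by (simp add: lessThan_Suc_atMost[symmetric] d_def add.commute)
 finally have "1 = - (SUM i<d. coeff p i * y ^ (d - i))" by (simp add: eq_neg_iff_add_eq_0)
 also have "... : mx W"
 proof (intro mx_minus[OF W] mx_sum[OF W])
 fix i assume "i : {..<d}"
 then have "d - i = Suc (d - i - 1)" by auto
 then have "coeff p i * y ^ (d - i) = y * (y ^ (d - i - 1) * coeff p i)" by (metis mult.commute mult.left_commute power_Suc)
 also have "... : mx W" using mx_sub[OF y] polysD[OF p(1)]
  by (intro mx_mult[OF W y] vr_mult[OF W] vr_power[OF W])
 finally show "coeff p i * y ^ (d - i) : mx W" .
 qed
 finally show False using mx_1[OF W] by simp
qed

lemma good_galois: assumes F: "good F" and L: "galois F L" shows "good L"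
 unfolding good_def
proof (intro conjI allI impI)
 interpret galois F L by fact
 show "sfd L" by (rule sfL)
 show "k0 <= L" using goodD(2)[OF F] FL by auto
 fix W assume W: "pr L W"
 have "~ F <= W"
 proof
 assume FW: "F <= W"
 have "x : W" if x: "x : L" for x
 proof -
  obtain p where "p : polys F" "poly p x = 0" "lead_coeff p = 1" by (rule killing_poly[OF x]) blast
  then show ?thesis using vr_integrally_closed[OF prD(1)[OF W] _ _ _ x] polys_mono[OF FW] by blast
 qed
 then show False using prD(1)[OF W] by (auto simp: vr_def)
 qed
 then have "vr F (W Int F)" by (rule vr_Int[OF prD(1)[OF W] sfF FL])
 then have p: "pr F (W Int F)" using prD(2)[OF W] const_base goodD(2)[OF F] by (auto simp: pr_def)
 then show "dvr L W" using dvr_above[OF goodD(3)[OF F] prD(1)[OF W]] by simp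
 show "~ k0 <= W" using p F goodD(2)[OF F] by (auto simp: good_def)
qed

lemma pr_extend: assumes "good F" "pr F V" "sfd L" "F <= L" shows "EX W. pr L W & W Int F = V"
 using dvr_extends[OF goodD(3)[OF assms(1,2)] assms(3,4)] assms(2) by (auto simp: pr_def)

text \<open>The members of the family defining the Hilbert class field of \<open>F\<close>, in terms
  of groups; the condition at infinity is imposed on all primes over
  \<open>P_infinity\<close>.\<close>

definition fam :: "('q::{field,finite}) ratfun_ac set => 'q ratfun_ac set => bool" where
 "fam F L \<longleftrightarrow> abel F L & (ALL W. pr L W --> tin F L W & (W Int k0 = P_infinity --> tdec F L W))"

lemma primes_of_iff: "sfd F ==> W : primes_of F \<longleftrightarrow> pr F W"
 unfolding primes_of_def pr_def vr_def subring_iff by blast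

lemma max_ideal_eq: "max_ideal W = mx W"
 by (simp add: max_ideal_def mx_def)

text \<open>Both sides say that some element of \<open>F\<close> is a uniformizer at
  \<open>W\<close>.\<close>

lemma unramified_over_iff:
 assumes F: "good F" and g: "galois F L" and W: "pr L W"
 shows "unramified_over (W Int F) W \<longleftrightarrow> tin F L W"
proof -
 interpret galois F L by fact
 interpret W: dvr L W using good_galois[OF F g] W by (auto simp: good_def)
 have pV: "pr F (W Int F)" using pr_lower[OF good_galois[OF F g] W sfF goodD(2)[OF F] FL] .
 interpret V: dvr F "W Int F" by (rule goodD(3)[OF F pV])
 note mI = mx_Int[OF W.vr sfF]
 have "unramified_over (W Int F) W \<longleftrightarrow> (EX p:F. p ~= 0 & W.nu p = 1)"
 proof
 assume u: "unramified_over (W Int F) W"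
 obtain r where r: "r : L" "r ~= 0" "W.nu r = 1" using W.unif by auto
 then have "r : mx W" by (auto simp: W.mx_eq pw_def)
 then obtain x y where xy: "x : mx (W Int F)" "y : W" "r = x * y"
  using u by (auto simp: unramified_over_def max_ideal_eq)
 have nz: "x ~= 0" "y ~= 0" using xy r by auto
 have x: "x : F" "x : L" "1 <= W.nu x" using xy(1) mI nz FL by (auto simp: W.mx_eq pw_def)
 have y: "y : L" "0 <= W.nu y" using xy(2) nz vr_sub[OF W.vr] W.mem_iff[of y] by auto
 have "W.nu x = 1" using W.ord_mult[OF x(2) y(1) nz] r(3) xy(3) x y by simp
 then show "EX p:F. p ~= 0 & W.nu p = 1" using x nz by auto
 next
 assume "EX p:F. p ~= 0 & W.nu p = 1"
 then obtain p where p: "p : F" "p ~= 0" "W.nu p = 1" by auto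
 have pL: "p : L" using p FL by auto
 have pm: "p : mx (W Int F)" using p pL mI by (auto simp: W.mx_eq pw_def)
 have "z : {x * y | x y. x : mx (W Int F) & y : W}" if z: "z : mx W" for z
 proof -
  have "inverse p : pw L W (-1)" using W.ord_inverse[OF pL p(2)] p pL sfL by (auto simp: pw_def sfd_inverse)
  then have "inverse p * z : pw L W (-1 + 1)" using z W.mx_eq by (intro W.pw_mult) auto
  then have "inverse p * z : W" using W.pw_0_eq by simp
  moreover have "z = p * (inverse p * z)" using p by simp
  ultimately show ?thesis using pm by blast
 qed
 moreover have "x * y : mx W" if "x : mx (W Int F)" "y : W" for x y
  using that mI mx_mult[OF W.vr] by auto
 ultimately show "unramified_over (W Int F) W" unfolding unramified_over_def max_ideal_eq by blast
 qed
 also have "... \<longleftrightarrow> tin F L W"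
 proof
 assume "EX p:F. p ~= 0 & W.nu p = 1"
 then show "tin F L W" using index_one_imp_tin[OF prime_CHAR_ratfun_ac W.dvr_axioms] by auto
 next
 assume t: "tin F L W"
 obtain p where "p : F" "p ~= 0" "V.nu p = 1" using V.unif by auto
 then show "EX p:F. p ~= 0 & W.nu p = 1" using tin_imp_index_one[OF W.dvr_axioms V.dvr_axioms t] by auto
 qed
 finally show ?thesis .
qed

lemma decomposes_fully_iff:
 assumes F: "good F" and g: "galois F L" and V: "pr F V"
 shows "decomposes_fully F L V \<longleftrightarrow> (ALL W. pr L W --> W Int F = V --> tdec F L W)"
proof -
 interpret galois F L by fact
 obtain W where W: "pr L W" "W Int F = V" using pr_extend[OF F V sfL FL] by auto
 have "primes_above F L V = {W. vr L W & W Int F = V}"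
 using V by (auto simp: primes_above_def primes_of_iff[OF sfL] pr_def)
 then have "decomposes_fully F L V \<longleftrightarrow> card {W. vr L W & W Int F = V} = card G"
 by (simp add: decomposes_fully_def ext_degree_eq[OF g])
 moreover have "card {W. vr L W & W Int F = V} = card G \<longleftrightarrow> tdec F L W'" if "pr L W'" "W' Int F = V" for W'
 using card_primes_above[of W'] that good_galois[OF F g] goodD(3)[OF F V] by (auto simp: good_def)
 ultimately show ?thesis using W by blast
qed

lemma fam_iff:
 assumes F: "good F"
 shows "finite_abelian F L & unramified_extension F L &
 (ALL V : primes_above base_field F P_infinity. decomposes_fully F L V) \<longleftrightarrow> fam F L"
proof (cases "abel F L")
 case True
 then interpret abel F L .
 have g: "galois F L" by unfold_locales
 have gL: "good L" by (rule good_galois[OF F g])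
 have low: "pr F (W Int F)" if "pr L W" for W using pr_lower[OF gL that sfF goodD(2)[OF F] FL] .
 have "unramified_extension F L \<longleftrightarrow> (ALL W. pr L W --> unramified_over (W Int F) W)"
 unfolding unramified_extension_def primes_above_def using low by (auto simp: primes_of_iff sfF sfL)
 also have "... \<longleftrightarrow> (ALL W. pr L W --> tin F L W)" using unramified_over_iff[OF F g] by auto
 finally have u: "unramified_extension F L \<longleftrightarrow> (ALL W. pr L W --> tin F L W)" .
 have int: "W Int F Int k0 = W Int k0" for W :: "'a ratfun_ac set" using goodD(2)[OF F] by auto
 have pa: "V : primes_above base_field F P_infinity \<longleftrightarrow> pr F V & V Int k0 = P_infinity" for V :: "'a ratfun_ac set"
 by (auto simp: primes_above_def primes_of_iff sfF)
 have "(ALL V : primes_above base_field F P_infinity. decomposes_fully F L V) \<longleftrightarrow>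
  (ALL W. pr L W --> W Int k0 = P_infinity --> tdec F L W)"
 proof
 assume a: "ALL V : primes_above base_field F P_infinity. decomposes_fully F L V"
 show "ALL W. pr L W --> W Int k0 = P_infinity --> tdec F L W"
 proof (intro allI impI)
  fix W assume W: "pr L W" "W Int k0 = P_infinity"
  then have "W Int F : primes_above base_field F P_infinity" using low int by (simp add: pa)
  then have "decomposes_fully F L (W Int F)" using a by auto
  then show "tdec F L W" using decomposes_fully_iff[OF F g low[OF W(1)]] W by auto
 qed
 next
 assume a: "ALL W. pr L W --> W Int k0 = P_infinity --> tdec F L W"
 show "ALL V : primes_above base_field F P_infinity. decomposes_fully F L V"
 proof
  fix V :: "'a ratfun_ac set" assume "V : primes_above base_field F P_infinity"
  then have V: "pr F V" "V Int k0 = P_infinity" by (auto simp: pa)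
  show "decomposes_fully F L V" unfolding decomposes_fully_iff[OF F g V(1)]
  proof (intro allI impI)
  fix W assume W: "pr L W" "W Int F = V"
  then have "W Int k0 = P_infinity" using int[of W] V by simp
  then show "tdec F L W" using a W by auto
  qed
 qed
 qed
 then show ?thesis unfolding fam_def u finite_abelian_iff by blast
qed (auto simp: fam_def finite_abelian_iff)

section \<open>Inertia and decomposition in composita, towers and base change\<close>

lemma aut_trivial_gen:
 assumes "s : auts F L" "sfd L" "L = gen (L1 Un L2)" "!!x. x : L1 ==> s x = x" "!!x. x : L2 ==> s x = x"
 shows "s = (\<lambda>x\<in>L. x)"
proof (rule extensionalityI[of _ L])
 show "s : extensional L" using assms(1) by (simp add: auts_def)
 fix x assume x: "x : L"
 have id: "rhom L (%x. x)" by (simp add: rhom_def)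
 have "s x = x"
 by (rule rhom_gen_agree[OF auts_rhom[OF assms(1)] id assms(2), of "L1 Un L2"])
  (use assms(3-5) x gen_incl[of "L1 Un L2"] in auto)
 then show "s x = (\<lambda>x\<in>L. x) x" using x by simp
qed simp

lemma tin_compositum:
 assumes g: "galois F L" "galois F L1" "galois F L2" and L: "L = gen (L1 Un L2)" and W: "vr L W"
 and t: "tin F L1 (W Int L1)" "tin F L2 (W Int L2)"
 shows "tin F L W"
 unfolding tin_def
proof
 interpret galois F L by fact
 have sub: "L1 <= L" "L2 <= L" using gen_incl[of "L1 Un L2"] L by auto
 fix s assume s: "s : inert F L W"
 have "restrict s L1 = (\<lambda>x\<in>L1. x)" "restrict s L2 = (\<lambda>x\<in>L2. x)"
 using inert_restrict[OF g(2) sub(1) W s] inert_restrict[OF g(3) sub(2) W s] t by (auto simp: tin_def)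
 then have "s x = x" if "x : L1 | x : L2" for x using that by (metis restrict_apply')
 then show "s : {\<lambda>x\<in>L. x}" using aut_trivial_gen[OF _ sfL L] s by (auto simp: inert_def)
qed

lemma tdec_compositum:
 assumes g: "galois F L" "galois F L1" "galois F L2" and L: "L = gen (L1 Un L2)" and W: "vr L W"
 and t: "tdec F L1 (W Int L1)" "tdec F L2 (W Int L2)"
 shows "tdec F L W"
 unfolding tdec_def
proof (intro ballI impI)
 interpret galois F L by fact
 have sub: "L1 <= L" "L2 <= L" using gen_incl[of "L1 Un L2"] L by auto
 fix s assume s: "s : G" "s ` W = W"
 have "restrict s L1 = (\<lambda>x\<in>L1. x)" "restrict s L2 = (\<lambda>x\<in>L2. x)"
 using dec_restrict[OF g(2) sub(1) vr_sub[OF W] s] dec_restrict[OF g(3) sub(2) vr_sub[OF W] s] t by (auto simp: tdec_def)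
 then have "s x = x" if "x : L1 | x : L2" for x using that by (metis restrict_apply')
 then show "s = (\<lambda>x\<in>L. x)" using aut_trivial_gen[OF s(1) sfL L] by auto
qed

text \<open>
  Base change: the group of \<open>L = L1 L2\<close> over \<open>L2\<close> restricts injectively to the group of \<open>L1\<close> over \<open>F\<close>.
\<close>

lemma tin_base_change:
 assumes g: "galois F L" "galois F L1" and L: "L = gen (L1 Un L2)" and L2: "F <= L2" and W: "vr L W"
 and t: "tin F L1 (W Int L1)"
 shows "tin L2 L W"
 unfolding tin_def
proof
 interpret galois F L by fact
 have sub: "L1 <= L" using gen_incl[of "L1 Un L2"] L by auto
 fix s assume s: "s : inert L2 L W"
 then have sF: "s : inert F L W" using auts_mono[OF L2, of L] by (auto simp: inert_def)
 have "restrict s L1 = (\<lambda>x\<in>L1. x)" using inert_restrict[OF g(2) sub W sF] t by (auto simp: tin_def)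
 then have "s x = x" if "x : L1" for x using that by (metis restrict_apply')
 then show "s : {\<lambda>x\<in>L. x}" using aut_trivial_gen[OF _ sfL L] s auts_fix[of s L2 L] by (auto simp: inert_def)
qed

lemma tin_tower:
 assumes g: "galois F L" "galois F M" "M <= L" and W: "vr L W" and t: "tin F M (W Int M)" "tin M L W"
 shows "tin F L W"
 unfolding tin_def
proof
 interpret galois F L by fact
 fix s assume s: "s : inert F L W"
 have "restrict s M = (\<lambda>x\<in>M. x)" using inert_restrict[OF g(2,3) W s] t by (auto simp: tin_def)
 then have "s x = x" if "x : M" for x using that by (metis restrict_apply')
 then have "s : inert M L W" using s by (auto simp: inert_def auts_def)
 then show "s : {\<lambda>x\<in>L. x}" using t(2) by (auto simp: tin_def)
qed

lemma tdec_tower: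
 assumes g: "galois F L" "galois F M" "M <= L" and W: "vr L W" and t: "tdec F M (W Int M)" "tdec M L W"
 shows "tdec F L W"
 unfolding tdec_def
proof (intro ballI impI)
 interpret galois F L by fact
 fix s assume s: "s : G" "s ` W = W"
 have "restrict s M = (\<lambda>x\<in>M. x)" using dec_restrict[OF g(2,3) vr_sub[OF W] s] t by (auto simp: tdec_def)
 then have "s x = x" if "x : M" for x using that by (metis restrict_apply')
 then have "s : auts M L" using s by (auto simp: auts_def)
 then show "s = (\<lambda>x\<in>L. x)" using t(2) s(2) by (auto simp: tdec_def)
qed

lemma fam_compositum:
 assumes F: "good F" and a: "fam F L1" "fam F L2" shows "fam F (gen (L1 Un L2))"
proof -
 let ?L = "gen (L1 Un L2)"
 have ab: "abel F L1" "abel F L2" using a by (auto simp: fam_def)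
 then have ab3: "abel F ?L" by (rule abel_compositum)
 interpret L1: abel F L1 by (rule ab)
 interpret L2: abel F L2 by (rule ab)
 interpret L: abel F ?L by (rule ab3)
 have g: "good ?L" by (rule good_galois[OF F L.galois_axioms])
 have sub: "L1 <= ?L" "L2 <= ?L" using gen_incl[of "L1 Un L2"] by auto
 have p: "pr L1 (W Int L1)" "pr L2 (W Int L2)" if "pr ?L W" for W
 using pr_lower[OF g that L1.sfL _ sub(1)] pr_lower[OF g that L2.sfL _ sub(2)] goodD(2)[OF F] L1.FL L2.FL by auto
 have i: "W Int L1 Int k0 = W Int k0" "W Int L2 Int k0 = W Int k0" for W
 using goodD(2)[OF F] L1.FL L2.FL by auto
 note gal = L.galois_axioms L1.galois_axioms L2.galois_axioms
 have "tin F ?L W" if W: "pr ?L W" for W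
 by (rule tin_compositum[OF gal refl prD(1)[OF W]]) (use a p[OF W] in "auto simp: fam_def")
 moreover have "tdec F ?L W" if W: "pr ?L W" "W Int k0 = P_infinity" for W
 by (rule tdec_compositum[OF gal refl prD(1)[OF W(1)]]) (use a p[OF W(1)] W(2) i[of W] in "auto simp: fam_def")
 ultimately show ?thesis using ab3 by (auto simp: fam_def)
qed

lemma fam_lower:
 assumes F: "good F" and a: "fam F L" and M: "sfd M" "F <= M" "M <= L" shows "fam F M"
proof -
 have ab: "abel F L" using a by (auto simp: fam_def)
 interpret L: abel F L by (rule ab)
 have abM: "abel F M" by (rule L.abel_lower(1)[OF M])
 interpret M: abel F M by (rule abM)
 have g: "good M" "good L" using good_galois[OF F] M.galois_axioms L.galois_axioms by auto
 have "tin F M V & (V Int k0 = P_infinity --> tdec F M V)" if V: "pr M V" for V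
 proof -
 obtain W where W: "pr L W" "W Int M = V" using pr_extend[OF g(1) V L.sfL M(3)] by auto
 have d: "dvr L W" "dvr M (W Int M)" "dvr F (W Int F)"
  using goodD(3)[OF g(2) W(1)] goodD(3)[OF g(1) V] W(2) goodD(3)[OF F pr_lower[OF g(2) W(1) L.sfF goodD(2)[OF F] L.FL]] by auto
 have "tin F L W" using a W(1) by (auto simp: fam_def)
 then have "tin F M V" using L.tin_lower[OF prime_CHAR_ratfun_ac M.galois_axioms M(3) d] W(2) by simp
 moreover have "tdec F M V" if i: "V Int k0 = P_infinity"
 proof -
  have "W Int k0 = P_infinity" using i W(2) goodD(2)[OF F] M(2) by auto
  then have "tdec F L W" using a W(1) by (auto simp: fam_def)
  then show ?thesis using L.tdec_lower[OF M.galois_axioms M(3) d(1,2)] W(2) by simp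
 qed
 ultimately show ?thesis by simp
 qed
 then show ?thesis using abM by (auto simp: fam_def)
qed

lemma fam_refl: assumes "good F" shows "fam F F"
proof -
 have a: "abel F F" by (rule abel_refl[OF goodD(1)[OF assms]])
 have "s = (\<lambda>x\<in>F. x)" if "s : auts F F" for s
 using that auts_eqI[OF that auts_id[OF goodD(1)[OF assms]]] auts_fix[OF that] by auto
 then show ?thesis using a by (auto simp: fam_def tin_def tdec_def inert_def)
qed

section \<open>Hilbert class field and genus field as directed unions\<close>

lemma directed_Union_sfd:
 assumes "A ~= {}" "!!L. L : A ==> sfd L" "!!L M. L : A ==> M : A ==> EX N:A. L <= N & M <= N"
 shows "sfd (\<Union>A)"
proof -
 have two: "EX N:A. x : N & y : N" if xy: "x : \<Union>A" "y : \<Union>A" for x y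
 proof -
 obtain L M where "L : A" "x : L" "M : A" "y : M" using xy by auto
 with assms(3)[of L M] show ?thesis by auto
 qed
 obtain L where L: "L : A" using assms(1) by auto
 show ?thesis unfolding sfd_def
 proof (intro conjI ballI)
 show "0 : \<Union>A" "1 : \<Union>A" using L assms(2) sfd_0 sfd_1 by blast+
 fix x assume x: "x : \<Union>A"
 then obtain N where "N : A" "x : N" by auto
 then show "- x : \<Union>A" "inverse x : \<Union>A" using sfd_minus sfd_inverse assms(2) by blast+
 fix y assume "y : \<Union>A"
 then obtain N where "N : A" "x : N" "y : N" using two x by blast
 then show "x + y : \<Union>A" "x * y : \<Union>A" using sfd_add sfd_mult assms(2) by blast+
 qed
qed

lemma directed_finite_subset:
 assumes "A ~= {}" "!!L M. L : A ==> M : A ==> EX N:A. L <= N & M <= N" "finite S" "S <= \<Union>A"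
 shows "EX N:A. S <= N"
 using assms(3,4)
proof (induction S)
 case empty
 then show ?case using assms(1) by auto
next
 case (insert x S)
 then obtain N M where "N : A" "S <= N" "M : A" "x : M" by auto
 then show ?case using assms(2)[of N M] by blast
qed

text \<open>The family is directed under composita, so its union is a field already and generation
  adds nothing.\<close>

lemma hcf_eq: assumes F: "good F" shows "hilbert_class_field F = \<Union>{L. fam F L}"
proof -
 have d: "EX N:{L. fam F L}. L <= N & M <= N" if "L : {L. fam F L}" "M : {L. fam F L}" for L M
 using fam_compositum[OF F, of L M] that gen_incl[of "L Un M"] by auto
 have "sfd (\<Union>{L. fam F L})"
 by (rule directed_Union_sfd[OF _ _ d]) (use fam_refl[OF F] in "auto simp: fam_def abel_def galois_def")
 moreover have "F Un \<Union>{L. fam F L} = \<Union>{L. fam F L}" using fam_refl[OF F] by auto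
 ultimately have "gen (F Un \<Union>{L. fam F L}) = \<Union>{L. fam F L}" using gen_sfd by metis
 then show ?thesis by (simp add: hilbert_class_field_def fam_iff[OF F] compositum_eq)
qed

text \<open>\<open>L\<close> is generated over \<open>F\<close> by a finite set, which a single
  member of the directed family contains.\<close>

lemma fam_of_sub_hcf: assumes F: "good F" and L: "galois F L" "L <= hilbert_class_field F" shows "fam F L"
proof -
 interpret galois F L by fact
 obtain S where S: "S <= L" "split_set F S" "gen (F Un S) = L" using split_set_ex by auto
 have "EX N:{L. fam F L}. S <= N"
 proof (rule directed_finite_subset)
 show "finite S" using S by (auto simp: split_set_def)
 show "S <= \<Union>{L. fam F L}" using S(1) L(2) hcf_eq[OF F] by blast
 show "EX N:{L. fam F L}. L <= N & M <= N" if "L : {L. fam F L}" "M : {L. fam F L}" for L M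
  using fam_compositum[OF F, of L M] that gen_incl[of "L Un M"] by auto
 qed (use fam_refl[OF F] in auto)
 then obtain N where N: "fam F N" "S <= N" by auto
 then have "sfd N" "F <= N" by (auto simp: fam_def abel_def galois_def)
 then have "L <= N" using gen_least[of N "F Un S"] N S(3) by auto
 then show ?thesis using fam_lower[OF F N(1) sfL FL] by simp
qed

definition gfam :: "('q::{field,finite}) ratfun_ac set => 'q ratfun_ac set => bool" where
 "gfam F L \<longleftrightarrow> fam F L & abel k0 L"

lemma gfam_compositum: "good F ==> gfam F L1 ==> gfam F L2 ==> gfam F (gen (L1 Un L2))"
 using fam_compositum abel_compositum by (auto simp: gfam_def)

lemma genus_field_eq: assumes F: "abel k0 F" shows "genus_field F = \<Union>{L. gfam F L}"
proof -
 interpret F: abel k0 F by fact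
 have gF: "good F" by (rule good_galois[OF good_base F.galois_axioms])
 have eq: "F <= L & L <= hilbert_class_field F & finite_abelian base_field L \<longleftrightarrow> gfam F L" for L
 proof
 assume a: "F <= L & L <= hilbert_class_field F & finite_abelian base_field L"
 then interpret L: abel k0 L by (simp add: finite_abelian_iff)
 have "galois F L" using L.galois_upper[OF F.sfL F.FL] a by auto
 then show "gfam F L" using fam_of_sub_hcf[OF gF] a by (auto simp: gfam_def finite_abelian_iff)
 next
 assume a: "gfam F L"
 then show "F <= L & L <= hilbert_class_field F & finite_abelian base_field L"
  using hcf_eq[OF gF] by (auto simp: gfam_def finite_abelian_iff fam_def abel_def galois_def)
 qed
 have r: "gfam F F" using fam_refl[OF gF] F by (simp add: gfam_def)
 have "sfd (\<Union>{L. gfam F L})"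
 proof (rule directed_Union_sfd)
 show "EX N:{L. gfam F L}. L <= N & M <= N" if "L : {L. gfam F L}" "M : {L. gfam F L}" for L M
  using gfam_compositum[OF gF, of L M] that gen_incl[of "L Un M"] by auto
 qed (use r in "auto simp: gfam_def abel_def galois_def")
 moreover have "F Un \<Union>{L. gfam F L} = \<Union>{L. gfam F L}" using r by auto
 ultimately have "gen (F Un \<Union>{L. gfam F L}) = \<Union>{L. gfam F L}" using gen_sfd by metis
 then show ?thesis by (simp add: genus_field_def eq compositum_eq)
qed

section \<open>Unramified extensions in which the infinite prime splits\<close>

text \<open>The generators of the two prime ideals divide each other, and by
  \<open>base_vr_props\<close> such a generator determines the ring.\<close>

lemma prime_poly_unique:
 assumes t: "param t" and V: "pr k0 V" "t : V" and V': "pr k0 V'" "t : V'"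
 and P: "!!f. ev t f : mx V \<longleftrightarrow> P dvd f" and m: "ev t P : mx V'"
 shows "V = V'"
proof -
 have vV: "vr k0 V" "range const <= V" "vr k0 V'" "range const <= V'" using V V' by (auto simp: pr_def)
 obtain Q where Q: "ALL f. ev t f : mx V \<longleftrightarrow> Q dvd f" "V = {ev t a / ev t b | a b. ~ Q dvd b}"
 using base_vr_props(2)[OF vV(1,2) t V(2)] by blast
 obtain P' where P': "P' ~= 0" "ALL f. ev t f : mx V' \<longleftrightarrow> P' dvd f" "V' = {ev t a / ev t b | a b. ~ P' dvd b}"
 using base_vr_props(2)[OF vV(3,4) t V'(2)] by blast
 have QP: "Q dvd f \<longleftrightarrow> P dvd f" for f using Q(1) P by auto
 have "P' dvd P" using m P' by auto
 then obtain c where c: "P = P' * c" by auto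
 have in_V: "ev t f : V" for f using ev_in[OF vV(1,2) t V(2)] .
 have "ev t P' * ev t c : mx V" using P[of P] c by (simp add: ev_mult)
 then have "P dvd P' | P dvd c" using mx_prime[OF vV(1) in_V in_V] P by auto
 then have PP': "P dvd P'"
 proof
 assume "P dvd c"
 then obtain d where d: "c = P * d" by auto
 have "P ~= 0"
 proof
  assume "P = 0"
  then have "c = 0" using c P'(1) by auto
  obtain x where x: "x : k0" "x ~: V" using vV(1) by (auto simp: vr_def)
  obtain a b where "b ~= 0" "x = ev t a / ev t b" using param_base[OF t x(1)] by auto
  then show False using x(2) Q(2) QP[of b] `P = 0` by auto
 qed
 then have "P' * d = 1" using c d by (metis mult.assoc mult.commute mult_cancel_left2)
 then have "P' dvd 1" by (metis dvdI)
 then have "ev t 1 : mx V'" using P'(2) by blast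
 then show ?thesis using mx_1[OF vV(3)] by simp
 qed
 then have "P dvd f \<longleftrightarrow> P' dvd f" for f using `P' dvd P` dvd_trans by blast
 then show ?thesis using Q(2) P'(3) QP by simp
qed

text \<open>\<open>W0\<close> is one fixed prime over infinity. As infinity splits, the infinite
  primes are its distinct conjugates, and the values of all \<open>s x\<close> at \<open>W0\<close>
  record the behaviour of \<open>x\<close> at every infinite prime.\<close>

locale split_unr =
 fixes A W0 :: "('q::{field,finite}) ratfun_ac set"
 assumes famA: "fam k0 A" and W0: "pr A W0" "W0 Int k0 = P_infinity"
begin

sublocale abel k0 A using famA by (simp add: fam_def)

lemma goodA: "good A" by (rule good_galois[OF good_base galois_axioms])

lemma dvrA: "pr A W ==> dvr A W" using goodA by (rule goodD(3))

sublocale W: dvr A W0 by (rule dvrA[OF W0(1)])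

lemma pr_base: "pr A W ==> pr k0 (W Int k0)"
 by (rule pr_lower[OF goodA _ sfF order_refl FL])

lemma pr_image: assumes "s : G" "pr A W" shows "pr A (s ` W)" "s ` W Int k0 = W Int k0"
proof -
 have i: "s ` W Int k0 = W Int k0" using image_Int_F[OF assms(1)] vr_sub[OF prD(1)[OF assms(2)]] by auto
 then show "s ` W Int k0 = W Int k0" .
 have "const c : s ` W" for c
 proof -
 have "const c : W Int k0" using prD(2)[OF assms(2)] const_base by auto
 then show ?thesis using i by blast
 qed
 then show "pr A (s ` W)" using vr_image[OF assms(1) prD(1)[OF assms(2)]] by (auto simp: pr_def)
qed

lemma W0_const: "const c : W0" using prD(2)[OF W0(1)] by auto

lemma TA: "T : A" "inverse T : A" and constA: "const c : A" and evA: "ev T f : A" "ev T f : k0"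
proof -
 show T: "T : A" using T_base FL by auto
 then show "inverse T : A" using sfL sfd_inverse by auto
 show c: "const c : A" for c using const_base FL by auto
 show "ev T f : k0" unfolding ev_altdef
 using const_base T_base by (intro sfd_sum[OF sfF] sfd_mult[OF sfF] sfd_power[OF sfF]) auto
 then show "ev T f : A" using FL by auto
qed

lemma P_infinity_mx: "b ~= 0 ==> ev T a / ev T b : mx P_infinity \<longleftrightarrow> a = 0 | degree a < degree b"
proof -
 assume b: "b ~= 0"
 show ?thesis
 proof (cases "a = 0")
 case False
 have "inverse (ev T a / ev T b) = ev T b / ev T a" by simp
 then show ?thesis using P_infinity_iff[OF b, of a] P_infinity_iff[OF False, of b] b False
  by (simp add: mx_def) linarith
 qed (use b P_infinity_iff[OF b, of a] in "simp add: mx_def")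
qed

lemma ev_mx_infinity: "ev T f : mx W0 ==> f = 0"
 using P_infinity_mx[of 1 f] mx_Int[OF W.vr sfF] W0(2) evA(2)[of f] by auto

text \<open>\<open>inverse T\<close> is a uniformizer at \<open>W0\<close> because infinity is
  unramified; multiplication by \<open>T\<close> lowers values by one.\<close>

lemma mx_T: assumes "x : A" shows "x : mx W0 \<longleftrightarrow> x * T : W0"
proof -
 have "inverse T : mx P_infinity" using vr_dich[OF P_infinity_vr(1) T_base] P_infinity_vr(3) by (auto simp: mx_def)
 then have "ord k0 P_infinity (inverse T) = 1" by (intro base_zero_ord P_infinity_vr) (simp_all add: param_def)
 moreover have "tin k0 A W0" using famA W0 by (auto simp: fam_def)
 ultimately have "W.nu (inverse T) = 1"
 using tin_imp_index_one[OF W.dvr_axioms _ _ sfd_inverse[OF sfF T_base]] P_infinity_dvr W0(2) by simp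
 then have vT: "W.nu T = -1" using W.ord_inverse[OF TA(1)] by simp
 show ?thesis
 proof (cases "x = 0")
 case False
 then show ?thesis using assms W.ord_mult[OF assms TA(1)] vT W.mem_iff[of "x * T"] TA sfL
  by (auto simp: W.mx_eq pw_def sfd_mult)
 qed (use mx_0[OF W.vr] vr_0[OF W.vr] in auto)
qed

lemma conj_distinct: "s : G ==> t : G ==> s ` W0 = t ` W0 ==> s = t"
proof -
 assume a: "s : G" "t : G" "s ` W0 = t ` W0"
 have WL: "W0 <= A" using vr_sub[OF W.vr] .
 obtain u where u: "u : G" "!!x. x : A ==> u (t x) = x" "!!x. x : A ==> t (u x) = x"
 "!!B. B <= A ==> u ` t ` B = B" "!!B. B <= A ==> t ` u ` B = B" by (rule image_inv[OF a(2)]) blast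
 have "compose A u s ` W0 = W0" using a(3) u(4)[OF WL] WL by (simp add: compose_image)
 moreover have "tdec k0 A W0" using famA W0 by (auto simp: fam_def)
 ultimately have e: "compose A u s = (\<lambda>x\<in>A. x)" using compose_G[OF u(1) a(1)] by (auto simp: tdec_def)
 show "s = t"
 proof (rule auts_eqI[OF a(1,2)])
 fix x assume x: "x : A"
 have "u (s x) = x" using fun_cong[OF e, of x] x by (simp add: compose_eq)
 then show "s x = t x" using u(3)[OF auts_in[OF a(1) x]] by simp
 qed
qed

text \<open>The Chinese remainder theorem at the infinite primes, expressed through conjugates at
  the single prime \<open>W0\<close>.\<close>

lemma local_value:
 assumes i: "i : G" and b: "b : A"
 shows "EX x:A. i x - i b : mx W0 & (ALL s:G. s ~= i --> s x : mx W0)"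
proof -
 have WL: "W0 <= A" using vr_sub[OF W.vr] .
 obtain j where j: "j : G" "!!x. x : A ==> j (i x) = x" "!!x. x : A ==> i (j x) = x"
 "!!B. B <= A ==> j ` i ` B = B" "!!B. B <= A ==> i ` j ` B = B" by (rule image_inv[OF i]) blast
 define \<W> where "\<W> = (%s. s ` W0) ` G - {j ` W0}"
 obtain x where x: "x : A" "x - b : pw A (j ` W0) 1" "ALL V:\<W>. x : pw A V 1"
 using approximation_value[OF dvr_image(1)[OF j(1) W.dvr_axioms], of \<W> b 1] finG
  dvr_image(1)[OF _ W.dvr_axioms] b by (auto simp: \<W>_def)
 have m: "s z : mx W0" if "s : G" "u : G" "!!x. x : A ==> u (s x) = x" "z : A" "z : pw A (u ` W0) 1" for s u z
 using pw_image[OF that(2) W.dvr_axioms auts_in[OF that(1,4)], of 1] that W.mx_eq by simp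
 have "i (x - b) : mx W0" by (rule m[OF i j(1,2)]) (use x b sfL in "auto simp: sfd_diff")
 then have "i x - i b : mx W0" using rhom_diff[OF auts_rhom[OF i] sfL x(1) b] by simp
 moreover have "s x : mx W0" if s: "s : G" "s ~= i" for s
 proof -
 obtain u where u: "u : G" "!!x. x : A ==> u (s x) = x" "!!x. x : A ==> s (u x) = x"
  "!!B. B <= A ==> u ` s ` B = B" "!!B. B <= A ==> s ` u ` B = B" by (rule image_inv[OF s(1)]) blast
 have "u ` W0 ~= j ` W0"
 proof
  assume "u ` W0 = j ` W0"
  then have "u = j" using conj_distinct u(1) j(1) by blast
  then have "s = i" using u j s i auts_eqI[OF s(1) i] auts_in[OF s(1)] by metis
  then show False using s by simp
 qed
 then have "x : pw A (u ` W0) 1" using x u(1) by (auto simp: \<W>_def)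
 then show ?thesis using m[OF s(1) u(1,2) x(1)] by simp
 qed
 ultimately show ?thesis using x by auto
qed

text \<open>Splitting makes the residue field at \<open>W0\<close> that of \<open>k0\<close> at
  infinity: choose an element congruent to \<open>x\<close> at \<open>W0\<close> whose other
  conjugates are small. Its trace is congruent to \<open>x\<close> and is a rational function finite
  at infinity, whose value is read off from leading coefficients.\<close>

lemma residue_ex: assumes x: "x : W0" shows "EX c. x - const c : mx W0"
proof -
 have xA: "x : A" using x vr_sub[OF W.vr] by auto
 obtain y where y: "y : A" "y - x : mx W0" "!!s. s : G ==> s ~= (\<lambda>x\<in>A. x) ==> s y : mx W0"
 using local_value[OF G_id xA] xA by auto
 have "(SUM s:G. s y) = y + (SUM s:G - {\<lambda>x\<in>A. x}. s y)"
 using sum.remove[OF finG G_id, of "%s. s y"] y(1) by simp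
 then have "(SUM s:G. s y) - x = (y - x) + (SUM s:G - {\<lambda>x\<in>A. x}. s y)" by simp
 also have "... : mx W0" using y by (intro mx_add[OF W.vr] mx_sum[OF W.vr]) auto
 finally have m: "(SUM s:G. s y) - x : mx W0" .
 define z where "z = (SUM s:G. s y)"
 have "z : W0" using vr_add[OF W.vr mx_sub[OF m] x] by (simp add: z_def)
 then have z: "z : k0" "z : P_infinity" using trace_F[OF y(1)] W0(2) by (auto simp: z_def)
 obtain a b where ab: "b ~= 0" "z = ev T a / ev T b" using z by (auto simp: base_field_eq)
 have "EX c. z - const c : mx P_infinity"
 proof (cases "a = 0 | degree a < degree b")
 case True
 then show ?thesis using P_infinity_mx[OF ab(1), of a] ab(2) by (intro exI[of _ 0]) simp
 next
 case False
 then have d: "degree a = degree b" using P_infinity_iff[OF ab(1), of a] z ab by auto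
 define c where "c = lead_coeff a / lead_coeff b"
 have c: "c * lead_coeff b = lead_coeff a" using ab(1) by (simp add: c_def)
 have "degree (a - smult c b) <= degree b" using d by (intro degree_diff_le) auto
 moreover have "coeff (a - smult c b) (degree b) = 0" using c d by simp
 ultimately have "a - smult c b = 0 | degree (a - smult c b) < degree b" by (rule eq_zero_or_degree_less)
 moreover have "z - const c = ev T (a - smult c b) / ev T b"
  using ab by (simp add: ev_diff ev_smult diff_divide_distrib)
 ultimately show ?thesis using P_infinity_mx[OF ab(1), of "a - smult c b"] by metis
 qed
 then obtain c where "z - const c : mx W0" using mx_Int[OF W.vr sfF] W0(2) by auto
 then have "(z - const c) - (z - x) : mx W0" using m unfolding z_def by (rule mx_diff[OF W.vr])
 then show ?thesis by auto
qed

definition res :: "'q ratfun_ac => 'q" where "res x = (SOME c. x - const c : mx W0)"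

lemma const_mx: "const c : mx W0 \<longleftrightarrow> c = 0"
proof
 assume "const c : mx W0"
 then have "ev T [:c:] : mx W0" by (simp add: ev_pCons)
 then show "c = 0" using ev_mx_infinity[of "[:c:]"] by simp
qed (use mx_0[OF W.vr] in auto)

lemma res: "x : W0 ==> x - const (res x) : mx W0"
 unfolding res_def using residue_ex by (rule someI_ex)

lemma resI: assumes "x - const c : mx W0" shows "res x = c"
proof -
 have "x : W0" using vr_add[OF W.vr mx_sub[OF assms] W0_const[of c]] by simp
 from mx_diff[OF W.vr res[OF this] assms] have "const (c - res x) : mx W0"
 using const_simps(3)[of c "- res x"] by simp
 then show ?thesis by (simp only: const_mx) simp
qed

lemma res_0_iff: "x : W0 ==> res x = 0 \<longleftrightarrow> x : mx W0"
 using res[of x] resI[of x 0] by auto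

lemma res_add: "x : W0 ==> y : W0 ==> res (x + y) = res x + res y"
 using mx_add[OF W.vr res res, of x y] by (intro resI) (simp add: algebra_simps)

lemma res_mult: assumes "x : W0" "y : W0" shows "res (x * y) = res x * res y"
proof (rule resI)
 have "(x - const (res x)) * y + (y - const (res y)) * const (res x) : mx W0"
 using assms W0_const by (intro mx_add[OF W.vr] mx_mult[OF W.vr] res)
 then show "x * y - const (res x * res y) : mx W0" by (simp add: algebra_simps)
qed

lemma res_const [simp]: "res (const c) = c"
 using mx_0[OF W.vr] by (intro resI) simp

lemma res_0 [simp]: "res 0 = 0" using res_const[of 0] by simp

lemma res_sum: "(!!i. i : I ==> f i : W0) ==> res (sum f I) = (SUM i:I. res (f i))"
 by (induction I rule: infinite_finite_induct) (auto simp: res_add vr_sum[OF W.vr])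

text \<open>The functions regular away from infinity, that is the integral closure of the
  polynomials in \<open>T\<close>; the description by primes makes membership a local
  question.\<close>

definition Og :: "'q ratfun_ac set" where
 "Og = {x : A. ALL W. pr A W --> W Int k0 ~= P_infinity --> x : W}"

lemma Og_A: "x : Og ==> x : A" by (simp add: Og_def)

lemma T_in: assumes "pr A W" "W Int k0 ~= P_infinity" shows "T : W"
 using eq_P_infinity[of "W Int k0"] pr_base[OF assms(1)] assms(2) by (auto simp: pr_def)

lemma ev_in_W: assumes "pr A W" "W Int k0 ~= P_infinity" shows "ev T f : W"
 unfolding ev_altdef using T_in[OF assms] prD[OF assms(1)]
 by (intro vr_sum[of A] vr_mult[of A] vr_power[of A]) auto

lemma Og_add: "x : Og ==> y : Og ==> x + y : Og"
 and Og_mult: "x : Og ==> y : Og ==> x * y : Og"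
 and Og_minus: "x : Og ==> - x : Og"
 and Og_ev: "ev T f : Og"
 unfolding Og_def mem_Collect_eq using sfL ev_in_W evA
 by (blast intro: vr_add[OF prD(1)] vr_mult[OF prD(1)] vr_minus[OF prD(1)] sfd_add sfd_mult sfd_minus)+

lemma Og_diff: "x : Og ==> y : Og ==> x - y : Og"
 using Og_add[of x "- y"] Og_minus[of y] by simp

lemma Og_sum: "(!!i. i : I ==> f i : Og) ==> sum f I : Og"
 using Og_ev[of 0] by (induction I rule: infinite_finite_induct) (auto simp: Og_add)

lemma Og_prod: "(!!i. i : I ==> f i : Og) ==> prod f I : Og"
 using Og_ev[of 1] by (induction I rule: infinite_finite_induct) (auto simp: Og_mult)

lemma Og_stable: assumes "x : Og" "s : G" shows "s x : Og"
 unfolding Og_def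
proof (intro CollectI conjI allI impI)
 show "s x : A" using auts_in[OF assms(2) Og_A[OF assms(1)]] .
 fix W assume W: "pr A W" "W Int k0 ~= P_infinity"
 have WL: "W <= A" using vr_sub[OF prD(1)[OF W(1)]] .
 obtain t where t: "t : G" "!!x. x : A ==> t (s x) = x" "!!x. x : A ==> s (t x) = x"
 "!!B. B <= A ==> t ` s ` B = B" "!!B. B <= A ==> s ` t ` B = B" by (rule image_inv[OF assms(2)]) blast
 have "x : t ` W" using assms(1) pr_image[OF t(1) W(1)] W(2) by (auto simp: Og_def)
 then show "s x : W" using t(3) WL by auto
qed

text \<open>A nonconstant denominator of least degree would vanish at a finite prime; the numerator
  vanishes there too, and the common factor could be cancelled.\<close>

lemma Og_base: assumes x: "x : Og" "x : k0" shows "EX f. x = ev T f"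
proof -
 obtain a0 b0 where "b0 ~= 0" "x = ev T a0 / ev T b0" using x(2) by (auto simp: base_field_eq)
 then have "b0 ~= 0 & (EX a. x * ev T b0 = ev T a)" by auto
 then obtain b where b: "b ~= 0" "EX a. x * ev T b = ev T a"
 "!!b'. b' ~= 0 ==> EX a. x * ev T b' = ev T a ==> degree b <= degree b'"
 using ex_has_least_nat[of "%b. b ~= 0 & (EX a. x * ev T b = ev T a)" b0 degree] by blast
 obtain a where a: "x * ev T b = ev T a" using b by auto
 have "degree b = 0"
 proof (rule ccontr)
 assume d: "degree b ~= 0"
 obtain V :: "'q ratfun_ac set" where V: "vr k0 V" "ev T b : mx V" and c: "range const <= V" "T : V"
  using base_vr_ex[of T b] d by (auto simp: param_def)
 have pV: "pr k0 V" using V c by (simp add: pr_def)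
 obtain W where W: "pr A W" "W Int k0 = V" using pr_extend[OF good_base pV sfL FL] by auto
 have "V ~= P_infinity" using c P_infinity_vr(3) by auto
 then have xV: "x : V" using x W unfolding Og_def by blast
 have t: "param T" by (simp add: param_def)
 obtain P where P: "P ~= 0" "ALL f. ev T f : mx V \<longleftrightarrow> P dvd f" using prime_poly_ex[OF V(1) c(1) t c(2)] by blast
 have "ev T a : mx V" using mx_mult[OF V xV] a by (simp add: mult.commute)
 then obtain a' b' where ab': "a = P * a'" "b = P * b'" using P V(2) by (auto elim!: dvdE)
 have "b' ~= 0" using ab' b by auto
 have "x * ev T b' = ev T a'" using a ab' P(1) by (simp add: ev_mult)
 then have "degree b <= degree b'" using b(3) `b' ~= 0` by auto
 moreover have "degree b = degree P + degree b'" using ab' P(1) `b' ~= 0` by (simp add: degree_mult_eq)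
 ultimately have "degree P = 0" by simp
 then have "P dvd 1" using is_unit_iff_degree[OF P(1)] by simp
 then have "ev T 1 : mx V" using P by blast
 then show False using mx_1[OF V(1)] by simp
 qed
 then obtain c where c: "b = [:c:]" "c ~= 0" using b(1) by (auto elim: degree_eq_zeroE)
 have "x = ev T (smult (inverse c) a)"
 proof -
 have "const c * inverse (const c) = 1" using c(2) by simp
 moreover have "x * const c = ev T a" using a c by (simp add: ev_pCons)
 ultimately have "x = ev T a * inverse (const c)" by (metis mult.assoc mult.right_neutral)
 then show ?thesis by (simp only: ev_smult const_inverse mult.commute)
 qed
 then show ?thesis by blast
qed

lemma denominator: assumes x: "x : A" shows "EX g. g ~= 0 & ev T g * x : Og"
proof -
 obtain p where p: "p : polys k0" "poly p x = 0" "lead_coeff p = 1" by (rule killing_poly[OF x]) blast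
 define n where "n = degree p"
 have "ALL i. EX b. b ~= 0 & (EX a. coeff p i * ev T b = ev T a)"
 proof
 fix i
 have "coeff p i : k0" using polysD[OF p(1)] .
 then obtain a b where "b ~= 0" "coeff p i = ev T a / ev T b" by (auto simp: base_field_eq)
 then show "EX b. b ~= 0 & (EX a. coeff p i * ev T b = ev T a)" by (intro exI[of _ b]) auto
 qed
 then obtain b where b: "!!i. b i ~= 0" "!!i. EX a. coeff p i * ev T (b i) = ev T a" by metis
 define g where "g = (PROD i<=n. b i)"
 have g0: "g ~= 0" using b by (simp add: g_def)
 have cg: "EX a. coeff p i * ev T g = ev T a" if "i <= n" for i
 proof -
 obtain a where a: "coeff p i * ev T (b i) = ev T a" using b by auto
 have "g = b i * (PROD j:{..n} - {i}. b j)" unfolding g_def using that by (subst prod.remove[of _ i]) auto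
 then have "coeff p i * ev T g = ev T (a * (PROD j:{..n} - {i}. b j))" using a by (simp add: ev_mult mult.assoc[symmetric])
 then show ?thesis by blast
 qed
 define y where "y = ev T g * x"
 have yA: "y : A" using x evA sfL by (auto simp: y_def sfd_mult)
 \<comment> \<open>The monic equation of \<open>ev T g * x\<close>, obtained from that of
   \<open>x\<close> by scaling its roots; the powers of \<open>ev T g\<close> clear all
   denominators.\<close>
 define q where "q = (SUM i<=n. monom (coeff p i * ev T g ^ (n - i)) i)"
 have cq: "coeff q i = (if i <= n then coeff p i * ev T g ^ (n - i) else 0)" for i
 unfolding q_def by (simp add: coeff_sum)
 have "poly q y = (SUM i<=n. coeff p i * ev T g ^ (n - i) * y ^ i)" by (simp add: q_def poly_sum poly_monom)
 also have "... = (SUM i<=n. ev T g ^ n * (coeff p i * x ^ i))"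
 proof (intro sum.cong refl)
 fix i assume i: "i : {..n}"
 have "ev T g ^ (n - i) * ev T g ^ i = ev T g ^ n" using i by (simp add: power_add[symmetric])
 then show "coeff p i * ev T g ^ (n - i) * y ^ i = ev T g ^ n * (coeff p i * x ^ i)"
  by (simp add: y_def power_mult_distrib mult.left_commute mult.assoc flip: `_ = ev T g ^ n`)
 qed
 also have "... = ev T g ^ n * poly p x" by (simp add: poly_altdef n_def sum_distrib_left)
 finally have root: "poly q y = 0" using p by simp
 have dq: "degree q = n"
 proof (rule antisym)
 show "degree q <= n" by (rule degree_le) (simp add: cq)
 show "n <= degree q" by (rule le_degree) (use p(3) in "simp add: cq n_def")
 qed
 have lq: "lead_coeff q = 1" unfolding dq cq using p(3) by (simp add: n_def)
 have "y : W" if W: "pr A W" "W Int k0 ~= P_infinity" for W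
 proof (rule vr_integrally_closed[OF prD(1)[OF W(1)] _ lq root yA])
 note v = prD(1)[OF W(1)]
 have "coeff q i : W" for i
 proof (cases "i < n")
  case True
  obtain a where a: "coeff p i * ev T g = ev T a" using cg[of i] True by auto
  have "n - i = Suc (n - i - 1)" using True by simp
  then have "ev T g ^ (n - i) = ev T g * ev T g ^ (n - i - 1)" by (metis power_Suc)
  then have "coeff q i = ev T a * ev T g ^ (n - i - 1)" using True by (simp add: cq flip: a)
  then show ?thesis using ev_in_W[OF W] vr_mult[OF v] vr_power[OF v] by simp
 next
  case False
  then show ?thesis using p(3) vr_1[OF v] vr_0[OF v] by (auto simp: cq n_def)
 qed
 then show "q : polys W" by (simp add: polys_def)
 qed
 then show ?thesis using g0 yA by (intro exI[of _ g]) (auto simp: Og_def y_def)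
qed

text \<open>A denominator of least degree is prime to \<open>V\<close>: if \<open>P\<close> divided
  it, the remaining factor would still do, as \<open>x\<close> is integral above \<open>V\<close>
  and \<open>P\<close> is a unit at the other finite primes.\<close>

lemma denominator_at:
 assumes x: "x : A" and V: "pr k0 V" "V ~= P_infinity" and i: "!!W. pr A W ==> W Int k0 = V ==> x : W"
 shows "EX g. ev T g ~: mx V & ev T g * x : Og"
proof -
 have v: "vr k0 V" "range const <= V" using V by (auto simp: pr_def)
 have TV: "T : V" using eq_P_infinity[OF v] V(2) by auto
 have t: "param T" by (simp add: param_def)
 obtain P where P: "P ~= 0" "ALL f. ev T f : mx V \<longleftrightarrow> P dvd f" using prime_poly_ex[OF v t TV] by blast
 obtain g where g: "g ~= 0" "ev T g * x : Og" "!!f. f ~= 0 ==> ev T f * x : Og ==> degree g <= degree f"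
 proof -
 obtain g0 where "g0 ~= 0 & ev T g0 * x : Og" using denominator[OF x] by blast
 from ex_has_least_nat[of "%g. g ~= 0 & ev T g * x : Og", OF this, of degree] show ?thesis
  using that by blast
 qed
 have "~ P dvd g"
 proof
 assume "P dvd g"
 then obtain f where f: "g = P * f" by auto
 have f0: "f ~= 0" using f g by auto
 define z where "z = ev T f * x"
 have zA: "z : A" using x evA sfL by (auto simp: z_def sfd_mult)
 have "z : W" if W: "pr A W" "W Int k0 ~= P_infinity" for W
 proof (cases "W Int k0 = V")
  case True
  then show ?thesis using i[OF W(1)] ev_in_W[OF W] vr_mult[OF prD(1)[OF W(1)]] by (simp add: z_def)
 next
  case False
  note vW = prD(1)[OF W(1)]
  have TW: "T : W Int k0" using T_in[OF W] T_base by simp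
  have "ev T P ~: mx (W Int k0)"
  using prime_poly_unique[OF t V(1) TV pr_base[OF W(1)] TW, of P] P False by auto
  then have "ev T P ~: mx W" using mx_Int[OF vW sfF] evA by auto
  then have u: "inverse (ev T P) : W" "ev T P ~= 0" using mx_unit[OF ev_in_W[OF W]] by auto
  have "ev T g * x : W" using g(2) W by (auto simp: Og_def)
  then have "inverse (ev T P) * (ev T g * x) : W" using vr_mult[OF vW u(1)] by simp
  moreover have "inverse (ev T P) * (ev T g * x) = z" using u(2) by (simp add: f z_def ev_mult)
  ultimately show ?thesis by simp
 qed
 then have "z : Og" using zA by (simp add: Og_def)
 then have "degree g <= degree f" using g(3)[OF f0] by (simp add: z_def)
 moreover have "degree g = degree P + degree f" using f f0 P(1) by (simp add: degree_mult_eq)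
 ultimately have "degree P = 0" by simp
 then have "P dvd 1" using is_unit_iff_degree[OF P(1)] by simp
 then have "ev T 1 : mx V" using P by blast
 then show False using mx_1[OF v(1)] by simp
 qed
 then show ?thesis using P g(2) by auto
qed

text \<open>The extension being unramified, \<open>Og\<close> is its own dual for the trace form.\<close>

lemma self_dual:
 assumes y: "y : A" and tr: "!!x. x : Og ==> (SUM s:G. s (x * y)) : range (ev T)"
 shows "y : Og"
 unfolding Og_def
proof (intro CollectI conjI allI impI y, rule ccontr)
 fix W assume W: "pr A W" "W Int k0 ~= P_infinity" and n: "y ~: W"
 have t: "tin k0 A W" using famA W by (auto simp: fam_def)
 have d: "dvr A W" by (rule dvrA[OF W(1)])
 note v = prD(1)[OF W(1)]
 obtain x where x: "x : W" "ALL u:G. u ` W ~= W --> u x : pw A W 0" "(SUM s:G. s (x * y)) ~: W"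
 using trace_pairing[OF d t y n, of 0] by auto
 have xA: "x : A" using x vr_sub[OF v] by auto
 have ux: "u x : W" if "u : G" for u
 using x(1,2) that dvr.pw_0_eq[OF d] by (cases "u ` W = W") auto
 have "x : W'" if W': "pr A W'" "W' Int k0 = W Int k0" for W'
 proof -
 obtain s where s: "s : G" "s ` W' = W" using primes_conjugate[OF dvrA[OF W'(1)] d W'(2)] by auto
 have "s x : s ` W'" using ux s by auto
 then show ?thesis
  using inj_on_image_mem_iff[OF rhom_inj[OF auts_rhom[OF s(1)] sfL] xA vr_sub[OF prD(1)[OF W'(1)]]] by simp
 qed
 \<comment> \<open>Multiplication by \<open>ev T g\<close>, a unit at \<open>W\<close>, moves
   \<open>x\<close> into \<open>Og\<close>, so that the hypothesis on traces applies and contradicts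
   the choice of \<open>x\<close>.\<close>
 then obtain g where g: "ev T g ~: mx (W Int k0)" "ev T g * x : Og"
 using denominator_at[OF xA pr_base[OF W(1)] W(2)] by blast
 have "ev T g ~: mx W" using g(1) mx_Int[OF v sfF] evA by auto
 then have u: "inverse (ev T g) : W" "ev T g ~= 0" using mx_unit[OF ev_in_W[OF W]] by auto
 have "(SUM s:G. s (ev T g * x * y)) = ev T g * (SUM s:G. s (x * y))"
 proof -
 have "s (ev T g * x * y) = ev T g * s (x * y)" if s: "s : G" for s
  using rhom_mult[OF auts_rhom[OF s] evA(1)[of g], of "x * y"] auts_fix[OF s evA(2)] xA y sfL
  by (simp add: sfd_mult mult.assoc)
 then show ?thesis by (simp add: sum_distrib_left)
 qed
 moreover have "(SUM s:G. s (ev T g * x * y)) : W" using tr[OF g(2)] ev_in_W[OF W] by auto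
 ultimately have "inverse (ev T g) * (ev T g * (SUM s:G. s (x * y))) : W" using vr_mult[OF v u(1)] by simp
 then show False using x(3) u(2) by (simp add: mult.assoc[symmetric])
qed

text \<open>The product formula in disguise: the norm is a polynomial in \<open>T\<close> that
  vanishes at infinity, hence zero.\<close>

lemma Og_small:
 assumes z: "z : Og" and s: "!!s. s : G ==> s z : W0" and u: "u : G" "u z : mx W0"
 shows "z = 0"
proof -
 have "(PROD s:G. s z) : Og" using Og_stable[OF z] by (rule Og_prod)
 then obtain f where f: "(PROD s:G. s z) = ev T f" using Og_base norm_F[OF Og_A[OF z]] by blast
 have "(PROD s:G. s z) : mx W0" using s u by (intro mx_prod[OF W.vr finG, of "%s. s z" u]) auto
 then have "f = 0" using f ev_mx_infinity by simp
 then have "(PROD s:G. s z) = 0" using f by simp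
 then obtain s where "s : G" "s z = 0" using finG by (auto simp: prod_zero_iff)
 then show ?thesis using rhom_eq_0[OF auts_rhom sfL Og_A[OF z]] by auto
qed

end

text \<open>A square linear system over a finite field: the map on the finite set of vectors is
  surjective, hence injective by counting.\<close>

lemma finite_surj_coordinates:
 fixes l :: "'i => 'i => 'q::{field,finite}"
 assumes "finite I" and sp: "!!v. EX c. ALL s:I. v s = (SUM i:I. c i * l i s)"
 and z: "!!s. s : I ==> (SUM i:I. c i * l i s) = 0" and i: "i : I"
 shows "c i = 0"
proof -
 define P where "P = PiE I (%_. UNIV :: 'q set)"
 define \<Phi> where "\<Phi> = (%c. restrict (%s. SUM i:I. c i * l i s) I)"
 have "finite P" unfolding P_def using assms(1) by (intro finite_PiE) auto
 moreover have "P <= \<Phi> ` P"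
 proof
 fix v assume v: "v : P"
 obtain c where c: "ALL s:I. v s = (SUM i:I. c i * l i s)" using sp by blast
 have "v = \<Phi> (restrict c I)" unfolding \<Phi>_def
  using c v by (intro ext) (auto simp: P_def PiE_iff extensional_def)
 then show "v : \<Phi> ` P" by (auto simp: P_def)
 qed
 ultimately have inj: "inj_on \<Phi> P" by (rule finite_surj_inj)
 have "\<Phi> (restrict c I) = \<Phi> (restrict (%_. 0) I)"
 using z by (intro ext) (auto simp: \<Phi>_def)
 then have "restrict c I = restrict (%_. 0) I" by (rule inj_onD[OF inj]) (auto simp: P_def)
 then show ?thesis using i by (metis restrict_apply')
qed

section \<open>Reduced integral bases with respect to the infinite primes\<close>

context split_unr
begin

text \<open>A filtration by pole order at all infinite primes at once. The vector
  \<open>lead e x\<close> collects the coefficients of \<open>T ^ e\<close> in the expansions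
  there.\<close>

definition lev :: "nat => 'q ratfun_ac set" where
 "lev e = {x : A. ALL s:G. s x * inverse T ^ e : W0}"

definition lead :: "nat => 'q ratfun_ac => ('q ratfun_ac => 'q ratfun_ac) => 'q" where
 "lead e x s = res (s x * inverse T ^ e)"

lemma lev_A: "x : lev e ==> x : A" and lev_W0: "x : lev e ==> s : G ==> s x * inverse T ^ e : W0"
 by (auto simp: lev_def)

lemma iT_mx: "inverse T : mx W0"
 using mx_T[OF TA(2)] vr_1[OF W.vr] by simp

lemma shift_W0: assumes "z * inverse T ^ e : W0" "e <= f" shows "z * inverse T ^ f : W0"
proof -
 have "z * inverse T ^ f = z * inverse T ^ e * inverse T ^ (f - e)"
 using assms(2) by (simp add: mult.assoc flip: power_add)
 moreover have "z * inverse T ^ e * inverse T ^ (f - e) : W0"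
 by (rule vr_mult[OF W.vr assms(1) vr_power[OF W.vr mx_sub[OF iT_mx]]])
 ultimately show ?thesis by metis
qed

lemma degree_ex: assumes "z : A" shows "EX e. z * inverse T ^ e : W0"
proof (cases "z = 0")
 case False
 have p: "inverse T ^ e : A" for e using TA(2) sfL by (simp add: sfd_power)
 have v: "W.nu (inverse T) >= 1" using iT_mx by (simp add: W.mx_eq pw_def)
 define e where "e = nat (- W.nu z)"
 have "int e * 1 <= int e * W.nu (inverse T)" using v by (intro mult_left_mono) auto
 moreover have "- W.nu z <= int e" by (simp add: e_def)
 moreover have "W.nu (z * inverse T ^ e) = W.nu z + int e * W.nu (inverse T)"
 using W.ord_mult[OF assms p[of e]] W.ord_power[OF TA(2), of e] False by simp
 ultimately have "0 <= W.nu (z * inverse T ^ e)" by simp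
 then show ?thesis using W.mem_iff[of "z * inverse T ^ e"] False assms p sfL by (auto simp: sfd_mult)
qed (use vr_0[OF W.vr] in auto)

lemma lev_ex: assumes "x : A" shows "EX e. x : lev e"
proof -
 have "ALL s:G. EX e. s x * inverse T ^ e : W0" using degree_ex auts_in[OF _ assms] by blast
 then obtain e where e: "!!s. s : G ==> s x * inverse T ^ e s : W0" by metis
 have "x : lev (SUM s:G. e s)"
 unfolding lev_def using assms shift_W0[OF e] member_le_sum[of _ G e] finG by auto
 then show ?thesis by blast
qed

lemma mx_down: assumes "z : A" "z * inverse T ^ Suc e : mx W0" shows "z * inverse T ^ e : W0"
proof -
 have "z * inverse T ^ Suc e : A" using assms TA(2) sfL by (intro sfd_mult sfd_power) auto
 then have "z * inverse T ^ Suc e * T : W0" using mx_T assms(2) by blast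
 moreover have "z * inverse T ^ Suc e * T = z * inverse T ^ e * (inverse T * T)" by (simp only: power_Suc mult_ac)
 moreover have "inverse T * T = (1 :: 'q ratfun_ac)" by simp
 ultimately show ?thesis by (metis mult.right_neutral)
qed

text \<open>At the least possible level the leading vector cannot vanish, since otherwise the level
  could be lowered; at level zero this is excluded by \<open>Og_small\<close>.\<close>

lemma lev_least: assumes x: "x : Og" "x ~= 0" shows "EX e. x : lev e & (EX s:G. lead e x s ~= 0)"
proof -
 obtain e where e: "x : lev e" "!!f. x : lev f ==> e <= f"
 using lev_ex[OF Og_A[OF x(1)]] LeastI_ex[of "%e. x : lev e"] Least_le[of "%e. x : lev e"] by blast
 have "EX s:G. lead e x s ~= 0"
 proof (rule ccontr)
 assume "~ ?thesis"
 then have m: "s x * inverse T ^ e : mx W0" if "s : G" for s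
  using that res_0_iff[OF lev_W0[OF e(1) that]] by (auto simp: lead_def)
 show False
 proof (cases e)
  case 0
  have m0: "s x : mx W0" if "s : G" for s using m[OF that] 0 by simp
  have "x = 0" by (rule Og_small[OF x(1) _ G_id]) (use m0[OF G_id] mx_sub[OF m0] in simp_all)
  then show False using x by simp
 next
  case (Suc f)
  have "s x * inverse T ^ f : W0" if s: "s : G" for s
  by (rule mx_down[OF auts_in[OF s Og_A[OF x(1)]] m[OF s, unfolded Suc]])
  then have "x : lev f" using Og_A[OF x(1)] by (simp add: lev_def)
  then show False using e(2) Suc by fastforce
 qed
 qed
 then show ?thesis using e by blast
qed

text \<open>A reduced lattice basis. Indexing by \<open>G\<close> makes the number of elements equal
  to the degree, so that spanning leading vectors are also independent.\<close>

definition frame :: "(('q ratfun_ac => 'q ratfun_ac) => 'q ratfun_ac) => (('q ratfun_ac => 'q ratfun_ac) => nat) => bool" where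
 "frame x d \<longleftrightarrow> (ALL i:G. x i : Og & x i : lev (d i)) &
 (ALL v. EX c. ALL s:G. v s = (SUM i:G. c i * lead (d i) (x i) s))"

text \<open>Elements reducing to the unit vectors at infinity are made integral by a common
  denominator \<open>h\<close>. As \<open>ev T h\<close> is fixed by \<open>G\<close>, its leading
  vector is constant with entry \<open>r\<close>, and the leading vectors become \<open>r\<close>
  times unit vectors.\<close>

lemma frame_ex: "EX x d. frame x d"
proof -
 have "ALL i:G. EX z:A. i z - 1 : mx W0 & (ALL s:G. s ~= i --> s z : mx W0)"
 using local_value[of _ 1] rhom_1[OF auts_rhom] sfL by (metis sfd_1)
 then have "EX z. ALL i:G. z i : A & i (z i) - 1 : mx W0 & (ALL s:G. s ~= i --> s (z i) : mx W0)"
 by (intro bchoice) blast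
 then obtain z where z: "!!i. i : G ==> z i : A" "!!i. i : G ==> i (z i) - 1 : mx W0"
 "!!i s. i : G ==> s : G ==> s ~= i ==> s (z i) : mx W0" by blast
 obtain g where g: "!!i. i : G ==> g i ~= 0" "!!i. i : G ==> ev T (g i) * z i : Og" using denominator[OF z(1)] by metis
 define h where "h = (PROD i:G. g i)"
 define x where "x = (%i. ev T h * z i)"
 have h0: "h ~= 0" using g finG by (auto simp: h_def)
 have sh: "s (ev T h) = ev T h" if "s : G" for s using auts_fix[OF that evA(2)] .
 obtain e s where e: "ev T h : lev e" "s : G" "lead e (ev T h) s ~= 0"
 using lev_least[OF Og_ev[of h]] h0 by auto
 define r where "r = lead e (ev T h) s"
 have hW: "ev T h * inverse T ^ e : W0" using lev_W0[OF e(1,2)] sh[OF e(2)] by simp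
 have r: "res (ev T h * inverse T ^ e) = r" using sh[OF e(2)] by (simp add: r_def lead_def)
 have z1: "res (s (z i)) = (if s = i then 1 else 0)" "s (z i) : W0" if "i : G" "s : G" for i s
 proof -
 have m: "s (z i) - const (if s = i then 1 else 0) : mx W0" using z that by auto
 from resI[OF m] show "res (s (z i)) = (if s = i then 1 else 0)" .
 show "s (z i) : W0" using vr_add[OF W.vr mx_sub[OF m] W0_const[of "if s = i then 1 else 0"]] by simp
 qed
 have sx: "s (x i) * inverse T ^ e = ev T h * inverse T ^ e * s (z i)" if "i : G" "s : G" for i s
 using rhom_mult[OF auts_rhom[OF that(2)] evA(1)[of h] z(1)[OF that(1)]] sh[OF that(2)] by (simp add: x_def)
 have l: "lead e (x i) s = (if s = i then r else 0)" if "i : G" "s : G" for i s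
 unfolding lead_def sx[OF that] res_mult[OF hW z1(2)[OF that]] r z1(1)[OF that] by simp
 have "x i : Og" if i: "i : G" for i
 proof -
 have "h = (PROD j:G - {i}. g j) * g i" using prod.remove[OF finG i, of g] by (simp add: h_def mult.commute)
 then have "x i = ev T (PROD j:G - {i}. g j) * (ev T (g i) * z i)" by (simp add: x_def ev_mult mult.assoc)
 then show ?thesis using Og_mult[OF Og_ev g(2)[OF i]] by simp
 qed
 moreover have "x i : lev e" if i: "i : G" for i
 proof -
 have "s (x i) * inverse T ^ e : W0" if "s : G" for s
  unfolding sx[OF i that] by (rule vr_mult[OF W.vr hW z1(2)[OF i that]])
 then show ?thesis using evA(1) z(1)[OF i] sfL by (simp add: lev_def x_def sfd_mult)
 qed
 moreover have "EX c. ALL s:G. v s = (SUM i:G. c i * lead e (x i) s)" for v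
 proof (rule exI[of _ "%i. v i / r"], rule ballI)
 fix s assume s: "s : G"
 have "(SUM i:G. (v i / r) * lead e (x i) s) = (SUM i:G. if s = i then v i else 0)"
 proof (intro sum.cong refl)
  fix i assume i: "i : G"
  have "r ~= 0" using e(3) by (simp add: r_def)
  then show "(v i / r) * lead e (x i) s = (if s = i then v i else 0)" using l[OF i s] by simp
 qed
 also have "... = v s" using finG s by simp
 finally show "v s = (SUM i:G. (v i / r) * lead e (x i) s)" by (rule sym)
 qed
 ultimately have "frame x (%_. e)" unfolding frame_def by blast
 then show ?thesis by blast
qed

text \<open>Steinitz exchange: since \<open>c i0\<close> is nonzero, the replaced leading vector is
  recovered from that of \<open>y\<close> and the others.\<close>

lemma frame_exchange:
 assumes f: "frame x d" and i0: "i0 : G" "c i0 ~= 0" and y: "y : Og" "y : lev e"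
 and c: "!!s. s : G ==> lead e y s = (SUM i:G. c i * lead (d i) (x i) s)"
 shows "frame (x(i0 := y)) (d(i0 := e))"
proof -
 define l where "l = (%i. lead (d i) (x i))"
 define l' where "l' = (%i. lead ((d(i0 := e)) i) ((x(i0 := y)) i))"
 have "EX b. ALL s:G. v s = (SUM i:G. b i * l' i s)" for v
 proof -
 obtain a where a: "ALL s:G. v s = (SUM i:G. a i * l i s)" using f unfolding frame_def l_def by blast
 define k where "k = a i0 / c i0"
 define b where "b = (%i. if i = i0 then k else a i - k * c i)"
 have "v s = (SUM i:G. b i * l' i s)" if s: "s : G" for s
 proof -
  have y': "lead e y s = c i0 * l i0 s + (SUM i:G - {i0}. c i * l i s)"
  using c[OF s] sum.remove[OF finG i0(1), of "%i. c i * l i s"] by (simp add: l_def)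
  have k: "k * c i0 = a i0" using i0 by (simp add: k_def)
  have "(SUM i:G. b i * l' i s) = b i0 * l' i0 s + (SUM i:G - {i0}. b i * l' i s)" by (rule sum.remove[OF finG i0(1)])
  also have "(SUM i:G - {i0}. b i * l' i s) = (SUM i:G - {i0}. a i * l i s - k * (c i * l i s))"
  by (intro sum.cong) (auto simp: b_def l'_def l_def algebra_simps)
  also have "... = (SUM i:G - {i0}. a i * l i s) - k * (SUM i:G - {i0}. c i * l i s)"
  by (simp add: sum_subtractf sum_distrib_left)
  also have "b i0 * l' i0 s = k * lead e y s" by (simp add: b_def l'_def)
  finally have "(SUM i:G. b i * l' i s) = (k * c i0) * l i0 s + (SUM i:G - {i0}. a i * l i s)"
  unfolding y' by (simp add: algebra_simps)
  then show ?thesis using a s k sum.remove[OF finG i0(1), of "%i. a i * l i s"] by simp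
 qed
 then show ?thesis by blast
 qed
 then show ?thesis using f y unfolding frame_def l'_def by auto
qed

text \<open>Dividing a relation by the coefficient with the largest pole, adjusted by the degrees,
  and taking residues at every conjugate gives a relation of the leading vectors with coefficient
  one at \<open>j\<close>.\<close>

lemma frame_independent:
 assumes f: "frame x d" and c: "!!i. i : G ==> c i : k0" and z: "(SUM i:G. c i * x i) = 0" and i: "i : G"
 shows "c i = 0"
proof (rule ccontr)
 assume "c i ~= 0"
 define w where "w = (%i. c i * T ^ d i)"
 define J where "J = {i : G. c i ~= 0}"
 have J: "finite J" "J ~= {}" using finG i `c i ~= 0` by (auto simp: J_def)
 obtain j where j: "j : J" "!!i. i : J ==> W.nu (w j) <= W.nu (w i)"
 using arg_min_if_finite[OF J, of "%i. W.nu (w i)"] leI by blast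
 have jG: "j : G" using j by (simp add: J_def)
 have w: "w i : A" if "i : G" for i using c[OF that] FL TA(1) sfL by (auto simp: w_def sfd_mult sfd_power)
 have wj: "w j ~= 0" using j by (auto simp: J_def w_def)
 have wW: "w i / w j : W0" if i: "i : G" for i
 proof (cases "c i = 0")
 case False
 then have "w i ~= 0" "i : J" using i by (auto simp: w_def J_def)
 then show ?thesis using W.mem_iff[of "w i / w j"] W.ord_divide[OF w[OF i] w[OF jG]] wj j(2) w[OF i] w[OF jG] sfL
  by (simp add: sfd_divide)
 qed (use vr_0[OF W.vr] in "simp add: w_def")
 have "res (w j / w j) = 0"
 proof (rule finite_surj_coordinates[OF finG, of "%i. lead (d i) (x i)" "%i. res (w i / w j)" j])
 show "EX c. ALL s:G. v s = (SUM i:G. c i * lead (d i) (x i) s)" for v using f by (auto simp: frame_def)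
 show "j : G" by fact
 fix s assume s: "s : G"
 have xA: "x i : A" "s (x i) * inverse T ^ d i : W0" if "i : G" for i
  using f that s by (auto simp: frame_def Og_def lev_def)
 have cA: "c i : A" if "i : G" for i using c[OF that] FL by auto
 have e: "(w i / w j) * (s (x i) * inverse T ^ d i) = c i * s (x i) / w j" for i
 proof -
  have "T ^ d i * inverse T ^ d i = (1 :: 'q ratfun_ac)" by (simp flip: power_mult_distrib)
  moreover have "w i * (s (x i) * inverse T ^ d i) = c i * s (x i) * (T ^ d i * inverse T ^ d i)"
  unfolding w_def by (simp only: mult_ac)
  ultimately have "w i * (s (x i) * inverse T ^ d i) = c i * s (x i)" by (simp only: mult_1_right)
  then show ?thesis by (metis times_divide_eq_left)
 qed
 have "(SUM i:G. res (w i / w j) * lead (d i) (x i) s) = (SUM i:G. res ((w i / w j) * (s (x i) * inverse T ^ d i)))"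
  unfolding lead_def by (intro sum.cong refl res_mult[symmetric] wW xA)
 also have "... = res (SUM i:G. (w i / w j) * (s (x i) * inverse T ^ d i))"
  by (intro res_sum[symmetric] vr_mult[OF W.vr] wW xA)
 also have "(SUM i:G. (w i / w j) * (s (x i) * inverse T ^ d i)) = (SUM i:G. c i * s (x i)) / w j"
  unfolding sum_divide_distrib by (rule sum.cong[OF refl e])
 also have "(SUM i:G. c i * s (x i)) = (SUM i:G. s (c i * x i))"
 proof (intro sum.cong refl)
  fix i assume i: "i : G"
  show "c i * s (x i) = s (c i * x i)"
  using rhom_mult[OF auts_rhom[OF s] cA[OF i] xA(1)[OF i]] auts_fix[OF s c[OF i]] by simp
 qed
 also have "... = s (SUM i:G. c i * x i)"
  using cA xA sfL by (intro rhom_sum[OF auts_rhom[OF s] sfL, symmetric]) (auto simp: sfd_mult)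
 also have "... = 0" unfolding z using rhom_0[OF auts_rhom[OF s] sfL] .
 finally show "(SUM i:G. res (w i / w j) * lead (d i) (x i) s) = 0" by simp
 qed
 then show False using wj res_const[of 1] by simp
qed

text \<open>Induction on the pole order. If a vector with \<open>d i > e\<close> occurred in the
  expansion of the leading vector of \<open>y\<close>, exchanging it for \<open>y\<close> would
  lower the minimal sum of degrees. So the leading term is cancelled by polynomial multiples of the
  \<open>x i\<close>.\<close>

lemma frame_span:
 assumes f: "frame x d" and min: "!!x' d'. frame x' d' ==> (SUM i:G. d i) <= (SUM i:G. d' i)"
 shows "y : Og ==> y : lev e ==> EX p. y = (SUM i:G. ev T (p i) * x i)"
proof (induction e arbitrary: y rule: less_induct)
 case (less e)
 obtain c where c: "ALL s:G. lead e y s = (SUM i:G. c i * lead (d i) (x i) s)" using f unfolding frame_def by blast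
 have x: "x i : Og" "x i : A" "x i : lev (d i)" if "i : G" for i using f that by (auto simp: frame_def Og_def)
 have de: "d i <= e" if i: "i : G" "c i ~= 0" for i
 proof (rule ccontr)
 assume n: "~ d i <= e"
 have "(SUM j:G. d j) <= (SUM j:G. (d(i := e)) j)"
  using min[OF frame_exchange[where c = c, OF f i less.prems]] c by blast
 moreover have "(SUM j:G. (d(i := e)) j) < (SUM j:G. d j)"
  using n i finG by (intro sum_strict_mono_ex1) auto
 ultimately show False by simp
 qed
 define q where "q = (%i. if c i = 0 then 0 else monom (c i) (e - d i))"
 define y' where "y' = y - (SUM i:G. ev T (q i) * x i)"
 have y'O: "y' : Og" unfolding y'_def by (intro Og_diff less.prems Og_sum Og_mult Og_ev x)
 have qm: "ev T (q i) * z * inverse T ^ e = const (c i) * (z * inverse T ^ d i)" if i: "i : G" for i z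
 proof (cases "c i = 0")
 case False
 have "T ^ (e - d i) * inverse T ^ e = (inverse T ^ d i :: 'q ratfun_ac)"
 proof -
  have "inverse T ^ e = (inverse T ^ (e - d i) * inverse T ^ d i :: 'q ratfun_ac)"
  using de[OF i False] by (simp only: power_add[symmetric]) simp
  moreover have "T ^ (e - d i) * inverse T ^ (e - d i) = (1 :: 'q ratfun_ac)" by (simp flip: power_mult_distrib)
  ultimately show ?thesis by (simp only: mult.assoc[symmetric] mult_1_left)
 qed
 then have "T ^ (e - d i) * (z * inverse T ^ e) = z * inverse T ^ d i" by (metis mult.left_commute)
 then show ?thesis using False by (simp add: q_def ev_monom mult.assoc)
 qed (simp add: q_def)
 have m: "s y' * inverse T ^ e : mx W0" if s: "s : G" for s
 proof -
 have qA: "ev T (q i) * x i : A" if "i : G" for i using evA x that sfL by (simp add: sfd_mult)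
 have "s y' = s y - (SUM i:G. s (ev T (q i) * x i))"
 proof -
  have "(SUM i:G. ev T (q i) * x i) : A" by (rule sfd_sum[OF sfL]) (rule qA)
  from rhom_diff[OF auts_rhom[OF s] sfL Og_A[OF less.prems(1)] this]
  have "s y' = s y - s (SUM i:G. ev T (q i) * x i)" by (simp only: y'_def)
  moreover have "s (SUM i:G. ev T (q i) * x i) = (SUM i:G. s (ev T (q i) * x i))"
  by (rule rhom_sum[OF auts_rhom[OF s] sfL]) (rule qA)
  ultimately show ?thesis by simp
 qed
 also have "(SUM i:G. s (ev T (q i) * x i)) = (SUM i:G. ev T (q i) * s (x i))"
 proof (intro sum.cong refl)
  fix i assume i: "i : G"
  show "s (ev T (q i) * x i) = ev T (q i) * s (x i)"
  using rhom_mult[OF auts_rhom[OF s] evA(1)[of "q i"] x(2)[OF i]] auts_fix[OF s evA(2)] by simp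
 qed
 finally have "s y' * inverse T ^ e = s y * inverse T ^ e - (SUM i:G. ev T (q i) * s (x i) * inverse T ^ e)"
  by (simp add: left_diff_distrib sum_distrib_right)
 also have "(SUM i:G. ev T (q i) * s (x i) * inverse T ^ e) = (SUM i:G. const (c i) * (s (x i) * inverse T ^ d i))"
  by (intro sum.cong refl qm)
 finally have eq: "s y' * inverse T ^ e = s y * inverse T ^ e - (SUM i:G. const (c i) * (s (x i) * inverse T ^ d i))" .
 have xw: "const (c i) * (s (x i) * inverse T ^ d i) : W0" if "i : G" for i
  using lev_W0[OF x(3)[OF that] s] W0_const vr_mult[OF W.vr] by blast
 have S: "(SUM i:G. const (c i) * (s (x i) * inverse T ^ d i)) : W0" by (rule vr_sum[OF W.vr xw])
 have "res (SUM i:G. const (c i) * (s (x i) * inverse T ^ d i)) = (SUM i:G. c i * lead (d i) (x i) s)"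
 proof -
  have "res (SUM i:G. const (c i) * (s (x i) * inverse T ^ d i)) = (SUM i:G. res (const (c i) * (s (x i) * inverse T ^ d i)))"
  by (rule res_sum) (rule xw)
  also have "... = (SUM i:G. c i * lead (d i) (x i) s)"
  unfolding lead_def by (intro sum.cong refl) (use res_mult[OF W0_const lev_W0[OF x(3) s]] in simp)
  finally show ?thesis .
 qed
 then have "res (SUM i:G. const (c i) * (s (x i) * inverse T ^ d i)) = res (s y * inverse T ^ e)"
  using c s by (simp add: lead_def)
 then have "(s y * inverse T ^ e - const (res (s y * inverse T ^ e))) -
  ((SUM i:G. const (c i) * (s (x i) * inverse T ^ d i)) - const (res (s y * inverse T ^ e))) : mx W0"
  by (metis mx_diff[OF W.vr res[OF lev_W0[OF less.prems(2) s]] res[OF S]])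
 then show ?thesis unfolding eq by simp
 qed
 have "EX p. y' = (SUM i:G. ev T (p i) * x i)"
 proof (cases e)
 case 0
 have m0: "s y' : mx W0" if "s : G" for s using m[OF that] 0 by simp
 have "y' = 0" by (rule Og_small[OF y'O _ G_id]) (use m0[OF G_id] mx_sub[OF m0] in simp_all)
 then show ?thesis by (intro exI[of _ "%_. 0"]) simp
 next
 case (Suc k)
 have "s y' * inverse T ^ k : W0" if s: "s : G" for s
  by (rule mx_down[OF auts_in[OF s Og_A[OF y'O]] m[OF s, unfolded Suc]])
 then have "y' : lev k" using Og_A[OF y'O] by (simp add: lev_def)
 then show ?thesis using less.IH[of k y'] y'O Suc by simp
 qed
 then obtain p where "y' = (SUM i:G. ev T (p i) * x i)" by blast
 then have "y = (SUM i:G. ev T (p i + q i) * x i)"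
 by (simp add: y'_def ev_add distrib_right sum.distrib algebra_simps)
 then show ?case by (rule exI[of _ "%i. p i + q i"])
qed

theorem trivial: "A = k0"
proof -
 obtain x d where f: "frame x d" and min: "!!x' d'. frame x' d' ==> (SUM i:G. d i) <= (SUM i:G. d' i)"
 proof -
 define P where "P = (%(x, d). frame x d)"
 obtain xd0 where "P xd0" using frame_ex by (auto simp: P_def)
 from ex_has_least_nat[of P, OF this, of "%xd. SUM i:G. snd xd i"]
 obtain xd where "P xd" "!!xd'. P xd' ==> (SUM i:G. snd xd i) <= (SUM i:G. snd xd' i)" by blast
 then show ?thesis using that[of "fst xd" "snd xd"] by (auto simp: P_def)
 qed
 have x: "x i : Og" "x i : A" "x i : lev (d i)" if "i : G" for i using f that by (auto simp: frame_def Og_def)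
 have span: "EX p. y = (SUM i:G. ev T (p i) * x i)" if yO: "y : Og" for y
 proof -
 obtain e where "y : lev e" using lev_ex[OF Og_A[OF yO]] by blast
 from frame_span[OF f _ yO this] min show ?thesis by blast
 qed
 have "EX c. (ALL i:G. c i : k0) & y = (SUM i:G. c i * x i)" if y: "y : A" for y
 proof -
 obtain g where g: "g ~= 0" "ev T g * y : Og" using denominator[OF y] by blast
 obtain p where p: "ev T g * y = (SUM i:G. ev T (p i) * x i)" using span[OF g(2)] by blast
 have "y = (ev T g * y) / ev T g" using g(1) by simp
 also have "... = (SUM i:G. ev T (p i) / ev T g * x i)" unfolding p by (simp add: sum_divide_distrib)
 finally show ?thesis using sfF evA(2) by (intro exI[of _ "%i. ev T (p i) / ev T g"]) (auto simp: sfd_divide)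
 qed
 then have "EX l. ALL y:A. (ALL i:G. l y i : k0) & y = (SUM i:G. l y i * x i)" by (intro bchoice) blast
 then obtain l where l: "!!y i. y : A ==> i : G ==> l y i : k0" "!!y. y : A ==> y = (SUM i:G. l y i * x i)" by blast
 have uniq: "c i = b i" if "!!i. i : G ==> c i : k0" "!!i. i : G ==> b i : k0"
 "(SUM i:G. c i * x i) = (SUM i:G. b i * x i)" "i : G" for b c i
 proof -
 have "c i - b i = 0"
  by (rule frame_independent[OF f _ _ that(4)])
  (use that sfF in "auto simp: sfd_diff left_diff_distrib sum_subtractf")
 then show ?thesis by simp
 qed
 obtain n :: nat and a b where ab: "!!j. j < n ==> a j : A & b j : A"
 "!!x. x : A ==> x = (SUM j<n. a j * (SUM s:G. s (x * b j)))" by (rule dual_basis) blast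
 \<comment> \<open>The coordinate \<open>l z i\<close> is linear in \<open>z\<close>; the dual
   family writes it as the trace of \<open>z * y i\<close>, so \<open>y\<close> is the basis dual to
   \<open>x\<close>.\<close>
 define y where "y = (%i. SUM j<n. b j * l (a j) i)"
 have lA: "l z i : A" if "z : A" "i : G" for z i using l(1)[OF that] FL by auto
 have yA: "y i : A" if "i : G" for i
 unfolding y_def using ab(1) lA that sfL by (intro sfd_sum sfd_mult) auto
 have tr: "(SUM s:G. s (z * y i)) = l z i" if z: "z : A" and i: "i : G" for z i
 proof -
 define t where "t = (%j. SUM s:G. s (z * b j))"
 have tF: "t j : k0" if "j < n" for j unfolding t_def using ab(1)[OF that] z sfL by (intro trace_F) (auto simp: sfd_mult)
 have "(SUM s:G. s (z * y i)) = (SUM s:G. SUM j<n. s (z * b j) * l (a j) i)"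
 proof (intro sum.cong refl)
  fix s assume s: "s : G"
  have zb: "z * b j * l (a j) i : A" "z * b j : A" if "j < n" for j using ab(1)[OF that] lA i z sfL by (auto simp: sfd_mult)
  have "z * y i = (SUM j<n. z * b j * l (a j) i)" by (simp add: y_def sum_distrib_left mult.assoc)
  then have "s (z * y i) = (SUM j<n. s (z * b j * l (a j) i))" using rhom_sum[OF auts_rhom[OF s] sfL, of "{..<n}"] zb by simp
  also have "... = (SUM j<n. s (z * b j) * l (a j) i)"
  proof (intro sum.cong refl)
  fix j assume "j : {..<n}"
  then have j: "j < n" by simp
  have aj: "a j : A" using ab(1)[OF j] by simp
  show "s (z * b j * l (a j) i) = s (z * b j) * l (a j) i"
   using rhom_mult[OF auts_rhom[OF s] zb(2)[OF j] lA[OF aj i]] auts_fix[OF s l(1)[OF aj i]] by simp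
  qed
  finally show "s (z * y i) = (SUM j<n. s (z * b j) * l (a j) i)" .
 qed
 also have "... = (SUM j<n. t j * l (a j) i)" unfolding t_def by (subst sum.swap) (simp add: sum_distrib_right)
 also have "... = l z i"
 proof (rule uniq[OF _ _ _ i, of "%i. SUM j<n. t j * l (a j) i"])
  show "(SUM j<n. t j * l (a j) i) : k0" if "i : G" for i using tF ab(1) l(1) that sfF by (intro sfd_sum sfd_mult) auto
  show "l z i : k0" if "i : G" for i using l(1)[OF z that] .
  have "(SUM i:G. l z i * x i) = (SUM j<n. a j * t j)" using ab(2)[OF z] l(2)[OF z] by (simp add: t_def)
  also have "... = (SUM j<n. (SUM i:G. l (a j) i * x i) * t j)"
  proof (intro sum.cong refl)
  fix j assume "j : {..<n}"
  then have "a j = (SUM i:G. l (a j) i * x i)" using ab(1)[of j] by (intro l(2)) simp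
  then show "a j * t j = (SUM i:G. l (a j) i * x i) * t j" by (rule arg_cong)
  qed
  also have "... = (SUM j<n. SUM i:G. t j * l (a j) i * x i)"
  by (intro sum.cong refl) (simp add: sum_distrib_left mult_ac)
  also have "... = (SUM i:G. (SUM j<n. t j * l (a j) i) * x i)"
  by (subst sum.swap) (simp add: sum_distrib_right)
  finally show "(SUM i:G. (SUM j<n. t j * l (a j) i) * x i) = (SUM i:G. l z i * x i)" by simp
 qed
 finally show ?thesis .
 qed
 have yO: "y i : Og" if i: "i : G" for i
 proof (rule self_dual[OF yA[OF i]])
 fix z assume z: "z : Og"
 obtain p where p: "z = (SUM i:G. ev T (p i) * x i)" using span[OF z] by blast
 have "l z i = ev T (p i)"
  by (rule uniq[OF _ _ _ i]) (use l Og_A[OF z] evA(2) p in auto)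
 then show "(SUM s:G. s (z * y i)) : range (ev T)" using tr[OF Og_A[OF z] i] by simp
 qed
 have lx: "l (x i) j = (if i = j then 1 else 0)" if "i : G" "j : G" for i j
 proof (rule uniq[of "l (x i)" "%j. if i = j then 1 else 0", OF _ _ _ that(2)])
 show "(SUM j:G. l (x i) j * x j) = (SUM j:G. (if i = j then 1 else 0) * x j)"
  using l(2)[OF x(2)[OF that(1)]] finG that(1) by (simp add: if_distrib[of "%a. a * _"] cong: if_cong)
 qed (use l(1)[OF x(2)[OF that(1)]] sfF in auto)
 have d0: "d j = 0" if j: "j : G" for j
 proof (rule ccontr)
 assume dj: "d j ~= 0"
 have "y j ~= 0"
 proof
  assume "y j = 0"
  have "(SUM s:G. s (x j * y j)) = 0"
  proof (rule sum.neutral, rule ballI)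
  fix s assume s: "s : G"
  show "s (x j * y j) = 0" using rhom_0[OF auts_rhom[OF s] sfL] `y j = 0` by simp
  qed
  then show False using tr[OF x(2)[OF j] j] lx[OF j j] by simp
 qed
 then obtain e s0 where e: "y j : lev e" "s0 : G" "lead e (y j) s0 ~= 0" using lev_least[OF yO[OF j]] by blast
 \<comment> \<open>The trace of \<open>x i * y j\<close> is one or zero. Multiplied by
   \<open>inverse T ^ (d i + e)\<close> it has residue zero, for \<open>i = j\<close> because
   \<open>d j > 0\<close>; so the nonzero leading vector of \<open>y j\<close> is orthogonal to
   vectors that span everything.\<close>
 have orth: "(SUM s:G. lead (d i) (x i) s * lead e (y j) s) = 0" if i: "i : G" for i
 proof -
  have w: "s (x i) * inverse T ^ d i : W0" "s (y j) * inverse T ^ e : W0" if "s : G" for s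
  using lev_W0[OF x(3)[OF i] that] lev_W0[OF e(1) that] .
  have "(SUM s:G. lead (d i) (x i) s * lead e (y j) s) = res (SUM s:G. (s (x i) * inverse T ^ d i) * (s (y j) * inverse T ^ e))"
  unfolding lead_def using w by (subst res_sum) (auto simp: res_mult vr_mult[OF W.vr])
  also have "(SUM s:G. (s (x i) * inverse T ^ d i) * (s (y j) * inverse T ^ e)) = (SUM s:G. s (x i * y j)) * (inverse T ^ d i * inverse T ^ e)"
  unfolding sum_distrib_right
  proof (intro sum.cong refl)
  fix s assume s: "s : G"
  show "(s (x i) * inverse T ^ d i) * (s (y j) * inverse T ^ e) = s (x i * y j) * (inverse T ^ d i * inverse T ^ e)"
   unfolding rhom_mult[OF auts_rhom[OF s] x(2)[OF i] yA[OF j]] by (simp only: mult_ac)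
  qed
  also have "(SUM s:G. s (x i * y j)) = (if i = j then 1 else 0)" using tr[OF x(2)[OF i] j] lx[OF i j] by simp
  finally have eq: "(SUM s:G. lead (d i) (x i) s * lead e (y j) s) = res ((if i = j then 1 else 0) * (inverse T ^ d i * inverse T ^ e))" .
  show ?thesis
  proof (cases "i = j")
  case True
  obtain k where k: "d j + e = Suc k" using dj by (cases "d j + e") auto
  have "inverse T ^ d j * inverse T ^ e = inverse T * inverse T ^ k" using k by (metis power_Suc power_add)
  also have "... : mx W0" by (intro mx_mult[OF W.vr iT_mx] vr_power[OF W.vr] mx_sub[OF iT_mx])
  finally show ?thesis using eq True resI[of _ 0] by simp
  qed (use eq in simp)
 qed
 obtain c where c: "ALL s:G. (if s = s0 then 1 else 0) = (SUM i:G. c i * lead (d i) (x i) s)"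
  using f unfolding frame_def by (elim conjE allE[of _ "%s. if s = s0 then 1 else 0"]) blast
 have "lead e (y j) s0 = (SUM s:G. (if s = s0 then 1 else 0) * lead e (y j) s)"
  using finG e(2) by (simp add: if_distrib[of "%a. a * _"] cong: if_cong)
 also have "... = (SUM s:G. SUM i:G. c i * (lead (d i) (x i) s * lead e (y j) s))"
  using c by (intro sum.cong refl) (auto simp: sum_distrib_right mult.assoc)
 also have "... = (SUM i:G. c i * (SUM s:G. lead (d i) (x i) s * lead e (y j) s))"
  by (subst sum.swap) (simp add: sum_distrib_left)
 also have "... = 0" using orth by simp
 finally show False using e(3) by simp
 qed
 \<comment> \<open>All degrees being zero, \<open>x i\<close> is finite at infinity; subtracting its
   residue at \<open>W0\<close> leaves an element to which \<open>Og_small\<close> applies.\<close>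
 have xc: "EX c. x i = const c" if i: "i : G" for i
 proof -
 have w: "s (x i) : W0" if "s : G" for s using lev_W0[OF x(3)[OF i] that] d0[OF i] by simp
 define c where "c = res (x i)"
 have xi: "x i : W0" using w[OF G_id] x(2)[OF i] by simp
 have sc: "s (x i - const c) = s (x i) - const c" if s: "s : G" for s
  using rhom_diff[OF auts_rhom[OF s] sfL x(2)[OF i] constA[of c]] auts_fix[OF s, of "const c"] const_base by auto
 have "const c : Og" using Og_ev[of "[:c:]"] by (simp add: ev_pCons)
 then have "x i - const c : Og" by (rule Og_diff[OF x(1)[OF i]])
 then have "x i - const c = 0"
 proof (rule Og_small[OF _ _ G_id])
  show "s (x i - const c) : W0" if "s : G" for s using sc[OF that] w[OF that] W0_const vr_diff[OF W.vr] by simp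
  show "(\<lambda>x\<in>A. x) (x i - const c) : mx W0" unfolding sc[OF G_id] using res[OF xi] x(2)[OF i] by (simp add: c_def)
 qed
 then show ?thesis by auto
 qed
 have lc: "lead (d i) (x i) s = lead (d i) (x i) t" if i: "i : G" and "s : G" "t : G" for i s t
 proof -
 obtain c where c: "x i = const c" using xc[OF i] by blast
 have "s (x i) = x i" "t (x i) = x i" unfolding c using that const_base by (auto intro!: auts_fix)
 then show ?thesis by (simp add: lead_def)
 qed
 \<comment> \<open>Constants have leading vectors that are constant on \<open>G\<close>; these can
   span all vectors only if \<open>G\<close> has one element.\<close>
 have one: "s = (\<lambda>x\<in>A. x)" if s: "s : G" for s
 proof (rule ccontr)
 assume n: "s ~= (\<lambda>x\<in>A. x)"
 obtain c where c: "ALL t:G. (if t = s then 1 else 0 :: 'q) = (SUM i:G. c i * lead (d i) (x i) t)"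
  using f unfolding frame_def by (elim conjE allE[of _ "%t. if t = s then 1 else 0"]) blast
 have "(SUM i:G. c i * lead (d i) (x i) s) = (SUM i:G. c i * lead (d i) (x i) (\<lambda>x\<in>A. x))"
  using lc[OF _ s G_id] by (intro sum.cong) auto
 then show False using c[rule_format, OF s] c[rule_format, OF G_id] n by simp
 qed
 have "z : k0" if z: "z : A" for z
 proof -
 have "s z = z" if "s : G" for s using one[OF that] z by simp
 then show ?thesis using fixedD[OF z] by blast
 qed
 then show "A = k0" using FL by auto
qed

end

theorem fam_base_trivial:
 assumes "fam k0 A" shows "A = k0"
proof -
 have "pr k0 P_infinity" using P_infinity_vr by (simp add: pr_def)
 moreover have "sfd A" "k0 <= A" using assms by (auto simp: fam_def abel_def galois_def)
 ultimately obtain W0 where "pr A W0" "W0 Int k0 = P_infinity" using pr_extend[OF good_base] by blast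
 then interpret split_unr A W0 using assms by unfold_locales
 show ?thesis by (rule trivial)
qed

section \<open>Abelian \<open>p\<close>-extensions and the genus field\<close>

definition dec :: "'a::field set => 'a set => 'a set => ('a => 'a) set" where
 "dec F L W = {s : auts F L. s ` W = W}"

text \<open>Iterates instead of group powers let exponents pass through restrictions and lifts by
  \<open>funpow_restrict\<close>.\<close>

definition expo :: "'a::field set => 'a set => nat => bool" where
 "expo F L q \<longleftrightarrow> (ALL s:auts F L. ALL x:L. (s ^^ q) x = x)"

lemma agrp_funpow: assumes H: "agrp L H" and s: "s : H" shows "restrict (s ^^ n) L : H" "x : L ==> (s ^^ n) x : L"
proof -
 have L: "(s ^^ n) x : L" if "x : L" for x n using agrp_D(3)[OF H s] that by (induction n) auto
 then show "x : L ==> (s ^^ n) x : L" .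
 show "restrict (s ^^ n) L : H"
 proof (induction n)
 case 0
 have "restrict (s ^^ 0) L = (\<lambda>x\<in>L. x)" by auto
 then show ?case using H by (simp only: agrp_def)
 next
 case (Suc n)
 have "restrict (s ^^ Suc n) L = compose L s (restrict (s ^^ n) L)" by (auto simp: compose_def)
 then show ?case using H s Suc unfolding agrp_def by metis
 qed
qed

lemma funpow_restrict: assumes "!!x. x : Z ==> s x : Z" "x : Z" shows "(restrict s Z ^^ n) x = (s ^^ n) x"
proof -
 have "(restrict s Z ^^ n) x = (s ^^ n) x & (s ^^ n) x : Z" using assms by (induction n) auto
 then show ?thesis by simp
qed

context galois
begin

lemma dec_agrp: assumes "W <= L" shows "agrp L (dec F L W)"
proof -
 have "compose L s t : dec F L W" if "s : dec F L W" "t : dec F L W" for s t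
 using that compose_G[of s t] compose_image[OF assms, of s t] unfolding dec_def by simp
 moreover have "dec F L W <= G" by (auto simp: dec_def)
 moreover have "(\<lambda>x\<in>L. x) : dec F L W" using G_id assms by (auto simp: dec_def subset_iff)
 ultimately show ?thesis
 using finite_subset[OF _ finG] auts_mono[of "{}" F L] unfolding agrp_def by blast
qed

text \<open>A subgroup acting faithfully on \<open>M\<close> embeds into the group of
  \<open>M\<close> by restriction and inherits the bound on the order and the exponent. It is
  applied to inertia and decomposition groups with \<open>M = K\<close>.\<close>

lemma agrp_faithful:
 assumes M: "galois F M" "M <= L" and U: "agrp L U" "U <= G"
 and f: "!!s. s : U ==> (!!x. x : M ==> s x = x) ==> s = (\<lambda>x\<in>L. x)"
 shows "card U <= card (auts F M)" "expo F M q ==> s : U ==> x : L ==> (s ^^ q) x = x"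
proof -
 interpret M: galois F M by fact
 have r: "restrict s M : auts F M" if "s : U" for s using restrict_auts_galois[OF M] U(2) that by blast
 have "inj_on (%s. restrict s M) U"
 proof (rule inj_onI)
 fix s t assume st: "s : U" "t : U" "restrict s M = restrict t M"
 obtain t' where t': "t' : U" "ALL x:L. t' (t x) = x & t (t' x) = x" using agrp_inv[OF U(1) sfL st(2)] by blast
 have "compose L t' s : U" using U(1) t' st by (simp add: agrp_def)
 moreover have "compose L t' s x = x" if "x : M" for x
 proof -
  have "s x = t x" using fun_cong[OF st(3), of x] that by simp
  then show ?thesis using t' that M(2) by (auto simp: compose_eq)
 qed
 ultimately have e: "compose L t' s = (\<lambda>x\<in>L. x)" by (rule f)
 show "s = t"
 proof (rule auts_eqI)
  show "s : G" "t : G" using st U by auto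
  fix x assume x: "x : L"
  have "t' (s x) = x" using fun_cong[OF e, of x] x by (simp add: compose_eq)
  moreover have "s x : L" using agrp_D(3)[OF U(1) st(1) x] .
  ultimately show "s x = t x" using t' by metis
 qed
 qed
 then show "card U <= card (auts F M)" using r M.finG by (intro card_inj_on_le) auto
 assume e: "expo F M q" and s: "s : U" and x: "x : L"
 have "restrict (s ^^ q) L = (\<lambda>x\<in>L. x)"
 proof (rule f[OF agrp_funpow(1)[OF U(1) s]])
 fix y assume y: "y : M"
 have "(restrict s M ^^ n) y = (s ^^ n) y" for n
  by (rule funpow_restrict[OF _ y]) (use auts_in[OF r[OF s]] in auto)
 then show "restrict (s ^^ q) L y = y" using e r[OF s] y M(2) by (auto simp: expo_def) metis
 qed
 from fun_cong[OF this, of x] show "(s ^^ q) x = x" using x by simp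
qed

lemma card_auts_strict: assumes M: "galois F M" "M <= L" "M ~= L" shows "card (auts F M) < card G"
proof -
 interpret M: galois F M by fact
 interpret LM: galois M L by (rule galois_upper[OF M.sfL M.FL M(2)])
 obtain x where x: "x : L" "x ~: M" using M by auto
 obtain s where s: "s : auts M L" "s x ~= x" using LM.fixedD[OF x(1)] x(2) by blast
 have sG: "s : G" using s auts_M[OF M.FL] by auto
 let ?r = "%s. restrict s M"
 have "?r s = ?r (\<lambda>x\<in>L. x)" using auts_fix[OF s(1)] M(2) by (intro ext) (auto simp: restrict_def)
 moreover have "s ~= (\<lambda>x\<in>L. x)" using s x by auto
 ultimately have "~ inj_on ?r G" using sG G_id unfolding inj_on_def by blast
 moreover have "card (?r ` G) <= card G" by (rule card_image_le[OF finG])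
 ultimately have "card (?r ` G) < card G" using eq_card_imp_inj_on[OF finG, of ?r] by fastforce
 then show ?thesis using restrict_auts_galois[OF M(1,2)] by simp
qed

end

context abel
begin

lemma funpow_comm: assumes "s : G" "t : G" "x : L" shows "(s ^^ n) (t x) = t ((s ^^ n) x)"
proof (induction n)
 case (Suc n)
 then show ?case using comm[OF assms(1,2) agrp_funpow(2)[OF G_agrp assms(1,3), of n]] by simp
qed simp

lemma expo_agrp: "agrp L {s : G. ALL x:L. (s ^^ q) x = x}"
proof -
 have c: "(compose L s t ^^ n) x = (s ^^ n) ((t ^^ n) x)" if st: "s : G" "t : G" and x: "x : L" for s t x n
 proof (induction n)
 case (Suc n)
 have tn: "(t ^^ n) x : L" "(s ^^ n) ((t ^^ n) x) : L"
  using agrp_funpow(2)[OF G_agrp st(2) x] agrp_funpow(2)[OF G_agrp st(1)] by auto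
 then show ?case using Suc funpow_comm[OF st tn(1)] by (simp add: compose_eq)
 qed simp
 have "compose L s t : {s : G. ALL x:L. (s ^^ q) x = x}"
 if "s : {s : G. ALL x:L. (s ^^ q) x = x}" "t : {s : G. ALL x:L. (s ^^ q) x = x}" for s t
 using that c[of s t] compose_G by auto
 moreover have "((\<lambda>x\<in>L. x) ^^ n) x = x" if "x : L" for x n using that by (induction n) auto
 moreover have "{s : G. ALL x:L. (s ^^ q) x = x} <= G" by auto
 ultimately show ?thesis using finite_subset[OF _ finG] auts_mono[of "{}" F L] G_id unfolding agrp_def by blast
qed

text \<open>As the automorphisms commute, the products of elements of two subgroups form a subgroup
  of order at most the product of the orders.\<close>

lemma agrp_join:
 assumes "finite \<U>" "!!U. U : \<U> ==> agrp L U & U <= G & card U <= c"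
 shows "EX H. agrp L H & H <= G & (ALL U:\<U>. U <= H) & card H <= c ^ card \<U>"
 using assms
proof (induction \<U> rule: finite_induct)
 case empty
 have "agrp L {\<lambda>x\<in>L. x}" using G_agrp G_id unfolding agrp_def by (auto simp: compose_def)
 then show ?case using G_id by (intro exI[of _ "{\<lambda>x\<in>L. x}"]) auto
next
 case (insert U \<U>)
 then obtain H where H: "agrp L H" "H <= G" "ALL U:\<U>. U <= H" "card H <= c ^ card \<U>" by blast
 have U: "agrp L U" "U <= G" "card U <= c" using insert.prems by auto
 define J where "J = (%(s, t). compose L s t) ` (U \<times> H)"
 have id: "(\<lambda>x\<in>L. x) : U" "(\<lambda>x\<in>L. x) : H" using U H by (auto simp: agrp_def)
 have JG: "J <= G" using U(2) H(2) by (auto simp: J_def subset_iff intro!: compose_G)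
 have fin: "finite U" "finite H" using U H by (auto simp: agrp_def)
 have "compose L a b : J" if ab: "a : J" "b : J" for a b
 proof -
 obtain s t where a: "a = compose L s t" "s : U" "t : H" using ab(1) by (auto simp: J_def)
 obtain s' t' where b: "b = compose L s' t'" "s' : U" "t' : H" using ab(2) by (auto simp: J_def)
 have "compose L a b = compose L (compose L s s') (compose L t t')"
 proof (rule extensionalityI[of _ L])
  fix x assume x: "x : L"
  have m: "t' x : L" "s' (t' x) : L" "t (t' x) : L"
  using a b x agrp_D(3)[OF U(1)] agrp_D(3)[OF H(1)] by blast+
  have "t (s' (t' x)) = s' (t (t' x))" using comm[of t s' "t' x"] a b U H m by blast
  then show "compose L a b x = compose L (compose L s s') (compose L t t') x" using x m by (simp add: a b compose_eq)
 qed (auto simp: compose_def)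
 moreover have "compose L s s' : U" "compose L t t' : H" using a b U(1) H(1) by (auto simp: agrp_def)
 ultimately show ?thesis by (auto simp: J_def)
 qed
 moreover have e: "compose L s (\<lambda>x\<in>L. x) = s" "compose L (\<lambda>x\<in>L. x) s = s" if "s : G" for s
 proof -
 have e: "s : extensional L" using that by (simp add: auts_def)
 show "compose L s (\<lambda>x\<in>L. x) = s" by (rule extensionalityI[OF _ e]) (auto simp: compose_eq)
 show "compose L (\<lambda>x\<in>L. x) s = s" by (rule extensionalityI[OF _ e]) (use auts_in[OF that] in "auto simp: compose_eq")
 qed
 have sub: "U <= J" "H <= J"
 proof -
 have "s : J" if "s : U" for s
  unfolding J_def using that id e(1)[of s] U(2) by (intro image_eqI[of _ _ "(s, \<lambda>x\<in>L. x)"]) auto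
 then show "U <= J" by blast
 have "s : J" if "s : H" for s
  unfolding J_def using that id e(2)[of s] H(2) by (intro image_eqI[of _ _ "(\<lambda>x\<in>L. x, s)"]) auto
 then show "H <= J" by blast
 qed
 ultimately have "agrp L J"
 using finite_subset[OF JG finG] JG auts_mono[of "{}" F L] id sub unfolding agrp_def by blast
 moreover have "card J <= c * c ^ card \<U>"
 proof -
 have "card J <= card (U \<times> H)" unfolding J_def using fin by (intro card_image_le) auto
 also have "... <= c * c ^ card \<U>" unfolding card_cartesian_product using U H by (intro mult_mono) auto
 finally show ?thesis .
 qed
 ultimately show ?case using H(3) sub JG insert.hyps by (intro exI[of _ J]) auto
qed

text \<open>Conjugate primes have conjugate groups, which coincide by commutativity; one prime over
  each prime of \<open>k0\<close> then suffices for counting.\<close>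

lemma groups_conj:
 assumes W: "dvr L W" "dvr L W'" "W Int F = W' Int F"
 shows "inert F L W <= inert F L W'" "dec F L W <= dec F L W'"
proof -
 obtain g where g: "g : G" "g ` W = W'" using primes_conjugate[OF W] by blast
 have WL: "W <= L" using vr_sub[OF dvr.vr[OF W(1)]] .
 show "inert F L W <= inert F L W'"
 proof
 fix s assume s: "s : inert F L W"
 then have sG: "s : G" by (auto simp: inert_def)
 have "s y - y : mx W'" if y: "y : W'" for y
 proof -
  obtain x where x: "x : W" "y = g x" using y g by auto
  have xL: "x : L" using x WL by auto
  have "s y - y = g (s x - x)"
  using comm[OF sG g(1) xL] rhom_diff[OF auts_rhom[OF g(1)] sfL auts_in[OF sG xL] xL] x by simp
  moreover have "s x - x : mx W" using s x by (auto simp: inert_def)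
  moreover have "s x - x : L" using auts_in[OF sG xL] xL sfL by (simp add: sfd_diff)
  ultimately show ?thesis using mx_image[OF g(1) dvr.vr[OF W(1)], of "s x - x"] g(2) by simp
 qed
 then show "s : inert F L W'" using sG by (auto simp: inert_def)
 qed
 show "dec F L W <= dec F L W'"
 proof
 fix s assume s: "s : dec F L W"
 have "s ` g ` W = g ` s ` W" using comm[OF _ g(1)] s WL unfolding dec_def image_image by (intro image_cong) auto
 then show "s : dec F L W'" using s g by (auto simp: dec_def)
 qed
qed

end

lemma fam_dvr:
 assumes "abel k0 L" "pr L W"
 shows "dvr L W" "vr L W" "dvr k0 (W Int k0)" "!!M. sfd M ==> k0 <= M ==> M <= L ==> pr M (W Int M) & dvr M (W Int M)"
proof -
 interpret abel k0 L by fact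
 have g: "good L" by (rule good_galois[OF good_base galois_axioms])
 show "dvr L W" "vr L W" using goodD(3)[OF g] assms(2) by (auto simp: pr_def)
 show *: "pr M (W Int M) & dvr M (W Int M)" if "sfd M" "k0 <= M" "M <= L" for M
 using pr_lower[OF g assms(2) that] goodD(3)[OF good_galois[OF good_base]] abel_lower(1)[OF that] by (auto simp: abel_def)
 show "dvr k0 (W Int k0)" using *[OF sfF order_refl FL] by simp
qed

text \<open>
  As \<open>k0\<close> has no unramified extension in which \<open>P_infinity\<close> splits, inertia groups and the
  decomposition groups at \<open>P_infinity\<close> generate the Galois group.
\<close>

lemma inertia_generates:
 assumes L: "abel k0 L" and H: "agrp L H" "H <= auts k0 L"
 and i: "!!W. pr L W ==> inert k0 L W <= H" "!!W. pr L W ==> W Int k0 = P_infinity ==> dec k0 L W <= H"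
 shows "H = auts k0 L"
proof -
 interpret abel k0 L by fact
 define A where "A = Fix L H"
 have A: "sfd A" "k0 <= A" "A <= L"
 using Fix_sfd[of L H] agrp_D(1)[OF H(1)] sfL H(2) FL auts_fix[of _ k0 L] by (auto simp: A_def Fix_def)
 have aA: "abel k0 A" by (rule abel_lower(1)[OF A])
 interpret A: abel k0 A by (rule aA)
 have fixA: "restrict s A = (\<lambda>x\<in>A. x)" if "s : H" for s
 using that by (auto simp: A_def Fix_def restrict_def)
 have "tin k0 A V & (V Int k0 = P_infinity --> tdec k0 A V)" if V: "pr A V" for V
 proof -
 obtain W where W: "pr L W" "W Int A = V"
  using pr_extend[OF good_galois[OF good_base A.galois_axioms] V sfL A(3)] by auto
 note d = fam_dvr[OF L W(1)]
 have "tin k0 A V"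
  unfolding tin_def using inert_lift[OF prime_CHAR_ratfun_ac A d(1,3)] i(1)[OF W(1)] fixA W(2) by blast
 moreover have "tdec k0 A V" if "V Int k0 = P_infinity"
 proof -
  have "W Int k0 = P_infinity" using that W(2) A(2) by auto
  note D = i(2)[OF W(1) this]
  show ?thesis unfolding tdec_def
  proof (intro ballI impI)
  fix s assume s: "s : auts k0 A" "s ` V = V"
  obtain t where t: "t : G" "t ` W = W" "s = restrict t A"
   using dec_lift[OF A.galois_axioms A(3) d(1), of s] d(4)[OF A] s W(2) by blast
  then have "t : H" using D by (auto simp: dec_def)
  then show "s = (\<lambda>x\<in>A. x)" using fixA t(3) by simp
  qed
 qed
 ultimately show ?thesis by simp
 qed
 then have "fam k0 A" using aA by (auto simp: fam_def)
 then have "A = k0" by (rule fam_base_trivial)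
 then show ?thesis using artin_auts[OF H(1) sfL] by (simp add: A_def)
qed

text \<open>An element fixing \<open>K\<close> belongs to the inertia or decomposition group over
  \<open>K\<close>, which the condition defining the family makes trivial.\<close>

lemma gfam_faithful:
 assumes K: "abel k0 K" and L: "gfam K L" and W: "pr L W"
 shows "s : inert k0 L W ==> (!!x. x : K ==> s x = x) ==> s = (\<lambda>x\<in>L. x)"
 "W Int k0 = P_infinity ==> s : dec k0 L W ==> (!!x. x : K ==> s x = x) ==> s = (\<lambda>x\<in>L. x)"
proof -
 have f: "tin K L W" "W Int k0 = P_infinity ==> tdec K L W" using L W by (auto simp: gfam_def fam_def)
 show "s = (\<lambda>x\<in>L. x)" if "s : inert k0 L W" "!!x. x : K ==> s x = x"
 using that f(1) by (auto simp: tin_def inert_def auts_def)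
 show "s = (\<lambda>x\<in>L. x)" if "W Int k0 = P_infinity" "s : dec k0 L W" "!!x. x : K ==> s x = x"
 proof -
 have "s : auts K L" using that by (auto simp: dec_def auts_def)
 then show ?thesis using f(2)[OF that(1)] that(2) by (auto simp: tdec_def dec_def)
 qed
qed

text \<open>The elements killed by \<open>q\<close> form a subgroup; it contains the inertia groups
  and the decomposition groups at infinity, since these embed into the group of \<open>K\<close>,
  and so it is everything.\<close>

lemma gfam_expo:
 assumes K: "abel k0 K" "expo k0 K q" and L: "gfam K L" shows "expo k0 L q"
proof -
 have aL: "abel k0 L" "abel K L" using L by (auto simp: gfam_def fam_def)
 interpret L: abel k0 L by (rule aL)
 interpret K: abel k0 K by (rule K)
 have KL: "K <= L" using aL(2) by (simp add: abel_def galois_def)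
 define H where "H = {s : L.G. ALL x:L. (s ^^ q) x = x}"
 have "H = L.G"
 proof (rule inertia_generates[OF aL(1)])
 show "agrp L H" "H <= L.G" using L.expo_agrp by (auto simp: H_def)
 fix W assume W: "pr L W"
 note d = fam_dvr[OF aL(1) W]
 show "inert k0 L W <= H"
 proof
  fix s assume s: "s : inert k0 L W"
  have "(s ^^ q) x = x" if x: "x : L" for x
  by (rule L.agrp_faithful(2)[OF K.galois_axioms KL L.inert_agrp[OF d(1)] _ gfam_faithful(1)[OF K(1) L W] K(2) s x])
   (auto simp: inert_def)
  then show "s : H" using s by (simp add: H_def inert_def)
 qed
 assume i: "W Int k0 = P_infinity"
 show "dec k0 L W <= H"
 proof
  fix s assume s: "s : dec k0 L W"
  have "(s ^^ q) x = x" if x: "x : L" for x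
  by (rule L.agrp_faithful(2)[OF K.galois_axioms KL L.dec_agrp[OF vr_sub[OF d(2)]] _ gfam_faithful(2)[OF K(1) L W i] K(2) s x])
   (auto simp: dec_def)
  then show "s : H" using s by (simp add: H_def dec_def)
 qed
 qed
 then show ?thesis by (auto simp: expo_def H_def)
qed

text \<open>One inertia group for each prime in \<open>insert P_infinity S\<close> and one
  decomposition group at infinity generate everything, and each embeds into the group of
  \<open>K\<close>. The exponent generously bounds their number.\<close>

lemma gfam_bounded:
 assumes K: "abel k0 K" and S: "finite S" "!!W. pr K W ==> W Int k0 ~: S ==> tin k0 K W" and L: "gfam K L"
 shows "card (auts k0 L) <= card (auts k0 K) ^ (2 * card S + 2)"
proof -
 have aL: "abel k0 L" "abel K L" using L by (auto simp: gfam_def fam_def)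
 interpret L: abel k0 L by (rule aL)
 interpret K: abel k0 K by (rule K)
 have KL: "K <= L" using aL(2) by (simp add: abel_def galois_def)
 define P where "P = (%V W. pr L W & W Int k0 = V)"
 \<comment> \<open>As \<open>S\<close> is arbitrary, only those members that have a prime of
   \<open>L\<close> above them allow a choice of \<open>w\<close>.\<close>
 define S' where "S' = {V : insert P_infinity S. EX W. P V W}"
 have "ALL V:S'. EX W. P V W" by (simp add: S'_def)
 then obtain w where w: "!!V. V : S' ==> pr L (w V)" "!!V. V : S' ==> w V Int k0 = V"
 unfolding P_def by (metis (no_types))
 define I where "I = (%V. inert k0 L (w V))"
 define D where "D = (%V. dec k0 L (w V))"
 define \<U> where "\<U> = I ` S' Un D ` (S' Int {P_infinity})"
 have fS: "finite S'" "card S' <= Suc (card S)"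
 proof -
 show "finite S'" using S(1) by (simp add: S'_def)
 have "card S' <= card (insert P_infinity S)" using S(1) by (intro card_mono) (auto simp: S'_def)
 then show "card S' <= Suc (card S)" using card_insert_le_m1[of "Suc (card S)" S P_infinity] by simp
 qed
 have U: "agrp L U & U <= L.G & card U <= card K.G" if UU: "U : \<U>" for U
 proof -
 consider V where "V : S'" "U = I V" | V where "V : S'" "V = P_infinity" "U = D V" using UU unfolding \<U>_def by blast
 then show ?thesis
 proof cases
  case 1
  note d = fam_dvr[OF aL(1) w(1)[OF 1(1)]]
  show ?thesis
  unfolding 1(2) I_def
  proof (intro conjI L.inert_agrp[OF d(1)])
  show "card (inert k0 L (w V)) <= card K.G"
   by (rule L.agrp_faithful(1)[OF K.galois_axioms KL L.inert_agrp[OF d(1)] _ gfam_faithful(1)[OF K L w(1)[OF 1(1)]]])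
   (auto simp: inert_def)
  qed (auto simp: inert_def)
 next
  case 2
  note d = fam_dvr[OF aL(1) w(1)[OF 2(1)]]
  have i: "w V Int k0 = P_infinity" using w(2)[OF 2(1)] 2(2) by simp
  show ?thesis
  unfolding 2(3) D_def
  proof (intro conjI L.dec_agrp[OF vr_sub[OF d(2)]])
  show "card (dec k0 L (w V)) <= card K.G"
   by (rule L.agrp_faithful(1)[OF K.galois_axioms KL L.dec_agrp[OF vr_sub[OF d(2)]] _ gfam_faithful(2)[OF K L w(1)[OF 2(1)] i]])
   (auto simp: dec_def)
  qed (auto simp: dec_def)
 qed
 qed
 have fU: "finite \<U>" using fS by (auto simp: \<U>_def)
 obtain H where H: "agrp L H" "H <= L.G" "ALL U:\<U>. U <= H" "card H <= card K.G ^ card \<U>"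
 using L.agrp_join[OF fU U] by blast
 have "H = L.G"
 proof (rule inertia_generates[OF aL(1) H(1,2)])
 fix W assume W: "pr L W"
 note d = fam_dvr[OF aL(1) W]
 show "inert k0 L W <= H"
 proof (cases "W Int k0 : S")
  case True
  then have s: "W Int k0 : S'" using W by (auto simp: S'_def P_def)
  have "inert k0 L W <= I (W Int k0)"
  unfolding I_def by (rule L.groups_conj(1)[OF d(1) fam_dvr(1)[OF aL(1) w(1)[OF s]]]) (simp add: w(2)[OF s])
  then show ?thesis using H(3) s by (auto simp: \<U>_def)
 next
  case False
  have KW: "pr K (W Int K)" using d(4)[OF K.sfL K.FL KL] by simp
  have "W Int K Int k0 = W Int k0" using K.FL by auto
  then have t: "tin k0 K (W Int K)" using S(2)[OF KW] False by simp
  have "s = (\<lambda>x\<in>L. x)" if s: "s : inert k0 L W" for s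
  proof (rule gfam_faithful(1)[OF K L W s])
  fix x assume x: "x : K"
  have "restrict s K = (\<lambda>x\<in>K. x)" using L.inert_restrict[OF K.galois_axioms KL d(2) s] t by (auto simp: tin_def)
  from fun_cong[OF this, of x] show "s x = x" using x by simp
  qed
  then show ?thesis using H(1) by (auto simp: agrp_def)
 qed
 assume i: "W Int k0 = P_infinity"
 then have s: "W Int k0 : S'" using W by (auto simp: S'_def P_def)
 have "dec k0 L W <= D (W Int k0)"
  unfolding D_def by (rule L.groups_conj(2)[OF d(1) fam_dvr(1)[OF aL(1) w(1)[OF s]]]) (simp add: w(2)[OF s])
 then show "dec k0 L W <= H" using H(3) s i by (auto simp: \<U>_def)
 qed
 moreover have "card \<U> <= 2 * card S + 2"
 proof -
 have "card \<U> <= card (I ` S') + card (D ` (S' Int {P_infinity}))" unfolding \<U>_def by (rule card_Un_le)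
 also have "... <= card S' + card (S' Int {P_infinity})" using fS by (intro add_mono card_image_le) auto
 also have "... <= card S' + card S'" using fS by (intro add_left_mono card_mono) auto
 finally show ?thesis using fS by simp
 qed
 moreover have "card K.G >= 1" using K.finG K.G_id by (auto simp: Suc_le_eq card_gt_0_iff)
 ultimately show ?thesis using H(4) power_increasing[of "card \<U>" _ "card K.G"] by (meson le_trans order_trans)
qed

text \<open>Bounded degrees give a member of largest degree; closure under composita makes it
  contain all others, so the union is attained.\<close>

lemma gfam_genus_field:
 assumes K: "abel k0 K" and S: "finite S" "!!W. pr K W ==> W Int k0 ~: S ==> tin k0 K W"
 shows "gfam K (genus_field K)"
proof -
 interpret K: abel k0 K by (rule K)
 have gK: "good K" by (rule good_galois[OF good_base K.galois_axioms])
 have KK: "gfam K K" using fam_refl[OF gK] K by (simp add: gfam_def)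
 define b where "b = card (auts k0 K) ^ (2 * card S + 2)"
 obtain L where L: "gfam K L" "!!M. gfam K M ==> card (auts k0 M) <= card (auts k0 L)"
 proof -
 have "EX L. gfam K L & (ALL M. gfam K M --> card (auts k0 M) <= card (auts k0 L))"
  by (rule ex_has_greatest_nat[of _ K _ "Suc b"])
  (use KK gfam_bounded[OF K S] in "auto simp: b_def less_Suc_eq_le")
 then show ?thesis using that by blast
 qed
 have "M <= L" if M: "gfam K M" for M
 proof -
 have N: "gfam K (gen (L Un M))" by (rule gfam_compositum[OF gK L(1) M])
 have g: "galois k0 L" "galois k0 (gen (L Un M))" using L(1) N by (auto simp: gfam_def abel_def)
 have "L = gen (L Un M)"
  using galois.card_auts_strict[OF g(2,1)] L(2)[OF N] gen_incl[of "L Un M"] by fastforce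
 then show ?thesis using gen_incl[of "L Un M"] by auto
 qed
 then have "genus_field K = L" using genus_field_eq[OF K] L(1) by auto
 then show ?thesis using L(1) by simp
qed

text \<open>A prime \<open>l\<close> dividing the order yields, by Sylow, a nontrivial element of
  \<open>l\<close>-power order; this order also divides a power of \<open>p\<close>.\<close>

lemma (in group) exponent_prime_power_order:
 fixes p :: nat
 assumes fin: "finite (carrier G)" and p: "prime p" and e: "!!s. s : carrier G ==> s [^] (p ^ r) = \<one>"
 shows "EX a. Coset.order G = p ^ a"
proof -
 have o: "Coset.order G ~= 0" using order_gt_0_iff_finite fin by simp
 have "l = p" if l: "prime l" "l dvd Coset.order G" for l
 proof -
 obtain a m where am: "Coset.order G = l ^ a * m" "~ l dvd m"
  using multiplicity_decompose'[OF o] l(1) by (metis not_prime_unit)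
 have a0: "a ~= 0" using am l by (metis power_0 mult_1)
 obtain H where H: "subgroup H G" "card H = l ^ a"
  using sylow_thm[OF l(1) is_group am(1) fin] by blast
 have "card H > 1" using H(2) a0 prime_gt_1_nat[OF l(1)] one_less_power[of l a] by simp
 then have "~ H <= {\<one>}" by (metis card_mono finite.emptyI finite.insertI card.empty card_insert_if empty_iff leD One_nat_def)
 then obtain s where s: "s : H" "s ~= \<one>" by blast
 have sc: "s : carrier G" using subgroup.subset[OF H(1)] s by blast
 interpret H: group "G\<lparr>carrier := H\<rparr>" by (rule subgroup.subgroup_is_group[OF H(1) is_group])
 have "s [^]\<^bsub>G\<lparr>carrier := H\<rparr>\<^esub> card H = \<one>\<^bsub>G\<lparr>carrier := H\<rparr>\<^esub>"
  using H.pow_order_eq_1[of s] s by (simp add: Coset.order_def)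
 then have "s [^] (l ^ a) = \<one>" using H(2) by (simp flip: nat_pow_consistent)
 then have "ord s dvd l ^ a" using pow_eq_id[OF sc] by simp
 moreover have "ord s dvd p ^ r" using pow_eq_id[OF sc] e[OF sc] by simp
 moreover have "ord s ~= 1" using ord_eq_1[OF sc] s by simp
 ultimately have "~ coprime (l ^ a) (p ^ r)" by (metis coprime_common_divisor is_unit_gcd nat_dvd_1_iff_1)
 then show ?thesis using l(1) p primes_coprime[of l p] by (metis coprime_power_left_iff coprime_power_right_iff)
 qed
 then have "prime_factors (Coset.order G) <= {p}" by (auto simp: prime_factors_dvd)
 then have "prime_factorization (Coset.order G) = replicate_mset (multiplicity p (Coset.order G)) p"
 using count_prime_factorization_prime[OF p] by (intro multiset_eqI) (auto simp: not_in_iff subset_iff)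
 then have "Coset.order G = p ^ multiplicity p (Coset.order G)"
 using prod_mset_prime_factorization_nat[of "Coset.order G"] o by (metis gr0I prod_mset_replicate_mset)
 then show ?thesis by blast
qed

lemma Gal_pow_eq_one:
 assumes L: "abel F L" and s: "s : auts F L"
 shows "s [^]\<^bsub>Gal F L\<^esub> (n :: nat) = \<one>\<^bsub>Gal F L\<^esub> \<longleftrightarrow> (ALL x:L. (s ^^ n) x = x)"
proof -
 interpret abel F L by fact
 have one: "\<one>\<^bsub>Gal F L\<^esub> = (\<lambda>x\<in>L. x)" by (simp add: Gal_def restrict_def cong: if_cong)
 have "s [^]\<^bsub>Gal F L\<^esub> n = restrict (s ^^ n) L"
 proof (induction n)
 case (Suc n)
 have "s [^]\<^bsub>Gal F L\<^esub> Suc n = s [^]\<^bsub>Gal F L\<^esub> n \<otimes>\<^bsub>Gal F L\<^esub> s" by simp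
 also have "... = compose L (restrict (s ^^ n) L) s" unfolding Suc by (simp add: Gal_def)
 also have "... = restrict (s ^^ Suc n) L"
  using auts_in[OF s] by (intro ext) (simp add: compose_def funpow_swap1)
 finally show ?case .
 qed (auto simp: one)
 then show ?thesis unfolding one by (auto simp: restrict_def fun_eq_iff)
qed

lemma Gal_comm_group: "abel F L ==> comm_group (Gal F L)"
 by (simp add: finite_abelian_def flip: finite_abelian_iff)

lemma Gal_order: "abel F L ==> Coset.order (Gal F L) = card (auts F L)"
 by (simp add: Coset.order_def carrier_Gal abel_def galois_def)

lemma expo_card: assumes L: "abel (F :: ('q::{field,finite}) ratfun_ac set) L" shows "expo F L (card (auts F L))"
proof -
 interpret abel F L by fact
 interpret Ga: comm_group "Gal F L" by (rule Gal_comm_group[OF L])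
 show ?thesis
 unfolding expo_def using Ga.pow_order_eq_1 Gal_pow_eq_one[OF L] carrier_Gal[OF sfL] Gal_order[OF L] by metis
qed

text \<open>An exponent, unlike an order, can be checked on generating subgroups; this is the form
  used for the genus field.\<close>

lemma finite_abelian_p_extension_iff:
 "finite_abelian_p_extension k0 (L :: ('q::{field,finite}) ratfun_ac set) \<longleftrightarrow> abel k0 L & (EX r. expo k0 L (CHAR('q) ^ r))"
proof (cases "abel k0 L")
 case True
 interpret abel k0 L by fact
 interpret Ga: comm_group "Gal k0 L" by (rule Gal_comm_group[OF True])
 have "EX r. Coset.order (Gal k0 L) = CHAR('q) ^ r" if "expo k0 L (CHAR('q) ^ r)" for r
 by (rule Ga.exponent_prime_power_order[OF _ prime_CHAR_finite_field])
  (use carrier_Gal[OF sfL, of k0] finG that Gal_pow_eq_one[OF True] in "auto simp: expo_def")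
 then show ?thesis
 using True expo_card[OF True] Gal_order[OF True] by (auto simp: finite_abelian_p_extension_def finite_abelian_iff)
qed (simp add: finite_abelian_p_extension_def finite_abelian_iff)

section \<open>Constant extensions and the Carlitz module\<close>

lemma finite_field_pow_card: "c ^ CARD('q) = (c :: 'q::{field,finite})"
proof (cases "c = 0")
 case False
 let ?U = "UNIV - {0 :: 'q}"
 have "inj_on (%x. c * x) ?U" by (rule inj_onI) (use False in simp)
 moreover have "(%x. c * x) ` ?U <= ?U" using False by (intro image_subsetI) simp
 ultimately have "bij_betw (%x. c * x) ?U ?U" using endo_inj_surj[of ?U] by (simp add: bij_betw_def)
 from prod.reindex_bij_betw[OF this, of "%x. x"] have "c ^ card ?U * \<Prod>?U = 1 * \<Prod>?U"
 by (simp add: prod.distrib)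
 then have "c ^ card ?U = 1" by (subst (asm) mult_right_cancel) auto
 moreover have "CARD('q) = Suc (card ?U)" by (simp add: card_Diff_singleton Suc_diff_1)
 ultimately show ?thesis by (metis power_Suc mult_1_right)
qed (simp add: power_0_left)

text \<open>The additive group is killed by \<open>CHAR('q)\<close>, so its order is a power of this
  prime.\<close>

lemma finite_field_card: "EX a. CARD('q::{field,finite}) = CHAR('q) ^ a"
proof -
 define A :: "'q monoid" where "A = \<lparr>carrier = UNIV, monoid.mult = (+), one = 0\<rparr>"
 interpret group A by (rule groupI) (auto simp: A_def add.assoc intro: exI[of _ "- _"] left_minus)
 have pw: "s [^]\<^bsub>A\<^esub> (n :: nat) = of_nat n * s" for s n
 by (induction n) (auto simp: A_def nat_pow_def algebra_simps)
 have "EX a. Coset.order A = CHAR('q) ^ a"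
 by (rule exponent_prime_power_order[of _ 1]) (auto simp: pw prime_CHAR_finite_field, auto simp: A_def)
 then show ?thesis by (simp add: Coset.order_def A_def)
qed

lemma one_less_card: "CARD('q::{field,finite}) > 1"
proof -
 have "card {0, 1 :: 'q} <= CARD('q)" by (intro card_mono) auto
 then show ?thesis by simp
qed

lemma frobenius_add: "(x + y) ^ (CARD('q) ^ n) = x ^ (CARD('q) ^ n) + (y :: ('q::{field,finite}) ratfun_ac) ^ (CARD('q) ^ n)"
proof -
 obtain a where a: "CARD('q) = CHAR('q) ^ a" using finite_field_card by blast
 show ?thesis
 by (rule freshmans_dream'[OF prime_CHAR_ratfun_ac, where n = "a * n"]) (simp only: a CHAR_ratfun_ac power_mult)
qed

text \<open>The derivative is a nonzero constant, so no root is repeated and the product over the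
  set of roots is \<open>p\<close> made monic.\<close>

lemma split_set_roots:
 fixes p :: "('q::{field,finite}) ratfun_ac poly"
 assumes F: "sfd F" and p: "p : polys F" "pderiv p = [:d:]" "d ~= 0"
 shows "split_set F {x. poly p x = 0}"
proof -
 have p0: "p ~= 0" using p by auto
 then have fin: "finite {x. poly p x = 0}" by (rule poly_roots_finite)
 obtain A where A: "p = smult (lead_coeff p) (PROD x:#A. [:-x, 1:])" using alg_closed_imp_factorization[OF p0] by blast
 have "count A x <= 1" for x
 proof (rule ccontr)
 assume "~ count A x <= 1"
 then have "x \<in># A - {#x#}" by (simp add: in_diff_count)
 then obtain B where B: "A = add_mset x (add_mset x B)" by (metis insert_DiffM in_diffD)
 define r where "r = smult (lead_coeff p) (PROD x:#B. [:-x, 1:])"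
 have pr: "p = [:-x, 1:] * ([:-x, 1:] * r)" by (subst A) (simp add: B r_def)
 have "poly (pderiv p) x = 0" unfolding pr pderiv_mult by (simp add: pderiv_pCons)
 then show False using p by simp
 qed
 then have "count A x = (if x \<in># A then 1 else 0)" for x
 by (metis One_nat_def count_greater_zero_iff le_antisym Suc_leI not_in_iff)
 then have "A = mset_set (set_mset A)" by (intro multiset_eqI) (simp add: count_mset_set')
 moreover have "set_mset A = {x. poly p x = 0}"
 using p0 by (subst A) (auto simp: poly_prod_mset prod_mset_zero_iff)
 ultimately have "p = smult (lead_coeff p) (PROD x:{x. poly p x = 0}. [:-x, 1:])" using A by (metis prod_unfold_prod_mset)
 then have "(PROD x:{x. poly p x = 0}. [:-x, 1:]) = smult (inverse (lead_coeff p)) p"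
 using p0 by (metis (no_types) leading_coeff_0_iff smult_smult left_inverse smult_1_left)
 moreover have "smult (inverse (lead_coeff p)) p : polys F"
 using polysD[OF p(1)] F by (simp add: polys_def sfd_mult sfd_inverse)
 ultimately have "(PROD x:{x. poly p x = 0}. [:-x, 1:]) : polys F" by simp
 then show ?thesis
 using fin unfolding split_set_def by (intro conjI ballI exI[of _ "{x. poly p x = 0}"]) simp_all
qed

context
 fixes m :: nat assumes m: "m >= 1"
begin

text \<open>The field with \<open>q ^ m\<close> elements. The assumption \<open>m >= 1\<close>
  excludes the exponent one, for which every element of the closure would qualify.\<close>

definition froots :: "('q::{field,finite}) ratfun_ac set" where
 "froots = {x. x ^ (CARD('q) ^ m) = x}"

lemma froots_split: "split_set k0 (froots :: ('q::{field,finite}) ratfun_ac set)"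
proof -
 define p :: "'q ratfun_ac poly" where "p = monom 1 (CARD('q) ^ m) - monom 1 1"
 obtain a where a: "CARD('q) = CHAR('q) ^ a" using finite_field_card by blast
 have "a ~= 0" using a one_less_card[where 'q='q] by (metis less_irrefl power_0)
 then have "CHAR('q) dvd CARD('q) ^ m" using a m by (simp add: dvd_power flip: power_mult)
 then have z: "of_nat (CARD('q) ^ m) = (0 :: 'q ratfun_ac)" by (simp only: of_nat_eq_0_iff_char_dvd CHAR_ratfun_ac)
 have "split_set k0 {x. poly p x = 0}"
 proof (rule split_set_roots[OF sfd_base])
 show "p : polys k0" unfolding p_def using sfd_base by (intro polys_diff) (auto simp: polys_def)
 show "pderiv p = [:-1:]" unfolding p_def pderiv_diff pderiv_monom z by (simp add: monom_0 one_pCons)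
 qed simp
 moreover have "{x. poly p x = 0} = froots" by (simp add: p_def froots_def poly_monom)
 ultimately show ?thesis by simp
qed

lemma froots_sfd: "sfd (froots :: ('q::{field,finite}) ratfun_ac set)"
proof -
 let ?n = "CARD('q) ^ m"
 have n: "?n > 0" by simp
 have "- x : froots" if "x : froots" for x :: "'q ratfun_ac"
 proof -
 have "(x + - x) ^ ?n = x ^ ?n + (- x) ^ ?n" by (rule frobenius_add)
 then have "(- x) ^ ?n = - (x ^ ?n)" using n by (simp add: power_0_left eq_neg_iff_add_eq_0 add.commute)
 then show ?thesis using that by (simp add: froots_def)
 qed
 then show ?thesis unfolding sfd_def using n
 by (auto simp: froots_def frobenius_add power_mult_distrib power_inverse power_0_left)
qed

lemma const_extension_eq: "const_extension m = gen (k0 Un froots)"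
 by (simp add: const_extension_def froots_def compositum_eq)

text \<open>Nonzero elements are roots of unity and hence units at every prime; \<open>n\<close> is
  \<open>CARD('q) ^ m - 2\<close>, which makes \<open>x ^ n\<close> the inverse of
  \<open>x\<close>.\<close>

lemma froots_unit:
 assumes W: "vr L W" and x: "x : (froots :: ('q::{field,finite}) ratfun_ac set)" "x : L" shows "x : W" "x : mx W ==> x = 0"
proof -
 obtain n where n: "CARD('q) ^ m = Suc (Suc n)"
 using one_less_power[OF one_less_card[where 'q='q], of m] m by (metis Suc_le_D Suc_leI not0_implies_Suc not_less_zero One_nat_def Suc_lessE zero_less_Suc less_Suc_eq_0_disj Suc_less_eq)
 have xx: "x ^ Suc n = 1" if "x ~= 0"
 proof -
 have "x * x ^ Suc n = x * 1" using x(1) n by (simp add: froots_def)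
 then show ?thesis using that by (simp only: mult_cancel_left) simp
 qed
 show xW: "x : W"
 proof (rule ccontr)
 assume no: "x ~: W"
 then have x0: "x ~= 0" using vr_0[OF W] by auto
 then have "inverse x : W" using no x(2) W by (auto simp: vr_def)
 moreover have "inverse (x ^ n) = x" by (rule inverse_unique) (use xx[OF x0] in "simp add: mult.commute")
 then have "x = inverse x ^ n" by (simp add: power_inverse)
 ultimately show False using no vr_power[OF W] by metis
 qed
 show "x = 0" if "x : mx W"
 proof (rule ccontr)
 assume "x ~= 0"
 then have "1 : mx W" using xx mx_mult[OF W that vr_power[OF W xW, of n]] by simp
 then show False using mx_1[OF W] by simp
 qed
qed

text \<open>The multiplicative group of a finite field is cyclic; an automorphism raises its
  generator to a power, and such maps commute.\<close>

lemma const_extension_abel: "abel k0 (const_extension m :: ('q::{field,finite}) ratfun_ac set)"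
proof -
 let ?L = "const_extension m :: 'q ratfun_ac set"
 interpret galois k0 ?L unfolding const_extension_eq by (rule galois_split_set[OF sfd_base froots_split])
 have RL: "froots <= ?L" using gen_incl[of "k0 Un froots"] by (auto simp: const_extension_eq)
 define R where "R = (\<Omega> :: 'q ratfun_ac ring)\<lparr>carrier := froots\<rparr>"

 have "subfield froots (\<Omega> :: 'q ratfun_ac ring)" using froots_sfd by (simp add: subfield_iff)
 then interpret R: field R unfolding R_def by (rule R.subfield_iff(2))
 have "finite (carrier R)" using froots_split by (auto simp: split_set_def R_def)
 from R.finite_field_mult_group_has_gen[OF this] obtain g where
 g: "g : carrier (Multiplicative_Group.mult_of R)" "carrier (Multiplicative_Group.mult_of R) = {g [^]\<^bsub>R\<^esub> i | i::nat. i : UNIV}" by (rule bexE) (rule that)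
 have pw: "g [^]\<^bsub>R\<^esub> (i::nat) = g ^ i" for i
 by (induction i) (auto simp: R_def ring_of_type_algebra_def nat_pow_def mult.commute)
 have gR: "g : froots" using g(1) by (auto simp: R_def carrier_mult_of)
 have cy: "x = 0 | (EX i. x = g ^ i)" if "x : froots" for x
 using g(2) that unfolding pw by (auto simp: R_def ring_of_type_algebra_def)
 have gL: "g : ?L" using gR RL by auto
 have im: "EX i. s g = g ^ i" if s: "s : G" for s
 proof -
 have "s g ^ (CARD('q) ^ m) = s g" using rhom_power[OF auts_rhom[OF s] sfL gL, of "CARD('q) ^ m"] gR by (simp add: froots_def)
 then have "s g : froots" by (simp add: froots_def)
 moreover have "s g ~= 0" using rhom_eq_0[OF auts_rhom[OF s] sfL gL] g(1) by (auto simp: R_def ring_of_type_algebra_def)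
 ultimately show ?thesis using cy by blast
 qed
 show ?thesis
 proof unfold_locales
 fix s u x assume s: "s : G" and u: "u : G" and x: "x : ?L"
 obtain i j where ij: "s g = g ^ i" "u g = g ^ j" using im s u by blast
 have sg: "s (g ^ n) = g ^ (i * n)" "u (g ^ n) = g ^ (j * n)" for n
  using rhom_power[OF auts_rhom[OF s] sfL gL] rhom_power[OF auts_rhom[OF u] sfL gL] ij by (simp_all flip: power_mult)
 have "compose ?L s u = compose ?L u s"
 proof (rule auts_eqI[OF compose_G[OF s u] compose_G[OF u s]])
  fix y assume y: "y : ?L"
  show "compose ?L s u y = compose ?L u s y"
  proof (rule rhom_gen_agree[OF auts_rhom[OF compose_G[OF s u]] auts_rhom[OF compose_G[OF u s]] sfL])
  show "k0 Un froots <= ?L" using RL FL by auto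
  show "y : gen (k0 Un froots)" using y by (simp add: const_extension_eq)
  fix z :: "'q ratfun_ac" assume z: "z : k0 Un froots"
  then have zL: "z : ?L" using RL FL by auto
  consider "z : k0" | "z = 0" | i where "z = g ^ i" using z cy by blast
  then show "compose ?L s u z = compose ?L u s z"
   using zL auts_fix[OF s] auts_fix[OF u] rhom_0[OF auts_rhom[OF s] sfL] rhom_0[OF auts_rhom[OF u] sfL]
   by cases (auto simp: compose_eq sg mult_ac)
  qed
 qed
 from fun_cong[OF this, of x] show "s (u x) = u (s x)" using x by (simp add: compose_eq)
 qed
qed

text \<open>For inertial \<open>s\<close> the difference \<open>s x - x\<close> is an element of the
  finite field lying in the maximal ideal, hence zero.\<close>

lemma const_extension_tin:
 assumes W: "vr (const_extension m :: ('q::{field,finite}) ratfun_ac set) W"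
 shows "tin k0 (const_extension m) W"
 unfolding tin_def
proof
 let ?L = "const_extension m :: 'q ratfun_ac set"
 interpret galois k0 ?L by (rule abel.axioms(1)[OF const_extension_abel])
 have RL: "froots <= ?L" using gen_incl[of "k0 Un froots"] by (auto simp: const_extension_eq)
 fix s assume s: "s : inert k0 ?L W"
 then have sG: "s : G" by (simp add: inert_def)
 have "s x = x" if x: "x : froots" for x
 proof -
 have xL: "x : ?L" using x RL by auto
 have "s x ^ (CARD('q) ^ m) = s x" using rhom_power[OF auts_rhom[OF sG] sfL xL, of "CARD('q) ^ m"] x by (simp add: froots_def)
 then have "s x - x : froots" using x sfd_diff[OF froots_sfd, of "s x" x] by (simp add: froots_def)
 moreover have "s x - x : mx W" using s froots_unit(1)[OF W x xL] by (simp add: inert_def)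
 moreover have "s x - x : ?L" using auts_in[OF sG xL] xL sfL by (simp add: sfd_diff)
 ultimately show ?thesis using froots_unit(2)[OF W, of "s x - x"] by simp
 qed
 then show "s : {\<lambda>x\<in>?L. x}"
 using aut_trivial_gen[OF sG sfL const_extension_eq] auts_fix[OF sG] by simp
qed

end

section \<open>The Carlitz module and its torsion fields\<close>

definition phi :: "('q::{field,finite}) ratfun_ac => 'q ratfun_ac => 'q ratfun_ac" where
 "phi t u = u ^ CARD('q) + t * u"

text \<open>The action of a polynomial given by a length and a coefficient function, so that
  changing coefficients does not disturb the length of the sum.\<close>

definition comb :: "('q::{field,finite}) ratfun_ac => nat => (nat => 'q) => 'q ratfun_ac => 'q ratfun_ac" where
 "comb t n c u = (SUM i<=n. const (c i) * (phi t ^^ i) u)"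

lemma carlitz_comb: "carlitz_action t (f :: 'q::{field,finite} poly) u = comb t (degree f) (coeff f) u"
proof -
 have "(%z. z ^ CARD('q) + t * z) = phi t" by (intro ext) (simp add: phi_def)
 then show ?thesis by (simp add: carlitz_action_def comb_def)
qed

lemma phi_lin: "phi t (u + v) = phi t u + phi t v" "phi t (const c * u) = const c * phi t u"
 using frobenius_add[of u v 1] finite_field_pow_card[of c]
 by (simp_all add: phi_def power_mult_distrib algebra_simps flip: const_power)

lemma phi_pow_lin:
 "(phi t ^^ i) (u + v) = (phi t ^^ i) u + (phi t ^^ i) v" "(phi t ^^ i) (const c * u) = const c * (phi t ^^ i) u"
 by (induction i) (simp_all add: phi_lin)

lemma phi_pow_0: "(phi t ^^ i) 0 = 0"
 using phi_pow_lin(2)[of i t 0 0] by simp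

text \<open>One statement for two uses: \<open>g\<close> is an automorphism acting on
  \<open>Cy\<close>, or another operator of the Carlitz action.\<close>

lemma comb_hom:
 assumes S: "!!u v. u : S ==> v : S ==> u + v : S" "!!c u. u : S ==> const c * u : S" "!!u. u : S ==> phi t u : S"
 and g: "!!u v. u : S ==> v : S ==> g (u + v) = g u + g v" "!!c u. u : S ==> g (const c * u) = const c * g u"
  "!!u. u : S ==> g (phi t u) = phi t (g u)" and u: "u : S"
 shows "comb t n c u : S" "g (comb t n c u) = comb t n c (g u)"
proof -
 have p: "(phi t ^^ i) u : S & g ((phi t ^^ i) u) = (phi t ^^ i) (g u)" for i using u S(3) g(3) by (induction i) auto
 have "comb t n c u : S & g (comb t n c u) = comb t n c (g u)"
 unfolding comb_def using p S(1,2) g(1,2) u by (induction n) (auto simp del: funpow.simps(2))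
 then show "comb t n c u : S" "g (comb t n c u) = comb t n c (g u)" by auto
qed

lemma comb_lin: "comb t n c (u + v) = comb t n c u + comb t n c v" "comb t n c (const d * u) = const d * comb t n c u"
 by (simp_all add: comb_def phi_pow_lin distrib_left sum.distrib sum_distrib_left mult.left_commute)

lemma comb_0: "comb t n c 0 = 0"
 by (simp add: comb_def phi_pow_0)

lemma phi_comb: "(phi t ^^ i) (comb t n c u) = comb t n c ((phi t ^^ i) u)"
 by (rule comb_hom(2)[of UNIV]) (auto simp: phi_pow_lin funpow_swap1)

lemma comb_comb: "comb t m d (comb t n c u) = comb t n c (comb t m d u)"
 by (rule comb_hom(2)[of UNIV]) (auto simp: comb_lin phi_comb[of 1, simplified])

locale carlitz =
 fixes t :: "('q::{field,finite}) ratfun_ac" and f :: "'q poly"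
 assumes t: "param t" and f: "f ~= 0"
begin

definition "Lam = {u. carlitz_action t f u = 0}"

definition "Cy = cyclotomic_function_field t f"

lemma Cy_eq: "Cy = gen (k0 Un Lam)"
 by (simp add: Cy_def cyclotomic_function_field_def Lam_def compositum_eq)

lemma Lam_closed: "u : Lam ==> v : Lam ==> u + v : Lam" "u : Lam ==> const c * u : Lam" "u : Lam ==> phi t u : Lam"
proof -
 show "u : Lam ==> v : Lam ==> u + v : Lam" "u : Lam ==> const c * u : Lam" by (simp_all add: Lam_def carlitz_comb comb_lin)
 show "u : Lam ==> phi t u : Lam"
 using phi_comb[of 1 t "degree f" "coeff f" u] phi_pow_0[of 1 t] by (simp add: Lam_def carlitz_comb)
qed

lemma Lam_diff: "u : Lam ==> v : Lam ==> u - v : Lam"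
 using Lam_closed(1)[of u "const (-1) * v"] Lam_closed(2)[of v "-1"] by simp

lemma Lam_pow: "u : Lam ==> (phi t ^^ i) u : Lam"
 by (induction i) (auto simp: Lam_closed)

definition cpoly :: "'q ratfun_ac poly" where
 "cpoly = (SUM i<=degree f. smult (const (coeff f i)) (((%p. p ^ CARD('q) + smult t p) ^^ i) [:0, 1:]))"

text \<open>In characteristic \<open>p\<close> the Carlitz polynomial of \<open>f\<close> has the
  constant derivative \<open>ev t f\<close>, which is nonzero, so the torsion points are simple
  roots.\<close>

lemma split_Lam: "split_set k0 Lam"
proof -
 let ?\<Phi> = "%p. p ^ CARD('q) + smult t p"
 have pp: "poly ((?\<Phi> ^^ i) p) u = (phi t ^^ i) (poly p u)" for i p u by (induction i) (auto simp: phi_def)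
 have tk: "t : k0" by (rule param_in_base[OF t])
 have ck: "const c : k0" for c using const_base by auto
 have pk: "(?\<Phi> ^^ i) [:0, 1:] : polys k0" for i
 proof (induction i)
 case (Suc i)
 have pw: "p ^ n : polys k0" if "p : polys k0" for p :: "'q ratfun_ac poly" and n
  using that polys_mult[OF sfd_base] polys_1[OF sfd_base] by (induction n) auto
 have sm: "smult t p : polys k0" if "p : polys k0" for p
  using that sfd_mult[OF sfd_base tk] by (simp add: polys_def)
 show ?case unfolding funpow.simps o_apply by (intro polys_add[OF sfd_base] pw sm Suc)
 qed (auto simp: polys_def sfd_base coeff_pCons split: nat.split)
 have z: "of_nat CARD('q) = (0 :: 'q ratfun_ac)"
 proof -
 obtain a where a: "CARD('q) = CHAR('q) ^ a" using finite_field_card by blast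
 then have "CHAR('q) dvd CARD('q)" using one_less_card[where 'q='q] by (metis dvd_power gr0I less_irrefl power_0)
 then show ?thesis by (simp only: of_nat_eq_0_iff_char_dvd CHAR_ratfun_ac)
 qed
 have pd: "pderiv ((?\<Phi> ^^ i) [:0, 1:]) = [:t ^ i:]" for i
 proof (induction i)
 case (Suc i)
 then show ?case unfolding funpow.simps o_apply pderiv_add pderiv_power pderiv_smult z by simp
 qed (simp add: pderiv_pCons)
 have "split_set k0 {x. poly cpoly x = 0}"
 proof (rule split_set_roots[OF sfd_base, of _ "ev t f"])
 have "smult c p : polys k0" if "c : k0" "p : polys k0" for c :: "'q ratfun_ac" and p
  using that by (auto simp: polys_def intro!: sfd_mult[OF sfd_base])
 note sm = this
 have su: "sum g A : polys k0" if "!!i. i : A ==> g i : polys k0" for g :: "nat => 'q ratfun_ac poly" and A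
  using that by (induction A rule: infinite_finite_induct) (auto simp: polys_add[OF sfd_base], auto simp: polys_def sfd_base)
 show "cpoly : polys k0" unfolding cpoly_def by (rule su) (rule sm[OF ck pk])
 have "pderiv cpoly = (SUM i<=degree f. smult (const (coeff f i)) [:t ^ i:])"
 proof -
  have "pderiv (sum g {..n}) = (SUM i<=n. pderiv (g i))" for g :: "nat => 'q ratfun_ac poly" and n :: nat
  by (induction n) (auto simp: pderiv_add)
  then show ?thesis by (simp add: cpoly_def pderiv_smult pd)
 qed
 also have "... = [:ev t f:]"     proof -
  have "(SUM i<=n. smult (a i) [:b i:]) = [:SUM i<=n. a i * b i:]" for a b :: "nat => 'q ratfun_ac" and n :: nat
  by (induction n) auto
  then show ?thesis by (simp add: ev_altdef)
 qed
 finally show "pderiv cpoly = [:ev t f:]" .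
 show "ev t f ~= 0" using param_ev_0[OF t] f by simp
 qed
 moreover have "{x. poly cpoly x = 0} = Lam" by (simp add: Lam_def carlitz_comb comb_def cpoly_def poly_sum pp)
 ultimately show ?thesis by simp
qed

sublocale galois k0 Cy
 unfolding Cy_eq by (rule galois_split_set[OF sfd_base split_Lam])

lemma LamC: "Lam <= Cy" and tC: "t : Cy" "t : k0" and constC: "const c : Cy"
 using gen_incl[of "k0 Un Lam"] param_in_base[OF t] const_base FL by (auto simp: Cy_eq)

lemma fin_Lam: "finite Lam" using split_Lam by (simp add: split_set_def)

lemma goodC: "good Cy" by (rule good_galois[OF good_base galois_axioms])

lemma aut_phi: assumes s: "s : G" and u: "u : Cy"
 shows "s (const c * u) = const c * s u" "s (phi t u) = phi t (s u)" "phi t u : Cy"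
proof -
 note r = auts_rhom[OF s]
 have "s (const c) = const c" "s t = t" using auts_fix[OF s] tC const_base by auto
 then show "s (const c * u) = const c * s u" "s (phi t u) = phi t (s u)"
 using rhom_mult[OF r constC u] rhom_mult[OF r tC(1) u] rhom_power[OF r sfL u] u tC sfL
  rhom_add[OF r, of "u ^ CARD('q)" "t * u"] by (simp_all add: phi_def sfd_power sfd_mult)
 show "phi t u : Cy" using u tC sfL by (simp add: phi_def sfd_add sfd_power sfd_mult)
qed

lemma aut_comb: assumes s: "s : G" and u: "u : Cy" shows "s (comb t n c u) = comb t n c (s u)" "comb t n c u : Cy"
 using comb_hom[of Cy t s u n c] aut_phi[OF s] u rhom_add[OF auts_rhom[OF s]] constC sfL by (auto simp: sfd_add sfd_mult)

lemma aut_pow: assumes s: "s : G" and u: "u : Cy" shows "s ((phi t ^^ i) u) = (phi t ^^ i) (s u)"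
proof -
 have "(phi t ^^ i) u : Cy & s ((phi t ^^ i) u) = (phi t ^^ i) (s u)" using aut_phi[OF s] u by (induction i) auto
 then show ?thesis by simp
qed

lemma aut_Lam: assumes s: "s : G" and u: "u : Lam" shows "s u : Lam"
proof -
 have "carlitz_action t f (s u) = s (carlitz_action t f u)" using aut_comb[OF s] u LamC by (simp add: carlitz_comb subset_iff)
 then show ?thesis using u rhom_0[OF auts_rhom[OF s] sfL] by (simp add: Lam_def)
qed

lemma aut_eqI: assumes s: "s : G" "s' : G" and e: "!!u. u : Lam ==> s u = s' u" shows "s = s'"
proof (rule auts_eqI[OF s])
 fix x assume x: "x : Cy"
 show "s x = s' x"
 by (rule rhom_gen_agree[OF auts_rhom[OF s(1)] auts_rhom[OF s(2)] sfL, of "k0 Un Lam"])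
  (use x e auts_fix[OF s(1)] auts_fix[OF s(2)] FL LamC in "auto simp: Cy_eq")
qed

text \<open>The Newton polygon of \<open>u ^ q + t * u\<close>: the summand of smaller value
  decides. The case of equal values, where cancellation may occur, is left out.\<close>

lemma ord_phi_pole:
 assumes W: "dvr Cy W" and u: "u : Cy" "u ~= 0"
 shows "int CARD('q) * ord Cy W u < ord Cy W t + ord Cy W u ==> phi t u ~= 0 & ord Cy W (phi t u) = int CARD('q) * ord Cy W u"
 "int CARD('q) * ord Cy W u > ord Cy W t + ord Cy W u ==> phi t u ~= 0 & ord Cy W (phi t u) = ord Cy W t + ord Cy W u"
proof -
 interpret W: dvr Cy W by fact
 have t0: "t ~= 0" by (rule param_nonzero[OF t])
 have o: "W.nu (u ^ CARD('q)) = int CARD('q) * W.nu u" "W.nu (t * u) = W.nu t + W.nu u"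
 using W.ord_power[OF u] W.ord_mult[OF tC(1) u(1) t0 u(2)] by auto
 have m: "u ^ CARD('q) : Cy" "t * u : Cy" "u ^ CARD('q) ~= 0" "t * u ~= 0" using u tC t0 sfL by (auto simp: sfd_power sfd_mult)
 show "int CARD('q) * W.nu u < W.nu t + W.nu u ==> phi t u ~= 0 & W.nu (phi t u) = int CARD('q) * W.nu u"
 using W.ord_add_eq[OF m] o by (simp add: phi_def)
 show "int CARD('q) * W.nu u > W.nu t + W.nu u ==> phi t u ~= 0 & W.nu (phi t u) = W.nu t + W.nu u"
 using W.ord_add_eq[OF m(2,1,4,3)] o by (simp add: phi_def add.commute)
qed

text \<open>Elements of the finite set \<open>Lam\<close> cannot have values so small that applying \<open>phi t\<close> decreases them.\<close>

lemma Lam_bound: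
 assumes W: "dvr Cy W" and u: "u : Lam" "u ~= 0"
 shows "min 0 (ord Cy W t) <= (int CARD('q) - 1) * ord Cy W u"
proof (rule ccontr)
 assume n: "~ ?thesis"
 let ?nu = "ord Cy W" and ?S = "Lam - {0}"
 have q: "int CARD('q) > 1" using one_less_card[where 'q='q] by linarith
 obtain v where v: "v : ?S" "!!w. w : ?S ==> ?nu v <= ?nu w"
 using arg_min_if_finite[of ?S ?nu] fin_Lam u leI by blast
 have "(int CARD('q) - 1) * ?nu v <= (int CARD('q) - 1) * ?nu u" using v(2)[of u] u q by (intro mult_left_mono) auto
 then have "(int CARD('q) - 1) * ?nu v < min 0 (?nu t)" using n by linarith
 then have l: "int CARD('q) * ?nu v < ?nu t + ?nu v" "(int CARD('q) - 1) * ?nu v < 0" by (auto simp: algebra_simps)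
 from l(2) q have neg: "?nu v < 0" by (simp add: mult_less_0_iff)
 have vC: "v : Cy" "v ~= 0" using v LamC by auto
 have "phi t v : ?S" "?nu (phi t v) = int CARD('q) * ?nu v"
 using ord_phi_pole(1)[OF W vC l(1)] v Lam_closed(3) by auto
 moreover have "int CARD('q) * ?nu v < ?nu v" using l(2) by (simp add: algebra_simps)
 ultimately show False using v(2) by fastforce
qed

text \<open>Torsion points are integral at \<open>W\<close>. For \<open>w\<close> in the maximal
  ideal the action of \<open>f\<close> is \<open>w\<close> times the sum of \<open>ev t f\<close>
  and a multiple of \<open>w\<close>, so reduction is injective on torsion, and an inertial
  automorphism fixes every torsion point.\<close>

lemma tin_unit:
 assumes W: "pr Cy W" and tW: "t : W" and fW: "ev t f ~: mx W" shows "tin k0 Cy W"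
 unfolding tin_def
proof
 have d: "dvr Cy W" by (rule goodD(3)[OF goodC W])
 interpret W: dvr Cy W by (rule d)
 note v = prD[OF W]
 have LW: "u : W" if u: "u : Lam" for u
 proof (cases "u = 0 | t = 0")
 case False
 have "0 <= W.nu t" using tW W.mem_iff[OF tC(1)] False by simp
 then have "0 <= (int CARD('q) - 1) * W.nu u" using Lam_bound[OF d u] False by simp
 moreover have "int CARD('q) > 1" using one_less_card[where 'q='q] by linarith
 ultimately have "0 <= W.nu u" by (simp add: zero_le_mult_iff)
 then show ?thesis using W.mem_iff[of u] u LamC False by auto
 qed (use vr_0[OF v(1)] param_nonzero[OF t] in auto)
 have small: "w = 0" if w: "w : Lam" "w : mx W" for w
 proof (rule ccontr)
 assume w0: "w ~= 0"
 have wW: "w : W" using w(2) mx_sub by blast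
 have "EX r. r : W & (phi t ^^ i) w = t ^ i * w + w * (w * r)" for i
 proof (induction i)
  case (Suc i)
  then obtain r where r: "r : W" "(phi t ^^ i) w = t ^ i * w + w * (w * r)" by blast
  obtain k where k: "CARD('q) = Suc (Suc k)" using one_less_card[where 'q='q] that[of "CARD('q) - 2"] by simp
  define y where "y = t ^ i + w * r"
  have y: "(phi t ^^ i) w = w * y" "y : W" using r tW wW v(1) by (auto simp: y_def algebra_simps vr_add vr_mult vr_power)
  have "(phi t ^^ Suc i) w = (w * y) ^ Suc (Suc k) + t * (t ^ i * w + w * (w * r))" using y(1) r(2) by (simp add: phi_def k)
  also have "... = t ^ Suc i * w + w * (w * (w ^ k * y ^ Suc (Suc k) + t * r))" by (simp add: power_mult_distrib algebra_simps)
  finally show ?case using r y(2) wW tW v(1) by (intro exI[of _ "w ^ k * y ^ Suc (Suc k) + t * r"]) (auto simp: vr_add vr_mult vr_power simp del: power_Suc)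
 qed (auto intro: exI[of _ 0] vr_0[OF v(1)])
 then have "ALL i. EX r. r : W & (phi t ^^ i) w = t ^ i * w + w * (w * r)" by blast
 from choice[OF this] obtain r where r: "!!i. r i : W" "!!i. (phi t ^^ i) w = t ^ i * w + w * (w * r i)" by blast
 have "0 = (SUM i<=degree f. const (coeff f i) * (t ^ i * w + w * (w * r i)))"
  using w(1) by (simp add: Lam_def carlitz_comb comb_def r(2))
 also have "... = w * (ev t f + w * (SUM i<=degree f. const (coeff f i) * r i))"
  by (simp add: ev_altdef sum_distrib_left distrib_left sum.distrib mult_ac)
 finally have "ev t f = - (w * (SUM i<=degree f. const (coeff f i) * r i))" using w0 by (simp add: eq_neg_iff_add_eq_0)
 moreover have "(SUM i<=degree f. const (coeff f i) * r i) : W" using r(1) v by (intro vr_sum[OF v(1)] vr_mult[OF v(1)]) auto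
 ultimately show False using fW mx_minus[OF v(1)] mx_mult[OF v(1) w(2)] by metis
 qed
 fix s assume s: "s : inert k0 Cy W"
 then have sG: "s : G" by (simp add: inert_def)
 have "s = (\<lambda>x\<in>Cy. x)"
 proof (rule aut_eqI[OF sG G_id])
 fix u assume u: "u : Lam"
 have "s u - u = 0" using small[of "s u - u"] Lam_diff[OF aut_Lam[OF sG u] u] s LW[OF u] by (simp add: inert_def)
 then show "s u = (\<lambda>x\<in>Cy. x) u" using u LamC by auto
 qed
 then show "s : {\<lambda>x\<in>Cy. x}" by simp
qed

end

lemma prod_minus_const: "(PROD c:UNIV. z - const c) = z ^ CARD('q) - (z :: ('q::{field,finite}) ratfun_ac)"
proof -
 define P :: "'q ratfun_ac poly" where "P = (PROD c:UNIV. [:- const c, 1:])"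
 define D where "D = P - (monom 1 CARD('q) - monom 1 1)"
 have q: "CARD('q) > 1" by (rule one_less_card)
 have dP: "degree P = CARD('q)" unfolding P_def by (subst degree_prod_eq_sum_degree) auto
 have "lead_coeff P = 1" unfolding P_def lead_coeff_prod by simp
 then have lP: "coeff P CARD('q) = 1" by (simp add: dP)
 have pP: "poly P x = (PROD c:UNIV. x - const c)" for x by (simp add: P_def poly_prod)
 have "D = 0"
 proof (rule ccontr)
 assume D: "D ~= 0"
 have "degree (monom 1 CARD('q) - monom 1 1 :: 'q ratfun_ac poly) <= CARD('q)"
  using q by (intro degree_diff_le) (auto simp: degree_monom_eq)
 then have "degree D <= CARD('q)" unfolding D_def by (rule degree_diff_le[rotated]) (simp add: dP)
 moreover have "coeff D CARD('q) = 0" using q lP by (simp add: D_def)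
 ultimately have dD: "degree D < CARD('q)" using D eq_zero_or_degree_less by blast
 have "poly D (const c) = 0" for c
 proof -
  have "poly P (const c) = 0" unfolding pP using prod_zero[of UNIV "%d. const c - const d"] by auto
  moreover have "const c ^ CARD('q) = const c" by (simp add: finite_field_pow_card flip: const_power)
  ultimately show ?thesis by (simp add: D_def poly_monom)
 qed
 then have "card (range (const :: 'q => _)) <= card {x. poly D x = 0}"
  using poly_roots_finite[OF D] by (intro card_mono) auto
 also have "... <= degree D" by (rule card_poly_roots_bound[OF D])
 also have "card (range (const :: 'q => _)) = CARD('q)" by (intro card_image inj_onI) simp
 finally show False using dD by simp
 qed
 then have "poly P z = z ^ CARD('q) - z" by (simp add: D_def poly_monom)
 then show ?thesis by (simp add: pP)
qed

lemma (in dvr) ord_prod: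
 "finite A ==> (!!i. i : A ==> f i : L & f i ~= 0) ==> nu (prod f A) = (SUM i:A. nu (f i))"
proof (induction A rule: finite_induct)
 case (insert a A)
 have "prod f A : L" using insert by (intro sfd_prod[OF sfL]) auto
 moreover have "prod f A ~= 0" using insert by (simp add: prod_zero_iff)
 ultimately show ?case using insert ord_mult[of "f a" "prod f A"] by simp
qed simp

text \<open>\<open>nu p\<close> is the ramification index; elements of value zero below stay units
  above.\<close>

lemma (in dvr) ord_restrict:
 assumes Z: "dvr Z (W Int Z)" "Z <= L" and p: "p : Z" "p ~= 0" "ord Z (W Int Z) p = 1" and z: "z : Z" "z ~= 0"
 shows "nu z = ord Z (W Int Z) z * nu p"
proof -
 interpret Z: dvr Z "W Int Z" by fact
 have unit: "nu a = 0" if a: "a : Z" "a ~= 0" "Z.nu a = 0" for a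
 proof -
 have i: "inverse a : Z" using a Z.sfL by (simp add: sfd_inverse)
 have "a : W" "inverse a : W" using Z.mem_iff[OF a(1,2)] Z.mem_iff[OF i] Z.ord_inverse[OF a(1,2)] a by auto
 moreover have "a : L" "inverse a : L" using a i Z(2) by auto
 ultimately show ?thesis using mem_iff[of a] mem_iff[of "inverse a"] ord_inverse[of a] a(2) by simp
 qed
 define m where "m = Z.nu z"
 have pL: "p : L" "z : L" using p z Z(2) by auto
 have pm: "p ^ n : Z" "p ^ n : L" "p ^ n ~= 0" "Z.nu (p ^ n) = int n" "nu (p ^ n) = int n * nu p" for n
 using p pL Z.sfL sfL Z.ord_power[OF p(1,2)] ord_power[OF pL(1) p(2)] by (auto simp: sfd_power)
 show ?thesis
 proof (cases "m >= 0")
 case True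
 have "nu (z / p ^ nat m) = 0"
  using Z.ord_divide[OF z(1) pm(1) z(2) pm(3)] z pm Z.sfL True by (intro unit) (auto simp: sfd_divide m_def)
 then show ?thesis using ord_divide[OF pL(2) pm(2) z(2) pm(3), of "nat m"] pm(5) True by (simp add: m_def)
 next
 case False
 have "nu (z * p ^ nat (- m)) = 0"
  using Z.ord_mult[OF z(1) pm(1) z(2) pm(3)] z pm Z.sfL False by (intro unit) (auto simp: sfd_mult m_def)
 then show ?thesis using ord_mult[OF pL(2) pm(2) z(2) pm(3), of "nat (- m)"] pm(5) False by (simp add: m_def)
 qed
qed

lemma base_zero_ex: "param t ==> EX V. pr k0 V & t : mx V"
 using base_vr_ex[of t "[:0, 1:]"] by (auto simp: pr_def ev_pCons)

locale carlitz_pole = carlitz t f for t :: "('q::{field,finite}) ratfun_ac" and f +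
 fixes W and q :: int
 assumes W: "pr Cy W" "t ~: W" and nontrivial: "Lam ~= {0}" and q_def: "q = int CARD('q)"
begin

sublocale W: dvr Cy W by (rule goodD(3)[OF goodC W(1)])

abbreviation e :: int where "e == - W.nu t"

lemma q: "q > 1" using one_less_card[where 'q='q] by (simp add: q_def)

lemma t0: "t ~= 0" by (rule param_nonzero[OF t])

lemma e: "e > 0" using W(2) W.mem_iff[OF tC(1) t0] by simp

lemma LamD: "u : Lam - {0} ==> u : Cy & u ~= 0 & u : Lam" using LamC by auto

lemma bound: "u : Lam - {0} ==> - e <= (q - 1) * W.nu u"
 using Lam_bound[OF W.dvr_axioms, of u] e by (simp add: q_def)

lemma step: assumes u: "u : Lam - {0}" and n: "(q - 1) * W.nu u ~= - e" shows "phi t u : Lam - {0}" "W.nu (phi t u) = W.nu u - e"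
proof -
 have "(q - 1) * W.nu u > - e" using bound[OF u] n by linarith
 then have "q * W.nu u > W.nu t + W.nu u" by (simp add: algebra_simps)
 then show "phi t u : Lam - {0}" "W.nu (phi t u) = W.nu u - e"
 using ord_phi_pole(2)[OF W.dvr_axioms, of u, folded q_def] LamD[OF u] Lam_closed(3) by auto
qed

text \<open>The value of \<open>u\<close> lies \<open>j\<close> steps of size \<open>e\<close> above
  the smallest possible value \<open>- e / (q - 1)\<close>; each application of \<open>phi t\<close>
  descends one step.\<close>

definition level :: "nat => 'q ratfun_ac => bool" where
 "level j u \<longleftrightarrow> (q - 1) * (W.nu u - int j * e) = - e"

lemma level_ex: "u : Lam - {0} ==> EX j. level j u"
proof (induction "nat ((q - 1) * W.nu u + e)" arbitrary: u rule: less_induct)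
 case less
 show ?case
 proof (cases "level 0 u")
 case False
 then have n: "(q - 1) * W.nu u ~= - e" by (simp add: level_def)
 note s = step[OF less.prems n]
 have b: "(q - 1) * W.nu u > - e" using bound[OF less.prems] n by linarith
 have "(q - 1) * (W.nu u - e) < (q - 1) * W.nu u" using q e by (intro mult_strict_left_mono) auto
 then have "nat ((q - 1) * W.nu (phi t u) + e) < nat ((q - 1) * W.nu u + e)" unfolding s(2) using b by linarith
 from less.hyps[OF this s(1)] obtain j where "level j (phi t u)" by blast
 then have "level (Suc j) u" using s(2) by (simp add: level_def algebra_simps)
 then show ?thesis by blast
 qed blast
qed

lemma level_phi: assumes "level j u" "u : Lam - {0}" "i <= j"
 shows "(phi t ^^ i) u : Lam - {0} & W.nu ((phi t ^^ i) u) = W.nu u - int i * e"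
 using assms(3)
proof (induction i)
 case (Suc i)
 then have IH: "(phi t ^^ i) u : Lam - {0}" "W.nu ((phi t ^^ i) u) = W.nu u - int i * e" by auto
 have "(q - 1) * (int (j - i) * e) > 0" using q e Suc.prems by (intro mult_pos_pos) auto
 moreover have "(q - 1) * (W.nu u - int i * e) = (q - 1) * (W.nu u - int j * e) + (q - 1) * (int (j - i) * e)"
 using Suc.prems by (simp add: of_nat_diff algebra_simps)
 ultimately have "(q - 1) * W.nu ((phi t ^^ i) u) ~= - e" using assms(1) unfolding IH(2) level_def by linarith
 from step[OF IH(1) this] show ?case using IH(2) by (simp add: algebra_simps)
qed (use assms(2) in simp)

text \<open>At the lowest level \<open>phi t u / u\<close> and \<open>phi t v / v\<close> are
  integral while \<open>v ^ (q - 1)\<close> has a pole. Hence \<open>z = u / v\<close> satisfies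
  \<open>z ^ q - z\<close> in the maximal ideal, and so it is congruent to a constant of the field
  with \<open>q\<close> elements.\<close>

lemma congruent_top:
 assumes u: "u : Lam - {0}" "level 0 u" and v: "v : Lam - {0}" "level 0 v"
 shows "EX c. c ~= 0 & (u = const c * v | W.nu (u - const c * v) > W.nu u)"
proof -
 note uC = LamD[OF u(1)] and vC = LamD[OF v(1)]
 have lu: "(q - 1) * W.nu u = - e" "(q - 1) * W.nu v = - e" using u v by (auto simp: level_def)
 then have eq: "W.nu u = W.nu v" using q by (metis diff_gt_0_iff_gt less_irrefl mult_left_cancel)
 have aW: "phi t w / w : W" if w: "w : Lam - {0}" "(q - 1) * W.nu w = - e" for w
 proof (cases "phi t w = 0")
 case False
 note wC = LamD[OF w(1)]
 have p: "phi t w : Lam - {0}" using False Lam_closed(3) wC by auto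
 have "(q - 1) * W.nu w <= (q - 1) * W.nu (phi t w)" using bound[OF p] w(2) by linarith
 then have "W.nu w <= W.nu (phi t w)" using q by (simp add: mult_le_cancel_left)
 then show ?thesis using W.ord_divide[of "phi t w" w] W.mem_iff[of "phi t w / w"] LamD[OF p] wC sfL
  by (simp add: sfd_divide)
 qed (use vr_0[OF W.vr] in simp)
 define a b z where "a = phi t u / u" and "b = phi t v / v" and "z = u / v"
 have ab: "a - b : W" using aW[OF u(1) lu(1)] aW[OF v(1) lu(2)] vr_diff[OF W.vr] by (simp add: a_def b_def)
 have zC: "z : Cy" "z ~= 0" "W.nu z = 0" using uC vC sfL W.ord_divide[of u v] eq by (auto simp: z_def sfd_divide)
 then have zW: "z : W" "z ~: mx W" using W.mem_iff[OF zC(1,2)] by (auto simp: W.mx_eq pw_def)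
 define y where "y = v ^ CARD('q) / v"
 have vq: "v ^ CARD('q) : Cy" "v ^ CARD('q) ~= 0" using vC sfL by (auto simp: sfd_power)
 have y: "y : Cy" "y ~= 0" using vq vC sfL by (auto simp: y_def sfd_divide)
 have "W.nu y = q * W.nu v - W.nu v" using W.ord_divide[OF vq(1) _ vq(2), of v] W.ord_power[of v] vC by (simp add: y_def q_def)
 then have "W.nu (inverse y) = e" using W.ord_inverse[OF y] lu(2) by (simp add: algebra_simps)
 then have iy: "inverse y : mx W" using e y sfL by (simp add: W.mx_eq pw_def sfd_inverse)
 have "z ^ CARD('q) - z = z * (a - b) * inverse y"
 proof -
 have "a * u = phi t u" "b * v = phi t v" using uC vC by (auto simp: a_def b_def)
 then have "a * u = u ^ CARD('q) + t * u" "b * v = v ^ CARD('q) + t * v" by (simp_all add: phi_def)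
 moreover have "y * v = v ^ CARD('q)" "z * v = u" using vC by (auto simp: y_def z_def)
 moreover have "(a - b) * u * v = a * u * v - b * v * u" by (simp add: algebra_simps)
 ultimately have "(a - b) * u * v = (u ^ CARD('q) * v - v ^ CARD('q) * u)" by (simp add: algebra_simps)
 moreover have "inverse y * v ^ CARD('q) = v" using y `y * v = v ^ CARD('q)`[symmetric] by simp
 moreover have "z ^ CARD('q) * v ^ CARD('q) = u ^ CARD('q)" using vC by (simp add: z_def power_divide)
 moreover have "(z ^ CARD('q) - z) * (v ^ CARD('q) * v) = z ^ CARD('q) * v ^ CARD('q) * v - v ^ CARD('q) * (z * v)"
  "z * (a - b) * inverse y * (v ^ CARD('q) * v) = (a - b) * (z * v) * (inverse y * v ^ CARD('q))" by (simp_all add: algebra_simps)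
 ultimately have "(z ^ CARD('q) - z) * (v ^ CARD('q) * v) = z * (a - b) * inverse y * (v ^ CARD('q) * v)"
  using `z * v = u` by simp
 then show ?thesis using vC by simp
 qed
 also have "... : mx W" using mx_mult[OF W.vr iy vr_mult[OF W.vr zW(1) ab]] by (simp add: mult.commute)
 finally have "(PROD c:UNIV. z - const c) : mx W" by (simp add: prod_minus_const)
 then obtain c where c: "z - const c : mx W"
 using mx_prod_notin[OF W.vr, of UNIV "%c. z - const c"] zW(1) prD(2)[OF W(1)] vr_diff[OF W.vr] by blast
 have c0: "c ~= 0" using c zW(2) by auto
 have e1: "u - const c * v = v * (z - const c)" using vC by (simp add: z_def algebra_simps)
 show ?thesis
 proof (cases "z - const c = 0")
 case True
 then show ?thesis using e1 c0 by auto
 next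
 case False
 have "W.nu (z - const c) >= 1" "z - const c : Cy" using c False by (auto simp: W.mx_eq pw_def)
 then have "W.nu (u - const c * v) > W.nu u" unfolding e1 using W.ord_mult[of v "z - const c"] vC False eq by simp
 then show ?thesis using c0 by blast
 qed
qed

lemma ord_const_mult: "c ~= 0 ==> u : Cy ==> W.nu (const c * u) = W.nu u"
proof (cases "u = 0")
 case False
 assume c: "c ~= 0" and u: "u : Cy"
 have W': "const c : W" "inverse (const c) : W" using prD(2)[OF W(1)] by (auto simp flip: const_inverse)
 have "W.nu (const c) = 0"
 using W.mem_iff[OF constC, of c] W.mem_iff[OF constC, of "inverse c"] W.ord_inverse[OF constC, of c] c W' by (simp add: const_inverse)
 then show ?thesis using W.ord_mult[OF constC u, of c] c False by simp
qed simp

text \<open>Induction on the level through \<open>phi t\<close>. If the difference still had the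
  value of \<open>u\<close>, its image under \<open>phi t\<close> would have the value of
  \<open>phi t u\<close>, against the induction hypothesis.\<close>

lemma congruent:
 "level j u ==> u : Lam - {0} ==> v : Lam - {0} ==> W.nu u = W.nu v ==>
 EX c. c ~= 0 & (u = const c * v | W.nu (u - const c * v) > W.nu u)"
proof (induction j arbitrary: u v)
 case 0
 then show ?case using congruent_top[of u v] by (simp add: level_def)
next
 case (Suc j)
 have lv: "level (Suc j) v" using Suc.prems by (simp add: level_def)
 have p: "phi t u : Lam - {0}" "W.nu (phi t u) = W.nu u - e" "phi t v : Lam - {0}" "W.nu (phi t v) = W.nu v - e"
 using level_phi[OF Suc.prems(1,2), of 1] level_phi[OF lv Suc.prems(3), of 1] by auto
 have "level j (phi t u)" using Suc.prems(1) p(2) by (simp add: level_def algebra_simps)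
 from Suc.IH[OF this p(1,3)] obtain c where c: "c ~= 0" "phi t u = const c * phi t v | W.nu (phi t u - const c * phi t v) > W.nu (phi t u)"
 using p Suc.prems(4) by auto
 define w where "w = u - const c * v"
 have wL: "w : Lam" using Suc.prems Lam_closed(2) Lam_diff by (simp add: w_def)
 have pw: "phi t w = phi t u - const c * phi t v"
 using phi_lin(1)[of t u "const (- c) * v"] phi_lin(2)[of t "- c" v] by (simp add: w_def)
 have "W.nu w > W.nu u" if w0: "w ~= 0"
 proof (rule ccontr)
 assume n: "~ W.nu w > W.nu u"
 have uv: "u : Cy" "u ~= 0" "v : Cy" using LamD[OF Suc.prems(2)] LamD[OF Suc.prems(3)] by simp_all
 have "u : pw Cy W (W.nu u)" using uv by (simp add: pw_def)
 moreover have "const c * v : pw Cy W (W.nu u)"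
  using uv ord_const_mult[OF c(1) uv(3)] Suc.prems(4) constC sfL by (simp add: pw_def sfd_mult)
 ultimately have "w : pw Cy W (W.nu u)" unfolding w_def by (rule W.pw_diff)
 then have "W.nu w = W.nu u" using n w0 by (simp add: pw_def)
 then have "level (Suc j) w" using Suc.prems(1) by (simp add: level_def)
 from level_phi[OF this, of 1] have "phi t w ~= 0 & W.nu (phi t w) = W.nu u - e" using wL w0 `W.nu w = W.nu u` by auto
 then show False using c(2) p(2) unfolding pw by auto
 qed
 then show ?case using c(1) by (intro exI[of _ c]) (auto simp: w_def)
qed

text \<open>A torsion point \<open>u0\<close> of largest value generates. Every other
  \<open>v\<close> has the value of an iterate of \<open>u0\<close>, and subtracting a constant
  multiple of that iterate raises the value or gives zero; as values are bounded, this stops.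
  Cyclicity is thus obtained without counting the torsion.\<close>

lemma generator:
 "EX u0 j. u0 : Lam - {0} & (ALL v:Lam - {0}. W.nu v <= W.nu u0) & level j u0 & (ALL v:Lam. EX c. v = comb t j c u0)"
proof -
 have "0 : Lam" by (simp add: Lam_def carlitz_comb comb_0)
 then have "finite (Lam - {0})" "Lam - {0} ~= {}" using fin_Lam nontrivial by auto
 from arg_min_if_finite[OF this, of "%u. - W.nu u"]
 obtain u0 where u0: "u0 : Lam - {0}" "!!v. v : Lam - {0} ==> W.nu v <= W.nu u0" by (metis neg_le_iff_le not_le)
 obtain j where j: "level j u0" using level_ex[OF u0(1)] by blast
 have "v : Lam ==> EX c. v = comb t j c u0" for v
 proof (induction "nat (W.nu u0 - W.nu v)" arbitrary: v rule: less_induct)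
 case less
 show ?case
 proof (cases "v = 0")
  case True
  then show ?thesis by (intro exI[of _ "%_. 0"]) (simp add: comb_def)
 next
  case False
  then have v: "v : Lam - {0}" using less.prems by simp
  obtain i where i: "level i v" using level_ex[OF v] by blast
  have eq: "W.nu u0 - W.nu v = (int j - int i) * e"
  proof -
  have "(q - 1) * (W.nu u0 - int j * e) = (q - 1) * (W.nu v - int i * e)" using i j by (simp add: level_def)
  then have "W.nu u0 - int j * e = W.nu v - int i * e" using q by (metis diff_gt_0_iff_gt less_irrefl mult_left_cancel)
  then show ?thesis by (simp add: algebra_simps)
  qed
  then have ij: "i <= j" using u0(2)[OF v] e by (metis diff_ge_0_iff_ge of_nat_le_iff zero_le_mult_iff not_less order_less_le)
  have w: "(phi t ^^ (j - i)) u0 : Lam - {0}" "W.nu v = W.nu ((phi t ^^ (j - i)) u0)"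
  using level_phi[OF j u0(1), of "j - i"] eq ij by (auto simp: of_nat_diff)
  obtain c where c: "v = const c * (phi t ^^ (j - i)) u0 | W.nu (v - const c * (phi t ^^ (j - i)) u0) > W.nu v"
  using congruent[OF i v w] by blast
  define v' where "v' = v - const c * (phi t ^^ (j - i)) u0"
  have v'L: "v' : Lam" using v w(1) Lam_closed(2) Lam_diff by (simp add: v'_def)
  have "EX d. v' = comb t j d u0"
  proof (cases "v' = 0")
  case True
  then show ?thesis by (intro exI[of _ "%_. 0"]) (simp add: comb_def)
  next
  case False
  then have "W.nu v' > W.nu v" "W.nu v' <= W.nu u0" using c u0(2)[of v'] v'L by (auto simp: v'_def)
  then show ?thesis using less.hyps[OF _ v'L] by simp
  qed
  then obtain d where d: "v' = comb t j d u0" by blast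
  have "comb t j (%k. d k + (if k = j - i then c else 0)) u0 = comb t j d u0 + (SUM k<=j. if k = j - i then const c * (phi t ^^ k) u0 else 0)"
  unfolding comb_def sum.distrib[symmetric] by (intro sum.cong refl) (auto simp: distrib_right)
  also have "... = v" using d[symmetric] by (simp add: v'_def)
  finally show ?thesis by metis
 qed
 qed
 then show ?thesis using u0 j by blast
qed

text \<open>Both automorphisms send the generator to polynomial combinations of itself, and the
  operators of the Carlitz action commute.\<close>

lemma aut_comm: assumes s: "s : G" "s' : G" and u: "u : Lam" shows "s (s' u) = s' (s u)"
proof -
 obtain u0 j where g: "u0 : Lam" "!!v. v : Lam ==> EX c. v = comb t j c u0" using generator by auto
 obtain c d where cd: "s u0 = comb t j c u0" "s' u0 = comb t j d u0" using g aut_Lam[OF s(1) g(1)] aut_Lam[OF s(2) g(1)] by metis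
 obtain b where b: "u = comb t j b u0" using g(2)[OF u] by blast
 have C: "u0 : Cy" "s u0 : Cy" "s' u0 : Cy" using g(1) aut_Lam[OF s(1) g(1)] aut_Lam[OF s(2) g(1)] LamC by auto
 have "s (s' u0) = s' (s u0)"
 using aut_comb(1)[OF s(1) C(1), of j d] aut_comb(1)[OF s(2) C(1), of j c] cd by (simp add: comb_comb)
 then show ?thesis using aut_comb(1)[OF s(1)] aut_comb(1)[OF s(2)] C by (simp add: b)
qed

text \<open>The decomposition group preserves values, so \<open>s u0\<close> is congruent to a
  constant multiple of \<open>u0\<close>; a nonzero difference would have a value above the largest
  one.\<close>

lemma dec_scalar: assumes s: "s : dec k0 Cy W" shows "EX c. c ~= 0 & (ALL v:Lam. s v = const c * v)"
proof -
 have sG: "s : G" "s ` W = W" using s by (auto simp: dec_def)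
 obtain u0 j where g: "u0 : Lam - {0}" "ALL v:Lam - {0}. W.nu v <= W.nu u0" "level j u0" "!!v. v : Lam ==> EX c. v = comb t j c u0"
 using generator by auto
 note u = LamD[OF g(1)]
 have "s u0 ~= 0" using rhom_eq_0[OF auts_rhom[OF sG(1)] sfL] u by blast
 then have su: "s u0 : Lam - {0}" using aut_Lam[OF sG(1)] u by auto
 have eq: "W.nu (s u0) = W.nu u0" using dvr_image(2)[OF sG(1) W.dvr_axioms, of u0] sG(2) u by simp
 then have "level j (s u0)" using g(3) by (simp add: level_def)
 from congruent[OF this su g(1) eq] obtain c where
 c: "c ~= 0" "s u0 = const c * u0 | W.nu (s u0 - const c * u0) > W.nu (s u0)" by blast
 have "s u0 = const c * u0"
 proof (rule ccontr)
 assume n: "s u0 ~= const c * u0"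
 then have "s u0 - const c * u0 : Lam - {0}" using Lam_diff Lam_closed(2) su u by auto
 then have "W.nu (s u0 - const c * u0) <= W.nu u0" using g(2) by blast
 then show False using c(2) n eq by simp
 qed
 moreover have "s v = comb t j b (s u0)" if "v = comb t j b u0" for v b using aut_comb(1)[OF sG(1)] u that by simp
 ultimately have "s v = const c * v" if "v : Lam" for v using g(4)[OF that] comb_lin(2) by metis
 then show ?thesis using c(1) by blast
qed

end

lemma (in carlitz) pole_ex: "EX W. pr Cy W & t ~: W"
proof -
 obtain V where V: "pr k0 V" "inverse t : mx V" using base_zero_ex[OF param_inverse[OF t]] by blast
 obtain W where W: "pr Cy W" "W Int k0 = V" using pr_extend[OF good_base V(1) sfL FL] by blast
 have "t ~: V" using V(2) param_nonzero[OF t] by (auto simp: mx_def)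
 then show ?thesis using W tC(2) by blast
qed

lemma (in carlitz) abel: "abel k0 Cy"
proof (cases "Lam = {0}")
 case True
 have "s = s'" if "s : G" "s' : G" for s s'
 using True rhom_0[OF auts_rhom[OF that(1)] sfL] rhom_0[OF auts_rhom[OF that(2)] sfL] by (intro aut_eqI[OF that]) auto
 then show ?thesis by unfold_locales metis
next
 case False
 obtain W where "pr Cy W" "t ~: W" using pole_ex by blast
 then interpret carlitz_pole t f W "int CARD('q)" using False by unfold_locales auto
 show ?thesis
 proof unfold_locales
 fix s s' x assume s: "s : G" "s' : G" and x: "x : Cy"
 have "compose Cy s s' = compose Cy s' s"
  using aut_comm[OF s] LamC by (intro aut_eqI compose_G s) (auto simp: compose_eq subset_iff)
 from fun_cong[OF this, of x] show "s (s' x) = s' (s x)" using x by (simp add: compose_eq)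
 qed
qed

section \<open>The decomposition group at a pole of \<open>t\<close>\<close>

context carlitz_pole
begin

interpretation ab: abel k0 Cy by (rule abel)

lemma dec_expo: assumes s: "s : dec k0 Cy W" and x: "x : Cy" shows "(s ^^ (CARD('q) - 1)) x = x"
proof -
 obtain c where c: "c ~= 0" "!!v. v : Lam ==> s v = const c * v" using dec_scalar[OF s] by blast
 have sG: "s : G" using s by (simp add: dec_def)
 have p: "(s ^^ n) v = const (c ^ n) * v" if v: "v : Lam" for n v
 proof (induction n)
 case (Suc n)
 then show ?case using c(2)[OF Lam_closed(2)[OF v, of "c ^ n"]] by simp
 qed simp
 have "c * c ^ (CARD('q) - 1) = c * 1"
 using finite_field_pow_card[of c] power_Suc[of c "CARD('q) - 1"] one_less_card[where 'q='q] by simp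
 then have "c ^ (CARD('q) - 1) = 1" using c(1) by simp
 then have "restrict (s ^^ (CARD('q) - 1)) Cy = (\<lambda>x\<in>Cy. x)"
 using p LamC by (intro aut_eqI agrp_funpow(1)[OF G_agrp sG] G_id) auto
 from fun_cong[OF this, of x] show ?thesis using x by simp
qed

text \<open>
  An element of \<open>Lam\<close> of smallest value \<open>- e / (q - 1)\<close> shows that the inertia group has at least
  \<open>q - 1\<close> elements, while the decomposition group acts on \<open>Lam\<close> by scalars.
\<close>

lemma dec_eq_inert: "dec k0 Cy W = inert k0 Cy W" and card_dec: "card (dec k0 Cy W) = CARD('q) - 1"
proof -
 let ?I = "inert k0 Cy W" and ?D = "dec k0 Cy W"
 have ID: "?I <= ?D" using inert_stable[OF W.dvr_axioms] by (auto simp: dec_def)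
 have aI: "agrp Cy ?I" by (rule inert_agrp[OF W.dvr_axioms])
 have fD: "finite ?D" using finG by (auto simp: dec_def)
 have "EX sc. ALL s:?D. sc s ~= 0 & (ALL v:Lam. s v = const (sc s) * v)" using dec_scalar by (intro bchoice) blast
 then obtain sc where sc: "!!s. s : ?D ==> sc s ~= 0" "!!s v. s : ?D ==> v : Lam ==> s v = const (sc s) * v" by blast
 have "inj_on sc ?D"
 proof (rule inj_onI)
 fix a b assume ab: "a : ?D" "b : ?D" "sc a = sc b"
 show "a = b" by (rule aut_eqI) (use ab sc(2)[of a] sc(2)[of b] in "simp_all add: dec_def")
 qed
 then have "card ?D <= card (UNIV - {0 :: 'q})" using sc(1) by (intro card_inj_on_le) auto
 then have D: "card ?D <= CARD('q) - 1" by (simp add: card_Diff_singleton)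
 define Z where "Z = Fix Cy ?I"
 have Z: "sfd Z" "k0 <= Z" "Z <= Cy"
 using Fix_sfd[of Cy ?I] agrp_D(1)[OF aI] sfL FL auts_fix[of _ k0 Cy] by (auto simp: Z_def Fix_def inert_def)
 note d = fam_dvr[OF abel W(1)]
 have dZ: "dvr Z (W Int Z)" using d(4)[OF Z] by blast
 have WZ: "W Int Z Int k0 = W Int k0" using Z by auto
 interpret Z: galois k0 Z using ab.abel_lower(1)[OF Z] by (rule abel.axioms(1))
 have it: "inverse t : k0" "inverse t ~= 0" using t0 tC(2) sfF by (auto simp: sfd_inverse)
 have pV: "pr k0 (W Int k0)" using d(4)[OF sfF order_refl FL] by simp
 have "inverse t : W" using W(2) W.vr tC(1) t0 by (auto simp: vr_def)
 then have "inverse t : mx (W Int k0)" using W(2) it by (auto simp: mx_def)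
 then have o1: "ord k0 (W Int k0) (inverse t) = 1" by (rule base_zero_ord[OF param_inverse[OF t] prD[OF pV]])
 have tZ: "tin k0 Z (W Int Z)" unfolding Z_def by (rule ab.inert_fixed_field_tin[OF W.dvr_axioms]) (use dZ in "simp add: Z_def")
 have oZ: "ord Z (W Int Z) (inverse t) = 1"
 by (rule Z.tin_imp_index_one[OF dZ _ tZ it]) (use d(3) o1 WZ in auto)
 obtain u0 j where g: "u0 : Lam - {0}" "level j u0" using generator by blast
 \<comment> \<open>Applying \<open>phi t\<close> as often as the level allows reaches the smallest
   possible value \<open>- e / (q - 1)\<close>.\<close>
 define w where "w = (phi t ^^ j) u0"
 have w: "w : Lam - {0}" "(q - 1) * W.nu w = - e" using level_phi[OF g(2,1), of j] g(2) by (auto simp: w_def level_def)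
 note wC = LamD[OF w(1)]
 \<comment> \<open>The norm to the inertia field, where \<open>inverse t\<close> is a uniformizer,
   has a value divisible by \<open>e = - (q - 1) * W.nu w\<close>; comparison with the value
   \<open>card ?I * W.nu w\<close> gives divisibility of \<open>card ?I\<close> by
   \<open>q - 1\<close>.\<close>
 define z where "z = (PROD s:?I. s w)"
 have zZ: "z : Z" unfolding z_def Z_def by (rule agrp_norm_fixed[OF aI sfL]) (use wC in simp)
 have sw: "s w : Cy & s w ~= 0 & W.nu (s w) = W.nu w" if "s : ?I" for s
 proof -
 have s: "s : ?D" using that ID by blast
 have "s w = const (sc s) * w" using sc(2)[OF s] wC by blast
 then show ?thesis using sc(1)[OF s] wC constC sfL ord_const_mult by (auto simp: sfd_mult)
 qed
 have fI: "finite ?I" using aI by (simp add: agrp_def)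
 have z0: "z ~= 0" using sw fI by (auto simp: z_def prod_zero_iff)
 have "W.nu z = (SUM s:?I. W.nu (s w))" unfolding z_def by (rule W.ord_prod[OF fI]) (use sw in blast)
 also have "... = int (card ?I) * W.nu w" using sw by simp
 finally have "int (card ?I) * W.nu w = ord Z (W Int Z) z * W.nu (inverse t)"
 using W.ord_restrict[OF dZ Z(3) _ it(2) oZ zZ z0] it(1) Z(2) by auto
 also have "W.nu (inverse t) = - ((q - 1) * W.nu w)" using W.ord_inverse[OF tC(1) t0] w(2) by simp
 finally have "int (card ?I) * W.nu w = (- ord Z (W Int Z) z * (q - 1)) * W.nu w" by (simp add: algebra_simps)
 moreover have "W.nu w ~= 0" using w(2) e by auto
 ultimately have "int (card ?I) = - ord Z (W Int Z) z * (q - 1)" by (metis mult_right_cancel)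
 then have "q - 1 dvd int (card ?I)" by simp
 moreover have "card ?I > 0" using fI aI by (auto simp: card_gt_0_iff agrp_def)
 ultimately have "q - 1 <= int (card ?I)" by (intro zdvd_imp_le) auto
 then have "card ?D <= card ?I" using D unfolding q_def by linarith
 then show eq: "?D = ?I" using card_seteq[OF fD ID] by simp
 then show "card ?D = CARD('q) - 1" using D `q - 1 <= int (card ?I)` q by (simp add: q_def)
qed

end

lemma card_auts_tower:
 assumes L: "galois (F :: ('q::{field,finite}) ratfun_ac set) L" and M: "galois F M" "M <= L"
 shows "card (auts F L) = card (auts F M) * card (auts M L)"
proof -
 interpret M: galois F M by fact
 interpret LM: galois M L by (rule galois.galois_upper[OF L M.sfL M.FL M(2)])
 have sf: "subfield F \<Omega>" "subfield M \<Omega>" using M.sfF M.sfL by (auto simp: subfield_iff)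
 have "R.dimension (card (auts F M) * card (auts M L)) F L"
 by (rule R.telescopic_base[OF sf M.dimension LM.dimension])
 then show ?thesis using R.dimI[OF sf(1) galois.dimension[OF L]] R.dimI[OF sf(1)] by metis
qed

section \<open>Moduli that are powers of \<open>t\<close>, the order of their group, and the fields
  \<open>L_field n\<close>\<close>

locale carlitz_power = carlitz t "monom 1 (Suc n)" for t :: "('q::{field,finite}) ratfun_ac" and n
begin

lemma Lam_iff: "u : Lam \<longleftrightarrow> (phi t ^^ Suc n) u = 0"
proof -
 have "carlitz_action t (monom 1 (Suc n)) u = (SUM i<=Suc n. if i = Suc n then (phi t ^^ i) u else 0)"
 unfolding carlitz_comb comb_def degree_monom_eq[OF one_neq_zero] by (intro sum.cong) auto
 then show ?thesis by (simp add: Lam_def)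
qed

text \<open>A root of \<open>z ^ (q - 1) = - t\<close> is nonzero and killed by
  \<open>phi t\<close>; as \<open>phi t\<close> is surjective on the closure, it can be pulled back
  \<open>n\<close> times.\<close>

lemma primitive_ex: "EX v:Lam. (phi t ^^ n) v ~= 0"
proof -
 have t0: "t ~= 0" by (rule param_nonzero[OF t])
 have q: "CARD('q) > 1" by (rule one_less_card)
 have surj: "EX u. phi t u = c" for c
 proof -
 let ?p = "monom 1 CARD('q) + [:- c, t:]"
 have "degree ?p = CARD('q)" using q t0 by (subst degree_add_eq_left) (auto simp: degree_monom_eq)
 then obtain u where "poly ?p u = 0" using alg_closed_imp_poly_has_root[of ?p] q by auto
 then show ?thesis by (intro exI[of _ u]) (simp add: phi_def poly_monom algebra_simps)
 qed
 obtain v0 where v0: "v0 ^ (CARD('q) - 1) = - t" using nth_root_exists[of "CARD('q) - 1" "- t"] q by auto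
 have "v0 ^ CARD('q) = v0 * v0 ^ (CARD('q) - 1)" using q power_Suc[of v0 "CARD('q) - 1"] by simp
 then have p0: "phi t v0 = 0" unfolding phi_def by (simp only: v0) simp
 have z: "v0 ~= 0" using v0 q t0 by (auto simp: power_0_left)
 have "EX v. (phi t ^^ n) v = v0"
 proof (induction n)
 case (Suc n)
 then obtain v where "(phi t ^^ n) v = v0" by blast
 moreover obtain u where "phi t u = v" using surj by blast
 ultimately show ?case by (intro exI[of _ u]) (simp add: funpow_swap1)
 qed simp
 then show ?thesis using p0 z by (auto simp: Lam_iff)
qed

lemma nontrivial: "Lam ~= {0}"
proof
 assume "Lam = {0}"
 then have "(phi t ^^ n) 0 ~= 0" using primitive_ex by simp
 then show False by (simp add: phi_pow_0)
qed

text \<open>Total ramification over the zero of \<open>t\<close>: each preimage under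
  \<open>phi t\<close> has its value divided by \<open>q\<close>, starting from
  \<open>nu t / (q - 1)\<close>.\<close>

lemma ord_primitive:
 assumes W: "dvr Cy W" and tW: "t : mx W"
 shows "v : Cy ==> (phi t ^^ Suc m) v = 0 ==> (phi t ^^ m) v ~= 0 ==>
 (int CARD('q) - 1) * int CARD('q) ^ m * ord Cy W v = ord Cy W t"
proof (induction m arbitrary: v)
 interpret W: dvr Cy W by fact
 have t0: "t ~= 0" by (rule param_nonzero[OF t])
 case 0
 then have v: "v : Cy" "v ~= 0" "v ^ CARD('q) = - t * v" by (auto simp: phi_def eq_neg_iff_add_eq_0)
 have "int CARD('q) * W.nu v = W.nu (- t) + W.nu v"
 using W.ord_power[OF v(1,2), of "CARD('q)"] W.ord_mult[of "- t" v] v t0 tC sfL by (simp add: sfd_minus)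
 then show ?case using W.ord_minus[OF tC(1)] by (simp add: algebra_simps)
next
 interpret W: dvr Cy W by fact
 have t0: "t ~= 0" by (rule param_nonzero[OF t])
 case (Suc m)
 define w where "w = phi t v"
 have w: "(phi t ^^ Suc m) w = 0" "(phi t ^^ m) w ~= 0" "w : Cy"
 using Suc.prems aut_phi(3)[OF G_id] by (auto simp: w_def funpow_swap1)
 note IH = Suc.IH[OF w(3,1,2)]
 have q: "int CARD('q) > 1" using one_less_card[where 'q='q] by linarith
 have e: "W.nu t >= 1" using tW t0 by (simp add: W.mx_eq pw_def)
 have v0: "v ~= 0" using Suc.prems(3) by (auto simp del: funpow.simps simp: phi_pow_0)
 have w1: "W.nu w > 0"
 proof (rule ccontr)
 assume "~ W.nu w > 0"
 then have "(int CARD('q) - 1) * int CARD('q) ^ m * W.nu w <= 0" using q by (intro mult_nonneg_nonpos) auto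
 then show False using IH e by simp
 qed
 have "(int CARD('q) - 1) * int CARD('q) ^ m >= 1" using q mult_mono[of 1 "int CARD('q) - 1" 1 "int CARD('q) ^ m"] by simp
 then have we: "W.nu w <= W.nu t" using IH mult_right_mono[of 1 "(int CARD('q) - 1) * int CARD('q) ^ m" "W.nu w"] w1 by simp
 note o = ord_phi_pole[OF W Suc.prems(1) v0, folded w_def]
 have "W.nu v > 0"
 proof (rule ccontr)
 assume n: "~ W.nu v > 0"
 then have "int CARD('q) * W.nu v <= 1 * W.nu v" using q by (intro mult_right_mono_neg) auto
 then have "W.nu w = int CARD('q) * W.nu v" using o(1) e by simp
 then show False using w1 n `int CARD('q) * W.nu v <= 1 * W.nu v` by linarith
 qed
 then have "int CARD('q) * W.nu v < W.nu t + W.nu v | W.nu w > W.nu t"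
 proof (cases "int CARD('q) * W.nu v = W.nu t + W.nu v")
 case True
 have "v ^ CARD('q) : pw Cy W (W.nu t + W.nu v)" "t * v : pw Cy W (W.nu t + W.nu v)"
  using W.ord_power[OF Suc.prems(1) v0, of "CARD('q)"] W.ord_mult[OF tC(1) Suc.prems(1) t0 v0] True Suc.prems(1) tC sfL
  by (auto simp: pw_def sfd_power sfd_mult)
 from W.pw_add[OF this] have "w : pw Cy W (W.nu t + W.nu v)" by (simp add: w_def phi_def)
 moreover have "w ~= 0" using w(2) phi_pow_0 by auto
 ultimately show ?thesis using `W.nu v > 0` by (simp add: pw_def)
 qed (use o(2) in linarith)
 then have "W.nu w = int CARD('q) * W.nu v" using o(1) we by auto
 then show ?case using IH by (simp add: mult_ac)
qed

text \<open>The norm of a primitive torsion point lies in \<open>k0\<close>, so its value is a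
  multiple of that of \<open>t\<close>, while all conjugates share the value found in
  \<open>ord_primitive\<close>.\<close>

lemma card_lower: "(CARD('q) - 1) * CARD('q) ^ n dvd card G"
proof -
 obtain V where V: "pr k0 V" "t : mx V" using base_zero_ex[OF t] by blast
 obtain W where W: "pr Cy W" "W Int k0 = V" using pr_extend[OF good_base V(1) sfL FL] by blast
 have d: "dvr Cy W" by (rule goodD(3)[OF goodC W(1)])
 interpret W: dvr Cy W by (rule d)
 have t0: "t ~= 0" by (rule param_nonzero[OF t])
 have q: "int CARD('q) > 1" using one_less_card[where 'q='q] by linarith
 have tW: "t : mx W" using V(2) mx_Int[OF W.vr sfF] W(2) by auto
 obtain v where v: "v : Lam" "(phi t ^^ n) v ~= 0" using primitive_ex by blast
 have vC: "v : Cy" using v LamC by auto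
 define N where "N = (int CARD('q) - 1) * int CARD('q) ^ n"
 have s: "s v : Cy & s v ~= 0 & W.nu (s v) = W.nu v" if s: "s : G" for s
 proof -
 have sL: "s v : Lam" by (rule aut_Lam[OF s v(1)])
 have "(phi t ^^ n) (s v) ~= 0"
  using aut_pow[OF s vC, of n] rhom_eq_0[OF auts_rhom[OF s] sfL, of "(phi t ^^ n) v"] v Lam_pow[OF v(1), of n] LamC by auto
 then have "N * W.nu (s v) = N * W.nu v" "s v ~= 0"
  using ord_primitive[OF d tW, of _ n] v sL LamC phi_pow_0[of n t] by (auto simp: Lam_iff N_def subset_iff)
 moreover have "N ~= 0" using q by (simp add: N_def)
 ultimately show ?thesis using sL LamC by auto
 qed
 define z where "z = (PROD s:G. s v)"
 have z: "z : k0" "z ~= 0" using norm_F[OF vC] s finG by (auto simp: z_def prod_zero_iff)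
 have "W.nu z = (SUM s:G. W.nu (s v))" unfolding z_def by (rule W.ord_prod[OF finG]) (use s in blast)
 then have "int (card G) * W.nu v = W.nu z" using s by simp
 also have "... = ord k0 V z * W.nu t"
 using W.ord_restrict[of k0 t z] base_dvr[OF prD[OF V(1)]] W(2) FL tC(2) t0 base_zero_ord[OF t prD[OF V(1)] V(2)] z by simp
 also have "W.nu t = N * W.nu v" using ord_primitive[OF d tW vC _ v(2)] v(1) by (simp add: Lam_iff N_def)
 finally have "int (card G) * W.nu v = (ord k0 V z * N) * W.nu v" by simp
 moreover have "W.nu v ~= 0" using `W.nu t = N * W.nu v` tW t0 by (auto simp: W.mx_eq pw_def)
 ultimately have "int (card G) = ord k0 V z * N" by (metis mult_right_cancel)
 then have "N dvd int (card G)" by simp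
 moreover have "N = int ((CARD('q) - 1) * CARD('q) ^ n)" using q by (simp add: N_def of_nat_diff)
 ultimately show ?thesis by (simp only: of_nat_dvd_iff)
qed

text \<open>An automorphism is determined by the coefficients expressing the image of the generator.
  There are \<open>n + 1\<close> of them and the constant one is nonzero, as for units modulo a
  power of \<open>t\<close>; this meets the bound of \<open>card_lower\<close>.\<close>

lemma card_G: "card G = (CARD('q) - 1) * CARD('q) ^ n"
proof -
 obtain W where W: "pr Cy W" "t ~: W" using pole_ex by blast
 interpret carlitz_pole t "monom 1 (Suc n)" W "int CARD('q)" using W nontrivial by unfold_locales auto
 obtain u0 j where g: "u0 : Lam - {0}" "level j u0" "!!v. v : Lam ==> EX c. v = comb t j c u0" using generator by auto
 note u = LamD[OF g(1)]
 have jn: "j <= n"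
 proof (rule ccontr)
 assume "~ j <= n"
 then have "(phi t ^^ Suc n) u0 ~= 0" using level_phi[OF g(2,1), of "Suc n"] by auto
 then show False using u Lam_iff by blast
 qed
 have un: "(phi t ^^ n) u0 ~= 0"
 proof
 assume z: "(phi t ^^ n) u0 = 0"
 obtain v where v: "v : Lam" "(phi t ^^ n) v ~= 0" using primitive_ex by blast
 obtain c where "v = comb t j c u0" using g(3)[OF v(1)] by blast
 then show False using v(2) phi_comb[of n t j c u0] z by (simp add: comb_0)
 qed
 define S where "S = PiE {..n} (%i. if i = 0 then UNIV - {0 :: 'q} else UNIV)"
 have "EX c:S. s u0 = comb t n c u0" if s: "s : G" for s
 proof -
 obtain c where c: "s u0 = comb t j c u0" using g(3)[OF aut_Lam[OF s]] u by blast
 define d where "d = restrict (%i. if i <= j then c i else 0) {..n}"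
 have d: "s u0 = comb t n d u0"
 proof -
  have "comb t n d u0 = (SUM i<=n. if i : {..j} then const (c i) * (phi t ^^ i) u0 else 0)"
  unfolding comb_def by (intro sum.cong) (auto simp: d_def)
  also have "... = (SUM i:{..n} Int {..j}. const (c i) * (phi t ^^ i) u0)" by (rule sum.inter_restrict[symmetric]) simp
  also have "{..n} Int {..j} = {..j}" using jn by auto
  finally show ?thesis by (simp add: c comb_def)
 qed
 \<comment> \<open>Applying \<open>phi t\<close> another \<open>n\<close> times kills every term
   except the constant one, which shows that \<open>d 0\<close> is nonzero.\<close>
 have "(phi t ^^ n) (s u0) = (SUM i<=n. const (d i) * (phi t ^^ i) ((phi t ^^ n) u0))" unfolding d phi_comb by (simp add: comb_def)
 also have "... = (SUM i<=n. if i = 0 then const (d 0) * (phi t ^^ n) u0 else 0)"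
 proof (intro sum.cong refl)
  fix i
  have "(phi t ^^ i) ((phi t ^^ n) u0) = 0" if i: "i ~= 0"
  proof -
  obtain k where "i = Suc k" using i by (cases i) auto
  then have "i + n = k + Suc n" by simp
  then have "(phi t ^^ i) ((phi t ^^ n) u0) = (phi t ^^ k) ((phi t ^^ Suc n) u0)" by (metis comp_apply funpow_add)
  then show ?thesis using u Lam_iff phi_pow_0 by metis
  qed
  then show "const (d i) * (phi t ^^ i) ((phi t ^^ n) u0) = (if i = 0 then const (d 0) * (phi t ^^ n) u0 else 0)" by simp
 qed
 finally have "(phi t ^^ n) (s u0) = const (d 0) * (phi t ^^ n) u0" by simp
 moreover have "(phi t ^^ n) (s u0) ~= 0"
  using aut_pow[OF s, of u0 n] u un rhom_eq_0[OF auts_rhom[OF s] sfL, of "(phi t ^^ n) u0"] Lam_pow[of u0 n] LamC by auto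
 ultimately have "d 0 ~= 0" by auto
 then show ?thesis using d by (intro bexI[of _ d]) (auto simp: S_def d_def)
 qed
 then have "EX c. ALL s:G. c s : S & s u0 = comb t n (c s) u0" by (intro bchoice) blast
 then obtain c where c: "!!s. s : G ==> c s : S" "!!s. s : G ==> s u0 = comb t n (c s) u0" by blast
 have "inj_on c G"
 proof (rule inj_onI)
 fix a b assume ab: "a : G" "b : G" "c a = c b"
 then have e: "a u0 = b u0" using c(2) by metis
 show "a = b"
 proof (rule aut_eqI[OF ab(1,2)])
  fix v assume "v : Lam"
  then obtain d where "v = comb t j d u0" using g(3) by blast
  then show "a v = b v" using aut_comb(1)[OF ab(1)] aut_comb(1)[OF ab(2)] u e by simp
 qed
 qed
 moreover have "finite S" unfolding S_def by (intro finite_PiE) auto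
 ultimately have "card G <= card S" using c(1) by (intro card_inj_on_le) auto
 also have "card S = (PROD i<=n. card (if i = 0 then UNIV - {0 :: 'q} else UNIV))" unfolding S_def by (rule card_PiE) simp
 also have "... = (CARD('q) - 1) * CARD('q) ^ n" by (induction n) (auto simp: card_Diff_singleton)
 finally have "card G <= (CARD('q) - 1) * CARD('q) ^ n" .
 moreover have "card G > 0" using finG G_id by (auto simp: card_gt_0_iff)
 ultimately show ?thesis using dvd_imp_le[OF card_lower] by simp
qed

text \<open>
  The elements of order dividing \<open>q - 1\<close> of the Galois group form the decomposition group at a pole
  of \<open>t\<close>, as the group modulo the latter has order \<open>q ^ n\<close>.
\<close>

lemma fixed_dec_unique:
 assumes W: "pr Cy W" "t ~: W"
 defines "Z == Fix Cy (dec k0 Cy W)"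
 shows "sfd Z" "k0 <= Z" "Z <= Cy" "card (auts k0 Z) = CARD('q) ^ n" "auts Z Cy = dec k0 Cy W"
 "!!L. sfd L ==> k0 <= L ==> L <= Cy ==> card (auts k0 L) = CARD('q) ^ n ==> L = Z"
proof -
 interpret P: carlitz_pole t "monom 1 (Suc n)" W "int CARD('q)" using W nontrivial by unfold_locales auto
 interpret ab: abel k0 Cy by (rule abel)
 let ?D = "dec k0 Cy W"
 have aD: "agrp Cy ?D" by (rule dec_agrp[OF vr_sub[OF P.W.vr]])
 show Z: "sfd Z" "k0 <= Z" "Z <= Cy"
 using Fix_sfd[of Cy ?D] agrp_D(1)[OF aD] sfL FL auts_fix[of _ k0 Cy] by (auto simp: Z_def Fix_def dec_def)
 show aZ: "auts Z Cy = ?D" unfolding Z_def by (rule artin_auts[OF aD sfL])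
 have q: "CARD('q) > 1" by (rule one_less_card)
 have tower: "card (auts k0 L) * card (auts L Cy) = (CARD('q) - 1) * CARD('q) ^ n" if "sfd L" "k0 <= L" "L <= Cy" for L
 using card_auts_tower[OF galois_axioms _ that(3)] ab.abel_lower(1)[OF that] card_G by (simp add: abel_def)
 have "card (auts k0 Z) * (CARD('q) - 1) = CARD('q) ^ n * (CARD('q) - 1)"
 using tower[OF Z] P.card_dec by (simp add: aZ mult.commute)
 then show cZ: "card (auts k0 Z) = CARD('q) ^ n" using q by (subst (asm) mult_right_cancel) auto
 fix L assume L: "sfd L" "k0 <= L" "L <= Cy" and cL: "card (auts k0 L) = CARD('q) ^ n"
 have "CARD('q) ^ n * card (auts L Cy) = CARD('q) ^ n * (CARD('q) - 1)" using tower[OF L] cL by (simp add: mult.commute)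
 then have c: "card (auts L Cy) = CARD('q) - 1" using q by (subst (asm) mult_left_cancel) auto
 have eL: "expo L Cy (CARD('q) - 1)" using expo_card[OF ab.abel_upper[OF L]] c by simp
 have aZk: "abel k0 Z" by (rule ab.abel_lower(1)[OF Z])
 have eZ: "expo k0 Z (CARD('q) ^ n)" using expo_card[OF aZk] cZ by simp
 \<comment> \<open>By this congruence the \<open>q ^ n\<close>-th iterate of an element of exponent
   \<open>q - 1\<close> is the element itself, whereas it is trivial on \<open>Z\<close>; so the
   element fixes \<open>Z\<close>.\<close>
 obtain k where k: "CARD('q) ^ n = 1 + (CARD('q) - 1) * k"
 proof -
 obtain r where r: "CARD('q) = Suc r" using q by (cases "CARD('q)") auto
 have "EX k. Suc r ^ n = 1 + r * k"
 proof (induction n)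
  case (Suc n)
  then obtain k where "Suc r ^ n = 1 + r * k" by blast
  then have "Suc r ^ Suc n = 1 + r * (k * Suc r + 1)" by (simp add: algebra_simps)
  then show ?case by blast
 qed (intro exI[of _ 0], simp)
 then show ?thesis using that r by auto
 qed
 have "auts L Cy <= ?D"
 proof
 fix s assume s: "s : auts L Cy"
 then have sG: "s : G" using auts_M[OF L(2)] by blast
 have aL: "agrp Cy (auts L Cy)" by (rule agrp_M[OF L(2,3)])
 have "((s ^^ (CARD('q) - 1)) ^^ k) x = x" if "x : Cy" for x k
  using eL s that by (induction k) (auto simp: expo_def)
 then have p: "(s ^^ (CARD('q) ^ n)) x = s x" if "x : Cy" for x
  using that unfolding k funpow_add by (simp add: funpow_mult)
 have r: "restrict s Z : auts k0 Z" using ab.abel_lower(2)[OF Z] sG by blast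
 have "s x = x" if x: "x : Z" for x
 proof -
  have "(restrict s Z ^^ m) x = (s ^^ m) x" for m
  by (rule funpow_restrict[OF _ x]) (use auts_in[OF r] in auto)
  moreover have "(restrict s Z ^^ (CARD('q) ^ n)) x = x" using eZ r x unfolding expo_def by blast
  ultimately have "(s ^^ (CARD('q) ^ n)) x = x" by metis
  then show ?thesis using p x Z(3) by auto
 qed
 then have "s : auts Z Cy" using sG by (auto simp: auts_def)
 then show "s : ?D" by (simp add: aZ)
 qed
 then have "auts L Cy = ?D" using c P.card_dec aD by (intro card_subset_eq) (auto simp: agrp_def)
 moreover have "Fix Cy (auts L Cy) = L" using galois.Fix_G[OF galois_upper[OF L]] .
 ultimately show "L = Z" by (simp add: Z_def)
qed

end

text \<open>The definite description is resolved by \<open>fixed_dec_unique\<close>. At finite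
  primes containing \<open>inverse T\<close> the modulus is a unit; at a pole of
  \<open>inverse T\<close>, that is over \<open>T = 0\<close>, the inertia group equals the
  decomposition group, which fixes \<open>L\<close>.\<close>

lemma L_field_props:
 fixes n :: nat
 defines "L == L_field n :: ('q::{field,finite}) ratfun_ac set"
 shows "abel k0 L" "expo k0 L (CARD('q) ^ n)" "!!V. pr L V ==> V Int k0 ~= P_infinity ==> tin k0 L V"
proof -
 interpret carlitz_power "inverse T :: 'q ratfun_ac" n by unfold_locales (auto simp: param_def)
 interpret ab: abel k0 Cy by (rule abel)
 have LZ: "L = Fix Cy (dec k0 Cy W)" if W: "pr Cy W" "inverse T ~: W" for W
 proof -
 note Z = fixed_dec_unique[OF W]
 have deg: "ext_degree k0 M = card (auts k0 M)" if "sfd M" "k0 <= M" "M <= Cy" for M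
  using ab.abel_lower(1)[OF that] by (intro ext_degree_eq) (simp add: abel_def)
 have cyc: "cyclotomic_function_field (inverse T) (monom 1 (n + 1)) = Cy" by (simp add: Cy_def)
 show ?thesis unfolding L_def L_field_def cyc subextension_iff
 proof (rule the_equality)
  show "(sfd (k0 :: 'q ratfun_ac set) & sfd (Fix Cy (dec k0 Cy W)) & k0 <= Fix Cy (dec k0 Cy W)) &
  Fix Cy (dec k0 Cy W) <= Cy & ext_degree k0 (Fix Cy (dec k0 Cy W)) = CARD('q) ^ n"
  using Z(1-4) deg[OF Z(1-3)] sfF by simp
  fix M assume "(sfd (k0 :: 'q ratfun_ac set) & sfd M & k0 <= M) & M <= Cy & ext_degree k0 M = CARD('q) ^ n"
  then show "M = Fix Cy (dec k0 Cy W)" using Z(6)[of M] deg[of M] by simp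
 qed
 qed
 obtain W where W: "pr Cy W" "inverse T ~: W" using pole_ex by blast
 note Z = fixed_dec_unique[OF W, folded LZ[OF W]]
 show aL: "abel k0 L" by (rule ab.abel_lower(1)[OF Z(1-3)])
 show "expo k0 L (CARD('q) ^ n)" using expo_card[OF aL] Z(4) by simp
 fix V assume V: "pr L V" "V Int k0 ~= P_infinity"
 obtain U where U: "pr Cy U" "U Int L = V"
 using pr_extend[OF good_galois[OF good_base] V(1) sfL Z(3)] aL by (auto simp: abel_def)
 have Uk: "U Int k0 = V Int k0" using U(2) Z(2) by auto
 note d = fam_dvr[OF abel U(1)]
 show "tin k0 L V"
 proof (cases "inverse T : U")
 case True
 have "T : U" using eq_P_infinity[of "U Int k0"] d(4)[OF sfF order_refl FL] V(2) Uk by (auto simp: pr_def)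
 then have "T ^ Suc n : U" by (rule vr_power[OF d(2)])
 moreover have "ev (inverse T) (monom 1 (Suc n)) = inverse (T ^ Suc n :: 'q ratfun_ac)" by (simp add: ev_monom power_inverse)
 ultimately have "ev (inverse T) (monom 1 (Suc n)) ~: mx U" by (simp add: mx_def)
 then have "tin k0 Cy U" by (rule tin_unit[OF U(1) True])
 then show ?thesis
  using tin_lower[OF prime_CHAR_ratfun_ac abel.axioms(1)[OF aL] Z(3) d(1) _ d(3)] d(4)[OF Z(1-3)] U(2) by auto
 next
 case False
 interpret P: carlitz_pole "inverse T" "monom 1 (Suc n)" U "int CARD('q)" using U(1) False nontrivial by unfold_locales auto
 show ?thesis unfolding tin_def
 proof
  fix s assume "s : inert k0 L V"
  then obtain u where u: "u : inert k0 Cy U" "s = restrict u L"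
  using ab.inert_lift[OF prime_CHAR_ratfun_ac Z(1-3) d(1,3)] U(2) by blast
  have "u x = x" if "x : L" for x
  using u(1) that P.dec_eq_inert unfolding LZ[OF U(1) False] by (auto simp: Fix_def)
  then show "s : {\<lambda>x\<in>L. x}" using u(2) by (auto simp: restrict_def)
 qed
 qed
qed

section \<open>The genus field of an abelian \<open>p\<close>-extension\<close>

lemma funpow_coprime:
 assumes "coprime a b" "(s ^^ a) x = x" "(s ^^ b) x = x" "a ~= 0" shows "s x = x"
proof -
 have p: "(s ^^ (c * n)) x = x" if "(s ^^ c) x = x" for c n
 using that by (induction n) (auto simp: funpow_add)
 obtain i j where "a * i = b * j + 1" using bezout_nat[OF assms(4), of b] assms(1) by auto
 then have "(s ^^ (b * j + 1)) x = x" using p[OF assms(2), of i] by simp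
 moreover have "(s ^^ (b * j + 1)) x = s ((s ^^ (b * j)) x)" by simp
 ultimately show ?thesis using p[OF assms(3)] by simp
qed

lemma (in galois) expo_restrict:
 assumes M: "galois F M" "M <= L" and e: "expo F M q" and s: "s : G" and x: "x : M" shows "(s ^^ (q * n)) x = x"
proof -
 have r: "restrict s M : auts F M" using restrict_auts_galois[OF M] s by blast
 have sM: "s x : M" if "x : M" for x using auts_in[OF r that] that by simp
 have "(restrict s M ^^ q) x = x" using e r x unfolding expo_def by blast
 then have "(s ^^ q) x = x" using funpow_restrict[of M s x, OF sM x] by simp
 then have "((s ^^ q) ^^ n) x = x" by (induction n) auto
 then show ?thesis by (simp add: funpow_mult)
qed

lemma (in galois) tdec_imp_tin: "dvr L W ==> tdec F L W ==> tin F L W"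
 using inert_stable by (auto simp: tdec_def tin_def)

lemma tdec_base_change:
 assumes g: "galois F L" "galois F L1" and L: "L = gen (L1 Un L2)" and L2: "F <= L2" and W: "vr L W"
 and t: "tdec F L1 (W Int L1)"
 shows "tdec L2 L W"
 unfolding tdec_def
proof (intro ballI impI)
 interpret galois F L by fact
 have sub: "L1 <= L" using gen_incl[of "L1 Un L2"] L by auto
 fix s assume s: "s : auts L2 L" "s ` W = W"
 then have sF: "s : G" using auts_mono[OF L2, of L] by auto
 have "restrict s L1 = (\<lambda>x\<in>L1. x)" using dec_restrict[OF g(2) sub vr_sub[OF W] sF s(2)] t by (auto simp: tdec_def)
 then have "s x = x" if "x : L1" for x using that by (metis restrict_apply')
 then show "s = (\<lambda>x\<in>L. x)" using aut_trivial_gen[OF _ sfL L] s auts_fix[of s L2 L] by auto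
qed

text \<open>A modular law for fields, valid because \<open>C\<close> is stable. The group over
  \<open>N\<close>, restricted to \<open>C\<close>, has fixed field \<open>N Int C\<close>. So an
  \<open>s\<close> over the right-hand side agrees on \<open>C\<close> with some \<open>h\<close>
  over \<open>N\<close>; both fix \<open>M\<close>, hence \<open>s = h\<close> fixes
  \<open>N\<close>.\<close>

lemma (in galois) compositum_modular:
 assumes L: "L = gen (C Un M)" and sf: "sfd C" "sfd M" "sfd N" and F: "F <= M" "M <= N" "N <= L"
 and st: "!!s. s : G ==> s ` C = C"
 shows "N = gen ((N Int C) Un M)"
proof
 let ?P = "gen ((N Int C) Un M)"
 have sub: "C <= L" "M <= L" using gen_incl[of "C Un M"] L by auto
 show PN: "?P <= N" using gen_least[OF sf(3)] F by auto
 have MP: "M <= ?P" "N Int C <= ?P" using gen_incl[of "(N Int C) Un M"] by auto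
 interpret P: galois ?P L by (rule galois_upper) (use sfd_gen MP F PN in auto)
 interpret N: galois N L by (rule galois_upper) (use sf F in auto)
 define R where "R = (%s. restrict s C) ` N.G"
 have NG: "s : G" if "s : N.G" for s using auts_mono[of F N L] F that by auto
 have sC: "s x : C" if "s : G" "x : C" for s x using st[OF that(1)] that(2) by auto
 have aR: "agrp C R"
 unfolding agrp_def
 proof (intro conjI ballI subsetI)
 show "finite R" using N.finG by (simp add: R_def)
 have "(\<lambda>x\<in>C. x) = restrict (\<lambda>x\<in>L. x) C" using sub by (intro ext) (auto simp: restrict_def)
 then show "(\<lambda>x\<in>C. x) : R" using N.G_id unfolding R_def by (rule image_eqI)
 fix r assume "r : R"
 then obtain s where s: "s : N.G" "r = restrict s C" by (auto simp: R_def)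
 have "rhom C s" using rhom_mono[OF auts_rhom[OF s(1)] sub(1)] .
 moreover have "s ` C = C" by (rule st[OF NG[OF s(1)]])
 ultimately show "r : auts {} C" using s(2) sf(1) unfolding auts_def rhom_def by (auto simp: sfd_closed)
 next
 fix a b assume "a : R" "b : R"
 then obtain s u where su: "s : N.G" "a = restrict s C" "u : N.G" "b = restrict u C" by (auto simp: R_def)
 have "compose C a b = restrict (compose L s u) C"
  using su sC[OF NG[OF su(3)]] sub by (intro ext) (auto simp: compose_def restrict_def)
 then show "compose C a b : R" using N.compose_G[OF su(1,3)] by (auto simp: R_def)
 qed
 have fR: "Fix C R = C Int N"
 proof
 show "Fix C R <= C Int N"
 proof
  fix x assume x: "x : Fix C R"
  have "s x = x" if s: "s : N.G" for s
  proof -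
  have "restrict s C x = x" using x s unfolding Fix_def R_def by blast
  then show ?thesis using x by (simp add: Fix_def)
  qed
  then show "x : C Int N" using N.fixedD[of x] x sub by (auto simp: Fix_def)
 qed
 show "C Int N <= Fix C R" using auts_fix[of _ N L] by (auto simp: Fix_def R_def)
 qed
 show "N <= ?P"
 proof
 fix x assume x: "x : N"
 have xL: "x : L" using x F by auto
 have "s x = x" if s: "s : P.G" for s
 proof -
  have sG: "s : G" using auts_mono[of F ?P L] MP F s by auto
  have "restrict s C : auts (C Int N) C"
  using rhom_mono[OF auts_rhom[OF s] sub(1)] st[OF sG] auts_fix[OF s] MP sf(1)
  unfolding auts_def rhom_def by (auto simp: sfd_closed)
  then have "restrict s C : R" using artin_auts[OF aR sf(1)] fR by simp
  then obtain h where h: "h : N.G" "restrict s C = restrict h C" by (auto simp: R_def)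
  have "s x = h x"
  proof (rule rhom_gen_agree[OF auts_rhom[OF s] auts_rhom[OF h(1)] sfL, of "C Un M"])
  fix y assume "y : C Un M"
  then show "s y = h y"
   using h(2) auts_fix[OF s, of y] auts_fix[OF h(1), of y] MP F by (metis Un_iff restrict_apply' subsetD)
  qed (use sub xL L in auto)
  then show ?thesis using auts_fix[OF h(1) x] by simp
 qed
 then show "x : ?P" using P.fixedD[OF xL] by blast
 qed
qed

lemma (in carlitz) dec_pole:
 assumes W: "pr Cy W" "t ~: W" and s: "s : dec k0 Cy W"
 shows "s : inert k0 Cy W" "x : Cy ==> (s ^^ (CARD('q) - 1)) x = x"
proof -
 have "s : inert k0 Cy W & (ALL x:Cy. (s ^^ (CARD('q) - 1)) x = x)"
 proof (cases "Lam = {0}")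
 case True
 have sG: "s : G" using s by (simp add: dec_def)
 have e: "s = (\<lambda>x\<in>Cy. x)"
  by (rule aut_eqI[OF sG G_id]) (use True rhom_0[OF auts_rhom[OF sG] sfL] sfL in auto)
 have "(s ^^ n) x = x" if "x : Cy" for x n using that by (induction n) (auto simp: e)
 moreover have "s : inert k0 Cy W"
  using sG mx_0[OF prD(1)[OF W(1)]] vr_sub[OF prD(1)[OF W(1)]] by (auto simp: inert_def e)
 ultimately show ?thesis by blast
 next
 case False
 interpret carlitz_pole t f W "int CARD('q)" using W False by unfold_locales auto
 show ?thesis using dec_expo[OF s] dec_eq_inert s by auto
 qed
 then show "s : inert k0 Cy W" "x : Cy ==> (s ^^ (CARD('q) - 1)) x = x" by auto
qed

text \<open>\<open>Q\<close> selects primes by their restriction to \<open>k0\<close>, so that the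
  same statement serves the finite primes and the primes outside \<open>bad\<close>.\<close>

lemma tin_sub:
 assumes F: "abel k0 F" and L: "abel k0 L" and Z: "sfd Z" "F <= Z" "Z <= L"
 and t: "!!W. pr L W ==> Q (W Int k0) ==> tin F L W" and V: "pr Z V" "Q (V Int k0)"
 shows "tin F Z V"
proof -
 interpret F: abel k0 F by fact
 interpret L: abel k0 L by fact
 have kZ: "k0 <= Z" and FL: "F <= L" using F.FL Z by auto
 interpret FL: abel F L by (rule L.abel_upper[OF F.sfL F.FL FL])
 have aZ: "abel k0 Z" "abel F Z" using L.abel_lower(1)[OF Z(1) kZ Z(3)] FL.abel_lower(1)[OF Z] by auto
 obtain W where W: "pr L W" "W Int Z = V"
 using pr_extend[OF good_galois[OF good_base] V(1) L.sfL Z(3)] aZ by (auto simp: abel_def)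
 note d = fam_dvr[OF L W(1)]
 have "W Int k0 = V Int k0" using W(2) kZ by auto
 then have "tin F L W" using t[OF W(1)] V(2) by simp
 then show ?thesis
 using FL.tin_lower[OF prime_CHAR_ratfun_ac _ Z(3) d(1)] d(4)[OF Z(1) kZ Z(3)] d(4)[OF F.sfL F.FL FL] aZ(2) W(2)
 by (auto simp: abel_def)
qed

section \<open>Comparison of the genus fields of \<open>K\<close> and \<open>E\<close>\<close>

locale genus_setup =
 fixes K M E C Ln km :: "('q::{field,finite}) ratfun_ac set" and n m r :: nat and N :: "'q poly"
 assumes K: "abel k0 K" "expo k0 K (CHAR('q) ^ r)" and m: "m >= 1" and N: "N ~= 0"
 and Ln: "Ln = L_field n" and km: "km = const_extension m" and C: "C = cyclotomic_function_field T N"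
 and KB: "K <= gen (gen (Ln Un C) Un km)" and M: "M = gen (Ln Un km)" and E: "E = gen (K Un M) Int C"
begin

sublocale car: carlitz T N rewrites "car.Cy = C"
proof -
 show c: "carlitz T N" using N by unfold_locales (auto simp: param_def)
 show "carlitz.Cy T N = C" by (simp add: carlitz.Cy_def[OF c] C)
qed

lemma aC: "abel k0 C" by (rule car.abel)

lemma aLn: "abel k0 Ln" and eLn: "expo k0 Ln (CARD('q) ^ n)" and akm: "abel k0 km"
 using L_field_props(1,2)[of n] const_extension_abel[OF m] by (auto simp: Ln km)

lemma aM: "abel k0 M" unfolding M by (rule abel_compositum[OF aLn akm])

lemma subM: "Ln <= M" "km <= M" using gen_incl[of "Ln Un km"] by (auto simp: M)

abbreviation "F == gen (K Un M)"

lemma aF: "abel k0 F" by (rule abel_compositum[OF K(1) aM])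

lemma subF: "K <= F" "M <= F" "E <= F" "E <= C" using gen_incl[of "K Un M"] E by auto

lemma sf: "sfd K" "sfd M" "sfd C" "sfd F" "sfd E" "sfd Ln" "sfd km" and k0: "k0 <= K" "k0 <= M" "k0 <= C" "k0 <= F" "k0 <= E" "k0 <= Ln" "k0 <= km"
proof -
 show "sfd K" "sfd M" "sfd C" "sfd F" "sfd Ln" "sfd km" "k0 <= K" "k0 <= M" "k0 <= C" "k0 <= F" "k0 <= Ln" "k0 <= km"
 using K(1) aM aC aF aLn akm by (auto simp: abel_def galois_def)
 then show "sfd E" "k0 <= E" by (auto simp: E sfd_Int)
qed

lemma aE: "abel k0 E" by (rule abel.abel_lower(1)[OF aC sf(5) k0(5) subF(4)])

lemma gal: "galois k0 K" "galois k0 M" "galois k0 C" "galois k0 F" "galois k0 E" "galois k0 Ln" "galois k0 km"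
 using K(1) aM aC aF aLn akm aE by (auto simp: abel_def)

lemma tin_M: assumes V: "pr M V" "V Int k0 ~= P_infinity" shows "tin k0 M V"
proof (rule tin_compositum[OF gal(2,6,7) M prD(1)[OF V(1)]])
 note d = fam_dvr[OF aM V(1)]
 have "V Int Ln Int k0 = V Int k0" using k0 by auto
 then show "tin k0 Ln (V Int Ln)" using L_field_props(3)[of n "V Int Ln"] d(4)[OF sf(6) k0(6) subM(1)] V(2) by (simp add: Ln)
 show "tin k0 km (V Int km)"
 using const_extension_tin[OF m] d(4)[OF sf(7) k0(7) subM(2)] by (auto simp: km pr_def)
qed

abbreviation "B == gen (C Un M)"

lemma aB: "abel k0 B" by (rule abel_compositum[OF aC aM])

lemma subB: "C <= B" "M <= B" "K <= B" "F <= B"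
proof -
 show CM: "C <= B" "M <= B" using gen_incl[of "C Un M"] by auto
 have s: "sfd B" by (rule sfd_gen)
 have "gen (Ln Un C) <= B" by (rule gen_least[OF s]) (use CM subM in auto)
 then have "gen (gen (Ln Un C) Un km) <= B" by (intro gen_least[OF s]) (use CM subM in auto)
 then show "K <= B" using KB by auto
 then show "F <= B" by (intro gen_least[OF s]) (use CM in auto)
qed

lemma F_eq: "F = gen (M Un E)"
proof -
 interpret B: abel k0 B by (rule aB)
 have "F = gen ((F Int C) Un M)"
 proof (rule B.compositum_modular[OF refl sf(3,2,4) k0(2) subF(2) subB(4)])
 fix s assume s: "s : B.G"
 have "restrict s C : auts k0 C" using B.restrict_auts_galois[OF gal(3) subB(1)] s by blast
 from auts_image[OF this] show "s ` C = C" by simp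
 qed
 then show ?thesis by (simp add: E Un_commute)
qed

text \<open>A finite set outside which \<open>B\<close>, and therefore both \<open>K\<close> and
  \<open>E\<close>, is unramified over \<open>k0\<close>.\<close>

definition "bad = insert P_infinity {V. vr k0 V & range const <= V & T : V & ev T N : mx V}"

lemma fin_bad: "finite bad"
 unfolding bad_def using finite_primes_dividing[of T N] N by (simp add: param_def)

lemma tin_B: assumes W: "pr B W" "W Int k0 ~: bad" shows "tin k0 B W"
proof (rule tin_compositum[OF _ gal(3,2) refl prD(1)[OF W(1)]])
 show "galois k0 B" using aB by (simp add: abel_def)
 note d = fam_dvr[OF aB W(1)]
 have i: "W Int M Int k0 = W Int k0" "W Int C Int k0 = W Int k0" using k0 by auto
 have dM: "pr M (W Int M)" and dC: "pr C (W Int C)" using d(4)[OF sf(2) k0(2) subB(2)] d(4)[OF sf(3) k0(3) subB(1)] by auto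
 show "tin k0 M (W Int M)" using tin_M[OF dM] W(2) i by (simp add: bad_def)
 have V: "pr k0 (W Int k0)" using fam_dvr(4)[OF aC dC sfd_base order_refl k0(3)] i by simp
 have TW: "T : W Int k0" using eq_P_infinity[of "W Int k0"] V W(2) by (auto simp: pr_def bad_def)
 have nm: "ev T N ~: mx (W Int k0)" using V W(2) TW by (auto simp: pr_def bad_def)
 have "ev T N : W Int k0" using V TW by (intro ev_in) (auto simp: pr_def param_def)
 then have "ev T N ~: mx (W Int C)"
 using nm mx_Int[OF prD(1)[OF dC] sfd_base] i by auto
 then show "tin k0 C (W Int C)" using car.tin_unit[OF dC] TW k0 by auto
qed

lemma gfam_E: "gfam E (genus_field E)" and gfam_K: "gfam K (genus_field K)"
proof -
 have t: "tin k0 Z W" if "sfd Z" "k0 <= Z" "Z <= B" "pr Z W" "W Int k0 ~: bad" for Z W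
 by (rule tin_sub[OF abel_refl[OF sfd_base] aB that(1,2,3), of "%V. V ~: bad"]) (use tin_B that in auto)
 show "gfam E (genus_field E)" by (rule gfam_genus_field[OF aE fin_bad]) (use t[OF sf(5) k0(5)] subF subB in blast)
 show "gfam K (genus_field K)" by (rule gfam_genus_field[OF K(1) fin_bad]) (use t[OF sf(1) k0(1) subB(3)] in blast)
qed

text \<open>
  A decomposition group of \<open>E\<close> at infinity is an inertia group and has exponent \<open>q - 1\<close>, as this
  holds for \<open>C\<close>. Lifting its elements to inertia groups of \<open>F\<close>, where the constant extension
  is fixed, shows that they also have \<open>p\<close>-power order.
\<close>

lemma tdec_E: assumes W: "pr E W" "W Int k0 = P_infinity" shows "tdec k0 E W"
 unfolding tdec_def
proof (intro ballI impI)
 interpret E: abel k0 E by (rule aE)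
 interpret F: abel k0 F by (rule aF)
 fix s assume s: "s : auts k0 E" "s ` W = W"
 have gE: "good E" by (rule good_galois[OF good_base gal(5)])
 obtain U where U: "pr C U" "U Int E = W" using pr_extend[OF gE W(1) sf(3) subF(4)] by auto
 obtain U' where U': "pr F U'" "U' Int E = W" using pr_extend[OF gE W(1) sf(4) subF(3)] by auto
 note d = fam_dvr[OF aC U(1)] and d' = fam_dvr[OF aF U'(1)]
 obtain u where u: "u : auts k0 C" "u ` U = U" "s = restrict u E"
 using car.dec_lift[OF gal(5) subF(4) d(1)] d(4)[OF sf(5) k0(5) subF(4)] s U(2) by metis
 have "U Int k0 = P_infinity" using U(2) W(2) k0(5) by auto
 then have "T ~: U" using P_infinity_vr(3) T_base by blast
 note p = car.dec_pole[OF U(1) this, of u]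
 have u': "u : dec k0 C U" using u by (simp add: dec_def)
 have uE: "u x : E" if "x : E" for x using auts_in[OF s(1) that] u(3) that by simp
 have e1: "(s ^^ (CARD('q) - 1)) x = x" if "x : E" for x
 proof -
 have "x : C" using that subF(4) by blast
 from p(2)[OF u' this] show ?thesis using funpow_restrict[of E u x, OF uE that] by (simp add: u(3))
 qed
 have "s : inert k0 E W" using car.inert_restrict[OF gal(5) subF(4) d(2) p(1)[OF u']] u(3) U(2) by simp
 then obtain v where v: "v : inert k0 F U'" "s = restrict v E"
 using F.inert_lift[OF prime_CHAR_ratfun_ac sf(5) k0(5) subF(3) d'(1,3)] U'(2) by blast
 have vG: "v : F.G" using v by (simp add: inert_def)
 obtain a where a: "CARD('q) = CHAR('q) ^ a" using finite_field_card by blast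
 \<comment> \<open>A common multiple of the exponents of \<open>K\<close> and \<open>Ln\<close>;
   since the inertial \<open>v\<close> also fixes the constants \<open>km\<close>, its
   \<open>P\<close>-th iterate is trivial on all of \<open>F\<close>.\<close>
 define P where "P = CHAR('q) ^ r * CARD('q) ^ n"
 define w where "w = restrict (v ^^ P) F"
 have wG: "w : F.G" unfolding w_def by (rule agrp_funpow(1)[OF F.G_agrp vG])
 have kmF: "km <= F" "Ln <= F" using subM subF by auto
 have wx: "w x = x" if "x : K Un Ln Un km" for x
 proof -
 have "v x = x" if "x : km"
 proof -
  have "restrict v km = (\<lambda>x\<in>km. x)"
  using F.inert_restrict[OF gal(7) kmF(1) d'(2) v(1)] const_extension_tin[OF m] d'(4)[OF sf(7) k0(7) kmF(1)]
  by (auto simp: km tin_def pr_def)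
  from fun_cong[OF this, of x] show ?thesis using that by simp
 qed
 then have "(v ^^ P) x = x" if "x : km" using that by (induction P) auto
 moreover have "(v ^^ P) x = x" if "x : K"
  unfolding P_def by (rule F.expo_restrict[OF gal(1) subF(1) K(2) vG that])
 moreover have "(v ^^ P) x = x" if "x : Ln"
  unfolding P_def mult.commute[of "CHAR('q) ^ r"] by (rule F.expo_restrict[OF gal(6) kmF(2) eLn vG that])
 ultimately show ?thesis using that kmF subF by (auto simp: w_def)
 qed
 have wM: "w x = x" if "x : M" for x
 proof -
 have "restrict w M = (\<lambda>x\<in>M. x)"
 proof (rule aut_trivial_gen[OF _ sf(2) M])
  show "restrict w M : auts k0 M" using F.restrict_auts_galois[OF gal(2) subF(2)] wG by blast
 qed (use wx subM in auto)
 from fun_cong[OF this, of x] show ?thesis using that by simp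
 qed
 have w1: "w = (\<lambda>x\<in>F. x)" by (rule aut_trivial_gen[OF wG sf(4) refl]) (use wx wM in auto)
 have vE: "v x : E" if "x : E" for x using auts_in[OF s(1) that] v(2) that by simp
 have e2: "(s ^^ P) x = x" if "x : E" for x
 proof -
 have "x : F" using that subF(3) by blast
 then have "(v ^^ P) x = x" using fun_cong[OF w1, of x] by (simp add: w_def)
 then show ?thesis using funpow_restrict[of E v x P, OF vE that] by (simp add: v(2))
 qed
 have "coprime (CARD('q) - 1) (CHAR('q) ^ (r + a * n))"
 proof -
 have "CARD('q) > 1" by (rule one_less_card)
 then have "a ~= 0" using a by (metis less_irrefl power_0)
 have "coprime (CARD('q) - 1) CARD('q)" using `CARD('q) > 1` by (intro coprime_diff_one_left_nat) simp
 then show ?thesis using a `a ~= 0` by simp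
 qed
 then have cp: "coprime (CARD('q) - 1) P" by (simp add: P_def a power_add power_mult)
 show "s = (\<lambda>x\<in>E. x)"
 proof (rule auts_eqI[OF s(1) E.G_id])
 fix x assume x: "x : E"
 show "s x = (\<lambda>x\<in>E. x) x" using funpow_coprime[OF cp e1[OF x] e2[OF x]] one_less_card[where 'q='q] x by simp
 qed
qed

text \<open>Two steps of the tower are base changes: \<open>F\<close> over \<open>A\<close> comes
  from \<open>M\<close> over \<open>k0\<close>, and the top over \<open>F\<close> comes from
  \<open>L\<close> over \<open>D\<close>. The pair \<open>A\<close>, \<open>D\<close> is used as
  \<open>K\<close>, \<open>E\<close> and as \<open>E\<close>, \<open>K\<close>.\<close>

lemma tin_push:
 assumes A: "abel k0 A" "F = gen (M Un A)" and D: "abel k0 D" "D <= F" and L: "fam D L" "abel k0 L"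
 and U: "pr (gen (L Un F)) U" "U Int k0 ~= P_infinity"
 shows "tin A (gen (L Un F)) U"
proof -
 let ?Y = "gen (L Un F)"
 have aY: "abel k0 ?Y" by (rule abel_compositum[OF L(2) aF])
 interpret A: abel k0 A by (rule A)
 interpret D: abel k0 D by (rule D)
 interpret L: abel k0 L by (rule L)
 interpret Y: abel k0 ?Y by (rule aY)
 have s: "L <= ?Y" "F <= ?Y" "A <= F" using gen_incl[of "L Un F"] gen_incl[of "M Un A"] A(2) by auto
 have AF: "galois A F" and AY: "galois A ?Y" and DY: "galois D ?Y"
 using galois.galois_upper[OF gal(4) A.sfL A.FL s(3)] Y.galois_upper[OF A.sfL A.FL] Y.galois_upper[OF D.sfL D.FL] s D(2) by auto
 note d = fam_dvr[OF aY U(1)]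
 have "U Int F Int M = U Int M" using subF by auto
 moreover have "tin k0 M (U Int M)" using tin_M[of "U Int M"] d(4)[OF sf(2) k0(2)] subF s U(2) k0 by (auto simp: Int_assoc Int_absorb1)
 ultimately have "tin A F (U Int F)"
 using tin_base_change[OF gal(4,2) A(2) A.FL, of "U Int F"] fam_dvr(2)[OF aF] d(4)[OF sf(4) k0(4) s(2)] by simp
 moreover have "tin D L (U Int L)" using L(1) d(4)[OF L.sfL L.FL s(1)] by (simp add: fam_def)
 then have "tin F ?Y U" using tin_base_change[OF DY _ refl D(2) d(2)] L(1) by (simp add: fam_def abel_def)
 ultimately show ?thesis using tin_tower[OF AY AF s(2) d(2)] by blast
qed

text \<open>Infinity splits from \<open>k0\<close> to \<open>E\<close> and on to the genus field of
  \<open>E\<close>, so the condition there passes to \<open>K\<close> by plain base change; finite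
  primes are handled inside the larger field \<open>Y\<close>.\<close>

lemma genus_E_K: "gen (genus_field E Un K) <= genus_field K"
proof -
 define L where "L = genus_field E"
 define H where "H = gen (L Un K)"
 have L: "fam E L" "abel k0 L" "abel E L" using gfam_E by (auto simp: L_def gfam_def fam_def)
 interpret L: abel k0 L by (rule L)
 have EL: "E <= L" using L(3) by (simp add: abel_def galois_def)
 have aH: "abel k0 H" unfolding H_def by (rule abel_compositum[OF L(2) K(1)])
 interpret H: abel k0 H by (rule aH)
 have sH: "L <= H" "K <= H" using gen_incl[of "L Un K"] by (auto simp: H_def)
 define Y where "Y = gen (L Un F)"
 have aY: "abel k0 Y" unfolding Y_def by (rule abel_compositum[OF L(2) aF])
 interpret Y: abel k0 Y by (rule aY)
 have sY: "L <= Y" "F <= Y" using gen_incl[of "L Un F"] by (auto simp: Y_def)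
 have HY: "H <= Y" unfolding H_def by (rule gen_least[OF Y.sfL]) (use sY subF in auto)
 have tY: "tin K Y U" if "pr Y U" "U Int k0 ~= P_infinity" for U
 unfolding Y_def by (rule tin_push[OF K(1) _ aE subF(3) L(1,2)]) (use that in "simp_all add: Y_def Un_commute")
 have aKH: "abel K H" by (rule H.abel_upper[OF sf(1) k0(1) sH(2)])
 have "tin K H W & (W Int k0 = P_infinity --> tdec K H W)" if W: "pr H W" for W
 proof (cases "W Int k0 = P_infinity")
 case True
 note d = fam_dvr[OF aH W]
 have dL: "pr L (W Int L)" "vr L (W Int L)" and dE: "pr E (W Int L Int E)"
  using d(4)[OF L.sfL L.FL sH(1)] fam_dvr(4)[OF L(2) _ sf(5) k0(5) EL, of "W Int L"] by (auto simp: pr_def)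
 have i: "W Int L Int k0 = P_infinity" "W Int L Int E Int k0 = P_infinity" using True L.FL k0 by auto
 have "tdec k0 E (W Int L Int E)" by (rule tdec_E[OF dE i(2)])
 moreover have "tdec E L (W Int L)" using L(1) dL(1) i by (simp add: fam_def)
 ultimately have "tdec k0 L (W Int L)" by (rule tdec_tower[OF L.galois_axioms gal(5) EL dL(2)])
 then have "tdec K H W" by (rule tdec_base_change[OF H.galois_axioms L.galois_axioms H_def k0(1) d(2)])
 then show ?thesis using galois.tdec_imp_tin[OF abel.axioms(1)[OF aKH] d(1)] by blast
 next
 case False
 have "tin K H W" by (rule tin_sub[OF K(1) aY H.sfL sH(2) HY, of "%V. V ~= P_infinity"]) (use tY W False in auto)
 then show ?thesis using False by simp
 qed
 then have "gfam K H" using aKH aH by (auto simp: gfam_def fam_def)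
 then show ?thesis using genus_field_eq[OF K(1)] by (auto simp: H_def L_def)
qed

text \<open>
  Conversely the fixed field \<open>A\<close> of a decomposition group at infinity of the compositum \<open>Y\<close> of the
  genus field of \<open>K\<close> and \<open>E\<close> lies in the genus field of \<open>E\<close>, and \<open>Y\<close> is generated by \<open>A\<close> and \<open>K\<close>.
\<close>

lemma genus_K_E: "genus_field K <= gen (genus_field E Un K)"
proof -
 define L where "L = genus_field K"
 have L: "fam K L" "abel k0 L" "abel K L" using gfam_K by (auto simp: L_def gfam_def fam_def)
 interpret L: abel k0 L by (rule L)
 have KL: "K <= L" using L(3) by (simp add: abel_def galois_def)
 define Y where "Y = gen (L Un E)"
 have aY: "abel k0 Y" unfolding Y_def by (rule abel_compositum[OF L(2) aE])
 interpret Y: abel k0 Y by (rule aY)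
 have sY: "L <= Y" "E <= Y" using gen_incl[of "L Un E"] by (auto simp: Y_def)
 have "pr k0 P_infinity" using P_infinity_vr by (simp add: pr_def)
 then obtain W where W: "pr Y W" "W Int k0 = P_infinity" using pr_extend[OF good_base _ Y.sfL Y.FL] by blast
 note d = fam_dvr[OF aY W(1)]
 let ?D = "dec k0 Y W"
 have aD: "agrp Y ?D" by (rule Y.dec_agrp[OF vr_sub[OF d(2)]])
 define A where "A = Fix Y ?D"
 \<comment> \<open>Since infinity splits in \<open>E\<close>, the decomposition group acts trivially
   on it; hence \<open>A\<close> contains \<open>E\<close>.\<close>
 have Eid: "s x = x" if s: "s : ?D" and x: "x : E" for s x
 proof -
 have "restrict s E : auts k0 E" "restrict s E ` (W Int E) = W Int E"
  using Y.dec_restrict[OF gal(5) sY(2) vr_sub[OF d(2)]] s by (auto simp: dec_def)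
 moreover have "tdec k0 E (W Int E)" using d(4)[OF sf(5) k0(5) sY(2)] W(2) k0 by (intro tdec_E) auto
 ultimately have "restrict s E = (\<lambda>x\<in>E. x)" by (auto simp: tdec_def)
 from fun_cong[OF this, of x] show ?thesis using x by simp
 qed
 have A: "sfd A" "k0 <= A" "A <= Y" "E <= A"
 using Fix_sfd[of Y ?D] agrp_D(1)[OF aD] Y.sfL Y.FL auts_fix[of _ k0 Y] Eid sY(2) by (auto simp: A_def Fix_def dec_def)
 have aA: "abel k0 A" by (rule Y.abel_lower(1)[OF A(1-3)])
 interpret A: abel k0 A by (rule aA)
 have aEA: "abel E A" by (rule A.abel_upper[OF sf(5) k0(5) A(4)])
 define X' where "X' = gen (L Un F)"
 have aX: "abel k0 X'" unfolding X'_def by (rule abel_compositum[OF L(2) aF])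
 interpret X': abel k0 X' by (rule aX)
 have sX: "L <= X'" "F <= X'" using gen_incl[of "L Un F"] by (auto simp: X'_def)
 have AX: "A <= X'" using A(3) gen_least[OF X'.sfL, of "L Un E"] sX subF unfolding Y_def by blast
 have tX: "tin E X' U" if "pr X' U" "U Int k0 ~= P_infinity" for U
 unfolding X'_def by (rule tin_push[OF aE F_eq K(1) subF(1) L(1,2)]) (use that in "simp_all add: X'_def")
 have "tin E A V & (V Int k0 = P_infinity --> tdec E A V)" if V: "pr A V" for V
 proof (cases "V Int k0 = P_infinity")
 case True
 obtain U where U: "pr Y U" "U Int A = V"
  using pr_extend[OF good_galois[OF good_base A.galois_axioms] V Y.sfL A(3)] by auto
 note dU = fam_dvr[OF aY U(1)]
 have Uk: "U Int k0 = W Int k0" using U(2) True W(2) A(2) by auto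
 have "tdec k0 A V" unfolding tdec_def
 proof (intro ballI impI)
  fix s assume s: "s : auts k0 A" "s ` V = V"
  obtain u where u: "u : Y.G" "u ` U = U" "s = restrict u A"
  using Y.dec_lift[OF A.galois_axioms A(3) dU(1)] dU(4)[OF A(1-3)] s U(2) by metis
  then have "u : dec k0 Y U" by (simp add: dec_def)
  then have "u : ?D" using Y.groups_conj(2)[OF dU(1) d(1) Uk] by blast
  then show "s = (\<lambda>x\<in>A. x)" using u(3) by (auto simp: A_def Fix_def restrict_def)
 qed
 then have "tdec E A V" by (rule A.tdec_upper[OF _ k0(5)])
 then show ?thesis using galois.tdec_imp_tin[OF abel.axioms(1)[OF aEA] fam_dvr(1)[OF aA V]] by blast
 next
 case False
 have "tin E A V" by (rule tin_sub[OF aE aX A(1,4) AX, of "%V. V ~= P_infinity"]) (use tX V False in auto)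
 then show ?thesis using False by simp
 qed
 then have "gfam E A" using aEA aA by (auto simp: gfam_def fam_def)
 then have "A <= genus_field E" using genus_field_eq[OF aE] by auto
 then have Q: "gen (A Un K) <= gen (genus_field E Un K)" by (intro gen_mono) auto
 \<comment> \<open>An automorphism of \<open>Y\<close> fixing \<open>A\<close> lies in the
   decomposition group of \<open>W\<close>; if it also fixes \<open>K\<close>, it is trivial on
   \<open>L\<close>, because infinity splits from \<open>K\<close> to \<open>L\<close>.\<close>
 have "L <= gen (A Un K)"
 proof
 fix x assume x: "x : L"
 have AK: "A <= gen (A Un K)" "K <= gen (A Un K)" using gen_incl[of "A Un K"] by auto
 interpret Q: galois "gen (A Un K)" Y
  by (rule Y.galois_upper) (use sfd_gen AK A gen_least[OF Y.sfL, of "A Un K"] KL sY in auto)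
 have "s x = x" if s: "s : Q.G" for s
 proof -
  have "s : auts A Y" "s : auts K Y" using auts_mono[OF AK(1), of Y] auts_mono[OF AK(2), of Y] s by auto
  then have sW: "s : ?D" using artin_auts[OF aD Y.sfL] by (simp add: A_def)
  interpret KY: galois K Y by (rule Y.galois_upper) (use sf k0 KL sY in auto)
  have "restrict s L : auts K L" "restrict s L ` (W Int L) = W Int L"
  using KY.dec_restrict[OF abel.axioms(1)[OF L(3)] sY(1) vr_sub[OF d(2)] \<open>s : auts K Y\<close>] sW by (auto simp: dec_def)
  moreover have "W Int L Int k0 = P_infinity" using W(2) L.FL by auto
  then have "tdec K L (W Int L)" using L(1) d(4)[OF L.sfL L.FL sY(1)] by (simp add: fam_def)
  ultimately have "restrict s L = (\<lambda>x\<in>L. x)" by (auto simp: tdec_def)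
  from fun_cong[OF this, of x] show ?thesis using x by simp
 qed
 then show "x : gen (A Un K)" using Q.fixedD[of x] x sY by blast
 qed
 then show ?thesis using Q by (auto simp: L_def)
qed

end

theorem theorem2p3:
  fixes K M E :: "('q :: {field, finite}) ratfun_ac set"
    and n m :: nat and N :: "'q poly"
  assumes "finite_abelian_p_extension base_field K"
    and "m \<ge> 1" and "N \<noteq> 0"
    and "K \<subseteq> compositum (compositum (L_field n) (cyclotomic_function_field T N))
               (const_extension m)"
    and "M = compositum (L_field n) (const_extension m)"
    and "E = compositum K M \<inter> cyclotomic_function_field T N"
  shows "genus_field K = compositum (genus_field E) K \<and>
         finite_abelian_p_extension base_field (genus_field K)"
proof -
 obtain r where K: "abel k0 K" "expo k0 K (CHAR('q) ^ r)" using assms(1) by (auto simp: finite_abelian_p_extension_iff)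
 interpret genus_setup K M E "cyclotomic_function_field T N" "L_field n" "const_extension m" n m r N
 by (rule genus_setup.intro) (use K assms in "simp_all add: compositum_eq")
 have "genus_field K = gen (genus_field E Un K)" using genus_E_K genus_K_E by (rule subset_antisym[rotated])
 moreover have "finite_abelian_p_extension k0 (genus_field K)"
 using gfam_expo[OF K gfam_K] gfam_K by (auto simp: finite_abelian_p_extension_iff gfam_def)
 ultimately show ?thesis by (simp add: compositum_eq)
qed


end
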